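(* For every $n\in\mathbb{N}$ let $U^n(x):=\inf_{\boldsymbol{\pi}\in\boldsymbol{\Pi}}J^n(x,\boldsymbol{\pi})$ be the optimal risk sensitive cost of the $n$-th stochastic model. Let $U$ be the value function of the differential game, and let $\boldsymbol{\pi}^*$ be the feedback policy $\boldsymbol{\pi}^*(t)=\pi^*(\tilde W^n(t))$, $t\ge 0$. Then for every $x\ge a$, $$\lim_{n\to\infty}U^n(x)=U(x)\qquad\text{and moreover}\qquad \lim_{n\to\infty}J^n(x,\boldsymbol{\pi}^* )=U(x).$$
   Context: **Data.** Fix constants $\mu>r>0$ and $\sigma,M_0,a,\lambda,\rho>0$. Let $e:[a,\infty)\to(-\infty,M_0]$ be Lipschitz. Let $l:[a,\infty)\to[0,\lambda)$ be Lipschitz and non-increasing. Convention: $\inf\emptyset=\infty$. **Feedback function.** Put $b:=\inf\{x\ge a: e(x)<0\}$ and $$d:=b\wedge\inf\Big\{y>a:\ \rho-\int_a^y\frac{\lambda-l(u)+\frac12(\frac{\mu-r}{\sigma})^2}{e(u)}\,du=0\Big\}.$$ Define $\pi^*:[a,\infty)\to\mathbb{R}$ by $$\pi^*(x)=\frac{(\mu-r)e(x)}{\sigma^2\big(\frac12(\frac{\mu-r}{\sigma})^2+\lambda-l(x)\big)}\ \text{ for } a\le x<d,\qquad \pi^*(x)=0\ \text{ for } x\ge d.$$ The positive constant $M_1$ is fixed and large enough that $|\pi^*|\le M_1$. **Stochastic model.** Let $B$ be a standard Brownian motion with augmented natural filtration. $\boldsymbol{\Pi}$ is the set of progressively measurable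 processes $\boldsymbol{\pi}=(\boldsymbol{\pi}(t))_{t\ge0}$ with $|\boldsymbol{\pi}(\cdot)|\le M_1$. For $x\ge a$, $n\in\mathbb{N}$ and a policy $\boldsymbol{\pi}$, the scaled wealth process satisfies $$d\tilde W^n(t)=\big(-e(\tilde W^n(t))+(\mu-r)\boldsymbol{\pi}(t)\big)dt+\tfrac{1}{\sqrt n}\sigma\boldsymbol{\pi}(t)\,dB(t),\qquad \tilde W^n(0)=x.$$ Let $\tau^n_a$ be the first time $\tilde W^n$ reaches $a$ (only the process up to $\tau^n_a$ matters). Let $\tau^n_d$ be an exponential random time with parameter $\lambda n$, independent of $B$. The cost is $$J^n(x,\boldsymbol{\pi}):=\frac1n\ln\mathbb{E}\Big[e^{n\left(\int_0^{\tau^n_a\wedge\tau^n_d}l(\tilde W^n(s))ds+\rho 1_{\{\tau^n_a\le\tau^n_d\}}\right)}\Big].$$ For the feedback policy $\boldsymbol{\pi}^*$, the process $\tilde W^n$ is the solution of the equation with $\boldsymbol{\pi}(t)=\pi^*(\tilde W^n(t))$. **Differential game.** $\Pi$ is the set of Lipschitz functions $\pi:[a,\infty)\to[-M_1,M_1]$. $\mathcal{AC}_0[0,\infty)$ is the set of absolutely continuous $\psi:[0,\infty)\to\mathbb{R}$ with $\psi(0)=0$. Given $x\ge a$, $\pi\in\Pi$ and $\psi\in\mathcal{AC}_0[0,\infty)$, the state process $\varphi$ solves $$\dot\varphi(t)=-e(\varphi(t))+(\mu-r)\pi(\varphi(t))+\sigma\pi(\varphi(t))\dot\psi(t),\qquad\varphi(0)=x,$$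 and $\tau$ is the first time $\varphi$ hits $a$ ($\tau=\infty$ if never). For $T\in[0,\infty)$ set $$C(x,\pi,\psi,T):=\int_0^{T\wedge\tau}\big[-\lambda+l(\varphi(t))-\tfrac12\dot\psi^2(t)\big]dt+\rho1_{\{\tau\le T\}}.$$ The value of the game is $$U(x):=\inf_{\pi\in\Pi}\ \sup_{\psi\in\mathcal{AC}_0[0,\infty),\,T\in[0,\infty)}C(x,\pi,\psi,T).$$ *)

theory Defs
  imports "HOL-Probability.Probability"
begin

section \<open>Hitting times and the feedback function\<close>

text \<open>Times that may be infinite are extended reals; \<open>Inf {} = \<infinity>\<close> holds there.\<close>

definition hit_time :: "real \<Rightarrow> (real \<Rightarrow> real) \<Rightarrow> ereal" where
  "hit_time a f = Inf (ereal ` {t. 0 \<le> t \<and> f t = a})"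

definition b_level :: "real \<Rightarrow> (real \<Rightarrow> real) \<Rightarrow> ereal" where
  "b_level a e = Inf (ereal ` {x. a \<le> x \<and> e x < 0})"

text \<open>
  A divergent integral has the Bochner value 0 here instead of \<open>\<infinity>\<close>. Since \<open>rho \<noteq> 0\<close>, such a
  \<open>y\<close> is excluded from the set either way. As \<open>e\<close> is Lipschitz, \<open>1 / e\<close> is not
  integrable up to a zero of \<open>e\<close> next to which \<open>e\<close> is positive, and an interval on which
  \<open>e\<close> vanishes contributes 0 and not \<open>rho\<close>, so that \<open>x / 0 = 0\<close> is harmless as well.
  Values \<open>y\<close> above \<open>b_level a e\<close> do not affect the minimum.
\<close>

definition d_level ::
  "real \<Rightarrow> real \<Rightarrow> real \<Rightarrow> real \<Rightarrow> real \<Rightarrow> real \<Rightarrow> (real \<Rightarrow> real) \<Rightarrow> (real \<Rightarrow> real) \<Rightarrow> ereal" where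
  "d_level mu r sig a lam rho e l =
     min (b_level a e)
       (Inf (ereal ` {y. a < y \<and>
          rho - (LBINT u:{a..y}. (lam - l u + 1/2 * ((mu - r) / sig)\<^sup>2) / e u) = 0}))"

definition pi_star ::
  "real \<Rightarrow> real \<Rightarrow> real \<Rightarrow> real \<Rightarrow> real \<Rightarrow> real \<Rightarrow> (real \<Rightarrow> real) \<Rightarrow> (real \<Rightarrow> real) \<Rightarrow> real \<Rightarrow> real" where
  "pi_star mu r sig a lam rho e l x =
     (if ereal x < d_level mu r sig a lam rho e l
      then (mu - r) * e x / (sig\<^sup>2 * (1/2 * ((mu - r) / sig)\<^sup>2 + lam - l x))
      else 0)"


section \<open>Brownian motion and filtrations\<close>

definition preimages :: "'w measure \<Rightarrow> ('w \<Rightarrow> real) \<Rightarrow> 'w set set" where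
  "preimages M X = {X -` A \<inter> space M | A. A \<in> sets borel}"

definition natural_filtration ::
  "'w measure \<Rightarrow> (real \<Rightarrow> 'w \<Rightarrow> real) \<Rightarrow> real \<Rightarrow> 'w measure" where
  "natural_filtration M X t = sigma (space M) (\<Union>s\<in>{0..t}. preimages M (X s))"

definition augmented_filtration ::
  "'w measure \<Rightarrow> (real \<Rightarrow> 'w \<Rightarrow> real) \<Rightarrow> real \<Rightarrow> 'w measure" where
  "augmented_filtration M X t =
     sigma (space M) (sets (natural_filtration M X t) \<union> null_sets M)"

definition adapted :: "(real \<Rightarrow> 'w measure) \<Rightarrow> (real \<Rightarrow> 'w \<Rightarrow> real) \<Rightarrow> bool" where
  "adapted F X \<longleftrightarrow> (\<forall>t\<ge>0. X t \<in> borel_measurable (F t))"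

definition progressively_measurable ::
  "(real \<Rightarrow> 'w measure) \<Rightarrow> (real \<Rightarrow> 'w \<Rightarrow> real) \<Rightarrow> bool" where
  "progressively_measurable F X \<longleftrightarrow>
     (\<forall>t\<ge>0. (\<lambda>(s, \<omega>). X s \<omega>) \<in> borel_measurable (restrict_space borel {0..t} \<Otimes>\<^sub>M F t))"

text \<open>Brownian motion relative to a filtration \<open>F\<close>; only times \<open>t \<ge> 0\<close> matter.\<close>

definition brownian_motion ::
  "'w measure \<Rightarrow> (real \<Rightarrow> 'w measure) \<Rightarrow> (real \<Rightarrow> 'w \<Rightarrow> real) \<Rightarrow> bool" where
  "brownian_motion M F B \<longleftrightarrow>
     prob_space M \<and>
     filtration (space M) F \<and> (\<forall>t. subalgebra M (F t)) \<and>
     adapted F B \<and>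
     (AE \<omega> in M. B 0 \<omega> = 0) \<and>
     (AE \<omega> in M. continuous_on {0..} (\<lambda>t. B t \<omega>)) \<and>
     (\<forall>s t. 0 \<le> s \<and> s < t \<longrightarrow>
        distributed M lborel (\<lambda>\<omega>. B t \<omega> - B s \<omega>) (normal_density 0 (sqrt (t - s))) \<and>
        prob_space.indep_set M (sets (F s)) (preimages M (\<lambda>\<omega>. B t \<omega> - B s \<omega>)))"

definition standard_brownian_motion :: "'w measure \<Rightarrow> (real \<Rightarrow> 'w \<Rightarrow> real) \<Rightarrow> bool" where
  "standard_brownian_motion M B \<longleftrightarrow> brownian_motion M (natural_filtration M B) B"

definition independent_of_filtration ::
  "'w measure \<Rightarrow> (real \<Rightarrow> 'w measure) \<Rightarrow> ('w \<Rightarrow> real) \<Rightarrow> bool" where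
  "independent_of_filtration M F X \<longleftrightarrow>
     prob_space.indep_set M (sigma_sets (space M) (\<Union>t. sets (F t))) (preimages M X)"


section \<open>The Ito integral\<close>

text \<open>
  \<open>simple_process k ts xi\<close> is the left-continuous step process with the value \<open>xi i\<close> on
  \<open>(ts i, ts (Suc i)]\<close>. The Ito integral of a progressively measurable integrand \<open>H\<close> is
  the continuous adapted process obtained as the \<open>L\<^sup>2\<close>-limit of integrals of simple processes
  that converge to \<open>H\<close> in \<open>L\<^sup>2\<close> on every \<open>[0, T]\<close>.
\<close>

definition simple_data ::
  "(real \<Rightarrow> 'w measure) \<Rightarrow> nat \<Rightarrow> (nat \<Rightarrow> real) \<Rightarrow> (nat \<Rightarrow> 'w \<Rightarrow> real) \<Rightarrow> bool" where
  "simple_data F k ts xi \<longleftrightarrow>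
     0 \<le> ts 0 \<and>
     (\<forall>i<k. ts i \<le> ts (Suc i) \<and> xi i \<in> borel_measurable (F (ts i)) \<and>
            (\<exists>C. \<forall>\<omega>\<in>space (F (ts i)). \<bar>xi i \<omega>\<bar> \<le> C))"

definition simple_process ::
  "nat \<Rightarrow> (nat \<Rightarrow> real) \<Rightarrow> (nat \<Rightarrow> 'w \<Rightarrow> real) \<Rightarrow> real \<Rightarrow> 'w \<Rightarrow> real" where
  "simple_process k ts xi t \<omega> = (\<Sum>i<k. xi i \<omega> * indicator {ts i <.. ts (Suc i)} t)"

definition simple_integral ::
  "(real \<Rightarrow> 'w \<Rightarrow> real) \<Rightarrow> nat \<Rightarrow> (nat \<Rightarrow> real) \<Rightarrow> (nat \<Rightarrow> 'w \<Rightarrow> real) \<Rightarrow> real \<Rightarrow> 'w \<Rightarrow> real" where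
  "simple_integral B k ts xi t \<omega> =
     (\<Sum>i<k. xi i \<omega> * (B (min t (ts (Suc i))) \<omega> - B (min t (ts i)) \<omega>))"

definition ito_integral ::
  "'w measure \<Rightarrow> (real \<Rightarrow> 'w measure) \<Rightarrow> (real \<Rightarrow> 'w \<Rightarrow> real) \<Rightarrow>
   (real \<Rightarrow> 'w \<Rightarrow> real) \<Rightarrow> (real \<Rightarrow> 'w \<Rightarrow> real) \<Rightarrow> bool" where
  "ito_integral M F B H I \<longleftrightarrow>
     progressively_measurable F H \<and>
     adapted F I \<and> (\<forall>\<omega>\<in>space M. continuous_on {0..} (\<lambda>t. I t \<omega>)) \<and>
     (\<exists>k ts xi. (\<forall>j. simple_data F (k j) (ts j) (xi j)) \<and>
        (\<forall>T\<ge>0.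
          (\<lambda>j. \<integral>\<^sup>+\<omega>. (\<integral>\<^sup>+t\<in>{0..T}.
             ennreal ((simple_process (k j) (ts j) (xi j) t \<omega> - H t \<omega>)\<^sup>2) \<partial>lborel) \<partial>M) \<longlonglongrightarrow> 0 \<and>
          (\<lambda>j. \<integral>\<^sup>+\<omega>.
             ennreal ((simple_integral B (k j) (ts j) (xi j) T \<omega> - I T \<omega>)\<^sup>2) \<partial>M) \<longlonglongrightarrow> 0))"


section \<open>The stochastic model\<close>

definition policies ::
  "'w measure \<Rightarrow> (real \<Rightarrow> 'w \<Rightarrow> real) \<Rightarrow> real \<Rightarrow> (real \<Rightarrow> 'w \<Rightarrow> real) set" where
  "policies M B M1 =
     {p. progressively_measurable (augmented_filtration M B) p \<and>
         (\<forall>t\<ge>0. \<forall>\<omega>\<in>space M. \<bar>p t \<omega>\<bar> \<le> M1)}"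

text \<open>
  \<open>W\<close> solves the wealth equation under the process \<open>p\<close> up to its hitting time of \<open>a\<close>. The
  path after that time is unconstrained, since \<open>e\<close> is only meaningful on \<open>[a, \<infinity>)\<close>. Cutting
  the integrand off after the hitting time does not change the Ito integral before it.
\<close>

definition wealth_process ::
  "real \<Rightarrow> real \<Rightarrow> real \<Rightarrow> real \<Rightarrow> (real \<Rightarrow> real) \<Rightarrow>
   'w measure \<Rightarrow> (real \<Rightarrow> 'w measure) \<Rightarrow> (real \<Rightarrow> 'w \<Rightarrow> real) \<Rightarrow>
   nat \<Rightarrow> real \<Rightarrow> (real \<Rightarrow> 'w \<Rightarrow> real) \<Rightarrow> (real \<Rightarrow> 'w \<Rightarrow> real) \<Rightarrow> bool" where
  "wealth_process mu r sig a e M F B n x p W \<longleftrightarrow>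
     adapted F W \<and>
     (\<forall>\<omega>\<in>space M. W 0 \<omega> = x \<and> continuous_on {0..} (\<lambda>t. W t \<omega>)) \<and>
     (\<exists>I. ito_integral M F B
            (\<lambda>t \<omega>. if ereal t \<le> hit_time a (\<lambda>s. W s \<omega>) then p t \<omega> else 0) I \<and>
          (AE \<omega> in M. \<forall>t\<ge>0. ereal t \<le> hit_time a (\<lambda>s. W s \<omega>) \<longrightarrow>
             W t \<omega> = x + (LBINT s:{0..t}. - e (W s \<omega>) + (mu - r) * p s \<omega>)
                       + 1 / sqrt (real n) * sig * I t \<omega>))"

text \<open>The cost of the wealth process \<open>W\<close>, with exponential clock \<open>D\<close>.\<close>

definition cost ::
  "real \<Rightarrow> real \<Rightarrow> (real \<Rightarrow> real) \<Rightarrow> 'w measure \<Rightarrow> nat \<Rightarrow> ('w \<Rightarrow> real) \<Rightarrow>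
   (real \<Rightarrow> 'w \<Rightarrow> real) \<Rightarrow> real" where
  "cost a rho l M n D W =
     1 / real n * ln (\<integral>\<omega>. exp (real n *
        ((LBINT s:{s. 0 \<le> s \<and> ereal s \<le> min (hit_time a (\<lambda>t. W t \<omega>)) (ereal (D \<omega>))}. l (W s \<omega>))
         + rho * (if hit_time a (\<lambda>t. W t \<omega>) \<le> ereal (D \<omega>) then 1 else 0))) \<partial>M)"

definition optimal_cost ::
  "real \<Rightarrow> real \<Rightarrow> real \<Rightarrow> real \<Rightarrow> real \<Rightarrow> real \<Rightarrow> (real \<Rightarrow> real) \<Rightarrow> (real \<Rightarrow> real) \<Rightarrow>
   'w measure \<Rightarrow> (real \<Rightarrow> 'w \<Rightarrow> real) \<Rightarrow> nat \<Rightarrow> ('w \<Rightarrow> real) \<Rightarrow> real \<Rightarrow> ereal" where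
  "optimal_cost mu r sig M1 a rho e l M B n D x =
     Inf {ereal (cost a rho l M n D W) | p W.
            p \<in> policies M B M1 \<and>
            wealth_process mu r sig a e M (augmented_filtration M B) B n x p W}"

text \<open>
  Since \<open>pi_star\<close> may jump at \<open>d_level\<close>, the feedback equation is a stochastic differential
  equation with discontinuous coefficients, which need not have a solution adapted to the
  augmented filtration of \<open>B\<close>. A solution is therefore taken with respect to a filtration
  \<open>F\<close> for which \<open>B\<close> is a Brownian motion and which is independent of the exponential clock
  \<open>D\<close>. The augmented filtration of \<open>B\<close> is one possible choice.
\<close>

definition feedback_wealth_process ::
  "real \<Rightarrow> real \<Rightarrow> real \<Rightarrow> real \<Rightarrow> real \<Rightarrow> real \<Rightarrow> (real \<Rightarrow> real) \<Rightarrow> (real \<Rightarrow> real) \<Rightarrow>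
   'w measure \<Rightarrow> (real \<Rightarrow> 'w measure) \<Rightarrow> (real \<Rightarrow> 'w \<Rightarrow> real) \<Rightarrow>
   nat \<Rightarrow> ('w \<Rightarrow> real) \<Rightarrow> real \<Rightarrow> (real \<Rightarrow> 'w \<Rightarrow> real) \<Rightarrow> bool" where
  "feedback_wealth_process mu r sig a lam rho e l M F B n D x W \<longleftrightarrow>
     brownian_motion M F B \<and>
     independent_of_filtration M F D \<and>
     wealth_process mu r sig a e M F B n x
       (\<lambda>t \<omega>. pi_star mu r sig a lam rho e l (W t \<omega>)) W"


section \<open>The differential game\<close>

definition abs_continuous_on_interval :: "real \<Rightarrow> real \<Rightarrow> (real \<Rightarrow> real) \<Rightarrow> bool" where
  "abs_continuous_on_interval s t f \<longleftrightarrow>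
     (\<forall>\<epsilon>>0. \<exists>\<delta>>0. \<forall>(k::nat) u v.
        (\<forall>i<k. s \<le> u i \<and> u i \<le> v i \<and> v i \<le> t) \<and>
        disjoint_family_on (\<lambda>i. {u i <..< v i}) {..<k} \<and>
        (\<Sum>i<k. v i - u i) < \<delta> \<longrightarrow>
        (\<Sum>i<k. \<bar>f (v i) - f (u i)\<bar>) < \<epsilon>)"

text \<open>On \<open>[0, \<infinity>)\<close>, absolute continuity means absolute continuity on every \<open>[0, T]\<close>.\<close>

definition abs_continuous_halfline :: "(real \<Rightarrow> real) \<Rightarrow> bool" where
  "abs_continuous_halfline f \<longleftrightarrow> (\<forall>T\<ge>0. abs_continuous_on_interval 0 T f)"

definition AC0 :: "(real \<Rightarrow> real) set" where
  "AC0 = {\<psi>. abs_continuous_halfline \<psi> \<and> \<psi> 0 = 0}"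

definition game_policies :: "real \<Rightarrow> real \<Rightarrow> (real \<Rightarrow> real) set" where
  "game_policies a M1 = {p. (\<exists>L. L-lipschitz_on {a..} p) \<and> (\<forall>x\<ge>a. \<bar>p x\<bar> \<le> M1)}"

text \<open>As in the stochastic model, the state is only constrained up to its hitting time of \<open>a\<close>.\<close>

definition state_process ::
  "real \<Rightarrow> real \<Rightarrow> real \<Rightarrow> real \<Rightarrow> (real \<Rightarrow> real) \<Rightarrow> real \<Rightarrow>
   (real \<Rightarrow> real) \<Rightarrow> (real \<Rightarrow> real) \<Rightarrow> (real \<Rightarrow> real) \<Rightarrow> bool" where
  "state_process mu r sig a e x p \<psi> \<phi> \<longleftrightarrow>
     abs_continuous_halfline \<phi> \<and> \<phi> 0 = x \<and>
     (AE t in lborel. 0 < t \<and> ereal t < hit_time a \<phi> \<longrightarrow>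
        (\<phi> has_real_derivative
           (- e (\<phi> t) + (mu - r) * p (\<phi> t) + sig * p (\<phi> t) * deriv \<psi> t)) (at t))"

text \<open>
  The quadratic term is a nonnegative integral, so that the payoff is \<open>-\<infinity>\<close> (and not a
  default value) when the derivative of \<open>\<psi>\<close> is not square integrable.
\<close>

definition payoff ::
  "real \<Rightarrow> real \<Rightarrow> real \<Rightarrow> (real \<Rightarrow> real) \<Rightarrow> (real \<Rightarrow> real) \<Rightarrow> (real \<Rightarrow> real) \<Rightarrow> real \<Rightarrow> ereal" where
  "payoff a lam rho l \<psi> \<phi> T =
     (let S = {t. 0 \<le> t \<and> ereal t \<le> min (ereal T) (hit_time a \<phi>)} in
        ereal (LBINT t:S. - lam + l (\<phi> t))
        - enn2ereal (\<integral>\<^sup>+t\<in>S. ennreal (1/2 * (deriv \<psi> t)\<^sup>2) \<partial>lborel)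
        + ereal (rho * (if hit_time a \<phi> \<le> ereal T then 1 else 0)))"

definition game_value ::
  "real \<Rightarrow> real \<Rightarrow> real \<Rightarrow> real \<Rightarrow> real \<Rightarrow> real \<Rightarrow> real \<Rightarrow>
   (real \<Rightarrow> real) \<Rightarrow> (real \<Rightarrow> real) \<Rightarrow> real \<Rightarrow> ereal" where
  "game_value mu r sig M1 a lam rho e l x =
     (INF p \<in> game_policies a M1.
        Sup {payoff a lam rho l \<psi> \<phi> T | \<psi> \<phi> T.
               \<psi> \<in> AC0 \<and> state_process mu r sig a e x p \<psi> \<phi> \<and> 0 \<le> T})"

end

theory Submission
  imports Defs "HOL-Real_Asymp.Real_Asymp"
begin

text \<open>
  The Hamiltonian \<open>HH y m q = l y - lam + m e y - (mu - r) m q + (sig m q)^2 / 2\<close> has minimum zero in \<open>q\<close>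
  when \<open>m = gq y = (lam - l y + nu) / e y\<close>, \<open>nu = ((mu - r) / sig)^2 / 2\<close>, and the minimiser is the feedback
  \<open>pi_star\<close>. So the common limit is \<open>Uv x = rho - (integral of gq from a to min x d)\<close>, and 0 for \<open>x > a\<close> if
  \<open>e a\<close> is not positive. Slightly smaller (larger) densities \<open>m\<close> are strict super- (sub-)solutions; once \<open>m\<close> is smooth,
  the strictness absorbs the second-order term of size \<open>1 / n\<close> in the generator applied to
  \<open>exp (n (rho - integral of m))\<close>, and Dynkin's formula for the absorbed wealth, with the exponential clock
  integrated out into a killing rate, bounds the costs for large \<open>n\<close>. For the upper bound on the optimal cost,
  a Lipschitz feedback is replaced by its piecewise constant (Euler) version, for which the wealth can be constructed
  path by path, with a mesh depending on \<open>n\<close>. In the game, completing the square in the derivative of \<open>psi\<close> along a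
  state path gives the upper bound, and the noise \<open>psi' = - sig q m\<close> attains the lower one.
\<close>

text \<open>The Ito integral is a predicate about approximating simple processes, so Dynkin's
  formula is derived from moments instead of Ito's formula: mean zero and weighted variance of
  increments identify the generator, and a fourth moment of order \<open>(t - s)^2\<close> removes
  the Taylor remainder as the grid is refined. The drift of the wealth can grow linearly, as
  \<open>e\<close> may tend to minus infinity; all densities therefore vanish beyond some
  \<open>R\<close>, which makes the test functions constant there. The same vanishing disarms the
  jump of \<open>pi_star\<close>: where the density is 0, \<open>HH\<close> equals
  \<open>l y - lam\<close> for every control. The feedback solution may live on a filtration larger
  than that of \<open>B\<close> and then is no admissible policy, so the optimal cost needs a
  competitor adapted to \<open>B\<close>. With the control frozen on each cell the noise is additive
  there, and the wealth solves an integral equation along each path. The threshold for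
  \<open>n\<close> and the mesh do not depend on the probability space, which makes the bounds
  uniform over policies. A bounded factor in the expectation costs only \<open>O(1 / n)\<close>
  after the logarithm.\<close>

notation LIMSEQ (infix "---->" 60)

notation borel_measurable ("\<B>")

abbreviation ival :: "real => real => (real => real) => real" where
 "ival s t f \<equiv> \<integral>r. indicator {s<..t} r*f r \<partial>lborel"

abbreviation iable :: "real => real => (real => real) => bool" where
 "iable s t f \<equiv> integrable lborel (%r. indicator {s<..t} r*f r)"

context prob_space
begin

abbreviation expect (binder "EE " 10) where "expect f \<equiv> integral\<^sup>L M f"

abbreviation nn_expect (binder "NN " 10) where "nn_expect f \<equiv> integral\<^sup>N M f"

abbreviation "MT \<equiv> M \<Otimes>\<^sub>M (lborel :: real measure)"

end

lemmas int_bound = Bochner_Integration.integrable_bound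
 and int_add = Bochner_Integration.integrable_add
 and int_sum = Bochner_Integration.integrable_sum
 and lint_add = Bochner_Integration.integral_add
 and lint_cong = Bochner_Integration.integral_cong
 and lint_sum = Bochner_Integration.integral_sum
 and lint_diff = Bochner_Integration.integral_diff
 and int_diff = Bochner_Integration.integrable_diff

section \<open>Moments and limits in L2\<close>

lemma prob_space_power_integrable:
 assumes "prob_space M" "f \<in> \<B> M" "integrable M (%x. (f x :: real)^4)" "j <= 4"
 shows "integrable M (%x. f x ^ j)"
proof -
 interpret prob_space M by fact
 show ?thesis
 proof (rule int_bound[where f = "%x. 1 + f x^4"])
  show "integrable M (%x. 1 + f x^4)" using assms by simp
  show "(%x. f x ^ j) \<in> \<B> M" using assms by simp
  have "abs (y ^ j) <= 1 + y^4" for y :: real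
  proof (cases "abs y <= 1")
   case True
   have "abs (y ^ j) <= 1" using True by (simp add: power_abs power_le_one)
   thus ?thesis by (smt (verit) zero_le_power_eq_numeral even_numeral zero_le_even_power)
  next
   case False
   hence "abs y ^ j <= abs y^4" using assms(4) by (intro power_increasing) auto
   thus ?thesis by (simp add: power_abs power_even_abs)
  qed
  thus "AE x in M. norm (f x ^ j) <= norm (1 + f x^4)" by (intro AE_I2) (smt (verit) real_norm_def)
 qed
qed

lemma bochner_abs_le:
 fixes f g :: "'a => real"
 assumes "!!x. x \<in> space N ==> abs (f x) <= g x" "integrable N f" "integrable N g"
 shows "abs (\<integral>x. f x \<partial>N) <= (\<integral>x. g x \<partial>N)"
proof -
 have "abs (\<integral>x. f x \<partial>N) <= (\<integral>x. abs (f x) \<partial>N)" by (rule integral_abs_bound)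
 also have "... <= (\<integral>x. g x \<partial>N)" using assms by (intro integral_mono) auto
 finally show ?thesis .
qed

text \<open>Fatou's lemma for the fourth powers: almost sure convergence passes a uniform moment
  bound on to the limit.\<close>

lemma fourth_moment_limit:
 fixes f :: "nat => 'a => real"
 assumes [measurable]: "!!j. f j \<in> \<B> N" "g \<in> \<B> N" and lim: "AE x in N. (%j. f j x) ----> g x"
  and f4: "!!j. integrable N (%x. f j x^4)" "!!j. (\<integral>x. f j x^4 \<partial>N) <= C"
 shows "integrable N (%x. g x^4)" "(\<integral>x. g x^4 \<partial>N) <= C" (is ?th1)
proof -
 have C0: "0 <= C" using f4(2)[of 0] by (rule order_trans[rotated]) simp
 have "(\<integral>\<^sup>+x. ennreal (g x^4) \<partial>N) = (\<integral>\<^sup>+x. liminf (%j. ennreal (f j x^4)) \<partial>N)"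
 proof (rule nn_integral_cong_AE, use lim in eventually_elim)
  case (elim x)
  hence "(%j. ennreal (f j x^4)) ----> ennreal (g x^4)" by (intro tendsto_ennrealI tendsto_power)
  thus ?case by (rule lim_imp_Liminf[symmetric, OF trivial_limit_sequentially])
 qed
 also have "... <= liminf (%j. \<integral>\<^sup>+x. ennreal (f j x^4) \<partial>N)" by (rule nn_integral_liminf) simp
 also have "... <= liminf (%j. ennreal C)"
  using f4 by (intro Liminf_mono always_eventually allI, subst nn_integral_eq_integral) (auto intro: ennreal_leI)
 finally have le: "(\<integral>\<^sup>+x. ennreal (g x^4) \<partial>N) <= ennreal C" by (simp add: Liminf_const)
 show gi: "integrable N (%x. g x^4)"
  using le by (intro integrableI_nonneg) (auto intro: le_less_trans[OF _ ennreal_less_top])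
 show ?th1 using le nn_integral_eq_integral[OF gi] C0 by (simp add: ennreal_le_iff)
qed

text \<open>Convergence is stated with the nonnegative integral, as in \<open>ito_integral\<close>,
  where integrability of the differences is not known beforehand; finiteness at a single index gives
  it for \<open>g\<close>, and then for all differences. Weighted first and second moments converge
  by Young's inequality with a parameter \<open>k j\<close> that tends to 0 slowly enough. Fourth
  moments come from an almost surely convergent subsequence and Fatou.\<close>

lemma L2_limit:
 fixes f :: "nat => 'a => real" and g :: "'a => real"
 assumes "finite_measure N"
  and [measurable]: "!!j. f j \<in> \<B> N" "g \<in> \<B> N" and fi: "!!j. integrable N (%x. (f j x)^2)"
  and lim: "(%j. \<integral>\<^sup>+x. ennreal ((f j x - g x)^2) \<partial>N) ----> 0"
 shows L2_limit_integrable: "integrable N (%x. (g x)^2)"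
  and L2_limit_diff: "integrable N (%x. (f j x - g x)^2)" "(%j. \<integral>x. (f j x - g x)^2 \<partial>N) ----> 0"
  and L2_limit_square: "Z \<in> \<B> N ==> (!!x. x \<in> space N ==> abs (Z x) <= K) ==>
   (%j. \<integral>x. Z x*(f j x)^2 \<partial>N) ----> (\<integral>x. Z x*(g x)^2 \<partial>N)"
  and L2_limit_linear: "Z \<in> \<B> N ==> (!!x. x \<in> space N ==> abs (Z x) <= K) ==>
   (%j. \<integral>x. Z x*f j x \<partial>N) ----> (\<integral>x. Z x*g x \<partial>N)"
  and L2_limit_fourth: "(!!j. integrable N (%x. f j x^4)) ==> (!!j. (\<integral>x. f j x^4 \<partial>N) <= C) ==>
   integrable N (%x. g x^4) \<and> (\<integral>x. g x^4 \<partial>N) <= C"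
proof -
 let ?d = "%j x. (f j x - g x)^2"
 let ?G = "\<integral>x. (g x)^2 \<partial>N"
 interpret finite_measure N by fact
 have "\<forall>\<^sub>F j in sequentially. (\<integral>\<^sup>+x. ennreal (?d j x) \<partial>N) < 1"
  using lim by (rule order_tendstoD) simp
 then obtain j0 where j0: "(\<integral>\<^sup>+x. ennreal (?d j0 x) \<partial>N) < 1"
  by (auto simp: eventually_sequentially)
 have "integrable N (%x. ?d j0 x)"
  using j0 by (intro integrableI_nonneg) (auto intro: less_trans[OF _ ennreal_one_less_top])
 hence "integrable N (%x. 2*(f j0 x)^2 + 2 * ?d j0 x)" using fi by simp
 moreover have "(y::real)^2 <= 2*x^2 + 2*(x - y)^2" for x y
  using zero_le_power2[of "2*x - y"] by (simp add: power2_eq_square algebra_simps)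
 ultimately show gi: "integrable N (%x. (g x)^2)"
  by (rule_tac int_bound[where f = "%x. 2*(f j0 x)^2 + 2 * ?d j0 x"])
   (auto intro!: AE_I2)
 have fgi: "integrable N (%x. ?d j x)" for j
 proof (rule int_bound[where f = "%x. 2*(f j x)^2 + 2*(g x)^2"])
  show "integrable N (%x. 2*(f j x)^2 + 2*(g x)^2)" using fi gi by simp
  have "(x - y)^2 <= 2*x^2 + 2*y^2" for x y :: real
   using zero_le_power2[of "x + y"] by (simp add: power2_eq_square algebra_simps)
  thus "AE x in N. norm (?d j x) <= norm (2*(f j x)^2 + 2*(g x)^2)" by (auto intro!: AE_I2)
 qed simp
 thus "integrable N (%x. ?d j x)" .
 define r where "r j = (\<integral>x. ?d j x \<partial>N)" for j
 have r0: "0 <= r j" for j by (simp add: r_def)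
 have "(%j. ennreal (r j)) ----> ennreal 0"
  using lim unfolding r_def by (subst nn_integral_eq_integral[symmetric, OF fgi]) auto
 hence r: "r ----> 0" using r0 by (subst (asm) tendsto_ennreal_iff) auto
 thus "(%j. \<integral>x. ?d j x \<partial>N) ----> 0" unfolding r_def .
 \<comment> \<open>The square root makes both \<open>k j\<close> and \<open>r j / k j\<close> vanish
   in the limit; the summand \<open>1 / real (Suc j)\<close> keeps \<open>k j\<close> positive when
   \<open>r j = 0\<close>.\<close>
 define k where "k j = sqrt (r j + 1 / real (Suc j))" for j
 have kpos: "0 < k j" for j using r0[of j] by (simp add: k_def add_nonneg_pos)
 have "(%j. r j + 1 / real (Suc j)) ----> 0 + 0"
  by (intro tendsto_add r) (use LIMSEQ_inverse_real_of_nat in "simp add: inverse_eq_divide")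
 from tendsto_real_sqrt[OF this] have k: "k ----> 0" by (simp add: k_def[abs_def])
 have rk: "r j / k j <= k j" for j
 proof -
  have "r j <= k j*k j" using r0[of j] by (simp add: k_def)
  thus ?thesis using kpos[of j] by (simp add: field_simps)
 qed
 have amgm: "2*abs (y*z) <= c*y^2 + z^2 / c" if "0 < c" for c y z :: real
 proof -
  have "0 <= (c*abs y - abs z)^2 / c" using that by simp
  also have "... = c*y^2 + z^2 / c - 2*abs (y*z)"
   using that by (simp add: power2_eq_square field_simps abs_mult)
  finally show ?thesis by simp
 qed
 { fix Z :: "'a => real" and K
 let ?J = "\<integral>x. Z x*g x \<partial>N"
 let ?I = "\<integral>x. Z x*(g x)^2 \<partial>N"
  assume Z [measurable]: "Z \<in> \<B> N" and K: "!!x. x \<in> space N ==> abs (Z x) <= K"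
  have K0: "abs (Z x) <= abs K" if "x \<in> space N" for x using K[OF that] by simp
  have int: "integrable N (%x. Z x*h x)" if "integrable N h" for h
  proof (rule int_bound[where f = "%x. abs K*h x"])
   show "AE x in N. norm (Z x*h x) <= norm (abs K*h x)"
    using K0 by (intro AE_I2) (auto simp: abs_mult intro!: mult_right_mono)
  qed (use that in auto)
  have fl: "integrable N h" if "integrable N (%x. (h x)^2)" "h \<in> \<B> N" for h :: "'a => real"
  proof (rule int_bound[where f = "%x. 1 + (h x)^2"])
   have "abs y <= 1 + y^2" for y :: real using amgm[of 1 1 y] by simp
   thus "AE x in N. norm (h x) <= norm (1 + (h x)^2)" by (auto intro!: AE_I2)
  qed (use that in auto)
  have "(%j. (\<integral>x. Z x*(f j x)^2 \<partial>N) - ?I) ----> 0"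
  proof (rule Lim_null_comparison[OF always_eventually, rule_format])
   fix j
   have "(\<integral>x. Z x*(f j x)^2 \<partial>N) - ?I = (\<integral>x. Z x*((f j x)^2 - (g x)^2) \<partial>N)"
    using int[OF fi] int[OF gi]
    by (subst lint_diff[symmetric]) (simp_all add: algebra_simps)
   also have "norm ... <= (\<integral>x. abs K*(?d j x + k j*(g x)^2 + ?d j x / k j) \<partial>N)"
   proof (unfold real_norm_def, rule bochner_abs_le)
    fix x assume x: "x \<in> space N"
    have "(f j x)^2 - (g x)^2 = ?d j x + 2*(g x*(f j x - g x))"
     by (simp add: power2_eq_square algebra_simps)
    hence "abs ((f j x)^2 - (g x)^2) <= ?d j x + k j*(g x)^2 + ?d j x / k j"
     using amgm[OF kpos[of j], of "g x" "f j x - g x"] zero_le_power2[of "f j x - g x"] by linarith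
    thus "abs (Z x*((f j x)^2 - (g x)^2)) <= abs K*(?d j x + k j*(g x)^2 + ?d j x / k j)"
     unfolding abs_mult using K0[OF x] by (intro mult_mono) simp_all
   qed (intro int int_diff fi gi int_add integrable_mult_right integrable_divide fgi)+
   also have "... = abs K*(r j + k j * ?G + r j / k j)"
    unfolding r_def using fgi gi by simp
   also have "... <= abs K*(r j + k j * ?G + k j)"
    using rk[of j] by (intro mult_left_mono) auto
   finally show "norm ((\<integral>x. Z x*(f j x)^2 \<partial>N) - ?I) <= abs K*(r j + k j * ?G + k j)" .
  next
   have "(%j. abs K*(r j + k j * ?G + k j)) ----> abs K*(0 + 0 * ?G + 0)"
    by (intro tendsto_intros r k)
   thus "(%j. abs K*(r j + k j * ?G + k j)) ----> 0" by simp
  qed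
  thus "(%j. \<integral>x. Z x*(f j x)^2 \<partial>N) ----> ?I" using LIM_zero_iff by blast
  have "(%j. (\<integral>x. Z x*f j x \<partial>N) - ?J) ----> 0"
  proof (rule Lim_null_comparison[OF always_eventually, rule_format])
   fix j
   have "(\<integral>x. Z x*f j x \<partial>N) - ?J = (\<integral>x. Z x*(f j x - g x) \<partial>N)"
    using int[OF fl[OF fi]] int[OF fl[OF gi]]
    by (subst lint_diff[symmetric]) (simp_all add: algebra_simps)
   also have "norm ... <= (\<integral>x. abs K*(k j + ?d j x / k j) \<partial>N)"
   proof (unfold real_norm_def, rule bochner_abs_le)
    fix x assume x: "x \<in> space N"
    have "abs (f j x - g x) <= 2*abs (1*(f j x - g x))" by simp
    also have "... <= k j*1^2 + ?d j x / k j" by (rule amgm[OF kpos])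
    finally have "abs (f j x - g x) <= k j + ?d j x / k j" by (simp only: one_power2 mult_1_right)
    thus "abs (Z x*(f j x - g x)) <= abs K*(k j + ?d j x / k j)"
     unfolding abs_mult using K0[OF x] by (intro mult_mono) simp_all
   next
    show "integrable N (%x. Z x*(f j x - g x))" by (rule int, rule fl[OF fgi]) measurable
    show "integrable N (%x. abs K*(k j + ?d j x / k j))"
     by (intro integrable_mult_right int_add integrable_divide fgi) simp
   qed
   also have "... = abs K*(k j*measure N (space N) + r j / k j)" unfolding r_def using fgi by simp
   also have "... <= abs K*(k j*measure N (space N) + k j)" using rk[of j] by (intro mult_left_mono) auto
   finally show "norm ((\<integral>x. Z x*f j x \<partial>N) - ?J) <= abs K*(k j*measure N (space N) + k j)" .
  next
   have "(%j. abs K*(k j*measure N (space N) + k j)) ----> abs K*(0*measure N (space N) + 0)"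
    by (intro tendsto_intros r k)
   thus "(%j. abs K*(k j*measure N (space N) + k j)) ----> 0" by simp
  qed
  thus "(%j. \<integral>x. Z x*f j x \<partial>N) ----> ?J" using LIM_zero_iff by blast
 }
 { assume f4: "!!j. integrable N (%x. f j x^4)" "!!j. (\<integral>x. f j x^4 \<partial>N) <= C"
  have "\<exists>q::nat=>nat. strict_mono q \<and> (AE x in N. (%j. ?d (q j) x) ----> 0)"
   using fgi r unfolding r_def by (intro tendsto_L1_AE_subseq) auto
  then obtain q :: "nat => nat" where q: "AE x in N. (%j. ?d (q j) x) ----> 0" by auto
  have "AE x in N. (%j. f (q j) x) ----> g x" using q
  proof eventually_elim
   case (elim x)
   from tendsto_real_sqrt[OF elim] show ?case using LIM_zero_iff by (simp add: tendsto_rabs_zero_iff) blast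
  qed
  from fourth_moment_limit[OF _ _ this, of C] f4 show "integrable N (%x. g x^4) \<and> (\<integral>x. g x^4 \<partial>N) <= C" by simp
 }
qed

section \<open>Moments of the Ito integral\<close>

locale brownian = prob_space M for M :: "'w measure" +
 fixes F :: "real => 'w measure" and B :: "real => 'w => real"
 assumes bm: "brownian_motion M F B"
begin

lemma space_F [simp]: "space (F t) = space M"
 using bm unfolding brownian_motion_def by (auto simp: filtration.space_F)

lemma sets_F: "sets (F t) \<subseteq> sets M"
 using bm unfolding brownian_motion_def subalgebra_def by auto

lemma F_mono: "s <= t ==> sets (F s) \<subseteq> sets (F t)"
 using bm unfolding brownian_motion_def by (auto dest: filtration.sets_F_mono)

lemma meas_mono: "s <= t ==> f \<in> measurable (F s) N ==> f \<in> measurable (F t) N"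
 using F_mono[of s t] by (auto simp: measurable_def)

lemma meas_M: "f \<in> measurable (F s) N ==> f \<in> measurable M N"
 using sets_F[of s] by (auto simp: measurable_def)

lemma B_meas: "0 <= t ==> t <= u ==> B t \<in> \<B> (F u)"
 using bm meas_mono unfolding brownian_motion_def adapted_def by blast

lemma B_meas_M: "0 <= t ==> B t \<in> \<B> M"
 using B_meas[of t t] meas_M by auto

lemma incr_has_moment:
 assumes "0 <= s" "s < t"
 shows "has_bochner_integral M (%w. B t w - B s w) 0"
  "has_bochner_integral M (%w. (B t w - B s w)^2) (t - s)"
  "has_bochner_integral M (%w. (B t w - B s w)^3) 0"
  "has_bochner_integral M (%w. (B t w - B s w)^4) (3*(t - s)^2)"
proof -
 let ?D = "%w. B t w - B s w" and ?s = "sqrt (t - s)"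
 have d: "distributed M lborel ?D (normal_density 0 ?s)" using bm assms unfolding brownian_motion_def by blast
 have pos: "0 < ?s" using assms by simp
 have *: "has_bochner_integral M (%w. ?D w ^ k) c"
  if "has_bochner_integral lborel (%x. normal_density 0 ?s x*(x - 0) ^ k) c" for k c
 proof -
  have i: "integrable M (%w. ?D w ^ k)"
   using distributed_integrable[OF d, of "%x. x ^ k"] that by (auto simp: has_bochner_integral_iff)
  have "(EE w. ?D w ^ k) = c"
   using distributed_integral[OF d, of "%x. x ^ k"] that by (auto simp: has_bochner_integral_iff)
  with i show ?thesis by (simp add: has_bochner_integral_iff)
 qed
 show "has_bochner_integral M ?D 0" using *[of 1 0] normal_moment_odd[OF pos, of 0 0] by simp
 show "has_bochner_integral M (%w. (?D w)^2) (t - s)"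
  using *[of 2 "t - s"] normal_moment_even[OF pos, of 0 1] assms by (simp add: diff_divide_distrib)
 show "has_bochner_integral M (%w. (?D w)^3) 0"
  using *[of 3 0] normal_moment_odd[OF pos, of 0 1] by (simp add: numeral_3_eq_3)
 have "fact 4 / ((2 / ?s^2)^2*fact 2) = (3::real)*(t - s)^2"
  using assms by (simp add: fact_numeral field_simps power2_eq_square)
 thus "has_bochner_integral M (%w. (?D w)^4) (3*(t - s)^2)"
  using *[of 4 "3*(t - s)^2"] normal_moment_even[OF pos, of 0 2] by simp
qed

text \<open>\<open>preimages\<close> of the increment is already a sigma-algebra, so the
  independence contained in \<open>brownian_motion\<close> is the one between generated
  sigma-algebras that \<open>indep_var\<close> asks for.\<close>

lemma incr_indep:
 assumes "0 <= s" "s < t" "Z \<in> \<B> (F s)"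
 shows "indep_var borel Z borel (%w. B t w - B s w)"
proof -
 let ?D = "%w. B t w - B s w"
 have i: "indep_set (sets (F s)) (preimages M ?D)" using bm assms unfolding brownian_motion_def by blast
 have D: "?D \<in> \<B> M" using assms B_meas_M by auto
 have "sigma_sets (space M) {Z -` A \<inter> space M |A. A \<in> sets borel} \<subseteq> sets (F s)"
  using sets.sigma_sets_subset[of "{Z -` A \<inter> space M |A. A \<in> sets borel}" "F s"] assms(3)
  by (auto simp: measurable_def)
 moreover have "sigma_sets (space M) {?D -` A \<inter> space M |A. A \<in> sets borel} = preimages M ?D"
  using sigma_sets_vimage_commute[of ?D "space M" UNIV "sets borel"]
  by (auto simp: preimages_def sets.sigma_sets_eq[of borel, simplified])
 ultimately show ?thesis unfolding indep_var_eq using i D meas_M[OF assms(3)]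
  by (auto simp: indep_set_def intro!: indep_sets_mono_sets[OF i[unfolded indep_set_def]] split: bool.splits)
qed

text \<open>Moments of the centred normal law with variance \<open>h\<close>, correct for orders up
  to 4, the only ones that occur.\<close>

definition gauss_mom :: "nat => real => real" where
 "gauss_mom k h = (if k = 0 then 1 else if k = 2 then h else if k = 4 then 3*h^2 else 0)"

lemma incr_moment:
 assumes "0 <= s" "s <= t" "Z \<in> \<B> (F s)" "integrable M Z" "k <= 4"
 shows "has_bochner_integral M (%w. Z w*(B t w - B s w) ^ k) ((EE w. Z w)*gauss_mom k (t - s))"
proof (cases "s = t")
 case True
 thus ?thesis using assms(4) by (cases k) (auto simp: gauss_mom_def has_bochner_integral_iff)
next
 case False
 with assms have st: "s < t" by simp
 have k: "k = 0 \<or> k = 1 \<or> k = 2 \<or> k = 3 \<or> k = 4" using assms(5) by auto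
 let ?D = "%w. (B t w - B s w)"
 have h: "has_bochner_integral M (%w. ?D w ^ k) (gauss_mom k (t - s))" using k incr_has_moment[OF assms(1) st]
  by (auto simp: gauss_mom_def has_bochner_integral_iff prob_space)
 have ind: "indep_var borel Z borel (%w. ?D w ^ k)"
  using indep_var_compose[OF incr_indep[OF assms(1) st assms(3)], of id borel "%x. x ^ k" borel]
  by (simp add: comp_def)
 show ?thesis using indep_var_lebesgue_integral[OF ind assms(4)] indep_var_integrable[OF ind assms(4)] h
  by (auto simp: has_bochner_integral_iff)
qed

definition msum :: "(nat => 'w => real) => (nat => real) => nat => 'w => real" where
 "msum xi c m w = (\<Sum>i<m. xi i w*(B (c (Suc i)) w - B (c i) w))"

text \<open>Induction on the number of cells, expanding powers of \<open>S + xi D\<close>: the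
  factor of each power of the new increment \<open>D\<close> is known at time \<open>c m\<close>, so
  expectations factorise and odd powers of \<open>D\<close> drop out. The fourth moment uses the
  second one for its mixed term, and the constant 3 reproduces itself because
  \<open>3 p^2 + 6 p q + 3 q^2 = 3 (p + q)^2\<close>; hence one induction for all claims. The weight
  \<open>Z\<close>, known at time \<open>c 0\<close>, stands for conditioning on the past.\<close>

lemma msum_moments:
 assumes "0 <= c 0" and c: "!!i. i < k ==> c i <= c (Suc i)"
  and xi: "!!i. i < k ==> xi i \<in> \<B> (F (c i))"
  and bd: "!!i w. i < k ==> w \<in> space M ==> abs (xi i w) <= C"
  and Z: "Z \<in> \<B> (F (c 0))" "!!w. w \<in> space M ==> abs (Z w) <= K" and "m <= k"
 shows "c 0 <= c m \<and> msum xi c m \<in> \<B> (F (c m)) \<and>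
  integrable M (%w. msum xi c m w^4) \<and>
  (EE w. msum xi c m w^4) <= 3*C^4*(c m - c 0)^2 \<and>
  (EE w. (msum xi c m w)^2) <= C^2*(c m - c 0) \<and>
  (EE w. Z w*msum xi c m w) = 0 \<and>
  (EE w. Z w*(msum xi c m w)^2) = (EE w. Z w*(\<Sum>i<m. (xi i w)^2*(c (Suc i) - c i)))"
 using \<open>m <= k\<close>
proof (induction m)
 case 0
 thus ?case by (simp add: msum_def)
next
 case (Suc m)
 hence mk: "m < k" by simp
 have IH: "c 0 <= c m" "msum xi c m \<in> \<B> (F (c m))"
  "integrable M (%w. msum xi c m w^4)"
  "(EE w. msum xi c m w^4) <= 3*C^4*(c m - c 0)^2"
  "(EE w. (msum xi c m w)^2) <= C^2*(c m - c 0)"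
  "(EE w. Z w*msum xi c m w) = 0"
  "(EE w. Z w*(msum xi c m w)^2) = (EE w. Z w*(\<Sum>i<m. (xi i w)^2*(c (Suc i) - c i)))"
  using Suc.IH Suc.prems by auto
 let ?S = "msum xi c m" and ?T = "msum xi c (Suc m)" and ?h = "c (Suc m) - c m" and ?D = "%w. B (c (Suc m)) w - B (c m) w"
 let ?m = "%q. gauss_mom q ?h"
 have cm: "0 <= c m" "c m <= c (Suc m)" using assms(1) IH(1) c[OF mk] by auto
 have meas [measurable]: "?S \<in> \<B> (F (c m))" "xi m \<in> \<B> (F (c m))"
  "Z \<in> \<B> (F (c m))" using IH(2) xi[OF mk] meas_mono[OF IH(1) Z(1)] by auto
 have measM: "?S \<in> \<B> M" "xi m \<in> \<B> M" "Z \<in> \<B> M" using meas meas_M by blast+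
 have C0: "0 <= C" using bd[OF mk] not_empty by force
 have K0: "0 <= K" using Z(2) not_empty by force
 have Sint: "integrable M (%w. ?S w ^ j)" if "j <= 4" for j
  using prob_space_power_integrable[OF prob_space_axioms measM(1) IH(3) that] .
 \<comment> \<open>The monomials in the old sum and the new coefficient that appear in all
   expansions; the flag \<open>z\<close> switches the weight \<open>Z\<close> on.\<close>
 define G where "G z j p = (%w. (if z then Z w else 1) * ?S w ^ j*xi m w ^ p)" for z j p
 let ?g = "%z j p. EE w. G z j p w"
 have Gm: "G z j p \<in> \<B> (F (c m))" for z j p unfolding G_def by measurable
 have Gi: "integrable M (G z j p)" if "j <= 4" for z j p
 proof (rule int_bound[where f = "%w. (max 1 K*C ^ p) * ?S w ^ j"])
  show "integrable M (%w. (max 1 K*C ^ p) * ?S w ^ j)" using Sint[OF that] by simp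
  show "G z j p \<in> \<B> M" using Gm meas_M by blast
  show "AE w in M. norm (G z j p w) <= norm (max 1 K*C ^ p * ?S w ^ j)"
  proof (rule AE_I2)
   fix w assume wv: "w \<in> space M"
   have 1: "abs (if z then Z w else 1) <= max 1 K" using Z(2)[OF wv] by auto
   have 2: "abs (xi m w ^ p) <= C ^ p" using bd[OF mk wv] by (simp add: power_abs power_mono)
   have "abs (if z then Z w else 1)*abs (xi m w ^ p)*abs (?S w ^ j) <= max 1 K*C ^ p*abs (?S w ^ j)"
    using 1 2 C0 by (intro mult_right_mono mult_mono) auto
   thus "norm (G z j p w) <= norm (max 1 K*C ^ p * ?S w ^ j)" using C0 by (simp add: G_def abs_mult mult_ac)
  qed
 qed
 have mom: "has_bochner_integral M (%w. G z j p w * ?D w ^ q) (?g z j p*gauss_mom q ?h)"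
  if "j <= 4" "q <= 4" for z j p q using incr_moment[OF cm Gm Gi[OF that(1)] that(2)] .
 have Suc_eq: "?T w = ?S w + xi m w * ?D w" for w by (simp add: msum_def)
 have m1: "c 0 <= c (Suc m)" using IH(1) cm by simp
 have "?S \<in> \<B> (F (c (Suc m)))" "xi m \<in> \<B> (F (c (Suc m)))"
  using meas(1,2) by (blast intro: meas_mono[OF cm(2)])+
 hence m2: "?T \<in> \<B> (F (c (Suc m)))"
  unfolding Suc_eq[abs_def] using B_meas[of "c (Suc m)" "c (Suc m)"] B_meas[of "c m" "c (Suc m)"] cm by auto
 have e4: "?T w^4 = G False 4 0 w * ?D w^0 + 4*(G False 3 1 w * ?D w^1)
   + 6*(G False 2 2 w * ?D w^2) + 4*(G False 1 3 w * ?D w^3) + G False 0 4 w * ?D w^4" for w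
  unfolding Suc_eq G_def by (simp add: power4_eq_xxxx power3_eq_cube power2_eq_square algebra_simps)
 have h4: "has_bochner_integral M (%w. ?T w^4)
  (?g False 4 0 * ?m 0 + 4*(?g False 3 1 * ?m 1)
   + 6*(?g False 2 2 * ?m 2) + 4*(?g False 1 3 * ?m 3)
   + ?g False 0 4 * ?m 4)" unfolding e4
  by (intro has_bochner_integral_add has_bochner_integral_mult_right mom) auto
 have G22: "?g False 2 2 <= C^2*(C^2*(c m - c 0))"
 proof -
  have "?g False 2 2 <= (EE w. C^2*(?S w)^2)"
  proof (rule integral_mono)
   fix w assume wv: "w \<in> space M"
   have "(xi m w)^2 <= C^2" using bd[OF mk wv] C0 by (simp add: abs_le_square_iff[symmetric])
   thus "G False 2 2 w <= C^2*(?S w)^2" by (simp add: G_def mult.commute mult_right_mono)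
  qed (use Gi[of 2] Sint[of 2] in auto)
  also have "... <= C^2*(C^2*(c m - c 0))" using mult_left_mono[OF IH(5), of "C^2"] by simp
  finally show ?thesis .
 qed
 have G04: "?g False 0 p <= C ^ p" for p
 proof -
  have "?g False 0 p <= (EE w. C ^ p)"
  proof (rule integral_mono)
   fix w assume wv: "w \<in> space M"
   have "abs (xi m w ^ p) <= C ^ p" using bd[OF mk wv] by (simp add: power_abs power_mono)
   thus "G False 0 p w <= C ^ p" by (simp add: G_def)
  qed (use Gi[of 0] in auto)
  thus ?thesis by (simp add: prob_space)
 qed
 have m4: "(EE w. ?T w^4) <= 3*C^4*(c (Suc m) - c 0)^2"
 proof -
  have "(EE w. ?T w^4) = (EE w. ?S w^4)
   + 6*(?g False 2 2 * ?h) + ?g False 0 4*(3 * ?h^2)"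
   using has_bochner_integral_integral_eq[OF h4] by (simp add: gauss_mom_def G_def)
  also have "... <= 3*C^4*(c m - c 0)^2 + 6*((C^2*(C^2*(c m - c 0))) * ?h) + C^4*(3 * ?h^2)"
   using IH(4) G22 G04[of 4] cm by (intro add_mono mult_left_mono mult_right_mono) auto
  also have "... = 3*C^4*(c (Suc m) - c 0)^2"
   by (simp add: power4_eq_xxxx power2_eq_square algebra_simps)
  finally show ?thesis .
 qed
 have e2: "(?T w)^2 = G False 2 0 w * ?D w^0 + 2*(G False 1 1 w * ?D w^1)
   + G False 0 2 w * ?D w^2" for w unfolding Suc_eq G_def by (simp add: power2_eq_square algebra_simps)
 have h2: "has_bochner_integral M (%w. (?T w)^2)
  (?g False 2 0 * ?m 0 + 2*(?g False 1 1 * ?m 1)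
   + ?g False 0 2 * ?m 2)"
  unfolding e2 by (intro has_bochner_integral_add has_bochner_integral_mult_right mom) auto
 have "(EE w. (?T w)^2) = (EE w. (?S w)^2) + ?g False 0 2 * ?h"
  using has_bochner_integral_integral_eq[OF h2] by (simp add: gauss_mom_def G_def)
 also have "... <= C^2*(c m - c 0) + C^2 * ?h"
  using IH(5) G04[of 2] cm by (intro add_mono mult_right_mono) auto
 finally have m5: "(EE w. (?T w)^2) <= C^2*(c (Suc m) - c 0)" by (simp add: algebra_simps)
 have e1: "Z w * ?T w = G True 1 0 w * ?D w^0 + G True 0 1 w * ?D w^1" for w
  unfolding Suc_eq G_def by (simp add: algebra_simps)
 have h1: "has_bochner_integral M (%w. Z w * ?T w)
  (?g True 1 0 * ?m 0 + ?g True 0 1 * ?m 1)"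
  unfolding e1 by (intro has_bochner_integral_add mom) auto
 have m6: "(EE w. Z w * ?T w) = 0"
  using has_bochner_integral_integral_eq[OF h1] IH(6) by (simp add: gauss_mom_def G_def)
 have ez: "Z w*(?T w)^2 = G True 2 0 w * ?D w^0 + 2*(G True 1 1 w * ?D w^1)
   + G True 0 2 w * ?D w^2" for w unfolding Suc_eq G_def by (simp add: power2_eq_square algebra_simps)
 have hz: "has_bochner_integral M (%w. Z w*(?T w)^2)
  (?g True 2 0 * ?m 0 + 2*(?g True 1 1 * ?m 1)
   + ?g True 0 2 * ?m 2)"
  unfolding ez by (intro has_bochner_integral_add has_bochner_integral_mult_right mom) auto
 have Zi: "integrable M (%w. Z w*(xi i w)^2)" if "i < k" for i
 proof (rule integrable_const_bound[where B = "K*C^2"])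
  show "(%w. Z w*(xi i w)^2) \<in> \<B> M" using measM(3) meas_M[OF xi[OF that]] by auto
  show "AE w in M. norm (Z w*(xi i w)^2) <= K*C^2" using Z(2) bd[OF that] K0 C0
   by (intro AE_I2) (auto simp: abs_mult abs_le_square_iff[symmetric] intro!: mult_mono)
 qed
 have Zi': "integrable M (%w. Z w*(\<Sum>i<m. (xi i w)^2*(c (Suc i) - c i)))"
  unfolding sum_distrib_left mult.assoc[symmetric]
  using Zi mk by (intro int_sum integrable_mult_left) auto
 have "(EE w. Z w*(?T w)^2)
   = (EE w. Z w*(?S w)^2) + (EE w. Z w*(xi m w)^2) * ?h"
  using has_bochner_integral_integral_eq[OF hz] by (simp add: gauss_mom_def G_def)
 also have "... = (EE w. Z w*(\<Sum>i<m. (xi i w)^2*(c (Suc i) - c i)) + Z w*(xi m w)^2 * ?h)"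
  using IH(7) Zi[OF mk] Zi' by (subst lint_add) auto
 also have "... = (EE w. Z w*(\<Sum>i<Suc m. (xi i w)^2*(c (Suc i) - c i)))" by (simp add: algebra_simps)
 finally have m7: "(EE w. Z w*(?T w)^2) = ..." .
 have i4: "integrable M (%w. ?T w^4)" using h4 by (simp add: has_bochner_integral_iff)
 from m1 m2 i4 m4 m5 m6 m7 show ?case by blast
qed

end

text \<open>The half-open cells are disjoint, so at each time at most one summand is active;
  \<open>phi 0 = 0\<close> takes care of times outside all cells.\<close>

lemma simple_process_comp:
 fixes phi :: "real => real"
 assumes "!!i. i < k ==> ts i <= ts (Suc i)" "phi 0 = 0"
 shows "phi (simple_process k ts xi t w) = simple_process k ts (%i w. phi (xi i w)) t w" using assms(1)
proof (induction k)
 case 0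
 thus ?case using assms(2) by (simp add: simple_process_def)
next
 case (Suc k)
 have IH: "phi (simple_process k ts xi t w) = simple_process k ts (%i w. phi (xi i w)) t w" using Suc by simp
 have mono: "ts j <= ts k" if "j <= k" for j
  using that by (induction k rule: dec_induct[where i = j]) (use Suc.prems in "auto intro: order_trans")
 show ?case
 proof (cases "t \<in> {ts k <.. ts (Suc k)}")
  case True
  hence "simple_process k ts y t w = 0" for y unfolding simple_process_def
  proof (intro sum.neutral ballI)
   fix i assume "i \<in> {..<k}"
   hence "ts (Suc i) <= ts k" by (intro mono) simp
   thus "y i w*indicator {ts i <.. ts (Suc i)} t = 0" using True by (simp add: indicator_def)
  qed
  thus ?thesis using True by (simp add: simple_process_def)
 next
  case False
  thus ?thesis using IH by (simp add: simple_process_def)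
 qed
qed

text \<open>Progressive measurability gives joint measurability on each \<open>[0, n]\<close>, and
  the claim follows in the pointwise limit. The indicator removes negative times, about which the
  definition says nothing.\<close>

lemma progressive_joint_measurable:
 assumes "progressively_measurable F H" "!!t. subalgebra M (F t)"
 shows "(%(s, w). indicator {0..} s*H s w) \<in> \<B> (borel \<Otimes>\<^sub>M M)"
proof (rule borel_measurable_LIMSEQ_real)
 fix n :: nat
 let ?T = "real n"
 let ?Q = "borel \<Otimes>\<^sub>M M" and ?A = "{0..?T} \<times> space M"
 let ?R = "restrict_space ?Q ?A"
 have 1: "(%(s, w). H s w) \<in> \<B> (restrict_space borel {0..?T} \<Otimes>\<^sub>M F ?T)"
  using assms(1) unfolding progressively_measurable_def by simp
 have "(%x. (fst x, snd x)) \<in> measurable ?R (restrict_space borel {0..?T} \<Otimes>\<^sub>M F ?T)"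
 proof (rule measurable_Pair)
  show "fst \<in> measurable ?R (restrict_space borel {0..?T})"
   by (rule measurable_restrict_space3) auto
  have "snd \<in> measurable ?R M"
   by (rule measurable_restrict_space1) simp
  thus "snd \<in> measurable ?R (F ?T)"
   using assms(2)[of ?T] by (auto simp: measurable_def subalgebra_def)
 qed
 from measurable_compose[OF this 1]
 have "(%x. H (fst x) (snd x)) \<in> \<B> ?R"
  by (simp add: case_prod_beta')
 hence 2: "(%x. indicator ?A x *\<^sub>R H (fst x) (snd x)) \<in> \<B> ?Q"
  by (subst (asm) borel_measurable_restrict_space_iff) auto
 show "(%(s, w). indicator {0..?T} s*H s w) \<in> \<B> ?Q"
  by (rule measurable_cong[THEN iffD1, OF _ 2]) (auto simp: space_pair_measure indicator_def)
next
 fix x :: "real \<times> 'a"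
 obtain s wv where x: "x = (s, wv)" by force
 obtain n where n: "s <= real n" using real_arch_simple by blast
 have "\<forall>\<^sub>F i in sequentially. (case x of (s, w) => indicat_real {0..real i} s*H s w) = (case x of (s, w) => indicat_real {0..} s*H s w)"
  using eventually_ge_at_top[of n] by eventually_elim (use n in "auto simp: x indicator_def")
 thus "(%i. case x of (s, w) => indicat_real {0..real i} s*H s w) ----> (case x of (s, w) => indicat_real {0..} s*H s w)"
  by (rule tendsto_eventually)
qed

lemma clamp_dist: "abs (max (-K) (min K x) - y) <= abs (x - y)" if "abs y <= K" for x y K :: real
 using that by (auto simp: max_def min_def abs_if split: if_splits)

lemma square_sum_le: "(x + y)^2 <= 2*x^2 + 2*y^2" for x y :: real
 using zero_le_power2[of "x - y"] by (simp add: power2_eq_square algebra_simps)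

lemma nn_integral_square_sum_le:
 fixes f p q :: "'a => real"
 assumes "!!x. abs (f x) <= abs (p x) + abs (q x)" and [measurable]: "p \<in> \<B> N" "q \<in> \<B> N"
 shows "(\<integral>\<^sup>+x. ennreal ((f x)^2) \<partial>N)
  <= 2*(\<integral>\<^sup>+x. ennreal ((p x)^2) \<partial>N) + 2*(\<integral>\<^sup>+x. ennreal ((q x)^2) \<partial>N)"
proof -
 have "(\<integral>\<^sup>+x. ennreal ((f x)^2) \<partial>N) <= (\<integral>\<^sup>+x. 2*ennreal ((p x)^2) + 2*ennreal ((q x)^2) \<partial>N)"
 proof (intro nn_integral_mono)
  fix x
  have "(f x)^2 <= (abs (p x) + abs (q x))^2" using power_mono[OF assms(1), of x 2] by simp
  hence "ennreal ((f x)^2) <= ennreal (2*(p x)^2 + 2*(q x)^2)"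
   using square_sum_le[of "abs (p x)" "abs (q x)"] by (intro ennreal_leI) simp
  thus "ennreal ((f x)^2) <= 2*ennreal ((p x)^2) + 2*ennreal ((q x)^2)"
   by (simp add: ennreal_plus ennreal_mult)
 qed
 also have "... = 2*(\<integral>\<^sup>+x. ennreal ((p x)^2) \<partial>N) + 2*(\<integral>\<^sup>+x. ennreal ((q x)^2) \<partial>N)"
  by (subst nn_integral_add) (auto simp: nn_integral_cmult)
 finally show ?thesis .
qed

context brownian
begin

lemma subalg: "subalgebra M (F t)"
 using sets_F by (auto simp: subalgebra_def)

text \<open>Clamping the partition to \<open>[s, t]\<close> turns the increment of the integral into
  a sum of the form \<open>msum\<close> that starts no earlier than \<open>s\<close>, so that
  weights known at time \<open>s\<close> are allowed.\<close>

lemma simple_integral_incr: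
 assumes "simple_data F k ts xi" "0 <= s" "s <= t"
  and bd: "!!i w. i < k ==> w \<in> space M ==> abs (xi i w) <= C" and "0 <= C"
  and Z: "Z \<in> \<B> (F s)" "!!w. w \<in> space M ==> abs (Z w) <= K"
 defines "D \<equiv> %w. simple_integral B k ts xi t w - simple_integral B k ts xi s w"
 shows "D \<in> \<B> M" "integrable M (%w. D w^4)"
  "(EE w. D w^4) <= 3*C^4*(t - s)^2" (is ?th1)
  "(EE w. Z w*D w) = 0"
  "(EE w. Z w*(D w)^2) = (EE w. Z w*ival s t (%r. (simple_process k ts xi r w)^2))" (is ?th2)
proof -
 define c where "c i = max s (min t (ts i))" for i
 \<comment> \<open>A cell that collapses under clamping may start after \<open>t\<close>, so that
   \<open>xi i\<close> is not yet known at the clamped time. Setting it to 0 restores adaptedness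
   and changes nothing, since the increment of \<open>B\<close> over such a cell is 0.\<close>
 define xi' where "xi' i = (if c i < c (Suc i) then xi i else (%_. 0))" for i
 have ts: "ts i <= ts (Suc i)" "xi i \<in> \<B> (F (ts i))" if "i < k" for i
  using assms(1) that by (auto simp: simple_data_def)
 have c: "c i <= c (Suc i)" if "i < k" for i using ts(1)[OF that] by (auto simp: c_def)
 have c0: "s <= c 0" "c k <= t" "0 <= c 0" using assms(2,3) by (auto simp: c_def)
 have m: "xi' i \<in> \<B> (F (c i))" if "i < k" for i
 proof (cases "c i < c (Suc i)")
  case True
  hence "ts i <= c i" by (auto simp: c_def max_def min_def split: if_splits)
  thus ?thesis using meas_mono[OF _ ts(2)[OF that]] True by (simp add: xi'_def)
 qed (simp add: xi'_def)
 have DB: "D w = msum xi' c k w" for w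
 proof -
  let ?b = "%t i w. B (min t (ts (Suc i))) w - B (min t (ts i)) w"
  have "xi i w * ?b t i w - xi i w * ?b s i w
   = xi' i w*(B (c (Suc i)) w - B (c i) w)" if "i < k" for i
  proof -
   have "?b t i w - ?b s i w
    = B (c (Suc i)) w - B (c i) w" using ts(1)[OF that] assms(2,3) by (auto simp: c_def max_def min_def)
   hence "xi i w * ?b t i w - xi i w * ?b s i w
    = xi i w*(B (c (Suc i)) w - B (c i) w)"  unfolding right_diff_distrib[symmetric] by simp
   thus ?thesis using c[OF that] by (auto simp: xi'_def)
  qed
  thus ?thesis unfolding D_def simple_integral_def msum_def by (simp add: sum_subtractf[symmetric])
 qed
 have bd': "abs (xi' i w) <= C" if "i < k" "w \<in> space M" for i w
  using bd[OF that] \<open>0 <= C\<close> by (auto simp: xi'_def)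
 note mm = msum_moments[OF c0(3) c m bd' meas_mono[OF c0(1) Z(1)] Z(2) order_refl]
 show "D \<in> \<B> M" using mm meas_M unfolding DB[abs_def] by blast
 show "integrable M (%w. D w^4)" using mm unfolding DB[abs_def] by blast
 have "(EE w. D w^4) <= 3*C^4*(c k - c 0)^2" using mm unfolding DB[abs_def] by blast
 also have "... <= 3*C^4*(t - s)^2" using c0 mm by (intro mult_left_mono power_mono) auto
 finally show ?th1 .
 show "(EE w. Z w*D w) = 0" using mm unfolding DB[abs_def] by blast
 have "(EE w. Z w*(D w)^2) = (EE w. Z w*(\<Sum>i<k. (xi' i w)^2*(c (Suc i) - c i)))"
  using mm unfolding DB[abs_def] by blast
 moreover have "(\<Sum>i<k. (xi' i w)^2*(c (Suc i) - c i)) = ival s t (%r. (simple_process k ts xi r w)^2)" for w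
 proof -
  have "ival s t (%r. (simple_process k ts xi r w)^2)
   = (\<integral>r. (\<Sum>i<k. (xi i w)^2*indicator {c i<..c (Suc i)} r) \<partial>lborel)"
  proof (rule lint_cong[OF refl])
   fix r
   have "(simple_process k ts xi r w)^2 = simple_process k ts (%i w. (xi i w)^2) r w"
    using simple_process_comp[of k ts "%x. x^2"] ts by simp
   hence "indicator {s<..t} r*(simple_process k ts xi r w)^2
     = (\<Sum>i<k. (xi i w)^2*(indicator {s<..t} r*indicator {ts i<..ts (Suc i)} r))"
    by (simp only: simple_process_def sum_distrib_left mult.left_commute)
   moreover have "indicat_real {s<..t} r*indicat_real {ts i<..ts (Suc i)} r = indicat_real {c i<..c (Suc i)} r" if "i < k" for i
    using ts(1)[OF that] assms(2,3) by (auto simp: c_def indicator_def)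
   ultimately show "indicator {s<..t} r*(simple_process k ts xi r w)^2 = (\<Sum>i<k. (xi i w)^2*indicator {c i<..c (Suc i)} r)"
    by (simp del: mult_eq_0_iff mult_cancel_left cong: sum.cong_simp)
  qed
  also have "... = (\<Sum>i<k. (xi i w)^2*(c (Suc i) - c i))"
   by (subst lint_sum) (auto intro!: sum.cong simp: c)
  also have "... = (\<Sum>i<k. (xi' i w)^2*(c (Suc i) - c i))"
   by (intro sum.cong refl) (use c in "fastforce simp: xi'_def")
  finally show ?thesis ..
 qed
 ultimately show ?th2
  by simp
qed

lemma simple_process_measurable:
 assumes "simple_data F k ts xi"
 shows "(%(r, w). simple_process k ts xi r w) \<in> \<B> (borel \<Otimes>\<^sub>M M)"
proof -
 have "xi i \<in> \<B> M" if "i < k" for i using assms that meas_M by (auto simp: simple_data_def)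
 hence [measurable]: "(%x. xi i (snd x)) \<in> \<B> (borel \<Otimes>\<^sub>M M)" if "i < k" for i
  using that by simp
 show ?thesis unfolding simple_process_def case_prod_beta'
  by (intro borel_measurable_sum borel_measurable_times) auto
qed

lemma simple_data_bounded:
 assumes "simple_data F k ts xi"
 obtains C where "0 <= C" "!!i w. i < k ==> w \<in> space M ==> abs (xi i w) <= C"
proof -
 have "\<forall>i<k. \<exists>C. \<forall>w\<in>space M. abs (xi i w) <= C" using assms by (auto simp: simple_data_def)
 then obtain C where C: "!!i w. i < k ==> w \<in> space M ==> abs (xi i w) <= C i" by metis
 have "abs (xi i w) <= (\<Sum>i<k. abs (C i))" if "i < k" "w \<in> space M" for i w
 proof -
  have "abs (xi i w) <= abs (C i)" using C[OF that] by simp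
  also have "... <= (\<Sum>i<k. abs (C i))" by (rule member_le_sum) (use that in auto)
  finally show ?thesis .
 qed
 thus ?thesis using that[of "\<Sum>i<k. abs (C i)"] by (simp add: sum_nonneg)
qed

text \<open>Ito's isometry, phrased with nonnegative integrals so that it can be used inside the
  limits of \<open>ito_integral\<close>.\<close>

lemma simple_integral_isometry:
 assumes sd: "simple_data F k ts xi" and T: "0 <= T"
 shows "(NN w. ennreal ((simple_integral B k ts xi T w)^2))
  = (NN w. (\<integral>\<^sup>+t\<in>{0..T}. ennreal ((simple_process k ts xi t w)^2) \<partial>lborel))"
proof -
 obtain C where C0: "0 <= C" and C: "!!i w. i < k ==> w \<in> space M ==> abs (xi i w) <= C"
  using simple_data_bounded[OF sd] by blast
 have R0: "simple_integral B k ts xi 0 w = 0" for w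
 proof -
  have "0 <= ts i" if "i <= k" for i
   using that by (induction i) (use sd in "auto simp: simple_data_def intro: order_trans")
  thus ?thesis unfolding simple_integral_def by (auto intro!: sum.neutral)
 qed
 let ?D = "simple_integral B k ts xi T" and ?P = "simple_process k ts xi"
 let ?G = "%w. ival 0 T (%r. (?P r w)^2)"
 note si = simple_integral_incr[OF sd order_refl T C C0, of "%_. 1" 1, unfolded R0 diff_zero, simplified]
 have Dm: "?D \<in> \<B> M" "integrable M (%w. ?D w^4)"
  "(EE w. (?D w)^2) = (EE w. ?G w)" using si by auto
 have D2: "integrable M (%w. (?D w)^2)"
  using prob_space_power_integrable[OF prob_space_axioms Dm(1,2), of 2] by simp
 define c where "c = (real k*C)^2"
 have c: "(?P t w)^2 <= c" if wv: "w \<in> space M" for t w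
 proof -
  have "abs (?P t w) <= (\<Sum>i<k. C)" unfolding simple_process_def using C[OF _ wv] C0
   by (intro order_trans[OF sum_abs] sum_mono) (auto simp: indicator_def abs_mult)
  thus "(?P t w)^2 <= c" unfolding c_def by (subst abs_le_square_iff[symmetric]) (use C0 in simp)
 qed
 have sm: "(%r. ?P r w) \<in> \<B> lborel" for w unfolding simple_process_def by measurable
 have ic: "iable 0 T (%r. c)" by (intro integrable_mult_left integrable_real_indicator) (use T in auto)
 have gi: "iable 0 T (%r. (?P r w)^2)" if "w \<in> space M" for w
 proof (rule int_bound[where f = "%r. indicator {0<..T} r*c"])
  show "iable 0 T (%r. c)" by (rule ic)
  show "(%r. indicator {0<..T} r*(?P r w)^2) \<in> \<B> lborel" using sm by measurable
  have "0 <= c" by (simp add: c_def)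
  thus "AE r in lborel. norm (indicator {0<..T} r*(?P r w)^2) <= norm (indicator {0<..T} r*c)"
   using c[OF that] by (intro AE_I2) (simp add: indicator_def)
 qed
 have G: "ennreal (?G w) = (\<integral>\<^sup>+t\<in>{0..T}. ennreal ((?P t w)^2) \<partial>lborel)" if "w \<in> space M" for w
 proof -
  have "ennreal (?G w) = (\<integral>\<^sup>+r. ennreal (indicator {0<..T} r*(?P r w)^2) \<partial>lborel)"
   using nn_integral_eq_integral[OF gi[OF that]] by simp
  also have "... = (\<integral>\<^sup>+t\<in>{0..T}. ennreal ((?P t w)^2) \<partial>lborel)"
   using AE_lborel_singleton[of "0::real"]
   by (intro nn_integral_cong_AE) (auto elim!: eventually_mono simp: indicator_def)
  finally show ?thesis .
 qed
 have Gm: "?G \<in> \<B> M"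
 proof -
  have "(%(w, r). indicator {0<..T} r*(?P r w)^2) \<in> \<B> MT"
   using measurable_compose[OF measurable_pair_swap' simple_process_measurable[OF sd]]
   by (auto simp: case_prod_beta')
  thus ?thesis by (intro lborel.borel_measurable_lebesgue_integral) auto
 qed
 have Gi: "integrable M ?G"
 proof (rule integrable_const_bound[where B = "ival 0 T (%r. c)"])
  show "AE w in M. norm (?G w) <= ival 0 T (%r. c)"
  proof (rule AE_I2)
   fix w assume wv: "w \<in> space M"
   have "0 <= ?G w" by simp
   moreover have "?G w <= ival 0 T (%r. c)"
    using c[OF wv] by (intro integral_mono gi[OF wv] ic mult_left_mono) auto
   ultimately show "norm (?G w) <= ival 0 T (%r. c)" by simp
  qed
 qed (rule Gm)
 have "(NN w. ennreal ((?D w)^2)) = ennreal (EE w. ?G w)" using nn_integral_eq_integral[OF D2] Dm(3) by simp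
 also have "... = (NN w. ennreal (?G w))" using nn_integral_eq_integral[OF Gi] by simp
 also have "... = (NN w. (\<integral>\<^sup>+t\<in>{0..T}. ennreal ((?P t w)^2) \<partial>lborel))"
  by (intro nn_integral_cong G)
 finally show ?thesis .
qed

lemma simple_integral_meas:
 assumes "simple_data F k ts xi" "0 <= T"
 shows "simple_integral B k ts xi T \<in> \<B> M"
proof -
 have ts: "0 <= ts i" if "i <= k" for i
  using that by (induction i) (use assms in "auto simp: simple_data_def intro: order_trans")
 have "xi i \<in> \<B> M" if "i < k" for i using assms that meas_M by (auto simp: simple_data_def)
 thus ?thesis unfolding simple_integral_def using ts assms(2)
  by (intro borel_measurable_sum borel_measurable_times borel_measurable_diff B_meas_M) auto
qed

text \<open>Simple processes that approximate \<open>H\<close> in L2 may lack a common bound, which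
  uniform fourth moments require. Truncation at the bound \<open>K\<close> of \<open>H\<close> only
  brings them closer to \<open>H\<close>. That the integrals still converge to the same
  \<open>I\<close> follows from the isometry for the difference of truncated and original processes,
  which is at most twice the original error.\<close>

lemma truncated_approximation:
 assumes ito: "ito_integral M F B H I" and "0 <= K"
  and K: "!!t w. 0 <= t ==> w \<in> space M ==> abs (H t w) <= K"
 obtains k ts xi where "!!j. simple_data F (k j) (ts j) (xi j)"
  "!!j i w. abs (xi j i w) <= K"
  "!!T. 0 <= T ==> (%j. NN w. (\<integral>\<^sup>+t\<in>{0..T}.
      ennreal ((simple_process (k j) (ts j) (xi j) t w - H t w)^2) \<partial>lborel)) ----> 0"
  "!!T. 0 <= T ==> (%j. NN w. ennreal ((simple_integral B (k j) (ts j) (xi j) T w - I T w)^2)) ----> 0"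
proof -
 obtain k ts xi where sd: "!!j. simple_data F (k j) (ts j) (xi j)"
  and l1: "!!T. 0 <= T ==> (%j. NN w. (\<integral>\<^sup>+t\<in>{0..T}.
      ennreal ((simple_process (k j) (ts j) (xi j) t w - H t w)^2) \<partial>lborel)) ----> 0"
  and l2: "!!T. 0 <= T ==> (%j. NN w. ennreal ((simple_integral B (k j) (ts j) (xi j) T w - I T w)^2)) ----> 0"
  using ito unfolding ito_integral_def by blast
 define ze where "ze j i w = max (-K) (min K (xi j i w))" for j i w
 have sdz: "simple_data F (k j) (ts j) (ze j)" for j
  using sd[of j] \<open>0 <= K\<close> unfolding simple_data_def ze_def by (auto intro!: exI[of _ K])
 have zK: "abs (ze j i w) <= K" for j i w using \<open>0 <= K\<close> by (auto simp: ze_def)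
 have tsm: "ts j i <= ts j (Suc i)" if "i < k j" for i j using sd that by (auto simp: simple_data_def)
 let ?P = "%j. simple_process (k j) (ts j) (xi j)" and ?Q = "%j. simple_process (k j) (ts j) (ze j)"
 let ?d = "%j t w. ennreal ((?P j t w - H t w)^2)"
 let ?S = "%j. simple_integral B (k j) (ts j) (xi j)" and ?R = "%j. simple_integral B (k j) (ts j) (ze j)"
 have Q: "?Q j t w = max (-K) (min K (?P j t w))" for j t w
  using simple_process_comp[of "k j" "ts j" "%x. max (-K) (min K x)" "xi j" t w] tsm \<open>0 <= K\<close>
  unfolding ze_def by simp
 let ?e = "%T j. NN w. (\<integral>\<^sup>+t\<in>{0..T}. ?d j t w \<partial>lborel)"
 have sq: "(?Q j t w - H t w)^2 <= (?P j t w - H t w)^2" if "0 <= t" "w \<in> space M" for j t w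
  using clamp_dist[OF K[OF that]] unfolding Q by (subst abs_le_square_iff[symmetric])
 have c1: "(%j. NN w. (\<integral>\<^sup>+t\<in>{0..T}. ennreal ((?Q j t w - H t w)^2) \<partial>lborel)) ----> 0" if "0 <= T" for T
 proof (rule tendsto_sandwich[OF _ _ tendsto_const l1[OF that]])
  show "\<forall>\<^sub>F j in sequentially. (NN w. (\<integral>\<^sup>+t\<in>{0..T}. ennreal ((?Q j t w - H t w)^2) \<partial>lborel)) <= ?e T j"
   using sq by (intro always_eventually allI nn_integral_mono) (auto simp: indicator_def intro: ennreal_leI)
 qed simp
 have Hj: "(%(s, w). indicator {0..} s*H s w) \<in> \<B> (borel \<Otimes>\<^sub>M M)"
  using ito subalg by (intro progressive_joint_measurable) (auto simp: ito_integral_def)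
 have Im: "I t \<in> \<B> M" if "0 <= t" for t
  using ito meas_M that unfolding ito_integral_def adapted_def by blast
 have PHm: "(%(w, t). ?d j t w*indicator {0..T} t) \<in> \<B> MT" for j T
 proof -
  have [measurable]: "(%x. indicator {0..} (snd x)*H (snd x) (fst x)) \<in> \<B> MT"
   using measurable_compose[OF measurable_pair_swap' Hj] by (simp add: case_prod_beta' cong: measurable_cong_sets)
  have [measurable]: "(%x. ?P j (snd x) (fst x)) \<in> \<B> MT"
   using measurable_compose[OF measurable_pair_swap' simple_process_measurable[OF sd]]
   by (simp add: case_prod_beta' cong: measurable_cong_sets)
  have "(%x. ennreal ((?P j (snd x) (fst x) - indicator {0..} (snd x)*H (snd x) (fst x))^2)*indicator {0..T} (snd x))
   \<in> \<B> MT" by measurable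
  thus ?thesis by (rule measurable_cong[THEN iffD1, rotated]) (auto simp: indicator_def)
 qed
 have sect: "(%t. ?d j t w*indicator {0..T} t) \<in> \<B> lborel" if "w \<in> space M" for j T w
  using measurable_compose[OF measurable_Pair1'[OF that] PHm[of j T]] by simp
 have outer: "(%w. \<integral>\<^sup>+t. ?d j t w*indicator {0..T} t \<partial>lborel) \<in> \<B> M" for j T
  using lborel.borel_measurable_nn_integral[OF PHm[of j T]] by simp
 have diff: "(NN w. ennreal ((?R j T w - ?S j T w)^2)) <= 4 * ?e T j" if "0 <= T" for j T
 proof -
  define dx where "dx i w = ze j i w - xi j i w" for i w
  have sdd: "simple_data F (k j) (ts j) dx" unfolding simple_data_def
  proof (intro conjI allI impI)
   show "0 <= ts j 0" using sd[of j] by (simp add: simple_data_def)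
   fix i assume i: "i < k j"
   show "ts j i <= ts j (Suc i)" using tsm[OF i] .
   have "xi j i \<in> \<B> (F (ts j i))" "ze j i \<in> \<B> (F (ts j i))"
    using sd[of j] sdz[of j] i by (simp_all add: simple_data_def)
   thus "dx i \<in> \<B> (F (ts j i))" unfolding dx_def by (rule borel_measurable_diff[rotated])
   obtain C where "\<forall>w\<in>space (F (ts j i)). abs (xi j i w) <= C" using sd[of j] i by (auto simp: simple_data_def)
   hence "\<forall>w\<in>space (F (ts j i)). abs (dx i w) <= K + C"
    using zK[of j i] by (auto simp: dx_def intro!: order_trans[OF abs_triangle_ineq4] add_mono)
   thus "\<exists>C. \<forall>w\<in>space (F (ts j i)). abs (dx i w) <= C" by blast
  qed
  have RS: "?R j T w - ?S j T w = simple_integral B (k j) (ts j) dx T w" for w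
   by (simp only: simple_integral_def dx_def sum_subtractf left_diff_distrib)
  have QP: "simple_process (k j) (ts j) dx t w = ?Q j t w - ?P j t w" for t w
   by (simp only: simple_process_def dx_def sum_subtractf left_diff_distrib)
  have pw: "(?Q j t w - ?P j t w)^2 <= 4*(?P j t w - H t w)^2" if "0 <= t" "w \<in> space M" for t w
   using square_sum_le[of "?Q j t w - H t w" "H t w - ?P j t w"] sq[OF that, of j]
   by (simp add: power2_commute[of "H t w"])
  have "(NN w. ennreal ((?R j T w - ?S j T w)^2))
   = (NN w. (\<integral>\<^sup>+t\<in>{0..T}. ennreal ((?Q j t w - ?P j t w)^2) \<partial>lborel))"
   unfolding RS simple_integral_isometry[OF sdd that] QP ..
  also have "... <= (NN w. (\<integral>\<^sup>+t. 4*(?d j t w*indicator {0..T} t) \<partial>lborel))"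
  proof (intro nn_integral_mono)
   fix t w assume "w \<in> space M"
   hence "ennreal ((?Q j t w - ?P j t w)^2) <= ennreal (4*(?P j t w - H t w)^2)" if "0 <= t"
    using pw[OF that] by (intro ennreal_leI)
   thus "ennreal ((?Q j t w - ?P j t w)^2)*indicator {0..T} t <= 4*(?d j t w*indicator {0..T} t)"
    by (auto simp: indicator_def ennreal_mult)
  qed
  also have "... = (NN w. 4*(\<integral>\<^sup>+t. ?d j t w*indicator {0..T} t \<partial>lborel))"
   by (intro nn_integral_cong nn_integral_cmult sect)
  also have "... = 4 * ?e T j" by (intro nn_integral_cmult outer)
  finally show ?thesis .
 qed
 have c2: "(%j. NN w. ennreal ((?R j T w - I T w)^2)) ----> 0" if T: "0 <= T" for T
 proof (rule tendsto_sandwich[OF _ _ tendsto_const])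
  have [measurable]: "?R j T \<in> \<B> M" "?S j T \<in> \<B> M" for j
   using simple_integral_meas[OF sdz] simple_integral_meas[OF sd] T by auto
  note [measurable] = Im[OF T]
  let ?b = "%j. 2*(4 * ?e T j) + 2*(NN w. ennreal ((?S j T w - I T w)^2))"
  have "?b ----> 2*(4*0) + 2*0" by (intro tendsto_add ennreal_tendsto_cmult l1 l2 T) auto
  thus "?b ----> 0" by simp
  have "(NN w. ennreal ((?R j T w - I T w)^2))
   <= 2*(NN w. ennreal ((?R j T w - ?S j T w)^2)) + 2*(NN w. ennreal ((?S j T w - I T w)^2))" for j
   by (rule nn_integral_square_sum_le) auto
  hence "(NN w. ennreal ((?R j T w - I T w)^2)) <= ?b j" for j
   by (rule order_trans) (use diff[OF T, of j] in "intro add_mono mult_left_mono, auto")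
  thus "\<forall>\<^sub>F j in sequentially. (NN w. ennreal ((?R j T w - I T w)^2)) <= ?b j" by simp
 qed simp
 show ?thesis by (rule that[of k ts ze, OF sdz zK c1 c2])
qed

end

context brownian
begin

lemma ito_joint:
 assumes "ito_integral M F B H I"
 shows "(%(s, w). indicator {0..} s*H s w) \<in> \<B> (borel \<Otimes>\<^sub>M M)"
 using assms subalg by (intro progressive_joint_measurable) (auto simp: ito_integral_def)

lemma ito_meas:
 assumes "ito_integral M F B H I" "0 <= t" "t <= u"
 shows "I t \<in> \<B> (F u)" using assms meas_mono unfolding ito_integral_def adapted_def by blast

text \<open>All claims pass to the limit from the truncated simple processes. For the variance two
  limits are compared: that of the integrals on the probability space, and that of the integrands on
  its product with \<open>(s, t]\<close>, the weight depending on the first coordinate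
  alone.\<close>

lemma ito_moments:
 assumes ito: "ito_integral M F B H I"
  and K: "!!t w. 0 <= t ==> w \<in> space M ==> abs (H t w) <= K" and st: "0 <= s" "s <= t"
 shows ito_fourth_integrable: "integrable M (%w. (I t w - I s w)^4)" (is ?th1)
  and ito_fourth: "(EE w. (I t w - I s w)^4) <= 3*K^4*(t - s)^2" (is ?th2)
  and ito_mean: "!!Z c. Z \<in> \<B> (F s) ==> (!!w. w \<in> space M ==> abs (Z w) <= c) ==>
   (EE w. Z w*(I t w - I s w)) = 0"
  and ito_variance: "!!Z c. Z \<in> \<B> (F s) ==> (!!w. w \<in> space M ==> abs (Z w) <= c) ==>
   (EE w. Z w*(I t w - I s w)^2)
    = (EE w. Z w*ival s t (%r. (H r w)^2))"
  and ito_square_integrable: "integrable M (%w. (I t w - I s w)^2)" (is ?th3)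
proof -
 obtain wv where wv: "wv \<in> space M" using not_empty by blast
 have K0: "0 <= K" using K[OF order_refl wv] by simp
 obtain k ts xi where sd: "!!j. simple_data F (k j) (ts j) (xi j)" and xK: "!!j i w. abs (xi j i w) <= K"
  and l1: "!!T. 0 <= T ==> (%j. NN w. (\<integral>\<^sup>+t\<in>{0..T}.
      ennreal ((simple_process (k j) (ts j) (xi j) t w - H t w)^2) \<partial>lborel)) ----> 0"
  and l2: "!!T. 0 <= T ==> (%j. NN w. ennreal ((simple_integral B (k j) (ts j) (xi j) T w - I T w)^2)) ----> 0"
  by (rule truncated_approximation[OF ito K0 K]) (assumption | rule that)+
 have t0: "0 <= t" using st by simp
 let ?P = "%j. simple_process (k j) (ts j) (xi j)" and ?S = "%j. simple_integral B (k j) (ts j) (xi j)"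
 define f where "f j w = ?S j t w - ?S j s w" for j w
 define g where "g w = I t w - I s w" for w
 have Im: "I t \<in> \<B> M" if "0 <= t" for t using ito_meas[OF ito that order_refl] meas_M by blast
 note Im [OF st(1), measurable] Im [OF t0, measurable]
 have [measurable]: "?S j s \<in> \<B> M" "?S j t \<in> \<B> M" for j
  using simple_integral_meas[OF sd] st t0 by auto
 have gm [measurable]: "g \<in> \<B> M" unfolding g_def by measurable
 have fm [measurable]: "f j \<in> \<B> M" for j unfolding f_def by measurable
 note si = simple_integral_incr[OF sd st xK K0, folded f_def]
 have f4: "integrable M (%w. f j w^4)" "(EE w. f j w^4) <= 3*K^4*(t - s)^2" for j
  using si(2,3)[of "%_. 0" 0] by auto
 have f2: "integrable M (%w. (f j w)^2)" for j
  using prob_space_power_integrable[OF prob_space_axioms fm f4(1), of 2] by simp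
 have lim: "(%j. NN w. ennreal ((f j w - g w)^2)) ----> 0"
 proof (rule tendsto_sandwich[OF _ _ tendsto_const])
  let ?b = "%j. 2*(NN w. ennreal ((?S j t w - I t w)^2)) + 2*(NN w. ennreal ((?S j s w - I s w)^2))"
  have "?b ----> 2*0 + 2*0" by (intro tendsto_add ennreal_tendsto_cmult l2 st t0) auto
  thus "?b ----> 0" by simp
  have "(NN w. ennreal ((f j w - g w)^2)) <= ?b j" for j
   by (rule nn_integral_square_sum_le) (auto simp: f_def g_def)
  thus "\<forall>\<^sub>F j in sequentially. (NN w. ennreal ((f j w - g w)^2)) <= ?b j" by simp
 qed simp
 note L = L2_limit[OF finite_measure_axioms fm gm f2 lim]
 show ?th1 ?th2
  using L(6)[OF f4] unfolding g_def by auto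
 show ?th3 using L(1) unfolding g_def .
 fix Z :: "'w => real" and c assume Z: "Z \<in> \<B> (F s)" "!!w. w \<in> space M ==> abs (Z w) <= c"
 have ZM [measurable]: "Z \<in> \<B> M" using Z(1) meas_M by blast
 have "(%j. EE w. Z w*f j w) ----> (EE w. Z w*g w)" by (rule L(5)[OF ZM Z(2)])
 moreover have "(%j. EE w. Z w*f j w) = (%_. 0)" using si(4)[OF Z] by auto
 ultimately show "(EE w. Z w*(I t w - I s w)) = 0" unfolding g_def by (simp add: LIMSEQ_const_iff)
 \<comment> \<open>Lebesgue measure on a bounded interval is finite, so the product with
   \<open>M\<close> is finite and \<open>L2_limit\<close> applies to it.\<close>
 define L where "L = restrict_space lborel {s<..t}"
 have fL: "finite_measure L"
  by (rule finite_measureI) (simp add: L_def emeasure_restrict_space space_restrict_space st)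
 let ?Q = "M \<Otimes>\<^sub>M L" and ?p = "%j (w, r). ?P j r w" and ?h = "%(w, r). H r w"
 let ?r = "%j w. (\<integral>\<^sup>+r\<in>{0..t}. ennreal ((?P j r w - H r w)^2) \<partial>lborel)"
 let ?e = "%j. \<integral>\<^sup>+x. ennreal ((?p j x - ?h x)^2) \<partial>?Q"
 interpret L: finite_measure L by (rule fL)
 interpret P: pair_sigma_finite M L ..
 interpret Pf: finite_measure "?Q"
  by (intro finite_measure_pair_measure finite_measure_axioms fL)
 have sp: "space L = {s<..t}" by (simp add: L_def space_restrict_space)
 have idm: "(%x. (snd x, fst x)) \<in> measurable ?Q (borel \<Otimes>\<^sub>M M)"
 proof (rule measurable_Pair)
  have "id \<in> measurable L borel" unfolding L_def by (rule measurable_restrict_space1) auto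
  from measurable_compose[OF measurable_snd this]
  show "snd \<in> measurable ?Q borel" by simp
 qed simp
 have Pm: "?p j \<in> \<B> ?Q" for j
  using measurable_compose[OF idm simple_process_measurable[OF sd]] by (simp add: case_prod_beta')
 have Hm: "?h \<in> \<B> ?Q"
  by (rule measurable_cong[THEN iffD1, OF _ measurable_compose[OF idm ito_joint[OF ito]]])
   (use st in "auto simp: space_pair_measure sp")
 have Pb: "abs (?P j r w) <= K" for j r w
 proof -
  have "max (-K) (min K (?P j r w)) = simple_process (k j) (ts j) (%i w. max (-K) (min K (xi j i w))) r w"
   using sd[of j] K0 by (intro simple_process_comp) (auto simp: simple_data_def)
  also have "(%i w. max (-K) (min K (xi j i w))) = xi j"
   using xK by (intro ext) (auto simp: abs_le_iff max_def min_def, smt+)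
  finally show ?thesis by (auto simp: max_def min_def abs_if split: if_splits) (use K0 in auto)
 qed
 have P2: "integrable ?Q (%x. ?p j x^2)" for j
 proof (rule Pf.integrable_const_bound[where B = "K^2"])
  show "AE x in ?Q. norm (?p j x^2) <= K^2"
   using Pb K0 by (intro AE_I2) (auto simp: abs_le_square_iff[symmetric])
 qed (use Pm in measurable)
 have H2: "(H r w)^2 <= K^2" if "s < r" "w \<in> space M" for r w
  using K[of r w] that st K0 by (subst abs_le_square_iff[symmetric]) auto
 have Plim: "?e ----> 0"
 proof (rule tendsto_sandwich[OF _ _ tendsto_const l1[OF t0]])
  show "\<forall>\<^sub>F j in sequentially. ?e j
   <= (NN w. ?r j w)"
  proof (intro always_eventually allI)
   fix j
   have "?e j
    = (NN w. (\<integral>\<^sup>+r. ennreal ((?P j r w - H r w)^2) \<partial>L))"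
    using Pm Hm by (subst L.nn_integral_fst[symmetric]) auto
   also have "... = (NN w. (\<integral>\<^sup>+r\<in>{s<..t}. ennreal ((?P j r w - H r w)^2) \<partial>lborel))"
    unfolding L_def by (simp add: nn_integral_restrict_space)
   also have "... <= (NN w. ?r j w)"
    using st by (intro nn_integral_mono) (auto simp: indicator_def)
   finally show "?e j
    <= (NN w. ?r j w)" .
  qed
 qed simp
 have Zm: "(%x. Z (fst x)) \<in> \<B> ?Q" by measurable
 have Zb: "abs (Z (fst x)) <= c" if "x \<in> space ?Q" for x using that Z(2) by (auto simp: space_pair_measure)
 have fub: "(\<integral>x. Z (fst x)*(case x of (w, r) => h r w)^2 \<partial>?Q)
   = (EE w. Z w*ival s t (%r. (h r w)^2))" if hm: "(%(w, r). h r w) \<in> \<B> ?Q"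
   and hb: "!!r w. s < r ==> w \<in> space M ==> (h r w)^2 <= K^2" for h :: "real => 'w => real"
 proof -
  have "integrable ?Q (%(w, r). Z w*(h r w)^2)"
  proof (rule Pf.integrable_const_bound[where B = "abs c*K^2"])
   have "(%x. Z (fst x)*((%(w, r). h r w) x)^2) \<in> \<B> ?Q"
    using Zm hm by (intro borel_measurable_times borel_measurable_power)
   thus "(%(w, r). Z w*(h r w)^2) \<in> \<B> ?Q" by (simp add: case_prod_beta')
   show "AE x in ?Q. norm (case x of (w, r) => Z w*(h r w)^2) <= abs c*K^2"
    using Z(2) hb by (intro AE_I2) (fastforce simp: space_pair_measure sp abs_mult intro!: mult_mono)
  qed
  from P.integral_fst'[OF this]
  have "(\<integral>x. Z (fst x)*(case x of (w, r) => h r w)^2 \<partial>?Q) = (EE w. (\<integral>r. Z w*(h r w)^2 \<partial>L))"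
   by (simp add: case_prod_beta')
  also have "... = (EE w. Z w*ival s t (%r. (h r w)^2))"
   unfolding L_def by (simp add: integral_restrict_space)
  finally show ?thesis .
 qed
 have "(%j. EE w. Z w*(f j w)^2) ----> (EE w. Z w*(g w)^2)" by (rule L(4)[OF ZM Z(2)])
 moreover have "(%j. \<integral>x. Z (fst x)*?p j x^2 \<partial>?Q)
  ----> (\<integral>x. Z (fst x)*?h x^2 \<partial>?Q)"
  by (rule L2_limit_square[OF Pf.finite_measure_axioms Pm Hm P2 Plim Zm Zb])
 moreover have "(EE w. Z w*(f j w)^2) = (\<integral>x. Z (fst x)*?p j x^2 \<partial>?Q)" for j
  using si(5)[OF Z] fub[OF Pm] Pb K0 by (simp add: abs_le_square_iff[symmetric])
 ultimately have "(EE w. Z w*(g w)^2) = (\<integral>x. Z (fst x)*?h x^2 \<partial>?Q)"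
  using LIMSEQ_unique by auto
 thus "(EE w. Z w*(I t w - I s w)^2) = (EE w. Z w*ival s t (%r. (H r w)^2))"
  using fub[OF Hm H2] by (simp add: g_def)
qed

end

text \<open>Derivatives are taken within \<open>{a..}\<close>, hence one-sided at \<open>a\<close>:
  the absorbed wealth rests at \<open>a\<close>, and \<open>e\<close> and \<open>l\<close> have no
  meaning below it. Uniform continuity of \<open>u2\<close> makes the Taylor remainder uniform in
  the state.\<close>

definition test_fun :: "real => (real => real) => (real => real) => (real => real) => bool" where
 "test_fun a u u1 u2 \<longleftrightarrow>
  (\<forall>y\<ge>a. (u has_real_derivative u1 y) (at y within {a..})) \<and>
  (\<forall>y\<ge>a. (u1 has_real_derivative u2 y) (at y within {a..})) \<and>
  uniformly_continuous_on {a..} u2 \<and>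
  (\<exists>C. \<forall>y\<ge>a. abs (u y) <= C) \<and> (\<exists>C. \<forall>y\<ge>a. abs (u1 y) <= C) \<and> (\<exists>C. \<forall>y\<ge>a. abs (u2 y) <= C)"

lemma test_fun_continuous:
 assumes "test_fun a u u1 u2"
 shows "continuous_on {a..} u" "continuous_on {a..} u1" "continuous_on {a..} u2"
 using assms unfolding test_fun_def by (auto intro: DERIV_continuous_on uniformly_continuous_imp_continuous)

lemma test_fun_second_order:
 assumes tf: "test_fun a u u1 u2" and "a <= y" "a <= wv"
  and k: "!!x. x \<in> closed_segment y wv ==> abs (u2 x - u2 y) <= k"
 shows "abs (u wv - u y - u1 y*(wv - y) - u2 y*(wv - y)^2 / 2) <= k*(wv - y)^2"
proof -
 let ?S = "closed_segment y wv"
 have sub: "?S \<subseteq> {a..}" using assms(2,3) by (auto simp: closed_segment_eq_real_ivl split: if_splits)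
 have d1: "(u has_real_derivative u1 x) (at x within ?S)" "(u1 has_real_derivative u2 x) (at x within ?S)"
  if "x \<in> ?S" for x using tf that sub unfolding test_fun_def by (auto intro: has_field_derivative_subset)
 have k0: "0 <= k" using k[of y] by simp
 have 1: "abs (u1 x - u1 y - u2 y*(x - y)) <= k*abs (wv - y)" if x: "x \<in> ?S" for x
 proof -
  have "norm ((u1 x - u2 y*x) - (u1 y - u2 y*y)) <= k*norm (x - y)"
  proof (rule field_differentiable_bound[where f' = "%x. u2 x - u2 y" and S = ?S])
   fix z assume "z \<in> ?S"
   thus "((%x. u1 x - u2 y*x) has_field_derivative u2 z - u2 y) (at z within ?S)"
    by (auto intro!: derivative_eq_intros d1)
   show "norm (u2 z - u2 y) <= k" using k[OF \<open>z \<in> ?S\<close>] by simp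
  qed (use x in auto)
  also have "... <= k*abs (wv - y)"
   using x k0 by (intro mult_left_mono) (auto simp: closed_segment_eq_real_ivl split: if_splits)
  finally show ?thesis by (simp add: algebra_simps)
 qed
 have "norm ((u wv - u1 y*(wv - y) - u2 y*(wv - y)^2 / 2) - (u y - u1 y*(y - y) - u2 y*(y - y)^2 / 2))
  <= (k*abs (wv - y))*norm (wv - y)"
 proof (rule field_differentiable_bound[where f' = "%x. u1 x - u1 y - u2 y*(x - y)" and S = ?S])
  fix z assume "z \<in> ?S"
  thus "((%x. u x - u1 y*(x - y) - u2 y*(x - y)^2 / 2) has_field_derivative u1 z - u1 y - u2 y*(z - y)) (at z within ?S)"
   by (auto intro!: derivative_eq_intros d1)
  show "norm (u1 z - u1 y - u2 y*(z - y)) <= k*abs (wv - y)" using 1[OF \<open>z \<in> ?S\<close>] by simp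
 qed auto
 thus ?thesis by (simp add: power2_eq_square abs_mult[symmetric] algebra_simps)
qed

text \<open>\<open>b\<close> is the drift part of an increment and \<open>z\<close> its martingale
  part: over a grid the mean of the sum of \<open>z^2\<close> stays bounded, while those of
  \<open>b^2\<close> and \<open>z^4\<close> are of the order of the mesh. So \<open>z^2\<close> may
  only carry the small factor \<open>eta\<close>. For a short increment, continuity of
  \<open>u2\<close> supplies this factor; for a long one, either \<open>abs z <= abs b\<close>, or
  \<open>z\<close> is bounded away from 0 and \<open>z^2\<close> is at most a multiple of
  \<open>z^4\<close>.\<close>

lemma test_fun_remainder:
 assumes tf: "test_fun a u u1 u2" and e: "0 < eta"
 shows "\<exists>C\<ge>0. \<forall>y b z. a <= y --> a <= y + b + z -->
  abs (u (y + b + z) - u y - u1 y*(b + z) - u2 y*z^2 / 2) <= eta*z^2 + C*(b^2 + z^4)"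
proof -
 obtain K where K: "!!y. a <= y ==> abs (u2 y) <= K" using tf unfolding test_fun_def by blast
 have K0: "0 <= K" using K[OF order_refl] by simp
 obtain r where r: "0 < r" "!!x y. a <= x ==> a <= y ==> abs (x - y) < r ==> abs (u2 x - u2 y) < eta / 4"
  using tf e unfolding test_fun_def uniformly_continuous_on_def dist_real_def
  by (metis atLeast_iff divide_pos_pos zero_less_numeral)
 define C' where "C' = eta + 8*K + 16*K / r^2"
 define C where "C = C' + (K + K^2 / eta)"
 have C'0: "eta / 2 <= C'" "8*K <= C'" "16*K / r^2 <= C'" using e K0 r by (simp_all add: C'_def)
 have C0: "0 <= C" using e K0 C'0 by (simp add: C_def)
 have "abs (u (y + b + z) - u y - u1 y*(b + z) - u2 y*z^2 / 2) <= eta*z^2 + C*(b^2 + z^4)"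
  if y: "a <= y" "a <= y + b + z" for y b z
 proof -
  let ?h = "b + z"
  let ?R = "u (y + b + z) - u y - u1 y * ?h - u2 y * ?h^2 / 2"
  have h2: "?h^2 <= 2*b^2 + 2*z^2" by (rule square_sum_le)
  have R: "abs (?R) <= eta / 2*z^2 + C'*(b^2 + z^4)"
  proof (cases "abs (?h) < r")
   case True
   have "abs (?R) <= eta / 4 * ?h^2"
   proof -
    have "abs (u2 x - u2 y) <= eta / 4" if "x \<in> closed_segment y (y + b + z)" for x
     using r(2)[of x y] True y that
     by (intro less_imp_le) (auto simp: closed_segment_eq_real_ivl split: if_splits)
    thus ?thesis using test_fun_second_order[OF tf y, of "eta / 4"] by (simp add: add.assoc)
   qed
   also have "... <= eta / 4*(2*b^2 + 2*z^2)" using h2 e by (intro mult_left_mono) auto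
   also have "... = eta / 2*z^2 + eta / 2*b^2" by (simp add: algebra_simps)
   also have "... <= eta / 2*z^2 + C'*(b^2 + z^4)" using e C'0 by (intro add_left_mono mult_mono) auto
   finally show ?thesis .
  next
   case False
   have "abs (?R) <= (2*K) * ?h^2"
   proof -
    have "abs (u2 x - u2 y) <= 2*K" if "x \<in> closed_segment y (y + b + z)" for x
    proof -
     have "a <= x" using that y by (auto simp: closed_segment_eq_real_ivl split: if_splits)
     thus ?thesis using K[of x] K[of y] y by linarith
    qed
    thus ?thesis using test_fun_second_order[OF tf y, of "2*K"] by (simp add: add.assoc)
   qed
   also have "... <= (2*K)*(2*b^2 + 2*z^2)" using h2 K0 by (intro mult_left_mono) auto
   finally have R1: "abs (?R) <= 4*K*b^2 + 4*K*z^2" by (simp add: algebra_simps)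
   have "z^2 <= b^2 + 4*z^4 / r^2"
   proof (cases "abs z <= r / 2")
    case True
    hence "abs z <= abs b" using False by linarith
    hence "z^2 <= b^2" by (simp add: abs_le_square_iff)
    thus ?thesis using r by (simp add: add_increasing2)
   next
    case False
    hence "(r / 2)^2 <= z^2" using r by (subst abs_le_square_iff[symmetric]) auto
    hence "r^2*z^2 <= 4*z^2*z^2" by (intro mult_right_mono) (auto simp: power_divide)
    hence "z^2 <= 4*z^4 / r^2" using r by (simp add: field_simps power4_eq_xxxx power2_eq_square)
    thus ?thesis by (simp add: add_increasing)
   qed
   hence "4*K*b^2 + 4*K*z^2 <= 4*K*b^2 + 4*K*(b^2 + 4*z^4 / r^2)"
    using K0 by (intro add_left_mono mult_left_mono) auto
   also have "... = 8*K*b^2 + (16*K / r^2)*z^4" by (simp add: algebra_simps)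
   also have "... <= C'*b^2 + C'*z^4" using C'0 by (intro add_mono mult_right_mono) auto
   also have "... <= eta / 2*z^2 + C'*(b^2 + z^4)" using e by (simp add: algebra_simps)
   finally show ?thesis using R1 by linarith
  qed
  \<comment> \<open>Replacing \<open>(b + z)^2\<close> by \<open>z^2\<close> costs the cross term
    \<open>b z\<close>, which Young's inequality with weight \<open>eta\<close> splits.\<close>
  have cr: "abs (u2 y * ?h^2 / 2 - u2 y*z^2 / 2) <= eta / 2*z^2 + (K + K^2 / eta)*b^2"
  proof -
   have "abs (u2 y * ?h^2 / 2 - u2 y*z^2 / 2) = abs (u2 y)*abs (b^2 / 2 + b*z)"
   proof -
    have "u2 y * ?h^2 / 2 - u2 y*z^2 / 2 = u2 y*(b^2 / 2 + b*z)"
     by (simp add: power2_eq_square field_simps)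
    thus ?thesis by (simp only: abs_mult)
   qed
   also have "... <= K*(b^2 / 2 + abs (b*z))"
    using K[OF y(1)] K0 by (intro mult_mono) (auto intro: order_trans[OF abs_triangle_ineq])
   finally have A: "abs (u2 y * ?h^2 / 2 - u2 y*z^2 / 2) <= K*(b^2 / 2 + abs (b*z))" .
   have "K*abs (b*z) <= eta / 2*z^2 + K^2 / (2*eta)*b^2"
   proof -
    have "0 <= (eta*abs z - K*abs b)^2 / (2*eta)" using e by simp
    also have "... = eta / 2*z^2 + K^2 / (2*eta)*b^2 - K*abs (b*z)"
     using e by (simp add: power2_eq_square field_simps abs_mult)
    finally show ?thesis by simp
   qed
   hence "K*(b^2 / 2 + abs (b*z)) <= K*(b^2 / 2) + (eta / 2*z^2 + K^2 / (2*eta)*b^2)"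
    by (simp add: distrib_left)
   also have "... = eta / 2*z^2 + (K / 2 + K^2 / eta / 2)*b^2" using e by (simp add: field_simps)
   also have "... <= eta / 2*z^2 + (K + K^2 / eta)*b^2"
   proof -
    have "x / 2 <= x" if "0 <= x" for x :: real using that by simp
    from this[of "K^2 / eta"] have "K^2 / eta / 2 <= K^2 / eta" using e by simp
    thus ?thesis using K0 by (intro add_left_mono mult_right_mono add_mono) auto
   qed
   finally show ?thesis using A by linarith
  qed
  have "(K + K^2 / eta)*b^2 <= (K + K^2 / eta)*(b^2 + z^4)" using K0 e by (intro mult_left_mono) auto
  moreover have "eta*z^2 + C*(b^2 + z^4) = eta / 2*z^2 + C'*(b^2 + z^4) + (eta / 2*z^2 + (K + K^2 / eta)*(b^2 + z^4))"
   unfolding C_def by (simp add: algebra_simps)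
  ultimately show ?thesis using R cr by linarith
 qed
 with C0 show ?thesis by blast
qed

lemma exp_remainder: "abs (exp x - 1 - x) <= x^2*exp (abs x)" for x :: real
proof -
 have "\<exists>t. abs t <= abs x \<and> exp x = (\<Sum>m<2. (x ^ m) / fact m) + exp t / fact 2*x^2"
  by (rule Maclaurin_exp_le)
 then obtain t where t: "abs t <= abs x" "exp x = 1 + x + exp t / 2*x^2" by (auto simp: numeral_2_eq_2)
 have "abs (exp x - 1 - x) = exp t / 2*x^2" using t by simp
 also have "... <= exp (abs x)*x^2"
 proof (intro mult_right_mono)
  have "exp t <= exp (abs x)" using t(1) by simp
  moreover have "0 < exp t" by simp
  ultimately show "exp t / 2 <= exp (abs x)" by linarith
 qed simp
 finally show ?thesis by (simp add: mult.commute)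
qed

text \<open>Cells are open on the left, to match \<open>simple_process\<close>; hence the ceiling
  minus 1 in place of the floor.\<close>

lemma grid_index:
 assumes "0 < N" "0 < T" "0 < s" "s <= (T::real)"
 defines "j \<equiv> nat \<lceil>s*real N / T\<rceil> - 1"
 shows "j < N" "real j*T / real N < s" "s <= real (Suc j)*T / real N" (is ?th1)
proof -
 let ?q = "s*real N / T"
 have q: "0 < ?q" "?q <= real N" using assms by (auto simp: field_simps)
 hence c: "1 <= \<lceil>?q\<rceil>" "\<lceil>?q\<rceil> <= int N" by (auto simp: one_le_ceiling ceiling_le_iff)
 have gen: "s*real N / T <= c ==> s <= c*T / real N" for c using assms(1-4) by (simp add: field_simps)
 have rj: "real (Suc j) = of_int \<lceil>?q\<rceil>" unfolding j_def using c by simp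
 show "j < N" using c unfolding j_def by linarith
 have "real j < ?q" using rj ceiling_correct[of ?q] by linarith
 thus "real j*T / real N < s" using assms by (simp add: field_simps)
 have "?q <= real (Suc j)" using rj ceiling_correct[of ?q] by linarith
 thus ?th1 by (rule gen)
qed

lemma grid_sum:
 assumes "0 < N" "0 < T" "0 < s" "s <= (T::real)"
 shows "(\<Sum>k<N. indicator {real k*T / real N <.. real (Suc k)*T / real N} s*f k) = (f (nat \<lceil>s*real N / T\<rceil> - 1) :: real)"
proof -
 define j where "j = nat \<lceil>s*real N / T\<rceil> - 1"
 note g = grid_index[OF assms, folded j_def]
 have "indicator {real k*T / real N <.. real (Suc k)*T / real N} s*f k = (if k = j then f k else 0)" for k
 proof (cases "k = j")
  case True
  thus ?thesis using g(2,3) by simp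
 next
  case False
  then consider "Suc k <= j" | "Suc j <= k" by linarith
  hence "s \<notin> {real k*T / real N <.. real (Suc k)*T / real N}"
  proof cases
   case 1
   have "real (Suc k)*T / real N <= real j*T / real N"
    using 1 assms by (intro divide_right_mono mult_right_mono) auto
   thus ?thesis using g(2) by auto
  next
   case 2
   have "real (Suc j)*T / real N <= real k*T / real N"
    using 2 assms by (intro divide_right_mono mult_right_mono) auto
   thus ?thesis using g(3) by auto
  qed
  thus ?thesis using False by simp
 qed
 thus ?thesis using g(1) by (simp add: j_def)
qed

text \<open>Cauchy-Schwarz against the constant 1, from the nonnegative integral of
  \<open>(f - c)^2\<close> with \<open>c\<close> the mean of \<open>f\<close>.\<close>

lemma integral_square_le:
 fixes f :: "real => real"
 assumes f: "f \<in> \<B> lborel" and i: "iable s t (%r. (f r)^2)" and "s <= t"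
 shows "iable s t (%r. f r)"
  "(ival s t (%r. f r))^2 <= (t - s)*ival s t (%r. (f r)^2)"
  "abs (\<integral>r. indicator {s<..t} r*f r \<partial>lborel) <= (t - s) + ival s t (%r. (f r)^2)"
proof -
 note [measurable] = f
 let ?i = "indicat_real {s<..t}"
 have ii: "integrable lborel ?i" using assms(3) by (intro integrable_real_indicator) auto
 have Ii: "(\<integral>r. ?i r \<partial>lborel) = t - s" using assms(3) by simp
 have am: "abs y <= 1 + y^2" for y :: real
  using zero_le_power2[of "abs y - 1"] by (simp add: power2_eq_square algebra_simps)
 show i1: "integrable lborel (%r. ?i r*f r)"
 proof (rule int_bound[where f = "%r. ?i r + ?i r*(f r)^2"])
  show "AE r in lborel. norm (?i r*f r) <= norm (?i r + ?i r*(f r)^2)"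
   using am by (intro AE_I2) (auto simp: indicator_def)
 qed (use ii i in auto)
 let ?m = "\<integral>r. ?i r*f r \<partial>lborel" and ?q = "\<integral>r. ?i r*(f r)^2 \<partial>lborel"
 have q: "0 <= (\<integral>r. ?i r*(f r - c)^2 \<partial>lborel)" for c by simp
 have exp: "(\<integral>r. ?i r*(f r - c)^2 \<partial>lborel) = ?q - 2*c * ?m + c^2*(t - s)" for c
 proof -
  have "(\<integral>r. ?i r*(f r - c)^2 \<partial>lborel) = (\<integral>r. ?i r*(f r)^2 - 2*c*(?i r*f r) + c^2 * ?i r \<partial>lborel)"
   by (intro lint_cong) (auto simp: power2_eq_square algebra_simps)
  also have "... = ?q - 2*c * ?m + c^2*(t - s)" using i i1 ii Ii
   by (subst lint_add, simp, simp, subst lint_diff) simp_all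
  finally show ?thesis .
 qed
 show "?m^2 <= (t - s) * ?q"
 proof (cases "s = t")
  case True
  thus ?thesis by simp
 next
  case False
  hence h: "0 < t - s" using assms(3) by simp
  have gen: "h*(q - 2*(m / h)*m + (m / h)^2*h) = h*q - m^2" if "0 < h" for h q m :: real
   using that by (simp add: power2_eq_square field_simps)
  have "0 <= (t - s)*(?q - 2*(?m / (t - s)) * ?m + (?m / (t - s))^2*(t - s))"
   using q[of "?m / (t - s)"] h unfolding exp by (intro mult_nonneg_nonneg) auto
  thus ?thesis unfolding gen[OF h] by simp
 qed
 have "abs (?m) <= (\<integral>r. ?i r + ?i r*(f r)^2 \<partial>lborel)"
  by (intro bochner_abs_le int_add ii i i1) (use am in "auto simp: indicator_def")
 thus "abs (?m) <= (t - s) + ?q" using ii i Ii by simp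
qed

lemma borel_measurable_continuous_on_ge:
 fixes f :: "real => real"
 assumes "continuous_on {a..} f" "Y \<in> \<B> N" "!!x. x \<in> space N ==> a <= Y x"
 shows "(%x. f (Y x)) \<in> \<B> N"
proof -
 have "continuous_on UNIV (%y. max a y)" by (intro continuous_on_max continuous_on_const continuous_on_id)
 hence "continuous_on UNIV (%y. f (max a y))" by (rule continuous_on_compose2[OF assms(1)]) auto
 hence "(%x. f (max a (Y x))) \<in> \<B> N" using assms(2) by (rule borel_measurable_continuous_on)
 thus ?thesis
  by (rule measurable_cong[THEN iffD1, rotated]) (use assms(3) in "simp add: max_absorb2")
qed

lemma integrable_bounded_mult:
 fixes W Y :: "'a => real"
 assumes "integrable N Y" "W \<in> \<B> N" "!!x. x \<in> space N ==> abs (W x) <= c"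
 shows "integrable N (%x. W x*Y x)"
proof (rule int_bound[where f = "%x. abs c*Y x"])
 have "abs (W x*Y x) <= abs c*abs (Y x)" if "x \<in> space N" for x
  using assms(3)[OF that] unfolding abs_mult by (intro mult_right_mono) auto
 thus "AE x in N. norm (W x*Y x) <= norm (abs c*Y x)" by (intro AE_I2) (simp add: abs_mult)
qed (use assms in auto)

lemma indicator_integral_split:
 fixes f :: "real => real"
 assumes "iable p t (%r. f r)" "p <= s" "s <= t"
 shows "iable p s (%r. f r)" "iable s t (%r. f r)"
  "ival p t (%r. f r) = ival p s (%r. f r) + ival s t (%r. f r)" (is ?th1)
proof -
 have *: "integrable lborel (%r. indicator S r*f r)" if "S \<subseteq> {p<..t}" "S \<in> sets borel" for S
 proof -
  have "integrable lborel (%r. indicator S r*(indicator {p<..t} r*f r))"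
   by (rule integrable_bounded_mult[OF assms(1), where c = 1]) (use that in auto)
  moreover have "indicator S r*(indicator {p<..t} r*f r) = indicator S r*f r" for r
   using that(1) by (auto simp: indicator_def)
  ultimately show ?thesis by simp
 qed
 show 1: "iable p s (%r. f r)" "iable s t (%r. f r)" using assms(2,3) by (auto intro!: *)
 have "ival p t (%r. f r) = (\<integral>r. indicator {p<..s} r*f r + indicator {s<..t} r*f r \<partial>lborel)"
  using assms(2,3) by (intro lint_cong) (auto simp: indicator_def)
 thus ?th1
  using lint_add[OF 1] by simp
qed

section \<open>Dynkin's formula\<close>

text \<open>An Ito process \<open>X\<close> with drift \<open>be\<close> and martingale part
  \<open>g * I\<close>, together with a bounded rate \<open>al\<close> whose integral
  \<open>A\<close> is the exponent of a discount factor. The drift is only square integrable in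
  mean, as fits a wealth with linear growth.\<close>

locale ito_process = brownian M F B for M :: "'w measure" and F B +
 fixes H I X A al be :: "real => 'w => real" and K Ka g a x :: real
 assumes ito: "ito_integral M F B H I"
  and HK: "!!t w. 0 <= t ==> w \<in> space M ==> abs (H t w) <= K"
  and Xm: "!!t. 0 <= t ==> X t \<in> \<B> (F t)"
  and Xc: "!!w. w \<in> space M ==> continuous_on {0..} (%t. X t w)"
  and Xa: "!!t w. 0 <= t ==> w \<in> space M ==> a <= X t w" and X0: "!!w. w \<in> space M ==> X 0 w = x"
  and Am: "!!t. 0 <= t ==> A t \<in> \<B> (F t)"
  and A: "!!t w. 0 <= t ==> w \<in> space M ==> A t w = ival 0 t (%r. al r w)"
  and alj: "(%(w, s). al s w) \<in> \<B> MT" and alb: "!!s w. w \<in> space M ==> abs (al s w) <= Ka"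
  and bej: "(%(w, s). be s w) \<in> \<B> MT" and be1: "!!T. 0 < T ==> AE w in M. iable 0 T (%r. (be r w)^2)"
  and be2: "!!T. 0 < T ==> integrable M (%w. ival 0 T (%r. (be r w)^2))"
  and Xeq: "AE w in M. \<forall>t\<ge>0. X t w = x + ival 0 t (%r. be r w) + g*I t w"
begin

lemma alm: "w \<in> space M ==> (%s. al s w) \<in> \<B> lborel"
 using measurable_compose[OF measurable_Pair1' alj, of w] by simp

lemma bem: "w \<in> space M ==> (%s. be s w) \<in> \<B> lborel"
 using measurable_compose[OF measurable_Pair1' bej, of w] by simp

lemma K0: "0 <= K"
proof -
 obtain wv where "wv \<in> space M" using not_empty by blast
 thus ?thesis using HK[of 0 wv] by linarith
qed

lemma Ka0: "0 <= Ka"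
proof -
 obtain wv where "wv \<in> space M" using not_empty by blast
 thus ?thesis using alb[of wv 0] by linarith
qed

lemma XM: "0 <= t ==> X t \<in> \<B> M" using Xm meas_M by blast

lemma AM: "0 <= t ==> A t \<in> \<B> M" using Am meas_M by blast

lemma IM: "0 <= t ==> I t \<in> \<B> M" using ito_meas[OF ito _ order_refl] meas_M by blast

lemma al_int:
 assumes "w \<in> space M" "s <= t"
 shows "iable s t (%r. al r w)"
proof -
 have "integrable lborel (%r. al r w*indicat_real {s<..t} r)"
  by (rule integrable_bounded_mult[where c = Ka])
   (use alm[OF assms(1)] alb[OF assms(1)] assms(2) in "auto intro!: integrable_real_indicator")
 thus ?thesis by (simp add: mult.commute)
qed

lemma A_incr:
 assumes "w \<in> space M" "0 <= s" "s <= t"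
 shows "A t w - A s w = ival s t (%r. al r w)" (is ?th1)
  "abs (A t w - A s w) <= Ka*(t - s)" (is ?th2)
proof -
 show 1: ?th1
  using indicator_integral_split(3)[OF al_int[OF assms(1), of 0 t], of s] assms by (subst (1 2) A) (simp_all)
 have ii: "iable s t (%r. Ka)" using assms(3) by (intro integrable_mult_left integrable_real_indicator) auto
 have "abs (A t w - A s w) <= ival s t (%r. Ka)"
  unfolding 1 by (intro bochner_abs_le al_int assms ii) (use alb[OF assms(1)] in "auto simp: indicator_def")
 thus ?th2 using assms(3) by (simp add: mult.commute)
qed

lemma A0: "w \<in> space M ==> A 0 w = 0"
 by (subst A) simp_all

lemma A_bound:
 assumes "w \<in> space M" "0 <= t" "t <= T"
 shows "exp (A t w) <= exp (Ka*T)"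
proof -
 have "abs (A t w) <= Ka*t" using A_incr(2)[OF assms(1) order_refl assms(2)] A0[OF assms(1)] by simp
 also have "... <= Ka*T" using Ka0 assms by (intro mult_left_mono)
 finally show ?thesis by simp
qed

lemma be_good:
 assumes "0 < T"
 shows "AE w in M. iable 0 T (%r. (be r w)^2) \<and>
  (\<forall>s t. 0 <= s --> s <= t --> t <= T --> X t w - X s w - g*(I t w - I s w) = ival s t (%r. be r w))"
 using be1[OF assms] Xeq AE_space
proof eventually_elim
 case (elim w)
 have "X t w - X s w - g*(I t w - I s w) = ival s t (%r. be r w)"
  if st: "0 <= s" "s <= t" "t <= T" for s t
 proof -
  have "iable 0 t (%r. (be r w)^2)" by (rule indicator_integral_split(1)[OF elim(1)]) (use st in auto)
  hence "iable 0 t (%r. be r w)" by (rule integral_square_le(1)[OF bem[OF elim(3)]]) (use st in auto)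
  from indicator_integral_split(3)[OF this st(1,2)]
  have "ival s t (%r. be r w)
   = ival 0 t (%r. be r w) - ival 0 s (%r. be r w)" by linarith
  moreover have "0 <= t" using st by linarith
  ultimately show ?thesis using elim(2)[rule_format, of t] elim(2)[rule_format, of s] st(1)
   by (simp add: algebra_simps)
 qed
 with elim show ?case by blast
qed

end

context ito_process
begin

lemma I_moments:
 assumes "0 <= s" "s <= t"
 shows "integrable M (%w. (I t w - I s w)^4)"
  "integrable M (%w. (I t w - I s w)^2)"
  "(EE w. (I t w - I s w)^4) <= 3*K^4*(t - s)^2"
 using HK by (rule ito_fourth_integrable[OF ito] ito_square_integrable[OF ito] ito_fourth[OF ito]; use assms in simp)+

lemma I_mean:
 assumes "0 <= s" "s <= t" "Z \<in> \<B> (F s)" "\<forall>w\<in>space M. abs (Z w) <= c"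
 shows "(EE w. Z w*(I t w - I s w)) = 0" by (rule ito_mean[OF ito HK assms(1-3)]) (use assms(4) in auto)

lemma I_variance:
 assumes "0 <= s" "s <= t" "Z \<in> \<B> (F s)" "\<forall>w\<in>space M. abs (Z w) <= c"
 shows "(EE w. Z w*(I t w - I s w)^2)
    = (EE w. Z w*ival s t (%r. (H r w)^2))"
 by (rule ito_variance[OF ito HK assms(1-3)]) (use assms(4) in auto)

definition grid :: "real => nat => nat => real" where
 "grid T N k = real k*T / real N"

text \<open>Approximates the time integral of \<open>exp A\<close> times the generator applied to
  \<open>u\<close>. Next to the increment of \<open>A\<close> the function \<open>u\<close> is taken
  at the right end of the cell, everything else at the left end, because this is how the discrete
  product rule splits \<open>exp (A) * u (X)\<close>.\<close>

definition riemann :: "(real => real) => (real => real) => (real => real) => real => nat => 'w => real" where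
 "riemann u u1 u2 T N w = (\<Sum>k<N. exp (A (grid T N k) w) *
  ((A (grid T N (Suc k)) w - A (grid T N k) w)*u (X (grid T N (Suc k)) w)
   + u1 (X (grid T N k) w)*(X (grid T N (Suc k)) w - X (grid T N k) w - g*(I (grid T N (Suc k)) w - I (grid T N k) w))
   + g^2 / 2*u2 (X (grid T N k) w)*ival (grid T N k) (grid T N (Suc k)) (%r. (H r w)^2)))"

lemma H_joint: "(%(w, r). indicator {s<..t} r*(H r w)^2) \<in> \<B> MT" if "0 <= s"
proof -
 have [measurable]: "(%x. indicator {0..} (snd x)*H (snd x) (fst x)) \<in> \<B> MT"
  using measurable_compose[OF measurable_pair_swap' ito_joint[OF ito]]
  by (simp add: case_prod_beta' cong: measurable_cong_sets)
 have "(%x. indicator {s<..t} (snd x)*(indicator {0..} (snd x)*H (snd x) (fst x))^2) \<in> \<B> MT"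
  by measurable
 thus ?thesis
  by (rule measurable_cong[THEN iffD1, rotated]) (use that in "auto simp: indicator_def")
qed

lemma H_section: "(%r. indicator {s<..t} r*(H r w)^2) \<in> \<B> lborel"
 if "0 <= s" "w \<in> space M"
 using measurable_compose[OF measurable_Pair1'[OF that(2)] H_joint[OF that(1), of t]] by simp

lemma H_cell:
 assumes "0 <= s" "s <= t"
 shows "(%w. ival s t (%r. (H r w)^2)) \<in> \<B> M" (is ?th1)
  "w \<in> space M ==> iable s t (%r. (H r w)^2)"
  "w \<in> space M ==> abs (\<integral>r. indicator {s<..t} r*(H r w)^2 \<partial>lborel) <= K^2*(t - s)"
proof -
 show ?th1
  by (rule lborel.borel_measurable_lebesgue_integral[OF H_joint[OF assms(1)]])
 assume wv: "w \<in> space M"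
 have H2: "(H r w)^2 <= K^2" if "s < r" for r
  using HK[of r w] that assms K0 wv by (subst abs_le_square_iff[symmetric]) auto
 have ii: "iable s t (%r. K^2)" using assms by (intro integrable_mult_left integrable_real_indicator) auto
 show i: "iable s t (%r. (H r w)^2)"
  by (rule int_bound[OF ii H_section[OF assms(1) wv]])
   (use H2 in "auto simp: indicator_def")
 have "abs (\<integral>r. indicator {s<..t} r*(H r w)^2 \<partial>lborel) <= ival s t (%r. K^2)"
  by (intro bochner_abs_le i ii) (use H2 in "auto simp: indicator_def")
 thus "abs (\<integral>r. indicator {s<..t} r*(H r w)^2 \<partial>lborel) <= K^2*(t - s)"
  using assms by (simp add: mult.commute)
qed

lemma u_meas:
 assumes "test_fun a u u1 u2" "0 <= t"
 shows "(%w. u (X t w)) \<in> \<B> (F t)" "(%w. u1 (X t w)) \<in> \<B> (F t)"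
  "(%w. u2 (X t w)) \<in> \<B> (F t)"
 by (rule borel_measurable_continuous_on_ge[OF _ Xm[OF assms(2)]], rule test_fun_continuous[OF assms(1)],
   use Xa[OF assms(2)] in simp)+

text \<open>Over a cell the increment of \<open>exp (A) * u (X)\<close> is the Riemann term
  \<open>S\<close> plus four errors: \<open>P1\<close> from linearising the exponential, the
  martingale term \<open>P2\<close>, the gap \<open>P3\<close> between the squared increment of the
  integral and its compensator, and the Taylor remainder \<open>P4\<close>. \<open>P2\<close> and
  \<open>P3\<close> have mean 0, \<open>P1\<close> is of order \<open>de^2\<close> per cell, and
  \<open>P4\<close> leaves one part with the factor \<open>eta\<close> and one of order
  \<open>de\<close>.\<close>

lemma dynkin_step:
 assumes tf: "test_fun a u u1 u2" and T: "0 < T" and N: "0 < N"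
  and Cu: "!!y. a <= y ==> abs (u y) <= C0" "!!y. a <= y ==> abs (u1 y) <= C1" "!!y. a <= y ==> abs (u2 y) <= C2"
  and rem: "!!y b z. a <= y ==> a <= y + b + z ==>
   abs (u (y + b + z) - u y - u1 y*(b + z) - u2 y*z^2 / 2) <= eta*z^2 + C*(b^2 + z^4)"
  and eta: "0 <= eta" "0 <= C"
 defines "de \<equiv> T / real N"
 shows "integrable M (riemann u u1 u2 T N)"
  "abs ((EE w. exp (A T w)*u (X T w)) - u x - (EE w. riemann u u1 u2 T N w))
  <= exp (Ka*T)*(eta*(g^2*K^2*T) + de*(Ka^2*exp (Ka*T)*C0*T
    + C*(EE w. ival 0 T (%r. (be r w)^2)) + C*(3*g^4*K^4*T)))"
proof -
 define t where "t = grid T N"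
 have t: "0 <= t k" "t (Suc k) - t k = de" "t k <= t (Suc k)" "t 0 = 0" "t N = T" for k
  using T N by (auto simp: t_def grid_def de_def field_simps)
 have tT: "t k <= T" if "k <= N" for k using that T N by (simp add: t_def grid_def field_simps)
 have de: "0 < de" "de <= T" using T N by (auto simp: de_def field_simps)
 have Nde: "real N*de = T" using N by (simp add: de_def)
 have C0: "0 <= C0" "0 <= C1" "0 <= C2" using Cu[OF order_refl] by linarith+
 let ?E = "exp (Ka*T)"
 let ?B = "?E*(Ka^2*de^2 * ?E*C0)"
 let ?d = "%k w. I (t (Suc k)) w - I (t k) w"
 define V where "V w = ival 0 T (%r. (be r w)^2)" for w
 let ?b = "%w r. (be r w)^2"
 let ?R = "eta*(g^2*K^2*T) + C*(de*(EE w. V w) + de*(3*g^4*K^4*T))"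
 define e where "e k w = exp (A (t k) w)" for k w
 define dA where "dA k w = A (t (Suc k)) w - A (t k) w" for k w
 define z where "z k w = g * ?d k w" for k w
 define b where "b k w = X (t (Suc k)) w - X (t k) w - z k w" for k w
 let ?W = "%w. eta*(\<Sum>k<N. (z k w)^2) + C*(de*V w + (\<Sum>k<N. z k w^4))"
 define h where "h k w = ival (t k) (t (Suc k)) (%r. (H r w)^2)" for k w
 define y where "y k w = X (t k) w" for k w
 let ?c1 = "%k w. e k w*u1 (y k w)"
 let ?c = "%k w. e k w*u2 (y k w) / 2*g^2"
 define R where "R k w = u (y (Suc k) w) - u (y k w) - u1 (y k w)*(b k w + z k w) - u2 (y k w)*(z k w)^2 / 2" for k w
 let ?A = "%w. \<Sum>k<N. abs (R k w)"
 define P1 where "P1 k w = e k w*((exp (dA k w) - 1 - dA k w)*u (y (Suc k) w))" for k w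
 define P2 where "P2 k w = (?c1 k w)*(g * ?d k w)" for k w
 define P3 where "P3 k w = (?c k w) * ?d k w^2 - (?c k w)*h k w" for k w
 define P4 where "P4 k w = e k w * R k w" for k w
 let ?P = "%k w. P1 k w + P2 k w + P3 k w + P4 k w"
 define S where "S k w = e k w*(dA k w*u (y (Suc k) w) + u1 (y k w)*b k w + g^2 / 2*u2 (y k w)*h k w)" for k w
 have rS: "riemann u u1 u2 T N w = (\<Sum>k<N. S k w)" for w
  unfolding riemann_def S_def e_def dA_def b_def z_def h_def y_def t_def ..
 have XtM [measurable]: "X (t k) \<in> \<B> M" "A (t k) \<in> \<B> M" "I (t k) \<in> \<B> M" for k
  using XM AM IM t by auto
 have um: "(%w. u (y k w)) \<in> \<B> (F (t k))" "(%w. u1 (y k w)) \<in> \<B> (F (t k))"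
  "(%w. u2 (y k w)) \<in> \<B> (F (t k))" "e k \<in> \<B> (F (t k))" for k
  using u_meas[OF tf t(1)] Am[OF t(1), of k] unfolding y_def e_def by auto
 have uM [measurable]: "(%w. u (y k w)) \<in> \<B> M" "(%w. u1 (y k w)) \<in> \<B> M"
  "(%w. u2 (y k w)) \<in> \<B> M" "e k \<in> \<B> M" for k using um meas_M by blast+
 have [measurable]: "dA k \<in> \<B> M" "z k \<in> \<B> M" "b k \<in> \<B> M" for k
  unfolding dA_def z_def b_def by measurable
 have [measurable]: "h k \<in> \<B> M" for k unfolding h_def using H_cell(1)[OF t(1) t(3)] by simp
 have [measurable]: "R k \<in> \<B> M" for k unfolding R_def by measurable
 have yb: "abs (u (y k w)) <= C0" "abs (u1 (y k w)) <= C1" "abs (u2 (y k w)) <= C2" if "w \<in> space M" for k w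
  using Cu Xa[OF t(1) that] unfolding y_def by auto
 have eb: "0 < e k w" "e k w <= ?E" if "w \<in> space M" "k <= N" for k w
  using A_bound[OF that(1) t(1) tT[OF that(2)]] unfolding e_def by auto
 have eabs: "abs (e k w) <= ?E" if "w \<in> space M" "k < N" for k w
  using eb[OF that(1), of k] that(2) by simp
 have dAb: "abs (dA k w) <= Ka*de" if "w \<in> space M" for k w
  using A_incr(2)[OF that t(1) t(3), of k] t(2) unfolding dA_def by simp
 have hb: "abs (h k w) <= K^2*de" if "w \<in> space M" for k w
  using H_cell(3)[OF t(1) t(3) that, of k] t(2) unfolding h_def by simp
 note I4 = I_moments(1)[OF t(1) t(3)]
 note I2 = I_moments(2)[OF t(1) t(3)]
 have I1: "integrable M (%w. I (t (Suc k)) w - I (t k) w)" for k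
  using prob_space_power_integrable[OF prob_space_axioms _ I4[of k], of 1] by simp
 have zi: "integrable M (%w. (z k w)^2)" "integrable M (%w. z k w^4)" "integrable M (z k)" for k
  unfolding z_def power_mult_distrib by (intro integrable_mult_right I2 I4 I1)+
 have Vi: "integrable M V" unfolding V_def using be2[OF T] .
 \<comment> \<open>Cauchy-Schwarz on each cell bounds the square of \<open>b k\<close> by
   \<open>de\<close> times the energy of the drift over that cell, and these energies add up to
   \<open>V\<close>.\<close>
 have bV: "AE w in M. (\<forall>k<N. (b k w)^2 <= de*V w) \<and> (\<Sum>k<N. (b k w)^2) <= de*V w"
  using be_good[OF T] AE_space
 proof eventually_elim
  case (elim w)
  have bk: "(b k w)^2 <= de*ival (t k) (t (Suc k)) (?b w)
   \<and> iable (t k) (t (Suc k)) (?b w)" if k: "k < N" for k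
  proof -
   have i: "iable 0 (t (Suc k)) (?b w)"
    by (rule indicator_integral_split(1)[OF conjunct1[OF elim(1)]]) (use t tT k in auto)
   have i2: "iable (t k) (t (Suc k)) (?b w)"
    by (rule indicator_integral_split(2)[OF i]) (use t in auto)
   have "b k w = ival (t k) (t (Suc k)) (%r. be r w)"
    unfolding b_def z_def using conjunct2[OF elim(1), rule_format, OF t(1) t(3), of k] tT[of "Suc k"] k by simp
   thus ?thesis using integral_square_le(2)[OF bem[OF elim(2)] i2 t(3)] i2 t(2) by simp
  qed
  have sumV: "(\<Sum>k<m. ival (t k) (t (Suc k)) (?b w))
   = ival 0 (t m) (?b w)" if "m <= N" for m using that
  proof (induction m)
   case 0
   thus ?case by (simp add: t(4))
  next
   case (Suc m)
   have i: "iable 0 (t (Suc m)) (?b w)"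
    by (rule indicator_integral_split(1)[OF conjunct1[OF elim(1)]]) (use t tT Suc.prems in auto)
   show ?case using indicator_integral_split(3)[OF i t(1) t(3)] Suc by simp
  qed
  have s: "(\<Sum>k<N. (b k w)^2) <= de*V w"
  proof -
   have "(\<Sum>k<N. (b k w)^2) <= (\<Sum>k<N. de*ival (t k) (t (Suc k)) (?b w))"
    using bk by (intro sum_mono) auto
   also have "... = de*V w" unfolding sum_distrib_left[symmetric] using sumV[of N] t(5) by (simp add: V_def)
   finally show ?thesis .
  qed
  have "(b k w)^2 <= de*V w" if "k < N" for k
   using s member_le_sum[of k "{..<N}" "%k. (b k w)^2"] that by auto
  with s show ?case by blast
 qed
 have b2i: "integrable M (%w. (b k w)^2)" if "k < N" for k
 proof (rule int_bound[where f = "%w. de*V w"])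
  show "AE w in M. norm ((b k w)^2) <= norm (de*V w)" using bV by eventually_elim (use that in auto)
 qed (use Vi in auto)
 have bi: "integrable M (b k)" if "k < N" for k
 proof (rule int_bound[where f = "%w. 1 + (b k w)^2"])
  have "abs y <= 1 + y^2" for y :: real
   using zero_le_power2[of "abs y - 1"] by (simp add: power2_eq_square algebra_simps)
  thus "AE w in M. norm (b k w) <= norm (1 + (b k w)^2)" by (intro AE_I2) auto
 qed (use b2i[OF that] in auto)
 have Rb: "abs (R k w) <= eta*(z k w)^2 + C*((b k w)^2 + z k w^4)" if "w \<in> space M" for k w
  using rem[of "y k w" "b k w" "z k w"] Xa[OF t(1) that, of k] Xa[OF t(1) that, of "Suc k"]
  unfolding R_def y_def b_def by simp
 have Ri: "integrable M (R k)" if "k < N" for k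
 proof (rule int_bound[where f = "%w. eta*(z k w)^2 + C*((b k w)^2 + z k w^4)"])
  show "AE w in M. norm (R k w) <= norm (eta*(z k w)^2 + C*((b k w)^2 + z k w^4))"
   unfolding real_norm_def by (intro AE_I2 order_trans[OF Rb abs_ge_self])
 qed (use zi b2i[OF that] in auto)
 have P4i: "integrable M (P4 k)" if "k < N" for k unfolding P4_def
  by (rule integrable_bounded_mult[OF Ri[OF that] uM(4) eabs[OF _ that]])
 have c1: "abs (?c1 k w) <= ?E*C1" "abs (?c k w) <= ?E*C2 / 2*g^2"
  if "k < N" "w \<in> space M" for k w
 proof -
  show "abs (?c1 k w) <= ?E*C1" unfolding abs_mult by (intro mult_mono eabs yb that) auto
  have "abs (e k w*u2 (y k w)) <= ?E*C2" unfolding abs_mult by (intro mult_mono eabs yb that) auto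
  hence "abs (e k w*u2 (y k w)) / 2*g^2 <= ?E*C2 / 2*g^2"
   by (intro mult_right_mono divide_right_mono) auto
  thus "abs (?c k w) <= ?E*C2 / 2*g^2"
   by (simp only: abs_mult abs_divide abs_numeral abs_power2)
 qed
 have cm: "(%w. ?c1 k w) \<in> \<B> (F (t k))"
  "(%w. ?c k w) \<in> \<B> (F (t k))" for k using um[of k] by measurable
 have cM: "(%w. ?c1 k w) \<in> \<B> M"
  "(%w. ?c k w) \<in> \<B> M" for k using cm meas_M by blast+
 have P2i: "integrable M (P2 k)" if "k < N" for k unfolding P2_def
  by (rule integrable_bounded_mult[OF _ cM(1) c1(1)[OF that]]) (rule integrable_mult_right[OF I1])
 have P3i1: "integrable M (%w. (?c k w) * ?d k w^2)" if "k < N" for k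
  by (rule integrable_bounded_mult[OF I2 cM(2) c1(2)[OF that]])
 have hi: "integrable M (h k)" for k
  by (rule integrable_const_bound[where B = "K^2*de"]) (auto intro!: AE_I2 hb)
 have P3i2: "integrable M (%w. (?c k w)*h k w)" if "k < N" for k
  by (rule integrable_bounded_mult[OF hi cM(2) c1(2)[OF that]])
 have P3i: "integrable M (P3 k)" if "k < N" for k unfolding P3_def using P3i1[OF that] P3i2[OF that] by simp
 have P1b: "abs (P1 k w) <= ?B" if "k < N" "w \<in> space M" for k w
 proof -
  have "abs (exp (dA k w) - 1 - dA k w) <= (dA k w)^2*exp \<bar>dA k w\<bar>" by (rule exp_remainder)
  also have "... <= (Ka*de)^2 * ?E"
  proof (intro mult_mono)
   show "(dA k w)^2 <= (Ka*de)^2" using dAb[OF that(2), of k] by (subst abs_le_square_iff[symmetric]) auto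
   have "Ka*de <= Ka*T" using de Ka0 by (intro mult_left_mono) auto
   thus "exp \<bar>dA k w\<bar> <= ?E" using dAb[OF that(2), of k] by simp
  qed auto
  finally have "abs (exp (dA k w) - 1 - dA k w)*abs (u (y (Suc k) w)) <= (Ka*de)^2 * ?E*C0"
   using yb(1)[OF that(2), of "Suc k"] by (intro mult_mono) auto
  hence "e k w*(abs (exp (dA k w) - 1 - dA k w)*abs (u (y (Suc k) w))) <= ?E*((Ka*de)^2 * ?E*C0)"
   using eb[OF that(2), of k] that(1) by (rule_tac mult_mono) simp_all
  thus ?thesis using eb(1)[OF that(2), of k] that(1) by (simp add: P1_def abs_mult power_mult_distrib)
 qed
 have P1m: "P1 k \<in> \<B> M" for k unfolding P1_def[abs_def] by measurable
 have P1i: "integrable M (P1 k)" if "k < N" for k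
 proof (rule integrable_const_bound[where B = "?B"])
  show "AE w in M. norm (P1 k w) <= ?B" using P1b[OF that] by (intro AE_I2) auto
 qed (rule P1m)
 have de_nn: "0 <= Ka*de" using Ka0 de by simp
 have Si: "integrable M (S k)" if "k < N" for k
 proof -
  have "integrable M (%w. dA k w*u (y (Suc k) w))"
   by (rule integrable_const_bound[where B = "Ka*de*C0"])
    (auto simp: abs_mult de_nn intro!: AE_I2 mult_mono dAb yb)
  moreover have "integrable M (%w. u1 (y k w)*b k w)"
   by (rule integrable_bounded_mult[OF bi[OF that] uM(2) yb(2)])
  moreover have "integrable M (%w. (g^2 / 2*u2 (y k w))*h k w)"
   by (rule integrable_bounded_mult[OF hi, where c = "g^2 / 2*C2"]) (auto simp: abs_mult intro!: mult_left_mono yb)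
  ultimately have "integrable M (%w. dA k w*u (y (Suc k) w) + u1 (y k w)*b k w + g^2 / 2*u2 (y k w)*h k w)"
   by simp
  thus ?thesis unfolding S_def by (rule integrable_bounded_mult[OF _ uM(4) eabs[OF _ that]])
 qed
 show rint: "integrable M (riemann u u1 u2 T N)"
  unfolding rS[abs_def] using Si by (intro int_sum) auto
 have id: "exp (A T w)*u (X T w) = u x + (\<Sum>k<N. S k w) + (\<Sum>k<N. ?P k w)"
  if wv: "w \<in> space M" for w
 proof -
  \<comment> \<open>The discrete product rule: the exponential is differenced against
    \<open>u\<close> at the new state, and \<open>u\<close> against the exponential at the old
    time.\<close>
  have st: "e (Suc k) w*u (y (Suc k) w) - e k w*u (y k w) = S k w + (?P k w)" for k
  proof -
   have "e (Suc k) w = e k w*exp (dA k w)" by (simp add: e_def dA_def exp_add[symmetric])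
   thus ?thesis
    unfolding S_def P1_def P2_def P3_def P4_def R_def z_def[of k w] by (simp add: field_simps power2_eq_square)
  qed
  have "(\<Sum>k<N. e (Suc k) w*u (y (Suc k) w) - e k w*u (y k w)) = (\<Sum>k<N. S k w) + (\<Sum>k<N. ?P k w)"
   unfolding st by (rule sum.distrib)
  moreover have "(\<Sum>k<N. e (Suc k) w*u (y (Suc k) w) - e k w*u (y k w)) = e N w*u (y N w) - e 0 w*u (y 0 w)"
   by (rule sum_lessThan_telescope)
  ultimately show ?thesis using A0[OF wv] X0[OF wv] by (simp add: e_def y_def t(4,5))
 qed
 have EP2: "(EE w. P2 k w) = 0" if "k < N" for k
 proof -
  have "(EE w. (?c1 k w) * ?d k w) = 0"
   by (rule I_mean[OF t(1) t(3) cm(1), where c = "?E*C1"]) (use c1(1)[OF that] in blast)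
  thus ?thesis unfolding P2_def by (simp add: mult.left_commute[of _ g])
 qed
 have EP3: "(EE w. P3 k w) = 0" if "k < N" for k
 proof -
  have "(EE w. (?c k w) * ?d k w^2)
   = (EE w. (?c k w)*h k w)"
   unfolding h_def by (rule I_variance[OF t(1) t(3) cm(2), where c = "?E*C2 / 2*g^2"]) (use c1(2)[OF that] in blast)
  thus ?thesis unfolding P3_def using P3i1[OF that] P3i2[OF that] by simp
 qed
 have EP1: "abs (\<integral>w. P1 k w \<partial>M) <= ?B" if "k < N" for k
 proof -
  have "abs (\<integral>w. P1 k w \<partial>M) <= (EE w. ?B)"
   using P1b[OF that] P1i[OF that] by (intro bochner_abs_le) auto
  thus ?thesis by (simp add: prob_space)
 qed
 have Ez2: "(EE w. (z k w)^2) <= g^2*(K^2*de)" for k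
 proof -
  have "(EE w. ?d k w^2) = (EE w. h k w)"
   using I_variance[OF t(1) t(3), of "%_. 1" k 1] unfolding h_def by simp
  also have "... <= (EE w. K^2*de)" using hi hb by (intro integral_mono) (auto simp: abs_le_iff)
  finally show ?thesis unfolding z_def power_mult_distrib by (simp add: prob_space mult_left_mono)
 qed
 have Ez4: "(EE w. z k w^4) <= g^4*(3*K^4*de^2)" for k
  using I_moments(3)[OF t(1) t(3), of k] t(2) unfolding z_def power_mult_distrib by (simp add: mult_left_mono)
 have Rsum: "(EE w. (?A w)) <= ?R"
 proof -
  have "(EE w. (?A w)) <= (EE w. ?W w)"
  proof (rule integral_mono_AE)
   show "integrable M (%w. ?A w)" using Ri by (intro int_sum) auto
   show "integrable M (%w. ?W w)"
    using zi Vi by simp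
   show "AE w in M. (?A w) <= ?W w"
    using bV AE_space
   proof eventually_elim
    case (elim w)
    have "(?A w) <= (\<Sum>k<N. eta*(z k w)^2 + C*((b k w)^2 + z k w^4))"
     using Rb[OF elim(2)] by (intro sum_mono)
    also have "... = eta*(\<Sum>k<N. (z k w)^2) + C*((\<Sum>k<N. (b k w)^2) + (\<Sum>k<N. z k w^4))"
     by (simp only: sum.distrib sum_distrib_left distrib_left)
    also have "... <= ?W w"
     using elim(1) eta by (intro add_left_mono mult_left_mono add_right_mono) auto
    finally show ?case .
   qed
  qed
  also have "... = eta*(\<Sum>k<N. EE w. (z k w)^2) + C*(de*(EE w. V w) + (\<Sum>k<N. EE w. z k w^4))"
   using zi Vi by simp
  also have "... <= eta*(\<Sum>k<N. g^2*(K^2*de)) + C*(de*(EE w. V w) + (\<Sum>k<N. g^4*(3*K^4*de^2)))"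
   by (intro add_mono mult_left_mono sum_mono Ez2 Ez4 eta order_refl)
  also have "... = eta*(g^2*K^2*(real N*de)) + C*(de*(EE w. V w) + de*(3*g^4*K^4*(real N*de)))"
   by (simp add: power2_eq_square mult_ac)
  finally show ?thesis unfolding Nde .
 qed
 have EP4: "abs (\<Sum>k<N. \<integral>w. P4 k w \<partial>M) <= ?E * ?R"
 proof -
  have "(\<Sum>k<N. EE w. P4 k w) = (EE w. (\<Sum>k<N. P4 k w))" using P4i by simp
  also have "abs (...) <= (EE w. ?E*(?A w))"
  proof (rule bochner_abs_le)
   fix w assume wv: "w \<in> space M"
   have "abs (\<Sum>k<N. P4 k w) <= (\<Sum>k<N. ?E*abs (R k w))"
   proof (rule order_trans[OF sum_abs], rule sum_mono)
    fix k assume "k \<in> {..<N}"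
    thus "abs (P4 k w) <= ?E*abs (R k w)"
     unfolding P4_def abs_mult using eb[OF wv, of k] by (intro mult_right_mono) auto
   qed
   thus "abs (\<Sum>k<N. P4 k w) <= ?E*(?A w)" by (simp add: sum_distrib_left)
  next
   show "integrable M (%w. \<Sum>k<N. P4 k w)" using P4i by (intro int_sum) simp
   show "integrable M (%w. ?E*(?A w))"
    using Ri by (intro integrable_mult_right int_sum integrable_abs) simp
  qed
  also have "... = ?E*(EE w. (?A w))" by simp
  also have "... <= ?E * ?R"
   by (rule mult_left_mono[OF Rsum]) simp
  finally show ?thesis .
 qed
 have "(EE w. exp (A T w)*u (X T w)) = (EE w. u x + (\<Sum>k<N. S k w) + (\<Sum>k<N. ?P k w))"
  by (intro lint_cong refl id)
 also have "... = u x + (EE w. (\<Sum>k<N. S k w)) + (EE w. (\<Sum>k<N. ?P k w))"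
 proof -
  have s1: "integrable M (%w. \<Sum>k<N. S k w)" using Si by (intro int_sum) auto
  have s2: "integrable M (%w. \<Sum>k<N. ?P k w)"
   using P1i P2i P3i P4i by (intro int_sum int_add) auto
  show ?thesis using s1 s2 by (simp add: prob_space)
 qed
 also have "(EE w. (\<Sum>k<N. ?P k w)) = (\<Sum>k<N. (EE w. P1 k w) + (EE w. P4 k w))"
 proof -
  have "(EE w. (\<Sum>k<N. ?P k w)) = (\<Sum>k<N. EE w. ?P k w)"
   using P1i P2i P3i P4i by (intro lint_sum int_add) auto
  also have "... = (\<Sum>k<N. (EE w. P1 k w) + (EE w. P4 k w))"
   using P1i P2i P3i P4i EP2 EP3 by (intro sum.cong) auto
  finally show ?thesis .
 qed
 finally have "abs ((EE w. exp (A T w)*u (X T w)) - u x - (EE w. (\<Sum>k<N. S k w)))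
  <= (\<Sum>k<N. abs (\<integral>w. P1 k w \<partial>M)) + abs (\<Sum>k<N. \<integral>w. P4 k w \<partial>M)"
  by (simp add: sum.distrib order_trans[OF abs_triangle_ineq add_right_mono[OF sum_abs]])
 also have "... <= (\<Sum>k<N. ?B) + ?E * ?R"
  by (intro add_mono[OF sum_mono EP4] EP1) simp
 also have "(\<Sum>k<N. ?B) = ?E*(de*(Ka^2 * ?E*C0*(real N*de)))"
  by (simp add: power2_eq_square mult_ac)
 finally show "abs ((EE w. exp (A T w)*u (X T w)) - u x - (EE w. riemann u u1 u2 T N w))
  <= exp (Ka*T)*(eta*(g^2*K^2*T) + de*(Ka^2*exp (Ka*T)*C0*T
    + C*(EE w. ival 0 T (?b w)) + C*(3*g^4*K^4*T)))"
 proof -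
  have gen: "E*(d*p) + E*(q + c*(d * v + d*wv)) = E*(q + d*(p + c * v + c*wv))" for E d p q c v wv :: real
   by (simp add: algebra_simps)
  assume "abs ((EE w. exp (A T w)*u (X T w)) - u x - (EE w. (\<Sum>k<N. S k w)))
   <= ?E*(de*(Ka^2 * ?E*C0*(real N*de))) + ?E * ?R"
  thus ?thesis unfolding rS Nde V_def gen .
 qed
qed

end

text \<open>Rounding the time down to a multiple of \<open>1 / real (Suc n)\<close> leaves countably
  many sections, and the rounded maps converge by continuity of the paths.\<close>

lemma continuous_joint_measurable:
 fixes Y :: "real => 'b => real"
 assumes Y: "!!t. Y t \<in> \<B> N" and c: "!!w. w \<in> space N ==> continuous_on UNIV (%t. Y t w)"
 shows "(%(w, t). Y t w) \<in> \<B> (N \<Otimes>\<^sub>M lborel)"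
proof (rule borel_measurable_LIMSEQ_real)
 fix n :: nat
 have "(%x. Y (real_of_int \<lfloor>snd x*real (Suc n)\<rfloor> / real (Suc n)) (fst x)) \<in> \<B> (N \<Otimes>\<^sub>M lborel)"
 proof (rule measurable_compose_countable[where g = "%x. \<lfloor>snd x*real (Suc n)\<rfloor>"
    and f = "%i x. Y (real_of_int i / real (Suc n)) (fst x)"])
  show "(%x. Y (real_of_int i / real (Suc n)) (fst x)) \<in> \<B> (N \<Otimes>\<^sub>M lborel)" for i
   using measurable_compose[OF measurable_fst Y] .
  show "(%x. \<lfloor>snd x*real (Suc n)\<rfloor>) \<in> measurable (N \<Otimes>\<^sub>M lborel) (count_space UNIV)"
   by measurable
 qed
 thus "(%(w, t). Y (real_of_int \<lfloor>t*real (Suc n)\<rfloor> / real (Suc n)) w) \<in> \<B> (N \<Otimes>\<^sub>M lborel)"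
  by (simp add: case_prod_beta')
next
 fix x :: "'b \<times> real" assume "x \<in> space (N \<Otimes>\<^sub>M lborel)"
 then obtain wv t where x: "x = (wv, t)" "wv \<in> space N" by (auto simp: space_pair_measure)
 have "(%n. real_of_int \<lfloor>t*real (Suc n)\<rfloor> / real (Suc n)) ----> t"
 proof (rule Lim_null_comparison[THEN LIM_zero_cancel])
  show "\<forall>\<^sub>F n in sequentially. norm (real_of_int \<lfloor>t*real (Suc n)\<rfloor> / real (Suc n) - t) <= inverse (real (Suc n))"
  proof (rule always_eventually, rule allI)
   fix n
   have "real_of_int \<lfloor>t*real (Suc n)\<rfloor> / real (Suc n) - t = (real_of_int \<lfloor>t*real (Suc n)\<rfloor> - t*real (Suc n)) / real (Suc n)"
    by (simp add: diff_divide_distrib del: of_nat_Suc)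
   thus "norm (real_of_int \<lfloor>t*real (Suc n)\<rfloor> / real (Suc n) - t) <= inverse (real (Suc n))"
    using floor_correct[of "t*real (Suc n)"] by (simp add: divide_simps del: of_nat_Suc) linarith
  qed
  show "(%n. inverse (real (Suc n))) ----> 0" by (rule LIMSEQ_inverse_real_of_nat)
 qed
 hence "(%n. Y (real_of_int \<lfloor>t*real (Suc n)\<rfloor> / real (Suc n)) wv) ----> Y t wv"
  by (rule continuous_on_tendsto_compose[OF c[OF x(2)]]) auto
 thus "(%n. case x of (w, t) => Y (real_of_int \<lfloor>t*real (Suc n)\<rfloor> / real (Suc n)) w) ----> (case x of (w, t) => Y t w)"
  by (simp add: x)
qed

context ito_process
begin

definition gen :: "(real => real) => (real => real) => (real => real) => real => 'w => real" where
 "gen u u1 u2 s w = al s w*u (X s w) + u1 (X s w)*be s w + g^2 / 2*u2 (X s w)*(H s w)^2"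

lemma A_cont:
 assumes "w \<in> space M"
 shows "continuous_on {0..} (%t. A t w)"
proof (rule lipschitz_on_continuous_on[where L = Ka], rule lipschitz_onI)
 fix s t :: real assume st: "s \<in> {0..}" "t \<in> {0..}"
 show "dist (A s w) (A t w) <= Ka*dist s t" using A_incr(2)[OF assms, of s t] A_incr(2)[OF assms, of t s] st
  by (cases "s <= t") (auto simp: dist_real_def abs_minus_commute)
qed (rule Ka0)

lemma X_joint: "(%(w, t). X (max 0 t) w) \<in> \<B> MT"
 by (rule continuous_joint_measurable[OF XM continuous_on_compose2[OF Xc]]) (auto intro!: continuous_on_max)

lemma A_joint: "(%(w, t). A (max 0 t) w) \<in> \<B> MT"
 by (rule continuous_joint_measurable[OF AM continuous_on_compose2[OF A_cont]]) (auto intro!: continuous_on_max)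

lemma uX_joint:
 fixes f :: "real => real"
 assumes "continuous_on {a..} f"
 shows "(%(w, t). f (X (max 0 t) w)) \<in> \<B> MT"
proof -
 have "(%x. f ((%(w, t). X (max 0 t) w) x)) \<in> \<B> MT"
  by (rule borel_measurable_continuous_on_ge[OF assms X_joint]) (auto simp: space_pair_measure intro!: Xa)
 thus ?thesis by (simp add: case_prod_beta')
qed

lemma gen_joint:
 assumes tf: "test_fun a u u1 u2"
 shows "(%(w, s). indicator {0<..T} s*(exp (A s w)*gen u u1 u2 s w)) \<in> \<B> MT"
proof -
 let ?x = "%x. X (max 0 (snd x)) (fst x)" and ?a = "%x. A (max 0 (snd x)) (fst x)" and ?h = "%x. (H (snd x) (fst x))^2"
 note c = test_fun_continuous[OF tf]
 have [measurable]: "(%x. u (?x x)) \<in> \<B> MT"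
  "(%x. u1 (?x x)) \<in> \<B> MT"
  "(%x. u2 (?x x)) \<in> \<B> MT"
  "(%x. ?a x) \<in> \<B> MT"
  "(%x. al (snd x) (fst x)) \<in> \<B> MT"
  "(%x. be (snd x) (fst x)) \<in> \<B> MT"
  "(%x. indicator {0<..T} (snd x) * ?h x) \<in> \<B> MT"
  using uX_joint[OF c(1)] uX_joint[OF c(2)] uX_joint[OF c(3)] A_joint alj bej H_joint[OF order_refl, of T]
  by (simp_all add: case_prod_beta')
 have "(%x. indicator {0<..T} (snd x)*exp (?a x)*(al (snd x) (fst x)*u (?x x) + u1 (?x x)*be (snd x) (fst x))
  + exp (?a x)*(g^2 / 2*u2 (?x x)*(indicator {0<..T} (snd x) * ?h x))) \<in> \<B> MT"
  by measurable
 thus ?thesis by (rule measurable_cong[THEN iffD1, rotated]) (auto simp: gen_def indicator_def algebra_simps)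
qed

text \<open>The Riemann sum is the exact integral of \<open>G N\<close>, in which
  \<open>exp A\<close>, \<open>u\<close> and its derivatives are frozen at grid times while
  \<open>al\<close>, \<open>be\<close> and \<open>H\<close> stay as they are; so continuity of
  \<open>X\<close> and \<open>A\<close> gives the limit. The bound \<open>bd\<close> is linear in
  the energy of the drift, hence integrable over the paths and fit for dominated
  convergence.\<close>

lemma riemann_tendsto:
 assumes tf: "test_fun a u u1 u2" and T: "0 < T"
  and Cu: "!!y. a <= y ==> abs (u y) <= C0" "!!y. a <= y ==> abs (u1 y) <= C1" "!!y. a <= y ==> abs (u2 y) <= C2"
  and wv: "w \<in> space M" and V: "iable 0 T (%r. (be r w)^2)"
  and eq: "!!s t. 0 <= s ==> s <= t ==> t <= T ==>
   X t w - X s w - g*(I t w - I s w) = ival s t (%r. be r w)"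
 defines "bd \<equiv> exp (Ka*T)*(Ka*C0*T + C1*(T + ival 0 T (%r. (be r w)^2)) + g^2 / 2*C2*K^2*T)"
 shows "(%n. riemann u u1 u2 T (Suc n) w) ----> (ival 0 T (%s. exp (A s w)*gen u u1 u2 s w))" (is ?th1)
  "abs (riemann u u1 u2 T (Suc n) w) <= bd" (is ?th2)
proof -
 let ?g = "grid T"
 let ?E = "exp (Ka*T)"
 have C0: "0 <= C0" "0 <= C1" "0 <= C2" using Cu[OF order_refl] by linarith+
 let ?x = "%N k. X (?g N k) w"
 have V1: "iable 0 T (%r. abs (be r w))" by (rule integral_square_le(1)) (use V T bem[OF wv] in auto)
 have V2: "ival 0 T (%r. abs (be r w)) <= T + ival 0 T (%r. (be r w)^2)"
  using integral_square_le(3)[of "%r. abs (be r w)" 0 T] V T bem[OF wv] by auto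
 define c where "c N k s = exp (A (?g N k) w)*(al s w*u (?x N (Suc k))
   + u1 (?x N k)*be s w + g^2 / 2*u2 (?x N k)*(H s w)^2)" for N k s
 define G where "G N s = (\<Sum>k<N. indicator {?g N k<..?g N (Suc k)} s*c N k s)" for N s
 define D where "D s = indicator {0<..T} s*(?E*Ka*C0) + ?E*C1*(indicator {0<..T} s*abs (be s w))
  + indicator {0<..T} s*(?E*(g^2 / 2*C2*K^2))" for s
 have ii: "iable 0 T (%r. (q::real))" for q
  using T by (intro integrable_mult_left integrable_real_indicator) auto
 have Di: "integrable lborel D"
  unfolding D_def by (intro int_add ii integrable_mult_right V1)
 have DI: "(\<integral>s. D s \<partial>lborel) <= bd"
 proof -
  have "(\<integral>s. D s \<partial>lborel) = T*(?E*Ka*C0) + ?E*C1*ival 0 T (%r. abs (be r w)) + T*(?E*(g^2 / 2*C2*K^2))"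
   unfolding D_def using ii V1 T
   by (subst lint_add, simp, simp, subst lint_add, simp, simp) simp
  also have "... <= T*(?E*Ka*C0) + ?E*C1*(T + ival 0 T (%r. (be r w)^2)) + T*(?E*(g^2 / 2*C2*K^2))"
   using C0 by (intro add_mono mult_left_mono V2 order_refl) auto
  also have "... = bd" unfolding bd_def by (simp add: algebra_simps)
  finally show ?thesis .
 qed
 have gr: "0 <= ?g N k" "?g N k <= ?g N (Suc k)" for N k
  using T by (auto simp: grid_def intro!: divide_right_mono mult_right_mono)
 have gT: "?g N k <= T" if "k <= N" "0 < N" for N k using that T by (simp add: grid_def field_simps)
 have cb: "abs (c N k s) <= ?E*(Ka*C0 + C1*abs (be s w) + g^2 / 2*C2*K^2)" if "k < N" "0 < s" for N k s
 proof -
  have 1: "abs (al s w*u (?x N (Suc k))) <= Ka*C0"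
   unfolding abs_mult using Ka0 by (intro mult_mono alb[OF wv] Cu Xa gr wv) auto
  have 2: "abs (u1 (?x N k)*be s w) <= C1*abs (be s w)"
   unfolding abs_mult by (intro mult_right_mono Cu Xa gr wv) auto
  have H2: "(H s w)^2 <= K^2" using HK[of s w] that wv by (simp add: abs_le_square_iff[symmetric] K0 abs_of_nonneg)
  have "abs (u2 (?x N k)*(H s w)^2) <= C2*K^2"
   unfolding abs_mult using H2 C0 by (intro mult_mono Cu Xa gr wv) auto
  hence "g^2 / 2*abs (u2 (?x N k)*(H s w)^2) <= g^2 / 2*(C2*K^2)" by (rule mult_left_mono) simp
  hence 3: "abs (g^2 / 2*u2 (?x N k)*(H s w)^2) <= g^2 / 2*C2*K^2"
   by (simp add: abs_mult mult.assoc)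
  have "abs (al s w*u (?x N (Suc k)) + u1 (?x N k)*be s w + g^2 / 2*u2 (?x N k)*(H s w)^2)
   <= Ka*C0 + C1*abs (be s w) + g^2 / 2*C2*K^2" using 1 2 3 by linarith
  thus ?thesis unfolding c_def abs_mult abs_exp_cancel
   using A_bound[OF wv gr(1) gT, of k N] that by (intro mult_mono) auto
 qed
 have Gd: "abs (G N s) <= D s" if "0 < N" for N s
 proof (cases "s \<in> {0<..T}")
  case True
  have "G N s = c N (nat \<lceil>s*real N / T\<rceil> - 1) s"
   unfolding G_def grid_def using grid_sum[OF that T, of s "%k. c N k s"] True by simp
  thus ?thesis using cb[OF grid_index(1)[OF that T], of s s] True by (simp add: D_def algebra_simps)
 next
  case False
  have "indicator {?g N k<..?g N (Suc k)} s*c N k s = 0" if "k < N" for k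
   using False gr(1)[of N k] gT[of "Suc k" N] that \<open>0 < N\<close> by (auto simp: indicator_def)
  hence "G N s = 0" unfolding G_def by (intro sum.neutral) auto
  thus ?thesis using False by (simp add: D_def)
 qed
 have cell: "iable (?g N k) (?g N (Suc k)) (%s. c N k s)
  \<and> (ival (?g N k) (?g N (Suc k)) (%s. c N k s)) = exp (A (?g N k) w) *
  ((A (?g N (Suc k)) w - A (?g N k) w)*u (?x N (Suc k))
   + u1 (?x N k)*(?x N (Suc k) - ?x N k - g*(I (?g N (Suc k)) w - I (?g N k) w))
   + g^2 / 2*u2 (?x N k)*ival (?g N k) (?g N (Suc k)) (%r. (H r w)^2))"
  if k: "k < N" for N k
 proof -
  let ?s = "?g N k" and ?t = "?g N (Suc k)"
  let ?i = "indicat_real {?s<..?t}"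
  have tT: "?t <= T" using gT[of "Suc k" N] k by simp
  have b2: "iable 0 (?t) (%r. (be r w)^2)" by (rule indicator_integral_split(1)[OF V]) (use gr tT in auto)
  have b3: "integrable lborel (%r. ?i r*(be r w)^2)"
   by (rule indicator_integral_split(2)[OF b2]) (use gr in auto)
  have bi: "integrable lborel (%r. ?i r*be r w)" by (rule integral_square_le(1)[OF bem[OF wv] b3 gr(2)])
  have ai: "integrable lborel (%r. ?i r*al r w)" by (rule al_int[OF wv gr(2)])
  have hi: "integrable lborel (%r. ?i r*(H r w)^2)" by (rule H_cell(2)[OF gr(1) gr(2) wv])
  have ceq: "?i s*c N k s = exp (A ?s w)*(u (X ?t w)*(?i s*al s w) + u1 (X ?s w)*(?i s*be s w)
   + g^2 / 2*u2 (X ?s w)*(?i s*(H s w)^2))" for s unfolding c_def by (simp only: distrib_left mult_ac)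
  have "integrable lborel (%s. ?i s*c N k s)"
   unfolding ceq by (intro integrable_mult_right int_add ai bi hi)
  moreover have "(\<integral>s. ?i s*c N k s \<partial>lborel) = exp (A ?s w)*(u (X ?t w)*(\<integral>s. ?i s*al s w \<partial>lborel) + u1 (X ?s w)*(\<integral>s. ?i s*be s w \<partial>lborel)
   + g^2 / 2*u2 (X ?s w)*(\<integral>s. ?i s*(H s w)^2 \<partial>lborel))" unfolding ceq using ai bi hi
   by (simp only: integral_mult_right_zero lint_add integrable_mult_right int_add)
  ultimately show ?thesis
   using A_incr(1)[OF wv gr(1) gr(2), of N k] eq[OF gr(1) gr(2) tT] by (simp add: mult.commute)
 qed
 have rG: "riemann u u1 u2 T N w = (\<integral>s. G N s \<partial>lborel)" "integrable lborel (G N)" for N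
 proof -
  have "(\<integral>s. G N s \<partial>lborel) = (\<Sum>k<N. ival (?g N k) (?g N (Suc k)) (%s. c N k s))"
   unfolding G_def using cell by (intro lint_sum) auto
  thus "riemann u u1 u2 T N w = (\<integral>s. G N s \<partial>lborel)"
   unfolding riemann_def using cell by simp
  show "integrable lborel (G N)" unfolding G_def[abs_def] using cell by (intro int_sum) auto
 qed
 have "abs (riemann u u1 u2 T (Suc n) w) <= (\<integral>s. D s \<partial>lborel)"
  unfolding rG(1) by (rule bochner_abs_le[OF Gd rG(2) Di]) simp
 thus ?th2 using DI by linarith
 show ?th1
  unfolding rG(1)
 proof (rule integral_dominated_convergence[where w = D])
  show "(%s. indicator {0<..T} s*(exp (A s w)*gen u u1 u2 s w)) \<in> \<B> lborel"
   using measurable_compose[OF measurable_Pair1'[OF wv] gen_joint[OF tf, of T]] by simp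
  show "G (Suc n) \<in> \<B> lborel" for n using rG(2) by blast
  show "AE s in lborel. norm (G (Suc n) s) <= D s" for n using Gd by simp
  show "AE s in lborel. (%n. G (Suc n) s) ----> indicator {0<..T} s*(exp (A s w)*gen u u1 u2 s w)"
  proof (rule AE_I2)
   fix s
   show "(%n. G (Suc n) s) ----> indicator {0<..T} s*(exp (A s w)*gen u u1 u2 s w)"
   proof (cases "s \<in> {0<..T}")
    case True
    hence s: "0 < s" "s <= T" by auto
    define j where "j N = nat \<lceil>s*real N / T\<rceil> - 1" for N
    have jG: "G (Suc n) s = c (Suc n) (j (Suc n)) s" for n
     unfolding G_def grid_def using grid_sum[OF _ T s, of "Suc n" "%k. c (Suc n) k s"] by (simp add: j_def)
    note gi = grid_index[OF _ T s, folded grid_def j_def]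
    have step: "?g N (Suc k) = ?g N k + T / real N" for N k
     by (simp add: grid_def add_divide_distrib algebra_simps)
    have l0: "(%n. T / real (Suc n)) ----> 0"
     using tendsto_mult[OF tendsto_const LIMSEQ_inverse_real_of_nat, of T] by (simp add: divide_inverse)
    have l1: "(%n. ?g (Suc n) (j (Suc n))) ----> s"
    proof (rule tendsto_sandwich)
     show "\<forall>\<^sub>F n in sequentially. s - T / real (Suc n) <= ?g (Suc n) (j (Suc n))"
      using gi(3)[OF zero_less_Suc] step
      by (intro always_eventually allI) (simp add: algebra_simps del: of_nat_Suc)
     show "\<forall>\<^sub>F n in sequentially. ?g (Suc n) (j (Suc n)) <= s"
      using gi(2) by (intro always_eventually allI less_imp_le) simp
     show "(%n. s - T / real (Suc n)) ----> s" using tendsto_diff[OF tendsto_const l0, of s] by simp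
    qed simp
    have l2: "(%n. ?g (Suc n) (Suc (j (Suc n)))) ----> s"
     unfolding step using tendsto_add[OF l1 l0] by simp
    have X1: "(%n. ?x (Suc n) (j (Suc n))) ----> X s w"
     by (rule continuous_on_tendsto_compose[OF Xc[OF wv] l1]) (use s gr in auto)
    have X2: "(%n. ?x (Suc n) (Suc (j (Suc n)))) ----> X s w"
     by (rule continuous_on_tendsto_compose[OF Xc[OF wv] l2]) (use s gr in auto)
    have A1: "(%n. A (?g (Suc n) (j (Suc n))) w) ----> A s w"
     by (rule continuous_on_tendsto_compose[OF A_cont[OF wv] l1]) (use s gr in auto)
    have Xs: "a <= X s w" using Xa s wv by simp
    note tc = test_fun_continuous[OF tf]
    have U: "(%n. u (?x (Suc n) (Suc (j (Suc n))))) ----> u (X s w)"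
     by (rule continuous_on_tendsto_compose[OF tc(1) X2]) (use Xs Xa[OF gr(1) wv] in auto)
    have U1: "(%n. u1 (?x (Suc n) (j (Suc n)))) ----> u1 (X s w)"
     by (rule continuous_on_tendsto_compose[OF tc(2) X1]) (use Xs Xa[OF gr(1) wv] in auto)
    have U2: "(%n. u2 (?x (Suc n) (j (Suc n)))) ----> u2 (X s w)"
     by (rule continuous_on_tendsto_compose[OF tc(3) X1]) (use Xs Xa[OF gr(1) wv] in auto)
    have "(%n. c (Suc n) (j (Suc n)) s) ----> exp (A s w)*gen u u1 u2 s w"
     unfolding c_def gen_def by (intro tendsto_intros A1 U U1 U2)
    thus ?thesis using True by (simp add: jG)
   next
    case False
    hence "G (Suc n) s = 0" for n using Gd[of "Suc n" s] by (simp add: D_def)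
    thus ?thesis using False by simp
   qed
  qed
 qed (rule Di)
qed

text \<open>In \<open>dynkin_step\<close> the mesh tends to 0 for fixed \<open>eta\<close>, as the
  constant \<open>C\<close> depends on \<open>eta\<close>; only afterwards does \<open>eta\<close>
  tend to 0.\<close>

lemma dynkin:
 assumes tf: "test_fun a u u1 u2" and T: "0 < T"
 shows "(EE w. exp (A T w)*u (X T w))
  = u x + (EE w. ival 0 T (%s. exp (A s w)*gen u u1 u2 s w))"
  (is "?L = u x + (EE w. ?G w)")
proof -
 obtain C0 C1 C2 where Cu: "!!y. a <= y ==> abs (u y) <= C0" "!!y. a <= y ==> abs (u1 y) <= C1" "!!y. a <= y ==> abs (u2 y) <= C2"
  using tf unfolding test_fun_def by blast
 obtain wv where "wv \<in> space M" using not_empty by blast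
 define V where "V w = ival 0 T (%r. (be r w)^2)" for w
 let ?r = "%n. riemann u u1 u2 T (Suc n)"
 let ?M = "EE w. ?G w"
 let ?B = "%w. exp (Ka*T)*(Ka*C0*T + C1*(T + V w) + g^2 / 2*C2*K^2*T)"
 have Vi: "integrable M V" unfolding V_def using be2[OF T] .
 have good: "AE w in M. (%n. ?r n w) ----> ?G w \<and>
  (\<forall>n. abs (?r n w) <= ?B w)"
  using be_good[OF T] AE_space
 proof eventually_elim
  case (elim w)
  thus ?case using riemann_tendsto[OF tf T Cu, of w] unfolding V_def by blast
 qed
 have rint: "integrable M (?r n)" for n
 proof -
  obtain C where "C \<ge> 0" "\<forall>y b z. a <= y --> a <= y + b + z -->
   abs (u (y + b + z) - u y - u1 y*(b + z) - u2 y*z^2 / 2) <= 1*z^2 + C*(b^2 + z^4)"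
   using test_fun_remainder[OF tf, of 1] by auto
  thus ?thesis using dynkin_step(1)[OF tf T, of "Suc n" C0 C1 C2 1 C] Cu by auto
 qed
 have lim: "(%n. EE w. ?r n w) ----> ?M"
 proof (rule integral_dominated_convergence[where w = "%w. ?B w"])
  show "?G \<in> \<B> M" by (rule lborel.borel_measurable_lebesgue_integral[OF gen_joint[OF tf]])
  show "?r n \<in> \<B> M" for n using rint by blast
  show "integrable M (%w. ?B w)"
   using Vi by simp
  show "AE w in M. (%n. ?r n w) ----> ?G w" using good by eventually_elim simp
  show "AE w in M. norm (?r n w) <= ?B w" for n
   using good by eventually_elim simp
 qed
 have "abs (?L - u x - ?M) <= exp (Ka*T)*(eta*(g^2*K^2*T))" if e: "0 < eta" for eta
 proof -
  obtain C where C: "C \<ge> 0" "!!y b z. a <= y ==> a <= y + b + z ==>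
   abs (u (y + b + z) - u y - u1 y*(b + z) - u2 y*z^2 / 2) <= eta*z^2 + C*(b^2 + z^4)"
   using test_fun_remainder[OF tf e] by blast
  define W where "W = Ka^2*exp (Ka*T)*C0*T + C*(EE w. V w) + C*(3*g^4*K^4*T)"
  have b: "abs (?L - u x - (EE w. ?r n w)) <= exp (Ka*T)*(eta*(g^2*K^2*T) + T / real (Suc n)*W)" for n
   unfolding W_def V_def by (rule dynkin_step(2)[OF tf T]) (use Cu C e in auto)
  have l0: "(%n. T / real (Suc n)) ----> 0"
   using tendsto_mult[OF tendsto_const LIMSEQ_inverse_real_of_nat, of T] by (simp add: divide_inverse)
  have l1: "(%n. exp (Ka*T)*(eta*(g^2*K^2*T) + T / real (Suc n)*W)) ----> exp (Ka*T)*(eta*(g^2*K^2*T) + 0*W)"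
   by (intro tendsto_intros l0)
  have l2: "(%n. abs (?L - u x - (EE w. ?r n w))) ----> abs (?L - u x - ?M)"
   by (intro tendsto_intros lim)
  have "abs (?L - u x - ?M) <= exp (Ka*T)*(eta*(g^2*K^2*T) + 0*W)"
   by (rule LIMSEQ_le[OF l2 l1]) (use b in blast)
  thus ?thesis by simp
 qed
 note * = this
 have "abs (?L - u x - ?M) <= 0"
 proof (rule field_le_epsilon)
  fix d :: real assume d: "0 < d"
  define q where "q = exp (Ka*T)*(g^2*K^2*T)"
  have q: "0 <= q" using T by (simp add: q_def)
  have "abs (?L - u x - ?M) <= exp (Ka*T)*(d / (q + 1)*(g^2*K^2*T))"
   using *[of "d / (q + 1)"] d q by simp
  also have "... = d / (q + 1)*q" by (simp add: q_def)
  also have "... <= 0 + d" using d q by (simp add: field_simps)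
  finally show "abs (?L - u x - ?M) <= 0 + d" .
 qed
 thus ?thesis by simp
qed

end

text \<open>The hitting set is closed, so a finite infimum is attained, and by the intermediate
  value theorem the path stays above \<open>a\<close> before it.\<close>

lemma hit_time_cases [consumes 2, case_names never hit]:
 assumes c: "continuous_on {0..} f" and f0: "a <= f 0"
 obtains (never) "hit_time a f = \<infinity>" "!!s. 0 <= s ==> a < f s"
 | (hit) t where "0 <= t" "hit_time a f = ereal t" "f t = a" "!!s. 0 <= s ==> s < t ==> a < f s"
proof -
 let ?S = "{t. 0 <= t \<and> f t = a}"
 have above: "a < f s" if s: "0 <= s" and no: "!!r. 0 <= r ==> r <= s ==> f r \<noteq> a" for s
 proof (rule ccontr)
  assume "\<not> a < f s"
  hence "\<exists>r. 0 <= r \<and> r <= s \<and> f r = a"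
   using f0 s by (intro IVT2') (auto intro: continuous_on_subset[OF c])
  thus False using no by blast
 qed
 show thesis
 proof (cases "?S = {}")
  case True
  hence "hit_time a f = \<infinity>" unfolding hit_time_def by (simp only: True image_empty Inf_empty top_ereal_def)
  moreover have "a < f s" if "0 <= s" for s using above[OF that] True by blast
  ultimately show thesis by (rule never)
 next
  case False
  have "closed ?S"
  proof -
   have "closed {t \<in> {0..}. f t = a}" by (intro continuous_closed_preimage_constant c) simp
   thus ?thesis by (simp add: Collect_conj_eq)
  qed
  moreover have bb: "bdd_below ?S" by (intro bdd_belowI[of _ 0]) auto
  ultimately have I: "Inf ?S \<in> ?S" using False by (intro closed_contains_Inf) auto
  have le: "Inf ?S <= s" if "s \<in> ?S" for s using that bb by (rule cInf_lower)
  have h: "hit_time a f = ereal (Inf ?S)" unfolding hit_time_def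
  proof (rule antisym)
   show "Inf (ereal ` ?S) <= ereal (Inf ?S)" using I by (intro Inf_lower) auto
   show "ereal (Inf ?S) <= Inf (ereal ` ?S)" using le by (intro Inf_greatest) auto
  qed
  show thesis
  proof (rule hit[OF _ h])
   show "0 <= Inf ?S" "f (Inf ?S) = a" using I by auto
   fix s assume s: "0 <= s" "s < Inf ?S"
   show "a < f s" by (rule above[OF s(1)]) (use le s in force)
  qed
 qed
qed

text \<open>A continuous path that avoids \<open>a\<close> on a compact interval keeps a positive
  distance from it. Thus countably many conditions at rational times up to \<open>t\<close> decide
  the event, which places it in \<open>F t\<close>.\<close>

lemma hit_time_le_iff:
 assumes c: "continuous_on {0..} f" and f0: "a <= f 0" and t: "0 <= t"
 shows "hit_time a f <= ereal t \<longleftrightarrow> (\<forall>m. \<exists>r\<in>\<rat> \<inter> {0..t}. abs (f r - a) < 1 / real (Suc m))"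
proof -
 have minimum: "\<exists>s\<in>{0..t}. \<forall>r\<in>{0..t}. f s <= f r"
  by (rule continuous_attains_inf) (use t c in "auto intro: continuous_on_subset")
 show ?thesis using c f0
proof (cases rule: hit_time_cases)
 case never
 obtain s where s: "s \<in> {0..t}" "!!r. r \<in> {0..t} ==> f s <= f r" using minimum by blast
 have "0 < f s - a" using never(2) s by simp
 then obtain m where "1 / real (Suc m) < f s - a" using nat_approx_posE by blast
 hence "\<not> (\<exists>r\<in>\<rat> \<inter> {0..t}. abs (f r - a) < 1 / real (Suc m))" using s(2) by fastforce
 thus ?thesis using never(1) by auto
next
 case (hit q)
 show ?thesis
 proof
  assume "hit_time a f <= ereal t"
  hence q: "q \<in> {0..t}" using hit by auto
  show "\<forall>m. \<exists>r\<in>\<rat> \<inter> {0..t}. abs (f r - a) < 1 / real (Suc m)"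
  proof
   fix m
   obtain d where d: "0 < d" "!!r. r \<in> {0..} ==> dist r q < d ==> dist (f r) (f q) < 1 / real (Suc m)"
    using c q unfolding continuous_on_iff by (metis atLeastAtMost_iff atLeast_iff of_nat_0_less_iff zero_less_Suc zero_less_divide_1_iff)
   show "\<exists>r\<in>\<rat> \<inter> {0..t}. abs (f r - a) < 1 / real (Suc m)"
   proof (cases "t = 0")
    case True
    thus ?thesis using q hit(3) by (intro bexI[of _ 0]) auto
   next
    case False
    hence "max 0 (q - d) < min t (q + d)" using q d t by auto
    then obtain r where "r \<in> \<rat>" "max 0 (q - d) < r" "r < min t (q + d)" using Rats_dense_in_real by blast
    thus ?thesis using d(2)[of r] hit(3) by (intro bexI[of _ r]) (auto simp: dist_real_def abs_less_iff)
   qed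
  qed
 next
  assume R: "\<forall>m. \<exists>r\<in>\<rat> \<inter> {0..t}. abs (f r - a) < 1 / real (Suc m)"
  show "hit_time a f <= ereal t"
  proof (rule ccontr)
   assume "\<not> hit_time a f <= ereal t"
   hence tq: "t < q" using hit by auto
   obtain s where s: "s \<in> {0..t}" "!!r. r \<in> {0..t} ==> f s <= f r" using minimum by blast
   have "0 < f s - a" using hit(4) s tq by simp
   then obtain m where "1 / real (Suc m) < f s - a" using nat_approx_posE by blast
   hence "\<not> (\<exists>r\<in>\<rat> \<inter> {0..t}. abs (f r - a) < 1 / real (Suc m))" using s(2) by fastforce
   thus False using R by auto
  qed
 qed
qed
qed

lemma (in brownian) hit_le_measurable:
 assumes W: "!!t. 0 <= t ==> W t \<in> \<B> (F t)"
  and Wc: "!!w. w \<in> space M ==> continuous_on {0..} (%t. W t w)"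
  and W0: "!!w. w \<in> space M ==> a <= W 0 w" and t: "0 <= t"
 shows "{w \<in> space M. hit_time a (%s. W s w) <= ereal t} \<in> sets (F t)"
proof -
 have "{w \<in> space M. hit_time a (%s. W s w) <= ereal t} = {w \<in> space (F t). \<forall>m. \<exists>r\<in>\<rat> \<inter> {0..t}. abs (W r w - a) < 1 / real (Suc m)}"
  using Wc W0 t by (auto simp: hit_time_le_iff)
 also have "... \<in> sets (F t)"
 proof (intro sets.sets_Collect_countable_All sets.sets_Collect_countable_Ex')
  show "countable (\<rat> \<inter> {0..t})" by (rule countable_subset[OF _ countable_rat]) auto
  fix m q assume "q \<in> \<rat> \<inter> {0..t}"
  hence [measurable]: "W q \<in> \<B> (F t)" using W meas_mono[of q t] by auto
  show "{w \<in> space (F t). abs (W q w - a) < 1 / real (Suc m)} \<in> sets (F t)" by measurable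
 qed
 finally show ?thesis .
qed

section \<open>Absorbed wealth and the exponential clock\<close>

text \<open>The bound on \<open>p\<close> is asked up to the hitting time only, because later the
  path is arbitrary and a feedback would be evaluated outside \<open>{a..}\<close>.\<close>

locale wealth = brownian M F B for M :: "'w measure" and F B +
 fixes mu r sig a lam rho M1 L :: real and e l :: "real => real" and n :: nat and x :: real
  and p W I :: "real => 'w => real"
 assumes par: "r < mu" "0 < sig" "0 < a" "0 < lam" "0 < rho" "0 < n" "a <= x"
  and eL: "L-lipschitz_on {a..} e" and lc: "continuous_on {a..} l"
  and l0: "!!y. a <= y ==> 0 <= l y" and l1: "!!y. a <= y ==> l y <= l a" and l2: "l a < lam"
  and Wad: "adapted F W" and W0: "!!w. w \<in> space M ==> W 0 w = x"
  and Wc: "!!w. w \<in> space M ==> continuous_on {0..} (%t. W t w)"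
  and Wito: "ito_integral M F B (%t w. if ereal t <= hit_time a (%s. W s w) then p t w else 0) I"
  and pb: "!!t w. 0 <= t ==> w \<in> space M ==> ereal t <= hit_time a (%s. W s w) ==> abs (p t w) <= M1"
  and Weq: "AE w in M. \<forall>t\<ge>0. ereal t <= hit_time a (%s. W s w) -->
      W t w = x + (LBINT s:{0..t}. - e (W s w) + (mu - r)*p s w)
           + 1 / sqrt (real n) * sig*I t w"
begin

definition tau :: "'w => ereal" where "tau w = hit_time a (%s. W s w)"

definition H :: "real => 'w => real" where
 "H t w = (if ereal t <= tau w then p t w else 0)"


text \<open>The wealth absorbed at \<open>a\<close>. It stays in \<open>{a..}\<close>, where
  \<open>e\<close>, \<open>l\<close> and the test functions make sense, and the cost depends on
  \<open>W\<close> only through it.\<close>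

definition X :: "real => 'w => real" where
 "X t w = (if tau w <= ereal t then a else W t w)"

lemma ito: "ito_integral M F B H I"
 using Wito unfolding H_def[abs_def] tau_def .

lemma tau_cases [consumes 1, case_names never hit]:
 assumes "w \<in> space M"
 obtains (never) "tau w = \<infinity>" "!!s. 0 <= s ==> X s w = W s w \<and> a < W s w"
 | (hit) t where "0 <= t" "tau w = ereal t" "W t w = a" "!!s. 0 <= s ==> s < t ==> X s w = W s w \<and> a < W s w"
  "!!s. t <= s ==> X s w = a"
proof -
 have "a <= W 0 w" using W0[OF assms] par(7) by simp
 with Wc[OF assms] show thesis
 proof (cases rule: hit_time_cases)
  case never
  show thesis by (rule that(1)) (use never in "auto simp: X_def tau_def")
 next
  case (hit t)
  show thesis by (rule that(2)[OF hit(1)]) (use hit in "auto simp: X_def tau_def")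
 qed
qed

lemma tau_le_measurable:
 assumes "0 <= t"
 shows "{w \<in> space M. tau w <= ereal t} \<in> sets (F t)" unfolding tau_def
 by (rule hit_le_measurable) (use Wad Wc W0 par(7) assms in "auto simp: adapted_def")

lemma Xm:
 assumes "0 <= t"
 shows "X t \<in> \<B> (F t)" unfolding X_def
proof (rule measurable_If)
 show "W t \<in> \<B> (F t)" using Wad assms by (auto simp: adapted_def)
 show "{w \<in> space (F t). tau w <= ereal t} \<in> sets (F t)" using tau_le_measurable[OF assms] by simp
qed simp

lemma X_cases:
 assumes "w \<in> space M" "0 <= t"
 shows "tau w <= ereal t \<and> X t w = a \<or> ereal t < tau w \<and> X t w = W t w \<and> a < X t w"
 using assms(1)
proof (cases rule: tau_cases)
 case never
 thus ?thesis using assms(2) by auto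
next
 case (hit s)
 thus ?thesis using assms(2) by (cases "t < s") auto
qed

lemma X_eq_a_iff: "w \<in> space M ==> 0 <= t ==> X t w = a \<longleftrightarrow> tau w <= ereal t"
 using X_cases[of w t] by auto

lemma Xa:
 assumes "0 <= t" "w \<in> space M"
 shows "a <= X t w" using X_cases[OF assms(2,1)] by auto

lemma Xc:
 assumes "w \<in> space M"
 shows "continuous_on {0..} (%t. X t w)" using assms
proof (cases rule: tau_cases)
 case never
 thus ?thesis using Wc[OF assms] by (subst continuous_on_cong[OF refl, of _ _ "%t. W t w"]) auto
next
 case (hit t)
 have "continuous_on {0..} (%s. W (min s t) w)"
  by (rule continuous_on_compose2[OF Wc[OF assms]]) (use hit(1) in "auto intro!: continuous_on_min")
 moreover have "X s w = W (min s t) w" if "0 <= s" for s using hit that by (cases "s < t") auto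
 ultimately show ?thesis by (subst continuous_on_cong[OF refl, of _ _ "%s. W (min s t) w"]) auto
qed

lemma X0:
 assumes "w \<in> space M"
 shows "X 0 w = x" using assms
proof (cases rule: tau_cases)
 case never
 thus ?thesis using W0[OF assms] by simp
next
 case (hit s)
 thus ?thesis using W0[OF assms] by (cases "0 < s") auto
qed

lemma HK: "0 <= t ==> w \<in> space M ==> abs (H t w) <= M1"
proof -
 assume t: "0 <= t" "w \<in> space M"
 have "0 <= hit_time a (%s. W s w)" unfolding hit_time_def by (intro Inf_greatest) auto
 hence "0 <= M1" using pb[of 0 w] t by (simp add: zero_ereal_def)
 thus ?thesis using pb[OF t] by (auto simp: H_def tau_def)
qed

end

lemma lborel_integral_continuous:
 fixes f :: "real => real"
 assumes "continuous_on {0..} f" "0 <= s"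
 shows "iable s t (%r. f r)"
  "s <= t ==> (ival s t (%r. f r)) = integral {s..t} f"
proof -
 have c: "continuous_on {s..t} f" using assms by (auto intro: continuous_on_subset)
 have i: "set_integrable lborel {s..t} f" by (rule borel_integrable_atLeastAtMost') (rule c)
 have ae: "AE r in lborel. indicat_real {s..t} r*f r = indicator {s<..t} r*f r"
  using AE_lborel_singleton[of s] by eventually_elim (auto simp: indicator_def)
 show i2: "iable s t (%r. f r)"
 proof -
  have "{s<..t} \<subseteq> {s..t}" by (intro subsetI) simp
  hence "set_integrable lborel {s<..t} f" by (intro set_integrable_subset[OF i]) simp
  thus ?thesis by (simp add: set_integrable_def)
 qed
 have "ival s t (%r. f r) = (LBINT r:{s..t}. f r)" unfolding set_lebesgue_integral_def using ae i2 i
  by (intro integral_cong_AE) (auto simp: set_integrable_def elim!: eventually_mono)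
 thus "ival s t (%r. f r) = integral {s..t} f" using set_borel_integral_eq_integral(2)[OF i] by simp
qed

text \<open>Gronwall with the integrating factor \<open>exp (- L * t)\<close>, for the integral of
  \<open>f\<close> rather than for \<open>f\<close>: the forcing \<open>q\<close> will contain a
  path of the noise, which is controlled in mean and through integrals only.\<close>

lemma gronwall_integral:
 fixes f q :: "real => real"
 assumes f: "continuous_on {0..} f" and q: "continuous_on {0..} q"
  and q0: "!!t. 0 <= t ==> 0 <= q t" and L: "0 <= L"
  and le: "!!t. 0 <= t ==> f t <= q t + L*integral {0..t} f" and T: "0 <= T"
 shows "integral {0..T} f <= exp (L*T)*integral {0..T} q"
proof (cases "T = 0")
 case True
 thus ?thesis by simp
next
 case False
 with T have T': "0 < T" by simp
 let ?G = "%t. exp (- L*t)*integral {0..t} f - integral {0..t} q"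
 have cf: "continuous_on {0..T} f" "continuous_on {0..T} q" using f q by (auto intro: continuous_on_subset)
 have "?G T <= ?G 0"
 proof (rule DERIV_nonpos_imp_decreasing_open[OF T])
  fix t assume t: "0 < t" "t < T"
  have at: "at t within {0..T} = at t" using t by (intro at_within_interior) auto
  have d: "((%t. integral {0..t} f) has_real_derivative f t) (at t)" "((%t. integral {0..t} q) has_real_derivative q t) (at t)"
   using integral_has_real_derivative[OF cf(1), of t] integral_has_real_derivative[OF cf(2), of t] t by (auto simp: at)
  have "(?G has_real_derivative (exp (- L*t)*f t - L*exp (- L*t)*integral {0..t} f - q t)) (at t)"
   by (auto intro!: derivative_eq_intros d)
  moreover have "exp (- L*t)*f t - L*exp (- L*t)*integral {0..t} f - q t <= 0"
  proof -
   have "exp (- L*t)*(f t - L*integral {0..t} f) <= exp (- L*t)*q t"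
    using le[of t] t by (intro mult_left_mono) auto
   also have "... <= 1*q t" using t L q0[of t] by (intro mult_right_mono) auto
   finally show ?thesis by (simp add: algebra_simps)
  qed
  ultimately show "\<exists>y. (?G has_real_derivative y) (at t) \<and> y <= 0" by blast
 next
  show "continuous_on {0..T} ?G"
   by (intro continuous_intros indefinite_integral_continuous_1 integrable_continuous_interval cf)
 qed
 hence "exp (- L*T)*integral {0..T} f <= integral {0..T} q" by simp
 hence "exp (L*T)*(exp (- L*T)*integral {0..T} f) <= exp (L*T)*integral {0..T} q"
  by (rule mult_left_mono) simp
 thus ?thesis by (simp add: mult.assoc[symmetric] exp_add[symmetric])
qed

lemma sum3_square_le: "(x + y + z)^2 <= 3*x^2 + 3*y^2 + 3*z^2" for x y z :: real
proof -
 have "0 <= (x - y)^2 + (x - z)^2 + (y - z)^2" by simp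
 thus ?thesis by (simp add: power2_eq_square algebra_simps)
qed

context wealth
begin

lemma IM: "0 <= t ==> I t \<in> \<B> M"
 using ito_meas[OF ito _ order_refl] meas_M by blast

lemma Ic: "w \<in> space M ==> continuous_on {0..} (%t. I t w)"
 using ito by (auto simp: ito_integral_def)

lemma gpos: "0 < 1 / sqrt (real n) * sig" using par by simp

lemma I_var:
 assumes "0 <= s" "s <= t"
 shows "(EE w. (I t w - I s w)^2) <= M1^2*(t - s)" (is ?th1) "integrable M (%w. (I t w - I s w)^2)" (is ?th2)
proof -
 show ?th2 by (rule ito_square_integrable[OF ito HK]) (use assms in auto)
 have "(EE w. 1*(I t w - I s w)^2) = (EE w. 1*ival s t (%r. (H r w)^2))"
  by (rule ito_variance[OF ito HK, where c = 1]) (use assms in auto)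
 also have "... <= (EE w. M1^2*(t - s))"
 proof (rule integral_mono')
  fix w assume wv: "w \<in> space M"
  have "ival s t (%r. (H r w)^2) <= ival s t (%r. M1^2)"
  proof (rule integral_mono')
   show "iable s t (%r. M1^2)" using assms by (intro integrable_mult_left integrable_real_indicator) auto
   show "indicat_real {s<..t} r*(H r w)^2 <= indicator {s<..t} r*M1^2" for r
    using HK[of r w] assms wv by (auto simp: indicator_def abs_le_square_iff[symmetric])
  qed auto
  thus "1*ival s t (%r. (H r w)^2) <= M1^2*(t - s)" using assms by (simp add: mult.commute)
 qed (use assms in auto)
 finally show ?th1 by (simp add: prob_space)
qed

text \<open>Read off from the wealth equation at time 0, where the drift is integrated over a single
  point.\<close>

lemma I_0: "AE w in M. I 0 w = 0"
 using Weq AE_space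
proof eventually_elim
 case (elim w)
 have "0 <= hit_time a (%s. W s w)" unfolding hit_time_def by (intro Inf_greatest) auto
 hence "W 0 w = x + (LBINT s:{0..0}. - e (W s w) + (mu - r)*p s w) + 1 / sqrt (real n) * sig*I 0 w"
  using elim(1) by (auto simp: zero_ereal_def)
 moreover have "(LBINT s:{0..0}. - e (W s w) + (mu - r)*p s w) = 0"
 proof -
  have "AE s in lborel. indicat_real {0..0} s *\<^sub>R (- e (W s w) + (mu - r)*p s w) = 0"
   using AE_lborel_singleton[of "0::real"] by eventually_elim auto
  thus ?thesis unfolding set_lebesgue_integral_def by (rule integral_eq_zero_AE)
 qed
 ultimately show ?case using W0[OF elim(2)] gpos par(2,6) by auto
qed

text \<open>On the event that \<open>a\<close> has been hit by time \<open>s\<close> the integrand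
  vanishes after \<open>s\<close>, so the variance formula weighted with its indicator forces the
  increment to be 0 almost surely. Rational times and continuity of the paths then give one null set
  for all times.\<close>

lemma I_const: "AE w in M. \<forall>s t. 0 <= s --> s <= t --> tau w <= ereal s --> I t w = I s w"
proof -
 have step: "AE w in M. tau w <= ereal s --> I t w = I s w" if st: "0 <= s" "s <= t" for s t
 proof -
  let ?A = "{w \<in> space M. tau w <= ereal s}"
  let ?Z = "indicat_real ?A"
  have Z: "?Z \<in> \<B> (F s)" using tau_le_measurable[OF st(1)] by simp
  have ZM: "?Z \<in> \<B> M" using Z meas_M by blast
  have "(EE w. ?Z w*(I t w - I s w)^2) = (EE w. ?Z w*ival s t (%r. (H r w)^2))"
   by (rule ito_variance[OF ito HK _ _ Z, where c = 1]) (use st in auto)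
  also have "... = 0"
  proof (rule integral_eq_zero_AE, rule AE_I2)
   fix w assume "w \<in> space M"
   have "indicator {s<..t} r*(H r w)^2 = 0" if "tau w <= ereal s" for r
   proof (cases "s < r")
    case True
    hence "\<not> ereal r <= tau w" using that by (metis ereal_less(1) ereal_less_eq(3) leD order_trans less_ereal.simps(1))
    thus ?thesis by (simp add: H_def)
   qed simp
   hence "ival s t (%r. (H r w)^2) = 0" if "tau w <= ereal s"
    using that by (simp only: Bochner_Integration.integral_zero)
   thus "?Z w*ival s t (%r. (H r w)^2) = 0" by (simp add: indicator_def del: mult_eq_0_iff)
  qed
  finally have z: "(EE w. ?Z w*(I t w - I s w)^2) = 0" .
  have i: "integrable M (%w. ?Z w*(I t w - I s w)^2)"
   by (rule integrable_bounded_mult[OF I_var(2)[OF st] ZM, where c = 1]) auto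
  have "AE w in M. ?Z w*(I t w - I s w)^2 = 0" using integral_nonneg_eq_0_iff_AE[OF i] z by simp
  thus ?thesis using AE_space by eventually_elim (auto simp: indicator_def split: if_splits)
 qed
 have "AE w in M. \<forall>s\<in>\<rat>. \<forall>t\<in>\<rat>. 0 <= s --> s <= t --> tau w <= ereal s --> I t w = I s w"
  by (intro AE_ball_countable[THEN iffD2] ballI countable_rat) (use step in "auto intro: AE_impI")
 thus ?thesis using AE_space
 proof eventually_elim
  case (elim w)
  show ?case
  proof (intro allI impI)
   fix s t :: real assume st: "0 <= s" "s <= t" "tau w <= ereal s"
   \<comment> \<open>Equality is known between rational times only, and \<open>s\<close> may be
     irrational; the rationals beyond \<open>s\<close> are dense in \<open>{s..}\<close>, and
     continuity extends the constancy to \<open>s\<close>.\<close>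
   define S where "S = \<rat> \<inter> {s<..}"
   have sub: "closure S \<subseteq> {s..}" by (rule closure_minimal) (auto simp: S_def)
   have cl: "r \<in> closure S" if "s <= r" for r unfolding closure_approachable
   proof (intro allI impI)
    fix d :: real assume "0 < d"
    then obtain q where "q \<in> \<rat>" "r < q" "q < r + d" using Rats_dense_in_real[of r "r + d"] by auto
    thus "\<exists>y\<in>S. dist y r < d" using that by (intro bexI[of _ q]) (auto simp: S_def dist_real_def)
   qed
   obtain q0 where "q0 \<in> \<rat>" "s < q0" using Rats_dense_in_real[of s "s + 1"] by auto
   hence q0: "q0 \<in> S" by (simp add: S_def)
   have eq: "I q w = I q0 w" if "q \<in> S" for q
   proof -
    have le: "tau w <= ereal y" if "y \<in> S" for y
     using st(3) that by (rule_tac order_trans) (auto simp: S_def)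
    have S: "y \<in> \<rat> \<and> 0 <= y" if "y \<in> S" for y using that st(1) by (auto simp: S_def)
    show ?thesis
    proof (cases "q <= q0")
     case True
     thus ?thesis using elim(1) le[OF that] S[OF that] S[OF q0] by metis
    next
     case False
     hence "q0 <= q" by simp
     thus ?thesis using elim(1) le[OF q0] S[OF that] S[OF q0] by metis
    qed
   qed
   have c: "continuous_on (closure S) (%t. I t w)"
    by (rule continuous_on_subset[OF Ic[OF elim(2)]]) (use sub st(1) in auto)
   have "I r w = I q0 w" if "s <= r" for r
    by (rule continuous_constant_on_closure[OF c _ cl[OF that]]) (rule eq)
   thus "I t w = I s w" using st by simp
  qed
 qed
qed

end

context wealth
begin

definition gg :: real where "gg = 1 / sqrt (real n) * sig"

text \<open>Drift of the absorbed wealth: after absorption the first term is switched off explicitly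
  and the second because \<open>H\<close> vanishes. \<open>max 0 s\<close> and the indicator define
  it for all real \<open>s\<close>, which keeps it jointly measurable on the whole line.\<close>

definition be :: "real => 'w => real" where
 "be s w = (if a < X (max 0 s) w then - e (X (max 0 s) w) else 0) + (mu - r)*(indicator {0..} s*H s w)"

text \<open>After absorption the running reward ends but the clock keeps running, so the rate drops
  to \<open>- n lam\<close>. Integrating out the clock thereby becomes killing on the whole
  half-line.\<close>

definition al :: "real => 'w => real" where
 "al s w = real n*((if a < X (max 0 s) w then l (X (max 0 s) w) else 0) - lam)"

definition A :: "real => 'w => real" where
 "A t w = ival 0 t (%s. al s w)"

definition bc :: real where "bc = abs (e a) + (mu - r)*M1"

text \<open>The constant that the Gronwall estimate in \<open>be_moment\<close> produces. It
  involves the data of the model only, not the process or the probability space, so that a mesh can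
  be chosen from it in advance.\<close>

definition be_bound :: "real => real" where
 "be_bound T = 3*bc^2*T + (3*L^2 + 3*(L^2*exp (L*T))^2*T^2)*(T*(3*x^2 + 3*(bc*T)^2) + 3*gg^2*(M1^2*T^2))"

lemma L0: "0 <= L" using eL by (rule lipschitz_on_nonneg)

lemma M1_nonneg: "0 <= M1"
proof -
 obtain wv where "wv \<in> space M" using not_empty by blast
 thus ?thesis using HK[of 0 wv] by (auto intro: order_trans[OF abs_ge_zero])
qed

lemma bc0: "0 <= bc" using M1_nonneg par by (simp add: bc_def)

lemma e_cont: "continuous_on {a..} e" using eL by (rule lipschitz_on_continuous_on)

lemma e_bound: "a <= y ==> abs (e y) <= abs (e a) + L*y"
proof -
 assume y: "a <= y"
 have "abs (e y - e a) <= L*(y - a)" using lipschitz_onD[OF eL, of y a] y by (simp add: dist_real_def)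
 also have "... <= L*y" using L0 par by (intro mult_left_mono) auto
 finally show ?thesis by linarith
qed

lemma XM: "0 <= t ==> X t \<in> \<B> M" using Xm meas_M by blast

lemma X_joint_gen:
 fixes c :: "real => real"
 assumes "!!t. (%w. X (max 0 (c t)) w) \<in> \<B> N" "space N = space M" "continuous_on UNIV c"
 shows "(%x. X (max 0 (c (snd x))) (fst x)) \<in> \<B> (N \<Otimes>\<^sub>M lborel)"
proof -
 have "(%(w, t). X (max 0 (c t)) w) \<in> \<B> (N \<Otimes>\<^sub>M lborel)"
 proof (rule continuous_joint_measurable[where Y = "%t w. X (max 0 (c t)) w", OF assms(1)])
  fix w assume "w \<in> space N"
  hence "continuous_on {0..} (%t. X t w)" using Xc assms(2) by simp
  thus "continuous_on UNIV (%t. X (max 0 (c t)) w)"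
   by (rule continuous_on_compose2) (auto intro!: continuous_on_max assms(3))
 qed
 thus ?thesis by (simp add: case_prod_beta')
qed

lemma X_joint [measurable]: "(%x. X (max 0 (snd x)) (fst x)) \<in> \<B> MT"
 by (rule X_joint_gen[of "%x. x"]) (auto intro: XM)

lemma f_joint:
 fixes f :: "real => real"
 assumes "continuous_on {a..} f"
 shows "(%x. f (X (max 0 (snd x)) (fst x))) \<in> \<B> MT"
 by (rule borel_measurable_continuous_on_ge[OF assms X_joint]) (auto simp: space_pair_measure intro!: Xa)

lemma H_joint [measurable]: "(%x. indicator {0..} (snd x)*H (snd x) (fst x)) \<in> \<B> MT"
 using measurable_compose[OF measurable_pair_swap' ito_joint[OF ito]]
 by (simp add: case_prod_beta' cong: measurable_cong_sets)

lemma be_joint: "(%(w, s). be s w) \<in> \<B> MT"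
 using f_joint[OF e_cont] unfolding be_def case_prod_beta' by measurable

lemma al_joint: "(%(w, s). al s w) \<in> \<B> MT"
 using f_joint[OF lc] unfolding al_def case_prod_beta' by measurable

lemma al_bounds:
 assumes "w \<in> space M"
 shows "abs (al s w) <= real n*lam" "al s w <= - real n*(lam - l a)" (is ?th1)
proof -
 have X: "a <= X (max 0 s) w" using Xa assms by simp
 let ?q = "(if a < X (max 0 s) w then l (X (max 0 s) w) else 0) - lam"
 have q: "- lam <= ?q" "?q <= - (lam - l a)" using l0[OF X] l1[OF X] l0[of a] by auto
 thus ?th1 unfolding al_def using mult_left_mono[OF q(2) of_nat_0_le_iff, of n]
  by (simp only: mult_minus_left mult_minus_right)
 have "abs (?q) <= lam" using q l2 by auto
 thus "abs (al s w) <= real n*lam" unfolding al_def abs_mult by (intro mult_mono) auto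
qed

text \<open>Evaluating the integrand at \<open>min t s\<close> lets only values of \<open>X\<close>
  up to time \<open>t\<close> enter, and changes nothing on \<open>(0, t]\<close>.\<close>

lemma Am:
 assumes t: "0 <= t"
 shows "A t \<in> \<B> (F t)"
proof -
 let ?Y = "%x. X (max 0 (min t (snd x))) (fst x)"
 let ?f = "%s w. real n*((if a < X (max 0 (min t s)) w then l (X (max 0 (min t s)) w) else 0) - lam)"
 have Y: "?Y \<in> \<B> (F t \<Otimes>\<^sub>M lborel)"
 proof (rule X_joint_gen)
  show "X (max 0 (min t s)) \<in> \<B> (F t)" for s by (rule meas_mono[OF _ Xm]) (use t in auto)
 qed (auto intro!: continuous_on_min)
 note [measurable] = Y
 have [measurable]: "(%x. l (?Y x)) \<in> \<B> (F t \<Otimes>\<^sub>M lborel)"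
  by (rule borel_measurable_continuous_on_ge[OF lc Y]) (auto simp: space_pair_measure intro!: Xa)
 have "(%(w, s). indicator {0<..t} s*(?f s w))
  \<in> \<B> (F t \<Otimes>\<^sub>M lborel)" unfolding case_prod_beta' by measurable
 hence "(%w. ival 0 t (%s. ?f s w)) \<in> \<B> (F t)"
  by (rule lborel.borel_measurable_lebesgue_integral)
 moreover have "indicator {0<..t} s*(?f s w) = indicator {0<..t} s*al s w" for s w
  by (auto simp: indicator_def al_def min_def)
 ultimately show ?thesis unfolding A_def[abs_def] by simp
qed

text \<open>Up to the hitting time this is the wealth equation; afterwards the drift is 0 and
  \<open>I\<close> is constant by \<open>I_const\<close>.\<close>

lemma Xeq: "AE w in M. \<forall>t\<ge>0. X t w = x + ival 0 t (%s. be s w) + gg*I t w"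
 using Weq I_const AE_space
proof eventually_elim
 case (elim w)
 have XW: "X t w = W t w" if "0 <= t" "ereal t <= tau w" for t
  using elim(3) by (cases rule: tau_cases) (use that in "auto, metis le_less")
 have XW': "X t w = W t w \<and> a < X t w" if "0 <= t" "ereal t < tau w" for t
  using X_cases[OF elim(3) that(1)] that(2) by auto
 have bes: "(%s. be s w) \<in> \<B> lborel"
  using measurable_compose[OF measurable_Pair1'[OF elim(3)] be_joint] by simp
 have Xs: "(%s. e (X (max 0 s) w)) \<in> \<B> lborel" "(%s. indicator {0..} s*H s w) \<in> \<B> lborel"
  using measurable_compose[OF measurable_Pair1'[OF elim(3)] f_joint[OF e_cont]]
   measurable_compose[OF measurable_Pair1'[OF elim(3)] H_joint] by auto
 have 1: "X t w = x + ival 0 t (%s. be s w) + gg*I t w" if t: "0 <= t" "ereal t <= tau w" for t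
 proof -
  have "(LBINT s:{0..t}. - e (W s w) + (mu - r)*p s w)
   = (\<integral>s. indicator {0..t} s*(- e (X (max 0 s) w) + (mu - r)*(indicator {0..} s*H s w)) \<partial>lborel)"
   unfolding set_lebesgue_integral_def
  proof (rule lint_cong[OF refl])
   fix s
   show "indicat_real {0..t} s *\<^sub>R (- e (W s w) + (mu - r)*p s w) = indicator {0..t} s*(- e (X (max 0 s) w) + (mu - r)*(indicator {0..} s*H s w))"
   proof (cases "s \<in> {0..t}")
    case True
    hence "ereal s <= tau w" using t(2) by (auto intro: order_trans[of _ "ereal t"])
    thus ?thesis using XW[of s] True by (simp add: H_def)
   qed simp
  qed
  also have "... = ival 0 t (%s. be s w)"
  proof (rule integral_cong_AE)
   show "AE s in lborel. indicat_real {0..t} s*(- e (X (max 0 s) w) + (mu - r)*(indicat_real {0..} s*H s w)) = indicator {0<..t} s*be s w"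
    using AE_lborel_singleton[of "0::real"] AE_lborel_singleton[of t]
   proof eventually_elim
    case (elim s)
    show ?case
    proof (cases "0 < s \<and> s < t")
     case True
     hence "ereal s < tau w" using t(2) by (auto intro: less_le_trans[of _ "ereal t"])
     thus ?thesis using XW'[of s] True by (simp add: be_def)
    qed (use elim in "auto simp: indicator_def")
   qed
   show "(%s. indicat_real {0..t} s*(- e (X (max 0 s) w) + (mu - r)*(indicat_real {0..} s*H s w))) \<in> \<B> lborel"
    using Xs by measurable
   show "(%s. indicator {0<..t} s*be s w) \<in> \<B> lborel" using bes by measurable
  qed
  finally show ?thesis using elim(1) t XW[OF t] by (simp add: tau_def gg_def)
 qed
 show ?case
 proof (intro allI impI)
  fix t :: real assume t: "0 <= t"
  show "X t w = x + ival 0 t (%s. be s w) + gg*I t w"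
  proof (cases "ereal t <= tau w")
   case True
   thus ?thesis using 1 t by simp
  next
   case False
   with elim(3) obtain s where s: "0 <= s" "tau w = ereal s" "s < t" by (cases rule: tau_cases) auto
   have Xa: "X q w = a" if "s <= q" for q using that s by (simp add: X_def)
   have "indicator {0<..t} q*be q w = indicator {0<..s} q*be q w" for q
    using Xa[of q] s by (auto simp: indicator_def be_def H_def)
   hence "ival 0 t (%q. be q w) = ival 0 s (%q. be q w)" by (simp only:)
   moreover have "I t w = I s w" by (rule elim(2)[rule_format]) (use s in auto)
   ultimately show ?thesis using 1[of s] s Xa[of s] Xa[of t] by simp
  qed
 qed
qed

lemma be_le: "w \<in> space M ==> 0 <= s ==> abs (be s w) <= bc + L*X s w"
proof -
 assume wv: "w \<in> space M" "0 <= s"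
 have X: "a <= X s w" using Xa wv by simp
 have "abs (if a < X s w then - e (X s w) else 0) <= abs (e a) + L*X s w"
  using e_bound[OF X] by (auto intro: order_trans[OF abs_ge_zero])
 moreover have "abs ((mu - r)*H s w) <= (mu - r)*M1"
  unfolding abs_mult using HK[OF wv(2,1)] par by (intro mult_mono) auto
 ultimately show ?thesis unfolding be_def bc_def using wv(2) by (simp add: max_absorb2)
qed

lemma be_sq_int:
 assumes wv: "w \<in> space M" and T: "0 < T"
 shows "iable 0 T (%s. (be s w)^2)"
proof (rule int_bound)
 show "iable 0 T (%s. (bc + L*X s w)^2)" by (intro lborel_integral_continuous continuous_intros Xc wv) simp
 have "(%s. be s w) \<in> \<B> lborel" using measurable_compose[OF measurable_Pair1'[OF wv] be_joint] by simp
 thus "(%s. indicator {0<..T} s*(be s w)^2) \<in> \<B> lborel" by measurable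
 show "AE s in lborel. norm (indicator {0<..T} s*(be s w)^2) <= norm (indicator {0<..T} s*(bc + L*X s w)^2)"
 proof (rule AE_I2)
  fix s
  have "(be s w)^2 <= (bc + L*X s w)^2" if "0 < s"
  proof -
   have "abs (be s w) <= abs (bc + L*X s w)" using be_le[OF wv, of s] that by linarith
   thus ?thesis by (simp add: abs_le_square_iff)
  qed
  thus "norm (indicator {0<..T} s*(be s w)^2) <= norm (indicator {0<..T} s*(bc + L*X s w)^2)"
   by (simp add: indicator_def)
 qed
qed

text \<open>Tonelli exchanges mean and time integral, and at each time the variance bound applies
  because \<open>I\<close> starts at 0.\<close>

lemma I_sq:
 assumes T: "0 < T"
 shows "integrable M (%w. ival 0 T (%s. (I s w)^2))" (is ?th1)
  "(EE w. ival 0 T (%s. (I s w)^2)) <= M1^2*T^2" (is ?th2)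
proof -
 interpret P: pair_sigma_finite M lborel ..
 let ?h = "%(w, s). indicator {0<..T} s*(I s w)^2"
 have "(%(w, s). I (max 0 s) w) \<in> \<B> MT"
  by (rule continuous_joint_measurable[OF IM continuous_on_compose2[OF Ic]]) (auto intro!: continuous_on_max)
 hence [measurable]: "(%x. I (max 0 (snd x)) (fst x)) \<in> \<B> MT" by (simp add: case_prod_beta')
 have "(%x. indicator {0<..T} (snd x)*(I (max 0 (snd x)) (fst x))^2) \<in> \<B> MT" by measurable
 hence hm: "?h \<in> \<B> MT" by (rule measurable_cong[THEN iffD1, rotated]) (auto simp: indicator_def)
 have sec: "(NN w. ennreal (?h (w, s))) <= ennreal (M1^2*T)*indicator {0<..T} s" for s
 proof (cases "s \<in> {0<..T}")
  case True
  have "(NN w. ennreal (?h (w, s))) = (NN w. ennreal ((I s w - I 0 w)^2))"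
   using True I_0 by (intro nn_integral_cong_AE) (auto elim!: eventually_mono)
  also have "... = ennreal (EE w. (I s w - I 0 w)^2)" using True by (intro nn_integral_eq_integral I_var) auto
  also have "... <= ennreal (M1^2*T)"
  proof (rule ennreal_leI)
   have "(EE w. (I s w - I 0 w)^2) <= M1^2*(s - 0)" using True by (intro I_var) auto
   also have "... <= M1^2*T" using True by (intro mult_left_mono) auto
   finally show "(EE w. (I s w - I 0 w)^2) <= M1^2*T" .
  qed
  finally show ?thesis using True by simp
 qed simp
 have "(\<integral>\<^sup>+z. ennreal (?h z) \<partial>MT) = (\<integral>\<^sup>+s. (NN w. ennreal (?h (w, s))) \<partial>lborel)"
  using hm by (subst P.nn_integral_snd[symmetric]) auto
 also have "... <= (\<integral>\<^sup>+s. ennreal (M1^2*T)*indicator {0<..T} s \<partial>lborel)"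
  by (intro nn_integral_mono sec)
 also have "... = ennreal (M1^2*T)*ennreal T" using T by (subst nn_integral_cmult_indicator) auto
 also have "... = ennreal (M1^2*T*T)" by (rule ennreal_mult[symmetric]) (use T in auto)
 also have "M1^2*T*T = M1^2*T^2" by (simp add: power2_eq_square)
 finally have fin: "(\<integral>\<^sup>+z. ennreal (?h z) \<partial>MT) <= ennreal (M1^2*T^2)" .
 have hi: "integrable MT ?h"
  by (rule integrableI_nonneg[OF hm]) (use fin in "auto intro: le_less_trans[OF _ ennreal_less_top]")
 show ?th1 using P.integrable_fst'[OF hi] by simp
 have "(EE w. ival 0 T (%s. (I s w)^2)) = (\<integral>z. ?h z \<partial>MT)"
  using P.integral_fst'[OF hi] by simp
 also have "... <= M1^2*T^2"
 proof -
  have "ennreal (\<integral>z. ?h z \<partial>MT) <= ennreal (M1^2*T^2)"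
   using fin nn_integral_eq_integral[OF hi] by (auto simp: case_prod_beta')
  thus ?thesis using T by (subst (asm) ennreal_le_iff) auto
 qed
 finally show ?th2 .
qed

text \<open>Pathwise \<open>abs be <= bc + L X\<close>, and Gronwall bounds \<open>X\<close> through
  the forcing \<open>q\<close>, which contains \<open>abs I\<close>. Squares of three-term sums then
  reduce everything to the time integral of \<open>I^2\<close>, whose mean is known.\<close>

lemma be_moment:
 assumes T: "0 < T"
 shows "integrable M (%w. ival 0 T (%s. (be s w)^2))" (is "integrable M ?V")
  "(EE w. ival 0 T (%s. (be s w)^2)) <= be_bound T"
proof -
 let ?c = "L^2*exp (L*T)"
 define Y where "Y w = ival 0 T (%s. (I s w)^2)" for w
 define c1 where "c1 = 3*bc^2*T"
 define c2 where "c2 = 3*L^2 + 3 * ?c^2*T^2"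
 define c3 where "c3 = T*(3*x^2 + 3*(bc*T)^2)"
 have c20: "0 <= c2" by (simp add: c2_def)
 have ptw: "AE w in M. ?V w <= c1 + c2*(c3 + 3*gg^2*Y w)" using Xeq AE_space
 proof eventually_elim
  case (elim w)
  define q where "q t = x + bc*t + gg*abs (I t w)" for t
  have gg0: "0 <= gg" using gpos by (simp add: gg_def)
  have x0: "0 <= x" using par by simp
  have X0': "0 <= X t w" if "0 <= t" for t using Xa[OF that elim(2)] par by linarith
  have qc: "continuous_on {0..} q" unfolding q_def by (intro continuous_intros Ic elim(2))
  have q0: "0 <= q t" if "0 <= t" for t using that bc0 gg0 x0 by (simp add: q_def)
  have le: "X t w <= q t + L*integral {0..t} (%s. X s w)" if t: "0 <= t" for t
  proof -
   note XI = lborel_integral_continuous[OF Xc[OF elim(2)] order_refl, of t]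
   have ci: "iable 0 t (%s. bc)" using t by (intro integrable_mult_left integrable_real_indicator) auto
   have "ival 0 t (%s. be s w) <= (\<integral>s. indicator {0<..t} s*bc + L*(indicator {0<..t} s*X s w) \<partial>lborel)"
   proof (rule integral_mono')
    show "integrable lborel (%s. indicator {0<..t} s*bc + L*(indicator {0<..t} s*X s w))"
     using ci XI(1) by simp
    show "indicator {0<..t} s*be s w <= indicator {0<..t} s*bc + L*(indicator {0<..t} s*X s w)" for s
     using be_le[OF elim(2), of s] by (auto simp: indicator_def abs_le_iff)
    show "0 <= indicator {0<..t} s*bc + L*(indicator {0<..t} s*X s w)" for s
     using X0'[of s] L0 bc0 by (auto simp: indicator_def)
   qed
   also have "... = bc*t + L*integral {0..t} (%s. X s w)" using ci XI t by (simp add: mult.commute)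
   moreover have "gg*I t w <= gg*abs (I t w)" using gg0 by (intro mult_left_mono) auto
   ultimately show ?thesis using elim(1) t unfolding q_def by fastforce
  qed
  define Q where "Q = integral {0..T} q"
  have Q: "Q = ival 0 T (%s. q s)"
   unfolding Q_def using lborel_integral_continuous(2)[OF qc order_refl, of T] T by simp
  have qq: "iable 0 T (%s. (q s)^2)" by (intro lborel_integral_continuous continuous_on_power qc) simp
  define Q2 where "Q2 = ival 0 T (%s. (q s)^2)"
  have QQ: "Q^2 <= T*Q2"
  proof -
   let ?q = "%s. indicator {0..} s*q s"
   have eq: "indicator {0<..T} s * ?q s = indicator {0<..T} s*q s" "indicator {0<..T} s*(?q s)^2 = indicator {0<..T} s*(q s)^2" for s
    by (auto simp: indicator_def)
   have "?q \<in> \<B> lborel" using borel_measurable_continuous_on_indicator[OF _ qc] by simp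
   from integral_square_le(2)[OF this, of 0 T] qq T show ?thesis unfolding eq Q Q2_def by simp
  qed
  have Xb: "X t w <= q t + L*exp (L*T)*Q" if t: "0 <= t" "t <= T" for t
  proof -
   have "integral {0..t} (%s. X s w) <= exp (L*t)*integral {0..t} q"
    by (rule gronwall_integral[OF Xc[OF elim(2)] qc q0 L0 le t(1)])
   also have "... <= exp (L*T)*Q"
   proof (intro mult_mono)
    show "exp (L*t) <= exp (L*T)" using L0 t by (simp add: mult_left_mono)
    have it: "q integrable_on {0..s}" for s
     by (rule integrable_continuous_interval, rule continuous_on_subset[OF qc]) auto
    show "integral {0..t} q <= Q" unfolding Q_def by (rule integral_subset_le[OF _ it it]) (use t q0 in auto)
    show "0 <= integral {0..t} q" by (rule integral_nonneg[OF it]) (use q0 in auto)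
   qed simp
   finally have "L*integral {0..t} (%s. X s w) <= L*(exp (L*T)*Q)" using L0 by (rule mult_left_mono)
   thus ?thesis using le[OF t(1)] by (simp add: mult.assoc)
  qed
  have bsq: "(be s w)^2 <= 3*bc^2 + 3*L^2*(q s)^2 + 3 * ?c^2*Q^2" if s: "0 < s" "s <= T" for s
  proof -
   have "abs (be s w) <= bc + L*(q s + L*exp (L*T)*Q)"
    using be_le[OF elim(2), of s] mult_left_mono[OF Xb[of s] L0] s by linarith
   also have "... = bc + L*q s + ?c*Q" by (simp add: power2_eq_square algebra_simps)
   finally have b: "abs (be s w) <= bc + L*q s + ?c*Q" .
   hence "(be s w)^2 <= (bc + L*q s + ?c*Q)^2"
    by (subst abs_le_square_iff[symmetric]) (rule order_trans[OF _ abs_ge_self])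
   also have "... <= 3*bc^2 + 3*(L*q s)^2 + 3*(?c*Q)^2" by (rule sum3_square_le)
   finally show ?thesis by (simp only: power_mult_distrib mult.assoc)
  qed
  have ci: "iable 0 T (%s. (c::real))" for c
   using T by (intro integrable_mult_left integrable_real_indicator) auto
  have "?V w <= (\<integral>s. indicator {0<..T} s*(3*bc^2 + 3 * ?c^2*Q^2) + 3*L^2*(indicator {0<..T} s*(q s)^2) \<partial>lborel)"
  proof (rule integral_mono'[OF int_add[OF ci integrable_mult_right[OF qq]]])
   fix s
   show "indicator {0<..T} s*(be s w)^2 <= indicator {0<..T} s*(3*bc^2 + 3 * ?c^2*Q^2) + 3*L^2*(indicator {0<..T} s*(q s)^2)"
    using bsq[of s] by (auto simp: indicator_def algebra_simps)
  qed (simp add: indicator_def)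
  also have "... = T*(3*bc^2 + 3 * ?c^2*Q^2) + 3*L^2*Q2"
   unfolding Q2_def using T by (subst lint_add[OF ci integrable_mult_right[OF qq]]) simp
  also have "... <= c1 + c2*Q2"
  proof -
   have "3 * ?c^2*T*Q^2 <= 3 * ?c^2*T*(T*Q2)"
    using QQ T by (intro mult_left_mono) auto
   thus ?thesis unfolding c1_def c2_def by (simp add: power2_eq_square algebra_simps)
  qed
  also have "Q2 <= c3 + 3*gg^2*Y w"
  proof -
   have I2: "iable 0 T (%s. (I s w)^2)"
    by (intro lborel_integral_continuous continuous_on_power Ic elim(2)) simp
   have "Q2 <= (\<integral>s. indicator {0<..T} s*(3*x^2 + 3*(bc*T)^2) + 3*gg^2*(indicator {0<..T} s*(I s w)^2) \<partial>lborel)"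
    unfolding Q2_def
   proof (rule integral_mono'[OF int_add[OF ci integrable_mult_right[OF I2]]])
    fix s
    have "(q s)^2 <= 3*x^2 + 3*(bc * s)^2 + 3*(gg*abs (I s w))^2" unfolding q_def by (rule sum3_square_le)
    moreover have "(bc * s)^2 <= (bc*T)^2" if "0 < s" "s <= T"
     using that bc0 by (intro power_mono mult_left_mono) auto
    ultimately have "(q s)^2 <= 3*x^2 + 3*(bc*T)^2 + 3*gg^2*(I s w)^2" if "0 < s" "s <= T"
     using that by (simp add: power_mult_distrib)
    thus "indicator {0<..T} s*(q s)^2 <= indicator {0<..T} s*(3*x^2 + 3*(bc*T)^2) + 3*gg^2*(indicator {0<..T} s*(I s w)^2)"
     by (simp add: indicator_def)
   qed (simp add: indicator_def)
   also have "... = c3 + 3*gg^2*Y w"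
    unfolding Y_def c3_def using T by (subst lint_add[OF ci integrable_mult_right[OF I2]]) simp
   finally show ?thesis .
  qed
  hence "c1 + c2*Q2 <= c1 + c2*(c3 + 3*gg^2*Y w)" using c20 by (intro add_left_mono mult_left_mono)
  finally show ?case .
 qed
 have Yi: "integrable M Y" "(EE w. Y w) <= M1^2*T^2" using I_sq[OF T] by (auto simp: Y_def[abs_def])
 have V0: "0 <= ?V w" for w by (intro integral_nonneg_AE AE_I2) (simp add: indicator_def)
 have "(%(w, s). indicator {0<..T} s*(be s w)^2) \<in> \<B> MT"
  using be_joint unfolding case_prod_beta' by measurable
 hence Vm: "?V \<in> \<B> M" by (rule lborel.borel_measurable_lebesgue_integral)
 have bi: "integrable M (%w. c1 + c2*(c3 + 3*gg^2*Y w))" using Yi by simp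
 show Vi: "integrable M ?V"
  by (rule int_bound[OF bi Vm], use ptw in eventually_elim) (use V0 in "simp add: abs_of_nonneg order_trans[OF _ abs_ge_self]")
 have "(EE w. ?V w) <= (EE w. c1 + c2*(c3 + 3*gg^2*Y w))" by (rule integral_mono_AE[OF Vi bi ptw])
 also have "... = c1 + c2*(c3 + 3*gg^2*(EE w. Y w))" using Yi by (simp add: prob_space)
 also have "... <= c1 + c2*(c3 + 3*gg^2*(M1^2*T^2))"
  using Yi(2) c20 by (intro add_left_mono mult_left_mono) auto
 finally show "(EE w. ?V w) <= be_bound T" unfolding be_bound_def c1_def c2_def c3_def .
qed

end

sublocale wealth \<subseteq> ito: ito_process M F B H I X A al be M1 "real n*lam" gg a x
proof unfold_locales
 show "ito_integral M F B H I" by (rule ito)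
 show "AE w in M. iable 0 T (%r. (be r w)^2)" if "0 < T" for T using be_sq_int that by (intro AE_I2)
 show "AE w in M. \<forall>t\<ge>0. X t w = x + ival 0 t (%r. be r w) + gg*I t w" by (rule Xeq)
qed (rule A_def HK Xm Xc Xa X0 Am al_joint al_bounds(1) be_joint be_moment(1); assumption)+

locale wealth_clock = wealth +
 fixes D :: "'a => real"
 assumes Dd: "distributed M lborel D (exponential_density (lam*real n))"
  and Di: "independent_of_filtration M F D"
begin

text \<open>The terminal factor when the clock rings: the reward \<open>rho\<close> is earned
  exactly if the wealth has been absorbed by then.\<close>

definition cc :: "real => real" where "cc y = (if y = a then exp (real n*rho) else 1)"

definition Psi :: "'a => real" where
 "Psi w = exp (real n *
    ((LBINT s:{s. 0 <= s \<and> ereal s <= min (hit_time a (%t. W t w)) (ereal (D w))}. l (W s w))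
    + rho*(if hit_time a (%t. W t w) <= ereal (D w) then 1 else 0)))"

text \<open>The value of \<open>Psi\<close> if the clock rings at \<open>t\<close>: the summand
  \<open>lam n t\<close> cancels the killing contained in \<open>A\<close>.\<close>

definition Phi :: "real => 'a => real" where
 "Phi t w = exp (A (max 0 t) w + lam*real n*t)*cc (X (max 0 t) w)"

definition Fi :: "'a measure" where "Fi = sigma (space M) (\<Union>t. sets (F t))"

lemma cost_eq: "cost a rho l M n D W = 1 / real n*ln (EE w. Psi w)"
 unfolding cost_def Psi_def ..

lemma Fi_props: "space Fi = space M" "sets Fi = sigma_sets (space M) (\<Union>t. sets (F t))" "sets Fi \<subseteq> sets M"
proof -
 have P: "(\<Union>t. sets (F t)) \<subseteq> Pow (space M)" using sets_F sets.sets_into_space by blast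
 show "space Fi = space M" "sets Fi = sigma_sets (space M) (\<Union>t. sets (F t))"
  unfolding Fi_def using P by (auto simp: space_measure_of sets_measure_of)
 thus "sets Fi \<subseteq> sets M" using sets_F by (auto intro!: sets.sigma_sets_subset)
qed

lemma meas_Fi: "f \<in> measurable (F t) N ==> f \<in> measurable Fi N"
proof -
 assume f: "f \<in> measurable (F t) N"
 have "sets (F t) \<subseteq> sets Fi" unfolding Fi_props by auto
 thus ?thesis using f Fi_props(1) by (auto simp: measurable_def)
qed

lemma D_meas [measurable]: "D \<in> \<B> M"
 using distributed_measurable[OF Dd] by simp

lemma Phi_joint: "(%(w, t). Phi t w) \<in> \<B> (Fi \<Otimes>\<^sub>M borel)"
proof -
 have [measurable]: "(%x. X (max 0 (snd x)) (fst x)) \<in> \<B> (Fi \<Otimes>\<^sub>M lborel)"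
  by (rule X_joint_gen[of "%x. x"]) (auto intro!: meas_Fi[OF Xm] simp: Fi_props)
 have "(%(w, t). A (max 0 t) w) \<in> \<B> (Fi \<Otimes>\<^sub>M lborel)"
 proof (rule continuous_joint_measurable)
  show "A (max 0 t) \<in> \<B> Fi" for t by (rule meas_Fi[OF Am]) simp
  fix w assume "w \<in> space Fi"
  hence "continuous_on {0..} (%t. A t w)" using ito.A_cont by (simp add: Fi_props)
  thus "continuous_on UNIV (%t. A (max 0 t) w)"
   by (rule continuous_on_compose2) (auto intro!: continuous_on_max)
 qed
 hence [measurable]: "(%x. A (max 0 (snd x)) (fst x)) \<in> \<B> (Fi \<Otimes>\<^sub>M lborel)"
  by (simp add: case_prod_beta')
 have "(%(w, t). Phi t w) \<in> \<B> (Fi \<Otimes>\<^sub>M lborel)"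
  unfolding Phi_def cc_def case_prod_beta' by measurable
 thus ?thesis by (simp cong: measurable_cong_sets)
qed

text \<open>Independence makes the joint law of the path information and the clock a product
  measure, the path information being represented by the identity map into \<open>Fi\<close>;
  Tonelli then integrates against the density of the clock.\<close>

lemma nn_clock:
 assumes h: "h \<in> \<B> (Fi \<Otimes>\<^sub>M borel)"
 shows "(NN w. h (w, D w)) = (NN w. (\<integral>\<^sup>+t. ennreal (exponential_density (lam*real n) t)*h (w, t) \<partial>lborel))"
proof -
 let ?u = "%w. (w, D w)"
 let ?r = "%w. \<integral>\<^sup>+t. ennreal (exponential_density (lam*real n) t)*h (w, t) \<partial>lborel"
 let ?Fi = "distr M Fi (%w. w)"
 let ?D = "distr M borel D"
 let ?Q = "Fi \<Otimes>\<^sub>M borel"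
 have idm: "(%w. w) \<in> measurable M Fi" using Fi_props by (auto simp: measurable_def)
 interpret PD: prob_space "distr M borel D" by (rule prob_space_distr) simp
 interpret PF: prob_space "distr M Fi (%w. w)" by (rule prob_space_distr[OF idm])
 have pm: "?u \<in> measurable M ?Q" using idm by measurable
 \<comment> \<open>The law of the identity into \<open>Fi\<close> is the restriction of
   \<open>M\<close> to \<open>Fi\<close>; the two measures are compared on rectangles.\<close>
 have de: "distr M Fi (%w. w) \<Otimes>\<^sub>M distr M borel D = distr M ?Q ?u"
 proof (rule pair_measure_eqI)
  show "sigma_finite_measure ?Fi" "sigma_finite_measure ?D" by unfold_locales
  show "sets (distr M Fi (%w. w) \<Otimes>\<^sub>M distr M borel D) = sets (distr M ?Q ?u)"
   by (simp cong: sets_pair_measure_cong)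
  fix U V assume "U \<in> sets ?Fi" "V \<in> sets ?D"
  hence UV: "U \<in> sets Fi" "V \<in> sets borel" by auto
  have U: "U \<in> sets M" "U \<subseteq> space M" using UV(1) Fi_props sets.sets_into_space by blast+
  have ind: "prob (U \<inter> (D -` V \<inter> space M)) = prob U*prob (D -` V \<inter> space M)"
   using Di UV unfolding independent_of_filtration_def
   by (intro indep_setD) (auto simp: Fi_props(2) preimages_def)
  have "emeasure (distr M ?Q ?u) (U \<times> V) = emeasure M (?u -` (U \<times> V) \<inter> space M)"
   using UV by (intro emeasure_distr[OF pm]) auto
  also have "?u -` (U \<times> V) \<inter> space M = U \<inter> (D -` V \<inter> space M)" using U by auto
  also have "emeasure M (U \<inter> (D -` V \<inter> space M)) = emeasure M U*emeasure M (D -` V \<inter> space M)"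
   using ind by (simp add: emeasure_eq_measure ennreal_mult)
  also have "emeasure M U = emeasure ?Fi U"
   using UV(1) U by (subst emeasure_distr[OF idm]) (auto simp: Int_absorb2)
  also have "emeasure M (D -` V \<inter> space M) = emeasure ?D V"
   using UV(2) by (simp add: emeasure_distr)
  finally show "emeasure ?Fi U*emeasure ?D V = emeasure (distr M ?Q ?u) (U \<times> V)" ..
 qed
 have "(NN w. h (w, D w)) = (\<integral>\<^sup>+z. h z \<partial>distr M ?Q ?u)"
  using nn_integral_distr[OF pm, of h] h by simp
 also have "... = (\<integral>\<^sup>+z. h z \<partial>(distr M Fi (%w. w) \<Otimes>\<^sub>M distr M borel D))" unfolding de ..
 also have "... = (\<integral>\<^sup>+w. (\<integral>\<^sup>+t. h (w, t) \<partial>distr M borel D) \<partial>distr M Fi (%w. w))"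
  by (rule PD.nn_integral_fst[symmetric]) (use h in "simp cong: measurable_cong_sets sets_pair_measure_cong")
 also have "... = (NN w. (\<integral>\<^sup>+t. h (w, t) \<partial>distr M borel D))"
 proof (rule nn_integral_distr[OF idm])
  have "h \<in> \<B> (Fi \<Otimes>\<^sub>M distr M borel D)" using h by (simp cong: measurable_cong_sets sets_pair_measure_cong)
  hence "(%w. \<integral>\<^sup>+t. h (w, t) \<partial>distr M borel D) \<in> \<B> Fi"
   by (rule PD.borel_measurable_nn_integral_fst)
  thus "(%w. \<integral>\<^sup>+t. h (w, t) \<partial>distr M borel D) \<in> \<B> ?Fi" by simp
 qed
 also have "... = (NN w. ?r w)"
 proof (rule nn_integral_cong)
  fix w assume "w \<in> space M"
  hence hm: "(%t. h (w, t)) \<in> \<B> borel"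
   using measurable_compose[OF measurable_Pair1' h, of w] by (simp add: Fi_props)
  have "(\<integral>\<^sup>+t. h (w, t) \<partial>distr M borel D) = (NN w'. h (w, D w'))"
   using hm by (simp add: nn_integral_distr)
  also have "... = ?r w"
   using distributed_nn_integral[OF Dd, of "%t. h (w, t)"] hm by simp
  finally show "(\<integral>\<^sup>+t. h (w, t) \<partial>distr M borel D) = ?r w" .
 qed
 finally show ?thesis .
qed

text \<open>The reward collected until the earlier of hitting time and clock equals that of the
  absorbed path until the clock, with \<open>l\<close> replaced by 0 at \<open>a\<close>. A negative
  clock value leaves an empty integration set and no terminal reward, hence 1; this happens on a
  null set only.\<close>

lemma Psi_eq:
 assumes wv: "w \<in> space M"
 shows "Psi w = (if D w < 0 then 1 else Phi (D w) w)"
proof (cases "D w < 0")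
 case True
 have h: "0 <= hit_time a (%t. W t w)" unfolding hit_time_def by (intro Inf_greatest) auto
 have "{s. 0 <= s \<and> ereal s <= min (hit_time a (%t. W t w)) (ereal (D w))} = {}" using True by auto
 moreover have "\<not> hit_time a (%t. W t w) <= ereal (D w)"
  using h True by (metis ereal_less(2) ereal_less_eq(5) less_le_trans not_less)
 ultimately show ?thesis using True by (simp add: Psi_def set_lebesgue_integral_def)
next
 case False
 hence D0: "0 <= D w" by simp
 let ?d = "D w"
 let ?S = "{s. 0 <= s \<and> ereal s <= min (tau w) (ereal ?d)}"
 define f where "f s = (if a < X (max 0 s) w then l (X (max 0 s) w) else 0)" for s
 have XW: "X t w = W t w" if "0 <= t" "ereal t <= tau w" for t
  using wv by (cases rule: tau_cases) (use that in "auto, metis le_less")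
 have lm: "(%s. l (X (max 0 s) w)) \<in> \<B> lborel" "(%s. X (max 0 s) w) \<in> \<B> lborel"
  using measurable_compose[OF measurable_Pair1'[OF wv] f_joint[OF lc]] measurable_compose[OF measurable_Pair1'[OF wv] X_joint] by auto
 have fm: "f \<in> \<B> lborel" unfolding f_def using lm by measurable
 have "(LBINT s:?S. l (W s w)) = (\<integral>s. indicator ?S s*l (X (max 0 s) w) \<partial>lborel)"
  unfolding set_lebesgue_integral_def
  by (intro lint_cong refl) (auto simp: indicator_def XW)
 also have "... = ival 0 (?d) (%s. f s)"
 proof (rule integral_cong_AE)
  \<comment> \<open>At the hitting time itself the integrands may differ, so this point is left out.
    If \<open>tau w\<close> is infinite, \<open>real_of_ereal\<close> yields 0 and just the point 0
    is left out.\<close>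
  have "AE s in lborel. s \<noteq> 0 \<and> s \<noteq> real_of_ereal (tau w)"
   using AE_lborel_singleton[of 0] AE_lborel_singleton[of "real_of_ereal (tau w)"] by eventually_elim simp
  thus "AE s in lborel. indicat_real ?S s*l (X (max 0 s) w) = indicator {0<..?d} s*f s"
  proof eventually_elim
   case (elim s)
   show ?case
   proof (cases "0 < s \<and> s <= ?d")
    case True
    hence "tau w <= ereal s \<and> X s w = a \<or> ereal s < tau w \<and> a < X s w" using X_cases[OF wv, of s] by auto
    thus ?thesis
    proof (elim disjE conjE)
     assume a: "tau w <= ereal s" "X s w = a"
     have "tau w \<noteq> ereal s" using elim by auto
     hence "\<not> ereal s <= tau w" using a by auto
     thus ?thesis using a True by (simp add: f_def)
    qed (use True in "simp add: f_def")
   qed (use elim in "auto simp: indicator_def")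
  qed
  have "?S \<in> sets borel"
  proof -
   have "?S = {0..} \<inter> {s. ereal s <= min (tau w) (ereal ?d)}" by auto
   also have "... \<in> sets borel" by measurable
   finally show ?thesis .
  qed
  thus "(%s. indicat_real ?S s*l (X (max 0 s) w)) \<in> \<B> lborel" using lm by measurable
  show "(%s. indicator {0<..?d} s*f s) \<in> \<B> lborel" using fm by measurable
 qed
 finally have L: "(LBINT s:?S. l (W s w)) = ival 0 (?d) (%s. f s)" .
 have ci: "iable 0 (?d) (%s. (c::real))" for c
  using D0 by (intro integrable_mult_left integrable_real_indicator) auto
 have fi: "iable 0 (?d) (%s. f s)"
 proof (rule int_bound[OF ci[of "l a"]])
  show "(%s. indicator {0<..?d} s*f s) \<in> \<B> lborel" using fm by measurable
  have "abs (f s) <= abs (l a)" for s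
   using l0[of "X (max 0 s) w"] l1[of "X (max 0 s) w"] Xa[of "max 0 s" w] wv unfolding f_def by auto
  thus "AE s in lborel. norm (indicator {0<..?d} s*f s) <= norm (indicator {0<..?d} s*l a)"
   by (intro AE_I2) (simp add: indicator_def)
 qed
 have "A ?d w = (\<integral>s. real n*(indicator {0<..?d} s*f s) - indicator {0<..?d} s*(real n*lam) \<partial>lborel)"
  unfolding A_def by (intro lint_cong) (auto simp: al_def f_def indicator_def algebra_simps)
 also have "... = real n*ival 0 (?d) (%s. f s) - ?d*(real n*lam)"
  using D0 by (subst lint_diff[OF integrable_mult_right[OF fi] ci]) simp
 finally have A: "A ?d w + lam*real n * ?d = real n*ival 0 (?d) (%s. f s)" by (simp add: algebra_simps)
 have "Psi w = exp (real n*ival 0 (?d) (%s. f s))*exp (real n*rho*(if tau w <= ereal ?d then 1 else 0))"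
  unfolding Psi_def tau_def[symmetric] L by (simp add: exp_add[symmetric] distrib_left mult.assoc)
 also have "exp (real n*rho*(if tau w <= ereal ?d then 1 else 0)) = cc (X ?d w)"
  using X_eq_a_iff[OF wv D0] by (simp add: cc_def)
 finally show ?thesis using False D0 A by (simp add: Phi_def max_absorb2)
qed

lemma Psi_measurable: "Psi \<in> \<B> M"
proof -
 have idm: "(%w. w) \<in> measurable M Fi" using Fi_props by (auto simp: measurable_def)
 have pm: "(%w. (w, D w)) \<in> measurable M (Fi \<Otimes>\<^sub>M borel)" using idm by measurable
 have [measurable]: "(%w. Phi (D w) w) \<in> \<B> M" using measurable_compose[OF pm Phi_joint] by simp
 have "(%w. if D w < 0 then 1 else Phi (D w) w) \<in> \<B> M" by measurable
 thus ?thesis by (rule measurable_cong[THEN iffD1, rotated]) (simp add: Psi_eq)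
qed

lemma D_nonneg: "AE w in M. 0 <= D w"
proof -
 have "AE t in density lborel (exponential_density (lam*real n)). 0 <= t"
  by (subst AE_density) (auto simp: exponential_density_def erlang_density_def intro!: AE_I2)
 hence "AE t in distr M lborel D. 0 <= t" unfolding distributed_distr_eq_density[OF Dd] .
 thus ?thesis by (subst (asm) AE_distr_iff) auto
qed

text \<open>The exponential in the density of the clock cancels the one in \<open>Phi\<close>. The
  expected exponential cost becomes the expected discounted total of a source
  \<open>lam n cc\<close> along the absorbed path, a form to which Dynkin's formula applies.\<close>

lemma nn_Psi: "(NN w. ennreal (Psi w))
 = (NN w. (\<integral>\<^sup>+t\<in>{0<..}. ennreal (exp (A t w)*(lam*real n*cc (X t w))) \<partial>lborel))"
proof -
 have "(NN w. ennreal (Psi w)) = (NN w. ennreal (Phi (D w) w))"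
  using D_nonneg AE_space by (intro nn_integral_cong_AE) (auto elim!: eventually_elim2 simp: Psi_eq)
 also have "... = (NN w. (\<integral>\<^sup>+t. ennreal (exponential_density (lam*real n) t)*ennreal (Phi t w) \<partial>lborel))"
  using nn_clock[of "%(w, t). ennreal (Phi t w)"] Phi_joint by (simp add: case_prod_beta')
 also have "... = (NN w. (\<integral>\<^sup>+t\<in>{0<..}. ennreal (exp (A t w)*(lam*real n*cc (X t w))) \<partial>lborel))"
 proof (rule nn_integral_cong, rule nn_integral_cong_AE)
  fix w assume "w \<in> space M"
  show "AE t in lborel. ennreal (exponential_density (lam*real n) t)*ennreal (Phi t w)
   = ennreal (exp (A t w)*(lam*real n*cc (X t w)))*indicator {0<..} t"
   using AE_lborel_singleton[of "0::real"]
  proof eventually_elim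
   case (elim t)
   show ?case
   proof (cases "0 < t")
    case True
    have "exponential_density (lam*real n) t*Phi t w = exp (A t w)*(lam*real n*cc (X t w))"
     using True by (simp add: exponential_density_def erlang_density_def Phi_def exp_add exp_minus field_simps max_absorb2)
    moreover have "0 <= exponential_density (lam*real n) t" using par by (simp add: exponential_density_def erlang_density_def)
    ultimately show ?thesis using True by (simp add: ennreal_mult'[symmetric])
   next
    case False
    thus ?thesis using elim by (simp add: exponential_density_def erlang_density_def)
   qed
  qed
 qed
 finally show ?thesis .
qed

end

context wealth_clock
begin

lemma A_le:
 assumes "w \<in> space M" "0 <= t"
 shows "A t w <= - (real n*(lam - l a))*t" (is ?th1) "- (real n*lam)*t <= A t w"
proof -
 have ci: "iable 0 t (%s. (c::real))" for c
  using assms by (intro integrable_mult_left integrable_real_indicator) auto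
 note ai = ito.al_int[OF assms]
 have "A t w <= ival 0 t (%s. - real n*(lam - l a))"
  unfolding A_def by (rule integral_mono[OF ai ci]) (use al_bounds(2)[OF assms(1)] in "auto simp: indicator_def")
 thus ?th1 using assms(2) by (simp add: mult.commute)
 have "ival 0 t (%s. - (real n*lam)) <= A t w" unfolding A_def
 proof (rule integral_mono[OF ci ai])
  fix s
  show "indicator {0<..t} s*(- (real n*lam)) <= indicator {0<..t} s*al s w"
   using al_bounds(1)[OF assms(1), of s] by (simp add: indicator_def abs_le_iff)
 qed
 thus "- (real n*lam)*t <= A t w" using assms(2) by (simp add: mult.commute)
qed

lemma A_exp_le1: "w \<in> space M ==> 0 <= t ==> exp (A t w) <= 1"
 using A_le(1)[of w t] l2 par by (auto intro: order_trans simp: mult_nonneg_nonneg)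

lemma cc_bounds: "1 <= cc y" "cc y <= exp (real n*rho)"
 using par by (auto simp: cc_def)

lemma cc_joint: "(%x. cc (X (max 0 (snd x)) (fst x))) \<in> \<B> MT"
 unfolding cc_def by measurable

definition run :: "real => 'a => real" where "run s w = exp (A s w)*(lam*real n*cc (X s w))"

lemma run_joint: "(%(w, s). indicator {0<..T} s*run s w) \<in> \<B> MT"
proof -
 have [measurable]: "(%x. A (max 0 (snd x)) (fst x)) \<in> \<B> MT"
  using ito.A_joint by (simp add: case_prod_beta')
 note [measurable] = cc_joint
 have "(%x. indicator {0<..T} (snd x)*(exp (A (max 0 (snd x)) (fst x))*(lam*real n*cc (X (max 0 (snd x)) (fst x))))) \<in> \<B> MT"
  by measurable
 thus ?thesis by (rule measurable_cong[THEN iffD1, rotated]) (auto simp: indicator_def run_def)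
qed

lemma bounded_iterated:
 fixes h :: "real => 'a => real"
 assumes h: "(%(w, s). indicator {0<..T} s*h s w) \<in> \<B> MT" and T: "0 < T"
  and b: "!!s w. 0 < s ==> w \<in> space M ==> abs (h s w) <= (b::real)"
 shows "w \<in> space M ==> iable 0 T (%s. h s w)"
  "integrable M (%w. ival 0 T (%s. h s w))" (is ?th1)
proof -
 have b0: "0 <= b"
 proof -
  obtain wv where "wv \<in> space M" using not_empty by blast
  thus ?thesis using b[of 1 wv] by (auto intro: order_trans[OF abs_ge_zero])
 qed
 have ci: "iable 0 T (%s. b)" using T by (intro integrable_mult_left integrable_real_indicator) auto
 show 1: "iable 0 T (%s. h s w)" if wv: "w \<in> space M" for w
 proof (rule int_bound[OF ci])
  show "(%s. indicator {0<..T} s*h s w) \<in> \<B> lborel"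
   using measurable_compose[OF measurable_Pair1'[OF wv] h] by simp
  show "AE s in lborel. norm (indicator {0<..T} s*h s w) <= norm (indicator {0<..T} s*b)"
   using b wv b0 by (intro AE_I2) (simp add: indicator_def)
 qed
 show ?th1
 proof (rule integrable_const_bound[where B = "T*b"])
  show "(%w. ival 0 T (%s. h s w)) \<in> \<B> M" by (rule lborel.borel_measurable_lebesgue_integral[OF h])
  show "AE w in M. norm (ival 0 T (%s. h s w)) <= T*b"
  proof (rule AE_I2)
   fix w assume wv: "w \<in> space M"
   have "abs (\<integral>s. indicator {0<..T} s*h s w \<partial>lborel) <= ival 0 T (%s. b)"
    by (intro bochner_abs_le 1 wv ci) (use b wv in "simp add: indicator_def")
   thus "norm (ival 0 T (%s. h s w)) <= T*b" using T by simp
  qed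
 qed
qed

lemma run_bound: "0 < s ==> w \<in> space M ==> 0 <= run s w" "0 < s ==> w \<in> space M ==> abs (run s w) <= lam*real n*exp (real n*rho)"
proof -
 assume s: "0 < s" "w \<in> space M"
 have c: "0 <= cc (X s w)" using cc_bounds(1)[of "X s w"] by linarith
 thus 1: "0 <= run s w" using par unfolding run_def by (intro mult_nonneg_nonneg) auto
 have "run s w <= 1*(lam*real n*exp (real n*rho))"
  unfolding run_def using A_exp_le1[of w s] s cc_bounds(2) par c by (intro mult_mono) auto
 thus "abs (run s w) <= lam*real n*exp (real n*rho)" using 1 by simp
qed

lemma nn_run:
 assumes T: "0 < T"
 shows "(NN w. (\<integral>\<^sup>+t\<in>{0<..T}. ennreal (run t w) \<partial>lborel))
  = ennreal (EE w. ival 0 T (%s. run s w))"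
proof -
 note bi = bounded_iterated[OF run_joint T run_bound(2)]
 have pos: "0 <= indicator {0<..T} s*run s w" if "w \<in> space M" for s w
  using run_bound(1)[of s w] that by (simp add: indicator_def)
 have 1: "(\<integral>\<^sup>+t\<in>{0<..T}. ennreal (run t w) \<partial>lborel) = ennreal (ival 0 T (%s. run s w))"
  if wv: "w \<in> space M" for w
 proof -
  have "(\<integral>\<^sup>+t\<in>{0<..T}. ennreal (run t w) \<partial>lborel) = (\<integral>\<^sup>+t. ennreal (indicator {0<..T} t*run t w) \<partial>lborel)"
   by (intro nn_integral_cong) (auto simp: indicator_def)
  thus ?thesis using nn_integral_eq_integral[OF bi(1)[OF _ _ wv]] pos[OF wv] by simp
 qed
 have "(NN w. (\<integral>\<^sup>+t\<in>{0<..T}. ennreal (run t w) \<partial>lborel)) = (NN w. ennreal (ival 0 T (%s. run s w)))"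
  by (intro nn_integral_cong 1)
 also have "... = ennreal (EE w. ival 0 T (%s. run s w))"
  by (rule nn_integral_eq_integral) (use bi(2) pos in "auto intro!: AE_I2 integral_nonneg_AE")
 finally show ?thesis .
qed

text \<open>Fatou's lemma, in time and over the paths, lets \<open>T\<close> tend to infinity before
  \<open>Psi\<close> is known to be integrable.\<close>

lemma Psi_nn_le:
 assumes "!!T. 0 < T ==> (EE w. ival 0 T (%s. run s w)) <= v + q T" "(q \<longlongrightarrow> 0) at_top"
 shows "(NN w. ennreal (Psi w)) <= ennreal v"
proof -
 let ?r = "%m w. \<integral>\<^sup>+t\<in>{0<..real (Suc m)}. ennreal (run t w) \<partial>lborel"
 have rm: "?r m \<in> \<B> M" for m
 proof -
  have "(%(w, s). ennreal (indicator {0<..real (Suc m)} s*run s w)) \<in> \<B> MT"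
   using measurable_compose[OF run_joint measurable_ennreal] by (simp add: case_prod_beta')
  hence "(%w. \<integral>\<^sup>+s. ennreal (indicator {0<..real (Suc m)} s*run s w) \<partial>lborel) \<in> \<B> M"
   by (rule lborel.borel_measurable_nn_integral)
  thus ?thesis by (rule measurable_cong[THEN iffD1, rotated]) (intro nn_integral_cong, auto simp: indicator_def)
 qed
 have sec: "(%t. ennreal (run t w)*indicator {0<..T} t) \<in> \<B> lborel" if "w \<in> space M" for w T
 proof -
  have "(%t. ennreal (indicator {0<..T} t*run t w)) \<in> \<B> lborel"
   using measurable_compose[OF measurable_compose[OF measurable_Pair1'[OF that] run_joint] measurable_ennreal] by simp
  thus ?thesis by (rule measurable_cong[THEN iffD1, rotated]) (auto simp: indicator_def)
 qed
 have "(NN w. ennreal (Psi w)) = (NN w. (\<integral>\<^sup>+t\<in>{0<..}. ennreal (run t w) \<partial>lborel))"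
  unfolding nn_Psi run_def ..
 also have "... <= (NN w. liminf (%m. ?r m w))"
 proof (intro nn_integral_mono)
  fix w assume wv: "w \<in> space M"
  have "(\<integral>\<^sup>+t\<in>{0<..}. ennreal (run t w) \<partial>lborel) = (\<integral>\<^sup>+t. liminf (%m. ennreal (run t w)*indicator {0<..real (Suc m)} t) \<partial>lborel)"
  proof (rule nn_integral_cong)
   fix t
   obtain m0 where m0: "t <= real m0" using real_arch_simple by blast
   have "\<forall>\<^sub>F m in sequentially. ennreal (run t w)*indicator {0<..real (Suc m)} t = ennreal (run t w)*indicator {0<..} t"
    using eventually_ge_at_top[of m0] by eventually_elim (use m0 in "auto simp: indicator_def")
   hence "(%m. ennreal (run t w)*indicator {0<..real (Suc m)} t) ----> ennreal (run t w)*indicator {0<..} t"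
    by (rule tendsto_eventually)
   thus "ennreal (run t w)*indicator {0<..} t = liminf (%m. ennreal (run t w)*indicator {0<..real (Suc m)} t)"
    using lim_imp_Liminf[OF trivial_limit_sequentially] by metis
  qed
  also have "... <= liminf (%m. ?r m w)" by (rule nn_integral_liminf) (rule sec[OF wv])
  finally show "(\<integral>\<^sup>+t\<in>{0<..}. ennreal (run t w) \<partial>lborel) <= liminf (%m. ?r m w)" .
 qed
 also have "... <= liminf (%m. NN w. ?r m w)" by (rule nn_integral_liminf[OF rm])
 also have "... <= liminf (%m. ennreal (v + q (real (Suc m))))"
  by (intro Liminf_mono always_eventually allI) (subst nn_run, auto intro!: ennreal_leI assms(1))
 also have "... = ennreal v"
 proof (rule lim_imp_Liminf[OF trivial_limit_sequentially])
  have "filterlim (%m. real (Suc m)) at_top sequentially"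
   using filterlim_compose[OF filterlim_real_sequentially filterlim_Suc] .
  from tendsto_add[OF tendsto_const filterlim_compose[OF assms(2) this], of v]
  show "(%m. ennreal (v + q (real (Suc m)))) ----> ennreal v" by (intro tendsto_ennrealI) simp
 qed
 finally show ?thesis .
qed

text \<open>The generator plus the source \<open>lam n cc\<close>, discounted and accumulated up to
  \<open>T\<close>: the defect of \<open>u\<close> in the equation that characterises the expected
  exponential cost. Its sign decides on which side of the cost \<open>u x\<close> lies.\<close>

definition drift :: "(real => real) => (real => real) => (real => real) => real => real" where
 "drift u u1 u2 T = (EE w. ival 0 T (%s. exp (A s w)*(ito.gen u u1 u2 s w + lam*real n*cc (X s w))))"

text \<open>Where \<open>u1\<close> is nonzero the state is below \<open>R\<close>, and this bounds
  the drift, although \<open>be\<close> itself grows with the state.\<close>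

lemma gen_bound:
 assumes tf: "test_fun a u u1 u2" and R: "\<forall>y\<ge>R. u1 y = 0"
 shows "\<exists>G. \<forall>s>0. \<forall>w\<in>space M. abs (exp (A s w)*ito.gen u u1 u2 s w) <= G"
proof -
 obtain C0 C1 C2 where Cu: "!!y. a <= y ==> abs (u y) <= C0" "!!y. a <= y ==> abs (u1 y) <= C1" "!!y. a <= y ==> abs (u2 y) <= C2"
  using tf unfolding test_fun_def by blast
 have C0: "0 <= C0" "0 <= C1" "0 <= C2" using Cu[OF order_refl] by linarith+
 define G where "G = real n*lam*C0 + C1*(bc + L*abs R) + gg^2 / 2*(C2*M1^2)"
 have "abs (exp (A s w)*ito.gen u u1 u2 s w) <= G" if s: "0 < s" "w \<in> space M" for s w
 proof -
  have X: "a <= X s w" using Xa s by simp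
  have 1: "abs (al s w*u (X s w)) <= real n*lam*C0"
   unfolding abs_mult using par by (intro mult_mono al_bounds(1) Cu X s) auto
  have 2: "abs (u1 (X s w)*be s w) <= C1*(bc + L*abs R)"
  proof (cases "R <= X s w")
   case True
   thus ?thesis using R C0 bc0 L0 by simp
  next
   case False
   have "L*X s w <= L*abs R" using False L0 by (intro mult_left_mono) auto
   hence "abs (be s w) <= bc + L*abs R" using be_le[OF s(2), of s] s(1) by linarith
   thus ?thesis unfolding abs_mult using C0 by (intro mult_mono Cu X) auto
  qed
  have H2: "(H s w)^2 <= M1^2" using HK[of s w] s M1_nonneg by (simp add: abs_le_square_iff[symmetric])
  have "abs (u2 (X s w)*(H s w)^2) <= C2*M1^2"
   unfolding abs_mult using H2 C0 by (intro mult_mono Cu X) auto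
  hence "gg^2 / 2*abs (u2 (X s w)*(H s w)^2) <= gg^2 / 2*(C2*M1^2)" by (rule mult_left_mono) simp
  hence 3: "abs (gg^2 / 2*u2 (X s w)*(H s w)^2) <= gg^2 / 2*(C2*M1^2)"
   by (simp add: abs_mult mult.assoc)
  have "abs (ito.gen u u1 u2 s w) <= G" using 1 2 3 unfolding ito.gen_def G_def by linarith
  hence "exp (A s w)*abs (ito.gen u u1 u2 s w) <= 1*G" using A_exp_le1[of w s] s by (intro mult_mono) auto
  thus ?thesis by (simp add: abs_mult)
 qed
 thus ?thesis by blast
qed

lemma run_identity:
 assumes tf: "test_fun a u u1 u2" and R: "\<forall>y\<ge>R. u1 y = 0" and T: "0 < T"
 shows "(EE w. ival 0 T (%s. run s w))
  = drift u u1 u2 T + u x - (EE w. exp (A T w)*u (X T w))"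
proof -
 let ?r = "%w. ival 0 T (%s. run s w)"
 let ?g = "%s w. exp (A s w)*ito.gen u u1 u2 s w"
 let ?G = "%w. ival 0 T (%s. ?g s w)"
 obtain G where G: "!!s w. 0 < s ==> w \<in> space M ==> abs (?g s w) <= G"
  using gen_bound[OF tf R] by blast
 note g = bounded_iterated[OF ito.gen_joint[OF tf] T G]
 note r = bounded_iterated[OF run_joint T run_bound(2)]
 have "drift u u1 u2 T = (EE w. (?G w) + (?r w))"
  unfolding drift_def
 proof (rule lint_cong[OF refl])
  fix w assume wv: "w \<in> space M"
  have "ival 0 T (%s. exp (A s w)*(ito.gen u u1 u2 s w + lam*real n*cc (X s w)))
   = (\<integral>s. indicator {0<..T} s*(?g s w) + indicator {0<..T} s*run s w \<partial>lborel)"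
   by (intro lint_cong) (simp_all add: run_def algebra_simps)
  also have "... = (?G w) + (?r w)"
   by (rule lint_add[OF g(1)[OF _ _ wv] r(1)[OF _ _ wv]])
  finally show "ival 0 T (%s. exp (A s w)*(ito.gen u u1 u2 s w + lam*real n*cc (X s w)))
   = (?G w) + (?r w)" .
 qed
 also have "... = (EE w. (?G w)) + (EE w. (?r w))"
  by (rule lint_add[OF g(2) r(2)])
 finally show ?thesis using ito.dynkin[OF tf T] by simp
qed

lemma terminal_bound:
 assumes tf: "test_fun a u u1 u2" and C: "\<forall>y\<ge>a. abs (u y) <= C" and T: "0 < T"
 shows "abs (\<integral>w. exp (A T w)*u (X T w) \<partial>M) <= exp (- (real n*(lam - l a))*T)*C"
proof -
 have C': "abs (u y) <= C" if "a <= y" for y using C that by simp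
 have b: "abs (exp (A T w)*u (X T w)) <= exp (- (real n*(lam - l a))*T)*C" if "w \<in> space M" for w
  unfolding abs_mult using A_le(1)[OF that, of T] T that by (intro mult_mono C' Xa) auto
 have "integrable M (%w. exp (A T w)*u (X T w))"
 proof (rule integrable_const_bound)
  show "AE w in M. norm (exp (A T w)*u (X T w)) <= exp (- (real n*(lam - l a))*T)*C"
   using b by (intro AE_I2) simp
  have "(%w. u (X T w)) \<in> \<B> M" using ito.u_meas(1)[OF tf, of T] T meas_M by auto
  thus "(%w. exp (A T w)*u (X T w)) \<in> \<B> M" using ito.AM[of T] T by auto
 qed
 hence "abs (\<integral>w. exp (A T w)*u (X T w) \<partial>M) <= (EE w. exp (- (real n*(lam - l a))*T)*C)"
  using b by (intro bochner_abs_le) auto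
 thus ?thesis by (simp add: prob_space)
qed

lemma terminal_vanish: "((%T. exp (- (real n*(lam - l a))*T)*C) \<longlongrightarrow> 0) at_top"
proof -
 have "0 < real n*(lam - l a)" using par l2 by simp
 hence "filterlim (%T. - (real n*(lam - l a))*T) at_bot at_top"
  by (intro filterlim_tendsto_neg_mult_at_bot[OF tendsto_const] filterlim_ident) auto
 from tendsto_mult[OF filterlim_compose[OF exp_at_bot this] tendsto_const, of C] show ?thesis by simp
qed

lemma Psi_pos: "0 <= Psi w" by (simp add: Psi_def)

text \<open>The terminal term decays at the rate \<open>n (lam - l a)\<close>, so the bound survives
  the limit in \<open>T\<close>. The allowance \<open>eps\<close> is meant for the discretisation
  error of Euler policies.\<close>

lemma value_upper:
 assumes tf: "test_fun a u u1 u2" and R: "\<forall>y\<ge>R. u1 y = 0"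
  and d: "!!T. 0 < T ==> drift u u1 u2 T <= eps" and v: "0 <= u x + eps"
 shows "integrable M Psi" "(EE w. Psi w) <= u x + eps"
proof -
 obtain C where C: "\<forall>y\<ge>a. abs (u y) <= C" using tf unfolding test_fun_def by blast
 have le: "(NN w. ennreal (Psi w)) <= ennreal (u x + eps)"
 proof (rule Psi_nn_le[OF _ terminal_vanish])
  fix T :: real assume T: "0 < T"
  show "(EE w. ival 0 T (%s. run s w)) <= u x + eps + exp (- (real n*(lam - l a))*T)*C"
   using run_identity[OF tf R T] terminal_bound[OF tf C T] d[OF T] by linarith
 qed
 show i: "integrable M Psi"
  by (rule integrableI_nonneg[OF Psi_measurable]) (use le in "auto simp: Psi_pos intro: le_less_trans[OF _ ennreal_less_top]")
 have "ennreal (EE w. Psi w) <= ennreal (u x + eps)"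
  using le nn_integral_eq_integral[OF i] by (simp add: Psi_pos)
 thus "(EE w. Psi w) <= u x + eps" using v by (simp add: ennreal_le_iff)
qed

text \<open>A constant test function has no derivative terms. Discounting at a rate of at least
  \<open>n (lam - l a)\<close> balances the largest possible source \<open>lam n exp (n rho)\<close>
  precisely for this \<open>c\<close>, which is therefore a supersolution.\<close>

lemma Psi_integrable: "integrable M Psi"
proof -
 define c where "c = lam*exp (real n*rho) / (lam - l a)"
 have c0: "0 <= c" using par l2 by (simp add: c_def)
 have nonpos: "integral\<^sup>L N h <= 0" if "!!x. x \<in> space N ==> h x <= 0" for N :: "'c measure" and h :: "'c => real"
  using integral_mono'[of N "%_. 0" h] that by simp
 have tf: "test_fun a (%_. c) (%_. 0) (%_. 0)" by (auto simp: test_fun_def uniformly_continuous_on_const)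
 show ?thesis
 proof (rule value_upper(1)[OF tf, of 0 0])
  fix T :: real assume "0 < T"
  show "drift (%_. c) (%_. 0) (%_. 0) T <= 0" unfolding drift_def
  proof (rule nonpos, rule nonpos)
   fix w s assume wv: "w \<in> space M"
   have "al s w*c <= - real n*(lam - l a)*c" using al_bounds(2)[OF wv] c0 by (rule mult_right_mono)
   also have "... = - (lam*real n*exp (real n*rho))" using l2 by (simp add: c_def)
   also have "... <= - (lam*real n*cc (X s w))" using cc_bounds(2) par by (simp add: mult_left_mono)
   finally have "al s w*c + lam*real n*cc (X s w) <= 0" by simp
   thus "indicator {0<..T} s*(exp (A s w)*(ito.gen (%_. c) (%_. 0) (%_. 0) s w + lam*real n*cc (X s w))) <= 0"
    by (simp add: ito.gen_def mult_nonneg_nonpos)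
  qed
 qed (use c0 in auto)
qed

lemma value_lower:
 assumes tf: "test_fun a u u1 u2" and R: "\<forall>y\<ge>R. u1 y = 0"
  and d: "!!T. 0 < T ==> 0 <= drift u u1 u2 T"
 shows "u x <= (EE w. Psi w)"
proof -
 obtain C where C: "\<forall>y\<ge>a. abs (u y) <= C" using tf unfolding test_fun_def by blast
 have P0: "0 <= (EE w. Psi w)" by (simp add: Psi_pos)
 have le: "u x - exp (- (real n*(lam - l a))*T)*C <= (EE w. Psi w)" if T: "0 < T" for T
 proof -
  have "ennreal (EE w. ival 0 T (%s. run s w)) <= (NN w. ennreal (Psi w))"
   unfolding nn_Psi run_def[symmetric] nn_run[OF T, symmetric]
   by (intro nn_integral_mono) (auto simp: indicator_def)
  also have "... = ennreal (EE w. Psi w)"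
   using nn_integral_eq_integral[OF Psi_integrable] by (simp add: Psi_pos)
  finally have "(EE w. ival 0 T (%s. run s w)) <= (EE w. Psi w)" using P0 by (simp add: ennreal_le_iff)
  thus ?thesis using run_identity[OF tf R T] terminal_bound[OF tf C T] d[OF T] by linarith
 qed
 have "((%T. u x - exp (- (real n*(lam - l a))*T)*C) \<longlongrightarrow> u x - 0) at_top"
  by (intro tendsto_diff tendsto_const terminal_vanish)
 from tendsto_le[OF _ tendsto_const this] show ?thesis
  using le by (simp add: eventually_at_top_dense) (metis less_trans gt_ex linorder_not_less not_less_iff_gr_or_eq)
qed

lemma Psi_ge: "w \<in> space M ==> 0 <= D w ==> cc (X (D w) w) <= Psi w"
 using A_le(2)[of w "D w"] cc_bounds(1)[of "X (D w) w"] by (simp add: Psi_eq Phi_def max_absorb2 mult.commute)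

lemma Psi_expectation_ge:
 assumes "!!t w. w \<in> space M ==> 0 <= t ==> v <= cc (X t w)"
 shows "v <= (EE w. Psi w)"
proof -
 have "(EE w. v) <= (EE w. Psi w)" using D_nonneg AE_space
  by (intro integral_mono_AE Psi_integrable integrable_const) (auto elim!: eventually_elim2 intro: order_trans[OF assms Psi_ge])
 thus ?thesis by (simp add: prob_space)
qed

lemma cost_nonneg: "0 <= cost a rho l M n D W"
proof -
 have "1 <= (EE w. Psi w)" by (rule Psi_expectation_ge) (rule cc_bounds)
 thus ?thesis unfolding cost_eq using par by simp
qed

lemma cost_at_a:
 assumes "x = a"
 shows "rho <= cost a rho l M n D W"
proof -
 have "exp (real n*rho) <= (EE w. Psi w)"
 proof (rule Psi_expectation_ge)
  fix t w assume wv: "w \<in> space M" "0 <= (t::real)"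
  have "tau w <= ereal 0" using X_eq_a_iff[OF wv(1) order_refl] X0[OF wv(1)] assms by simp
  hence "tau w <= ereal t" using wv(2) by (auto intro: order_trans)
  thus "exp (real n*rho) <= cc (X t w)" using X_eq_a_iff[OF wv] by (simp add: cc_def)
 qed
 hence "real n*rho <= ln (EE w. Psi w)" by (subst ln_ge_iff) (auto intro: less_le_trans[OF exp_gt_zero])
 thus ?thesis unfolding cost_eq using par by (simp add: field_simps)
qed

end

section \<open>Integral equations with additive forcing\<close>

fun picard :: "(real => real) => (real => real) => nat => real => real" where
 "picard h f 0 t = f t"
| "picard h f (Suc m) t = f t - integral {0..t} (%s. h (picard h f m s))"

text \<open>Solves \<open>y t = f t - integral {0..t} (%s. h (y s))\<close> for a continuous forcing
  \<open>f\<close>. It is an explicit limit of Picard iterates rather than a chosen solution, so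
  that causality and measurability in \<open>f\<close> are inherited from the iterates.\<close>

definition ode_sol :: "(real => real) => (real => real) => real => real" where
 "ode_sol h f t = lim (%m. picard h f m t)"

lemma continuous_on_halfline:
 fixes f :: "real => 'b::topological_space"
 assumes "!!T. 0 <= T ==> continuous_on {0..T} f"
 shows "continuous_on {0..} f" unfolding continuous_on_eq_continuous_within
proof
 fix t :: real assume t: "t \<in> {0..}"
 have "continuous (at t within {0..t + 1}) f"
  using assms[of "t + 1"] t by (auto simp: continuous_on_eq_continuous_within)
 moreover have "at t within {0..} = at t within {0..t + 1}" by (rule at_within_nhd[of _ "{..<t + 1}"]) auto
 ultimately show "continuous (at t within {0..}) f" by simp
qed

lemma integral_continuous_halfline:
 fixes g :: "real => real"
 assumes "continuous_on {0..} g"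
 shows "continuous_on {0..} (%t. integral {0..t} g)"
 by (rule continuous_on_halfline, rule indefinite_integral_continuous_1,
   rule integrable_continuous_interval, rule continuous_on_subset[OF assms]) auto

section \<open>Euler policies\<close>

locale lipschitz_ode =
 fixes h :: "real => real" and L :: real
 assumes hL: "L-lipschitz_on UNIV h"
begin

lemma L0: "0 <= L" using hL by (rule lipschitz_on_nonneg)

lemma h_cont: "continuous_on UNIV h" using hL by (rule lipschitz_on_continuous_on)

lemma picard_cont:
 assumes "continuous_on {0..} f"
 shows "continuous_on {0..} (picard h f m)"
proof (induction m)
 case 0
 thus ?case using assms by (subst continuous_on_cong[OF refl picard.simps(1)]) auto
next
 case (Suc m)
 have "continuous_on {0..} (%s. h (picard h f m s))" by (rule continuous_on_compose2[OF h_cont Suc]) auto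
 hence "continuous_on {0..} (%t. f t - integral {0..t} (%s. h (picard h f m s)))"
  by (intro continuous_on_diff assms integral_continuous_halfline)
 thus ?case by (simp cong: continuous_on_cong)
qed

lemma hp_integrable:
 fixes g :: "real => real"
 assumes "continuous_on {0..} g"
 shows "(%s. h (g s)) integrable_on {0..t}"
proof (rule integrable_continuous_interval)
 show "continuous_on {0..t} (%s. h (g s))"
  by (rule continuous_on_compose2[OF h_cont continuous_on_subset[OF assms]]) auto
qed

text \<open>Each step integrates the previous bound and multiplies it by the Lipschitz constant,
  which builds up the terms of the exponential series.\<close>

lemma picard_step:
 assumes f: "continuous_on {0..} f" and C: "!!t. 0 <= t ==> t <= T ==> abs (integral {0..t} (%s. h (f s))) <= C"
  and "0 <= t" "t <= T"
 shows "abs (picard h f (Suc m) t - picard h f m t) <= C*(L*t) ^ m / fact m" using assms(3,4)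
proof (induction m arbitrary: t)
 case 0
 thus ?case using C by simp
next
 case (Suc m)
 have c: "continuous_on {0..} (picard h f m)" "continuous_on {0..} (picard h f (Suc m))"
  using picard_cont[OF f] by blast+
 let ?q = "%s. C*(L * s) ^ m / fact m"
 have "picard h f (Suc (Suc m)) t - picard h f (Suc m) t = integral {0..t} (%s. h (picard h f m s) - h (picard h f (Suc m) s))"
  using hp_integrable[OF c(1)] hp_integrable[OF c(2)] by (simp add: integral_diff del: picard.simps) (simp add: integral_diff)
 also have "norm ... <= integral {0..t} (%s. L*(?q s))"
 proof (rule integral_norm_bound_integral)
  show "(%s. h (picard h f m s) - h (picard h f (Suc m) s)) integrable_on {0..t}"
   by (intro integrable_diff hp_integrable c)
  show "(%s. L*(?q s)) integrable_on {0..t}"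
   by (intro integrable_continuous_interval continuous_intros) auto
  fix s assume s: "s \<in> {0..t}"
  have "abs (h (picard h f m s) - h (picard h f (Suc m) s)) <= L*abs (picard h f m s - picard h f (Suc m) s)"
   using lipschitz_onD[OF hL, of "picard h f m s" "picard h f (Suc m) s"] by (simp add: dist_real_def del: picard.simps)
  also have "... <= L*(?q s)"
   using Suc.IH[of s] s Suc.prems L0 by (intro mult_left_mono) (auto simp: abs_minus_commute simp del: picard.simps)
  finally show "norm (h (picard h f m s) - h (picard h f (Suc m) s)) <= L*(?q s)" by simp
 qed
 also have "integral {0..t} (%s. L*(?q s)) = C*(L*t) ^ Suc m / fact (Suc m)"
 proof (rule integral_unique)
  have "((%s. L*(?q s)) has_integral (C*(L*t) ^ Suc m / fact (Suc m) - C*(L*0) ^ Suc m / fact (Suc m))) {0..t}"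
  proof (rule fundamental_theorem_of_calculus)
   fix s assume "s \<in> {0..t}"
   have "((%s. C*(L * s) ^ Suc m / fact (Suc m)) has_real_derivative L*(?q s)) (at s within {0..t})"
   proof -
    have "((%s. k * s ^ Suc m) has_real_derivative k*(real (Suc m) * s ^ m)) (at s within {0..t})" for k
     by (rule derivative_eq_intros refl | simp del: power_Suc of_nat_Suc)+
    note this[of "C*L ^ Suc m / fact (Suc m)"]
    moreover have "(%s. (C*L ^ Suc m / fact (Suc m)) * s ^ Suc m) = (%s. C*(L * s) ^ Suc m / fact (Suc m))"
     by (simp only: power_mult_distrib times_divide_eq_left mult.assoc)
    moreover have "(C*L ^ Suc m / fact (Suc m))*(real (Suc m) * s ^ m) = L*(?q s)"
     by (simp add: fact_Suc power_mult_distrib del: of_nat_Suc)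
    ultimately show ?thesis by metis
   qed
   thus "((%s. C*(L * s) ^ Suc m / fact (Suc m)) has_vector_derivative L*(?q s)) (at s within {0..t})"
    by (simp add: has_real_derivative_iff_has_vector_derivative)
  qed (use Suc.prems in auto)
  thus "((%s. L*(?q s)) has_integral C*(L*t) ^ Suc m / fact (Suc m)) {0..t}" by simp
 qed
 finally show ?case by simp
qed

lemma picard_uniform:
 assumes f: "continuous_on {0..} f" and T: "0 <= T"
 shows "uniform_limit {0..T} (picard h f) (ode_sol h f) sequentially"
proof -
 have "continuous_on {0..T} (%t. integral {0..t} (%s. h (f s)))"
  by (rule continuous_on_subset[OF integral_continuous_halfline[OF continuous_on_compose2[OF h_cont f]]]) auto
 hence "bounded ((%t. integral {0..t} (%s. h (f s))) ` {0..T})"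
  by (intro compact_imp_bounded compact_continuous_image) auto
 then obtain C where "\<forall>t\<in>{0..T}. abs (integral {0..t} (%s. h (f s))) <= C"
  by (auto simp: bounded_iff)
 hence C: "abs (integral {0..t} (%s. h (f s))) <= C" if "0 <= t" "t <= T" for t using that by simp
 have C0: "0 <= C" using C[of 0] T by simp
 define d where "d m t = picard h f (Suc m) t - picard h f m t" for m t
 have "uniform_limit {0..T} (%n t. \<Sum>i<n. d i t) (%t. suminf (%i. d i t)) sequentially"
 proof (rule Weierstrass_m_test)
  show "summable (%m. C*(L*T) ^ m / fact m)"
   using summable_mult[OF summable_exp[of "L*T"], of C] by (simp add: field_simps)
  fix m t assume t: "t \<in> {0..T}"
  have "abs (d m t) <= C*(L*t) ^ m / fact m" unfolding d_def using picard_step[OF f C] t by simp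
  also have "... <= C*(L*T) ^ m / fact m"
   using t L0 C0 by (intro divide_right_mono mult_left_mono power_mono) auto
  finally show "norm (d m t) <= C*(L*T) ^ m / fact m" by simp
 qed
 hence "uniform_limit {0..T} (%n t. f t + (\<Sum>i<n. d i t)) (%t. f t + suminf (%i. d i t)) sequentially"
  by (intro uniform_limit_add uniform_limit_const)
 moreover have "f t + (\<Sum>i<n. d i t) = picard h f n t" for n t
  using sum_lessThan_telescope[of "%m. picard h f m t" n] unfolding d_def by (simp del: picard.simps(2))
 ultimately have u: "uniform_limit {0..T} (picard h f) (%t. f t + suminf (%i. d i t)) sequentially" by simp
 have "f t + suminf (%i. d i t) = ode_sol h f t" if "t \<in> {0..T}" for t
  using tendsto_uniform_limitI[OF u that] unfolding ode_sol_def by (simp add: limI)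
 thus ?thesis using u by (rule_tac uniform_limit_cong'[THEN iffD1, OF _ _ u]) auto
qed

lemma ode_sol_tendsto:
 assumes "continuous_on {0..} f" "0 <= t"
 shows "(%m. picard h f m t) ----> ode_sol h f t"
 using tendsto_uniform_limitI[OF picard_uniform[OF assms], of t] assms(2) by simp

lemma ode_sol_cont:
 assumes "continuous_on {0..} f"
 shows "continuous_on {0..} (ode_sol h f)"
proof (rule continuous_on_halfline)
 fix T :: real assume T: "0 <= T"
 show "continuous_on {0..T} (ode_sol h f)"
 proof (rule uniform_limit_theorem[OF _ picard_uniform[OF assms T]])
  show "\<forall>\<^sub>F n in sequentially. continuous_on {0..T} (picard h f n)"
   by (intro always_eventually allI continuous_on_subset[OF picard_cont[OF assms]]) auto
 qed simp
qed

lemma ode_sol_eq: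
 assumes f: "continuous_on {0..} f" and t: "0 <= t"
 shows "ode_sol h f t = f t - integral {0..t} (%s. h (ode_sol h f s))"
proof -
 have uc: "uniformly_continuous_on UNIV h" using hL by (rule lipschitz_on_uniformly_continuous)
 have ul: "uniform_limit {0..t} (%m s. h (picard h f m s)) (%s. h (ode_sol h f s)) sequentially"
  by (rule uniform_limit_compose_uniformly_continuous_on[OF picard_uniform[OF f t] uc]) auto
 have cm: "continuous_on {0..t} (%s. h (picard h f m s))" for m
  by (rule continuous_on_compose2[OF h_cont continuous_on_subset[OF picard_cont[OF f]]]) auto
 obtain I J where I: "!!m. ((%s. h (picard h f m s)) has_integral I m) {0..t}"
  "((%s. h (ode_sol h f s)) has_integral J) {0..t}" "(I \<longlongrightarrow> J) sequentially"
  by (rule uniform_limit_integral[OF ul cm]) auto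
 have "(%m. f t - I m) ----> f t - J" by (intro tendsto_intros I)
 moreover have "f t - I m = picard h f (Suc m) t" for m using integral_unique[OF I(1)] by simp
 ultimately have "(%m. picard h f (Suc m) t) ----> f t - J" by simp
 moreover have "(%m. picard h f (Suc m) t) ----> ode_sol h f t" using LIMSEQ_Suc[OF ode_sol_tendsto[OF f t]] .
 ultimately show ?thesis using LIMSEQ_unique integral_unique[OF I(2)] by blast
qed

lemma ode_sol_causal:
 assumes "!!s. 0 <= s ==> s <= t ==> f s = f' s" "0 <= t"
 shows "ode_sol h f t = ode_sol h f' t"
proof -
 have "picard h f m s = picard h f' m s" if "0 <= s" "s <= t" for m s using that
 proof (induction m arbitrary: s)
  case (Suc m)
  have "integral {0..s} (%r. h (picard h f m r)) = integral {0..s} (%r. h (picard h f' m r))"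
   by (rule integral_cong) (use Suc in auto)
  thus ?case using assms(1) Suc.prems by simp
 qed (use assms in auto)
 thus ?thesis using assms(2) by (simp add: ode_sol_def)
qed

text \<open>By induction each Picard iterate at time \<open>s\<close> is a measurable function of
  the forcing up to \<open>s\<close>; clamping the integration variable to \<open>[0, s]\<close>
  keeps later values out.\<close>

lemma ode_sol_measurable:
 fixes f :: "'b => real => real"
 assumes fm: "!!s. 0 <= s ==> s <= t ==> (%w. f w s) \<in> \<B> N"
  and fc: "!!w. w \<in> space N ==> continuous_on {0..} (f w)" and t: "0 <= t"
 shows "(%w. ode_sol h (f w) t) \<in> \<B> N"
proof (rule borel_measurable_LIMSEQ_real)
 have *: "(%w. picard h (f w) m s) \<in> \<B> N" if "0 <= s" "s <= t" for m s using that
 proof (induction m arbitrary: s)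
  case 0
  thus ?case using fm by simp
 next
  case (Suc m)
  let ?Y = "%r w. picard h (f w) m (max 0 (min s r))"
  have "(%(w, r). ?Y r w) \<in> \<B> (N \<Otimes>\<^sub>M lborel)"
  proof (rule continuous_joint_measurable)
   show "?Y r \<in> \<B> N" for r using Suc by auto
   fix w assume "w \<in> space N"
   thus "continuous_on UNIV (%r. ?Y r w)"
    by (intro continuous_on_compose2[OF picard_cont[OF fc]] continuous_on_max continuous_on_min continuous_on_const continuous_on_id) auto
  qed
  hence "(%x. ?Y (snd x) (fst x)) \<in> \<B> (N \<Otimes>\<^sub>M lborel)" by (simp add: case_prod_beta')
  hence "(%x. h (?Y (snd x) (fst x))) \<in> \<B> (N \<Otimes>\<^sub>M lborel)"
   using borel_measurable_continuous_on[OF h_cont] by blast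
  hence "(%(w, r). indicator {0<..s} r*h (?Y r w)) \<in> \<B> (N \<Otimes>\<^sub>M lborel)"
   unfolding case_prod_beta' by measurable
  hence m: "(%w. ival 0 s (%r. h (?Y r w))) \<in> \<B> N" by (rule lborel.borel_measurable_lebesgue_integral)
  have "ival 0 s (%r. h (?Y r w)) = integral {0..s} (%r. h (picard h (f w) m r))" if "w \<in> space N" for w
  proof -
   have c: "continuous_on {0..} (%r. h (picard h (f w) m r))"
    by (rule continuous_on_compose2[OF h_cont picard_cont[OF fc[OF that]]]) auto
   have "ival 0 s (%r. h (?Y r w)) = ival 0 s (%r. h (picard h (f w) m r))"
    by (intro lint_cong refl) (auto simp: indicator_def min_def)
   thus ?thesis using lborel_integral_continuous(2)[OF c order_refl, of s] Suc.prems by simp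
  qed
  hence "(%w. integral {0..s} (%r. h (picard h (f w) m r))) \<in> \<B> N"
   using m by (subst measurable_cong[where g = "%w. ival 0 s (%r. h (?Y r w))"]) auto
  thus ?case using fm[OF Suc.prems] by simp
 qed
 show "(%w. picard h (f w) m t) \<in> \<B> N" for m using*t by simp
 show "(%m. picard h (f w) m t) ----> ode_sol h (f w) t" if "w \<in> space N" for w
  by (rule ode_sol_tendsto[OF fc[OF that] t])
qed

end

text \<open>Bounded fourth moments make the squares uniformly integrable. Concretely, dominated
  convergence handles the squared difference truncated at \<open>c\<close>; where it exceeds
  \<open>c\<close> it is at most its own square divided by \<open>c\<close>, which the fourth
  moments control.\<close>

lemma (in prob_space) L2_from_AE:
 fixes f :: "nat => 'a => real"
 assumes [measurable]: "!!j. f j \<in> \<B> M" "g \<in> \<B> M"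
  and lim: "AE w in M. (%j. f j w) ----> g w"
  and f4: "!!j. integrable M (%w. f j w^4)" "!!j. (EE w. f j w^4) <= C"
 shows "(%j. NN w. ennreal ((f j w - g w)^2)) ----> 0"
proof -
 let ?d = "%j w. (f j w - g w)^2"
 have C0: "0 <= C" using f4(2)[of 0] by (rule order_trans[rotated]) simp
 note gi = fourth_moment_limit(1)[OF assms] and g4 = fourth_moment_limit(2)[OF assms]
 have i2: "integrable M (%w. ?d j w)" for j
 proof (rule int_bound[where f = "%w. 2*(f j w)^2 + 2*(g w)^2"])
  show "integrable M (%w. 2*(f j w)^2 + 2*(g w)^2)"
   using prob_space_power_integrable[OF prob_space_axioms _ f4(1)[of j], of 2] prob_space_power_integrable[OF prob_space_axioms _ gi, of 2] by simp
  show "AE w in M. norm (?d j w) <= norm (2*(f j w)^2 + 2*(g w)^2)"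
   using square_sum_le[of "f j _" "- g _"] by (intro AE_I2) simp
 qed simp
 have "(%j. EE w. ?d j w) ----> 0"
 proof (rule LIMSEQ_I)
  fix d :: real assume d: "0 < d"
  \<comment> \<open>Chosen to make the tail \<open>8 / c * (C + C)\<close> at most
    \<open>d / 2\<close>.\<close>
  define c where "c = 32*(C + 1) / d"
  have c0: "0 < c" using C0 d by (simp add: c_def)
  have "(%j. EE w. min (?d j w) c) ----> (EE w. 0)"
  proof (rule integral_dominated_convergence[where w = "%_. c"])
   show "AE w in M. (%j. min (?d j w) c) ----> 0" using lim
   proof eventually_elim
    case (elim w)
    have "(%j. min (?d j w) c) ----> min ((g w - g w)^2) c" by (intro tendsto_intros elim)
    thus ?case using c0 by simp
   qed
   show "AE w in M. norm (min (?d j w) c) <= c" for j using c0 by (intro AE_I2) (simp add: abs_le_iff min_le_iff_disj)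
  qed auto
  hence "(%j. EE w. min (?d j w) c) ----> 0" by simp
  from LIMSEQ_D[OF this, of "d / 2"] d obtain j0 where
   j0: "!!j. j0 <= j ==> abs (\<integral>w. min (?d j w) c \<partial>M) < d / 2" by auto
  have "norm ((EE w. ?d j w) - 0) < d" if j: "j0 <= j" for j
  proof -
   have mi: "integrable M (%w. min (?d j w) c)"
    by (rule integrable_const_bound[where B = c]) (use c0 in "auto intro!: AE_I2 simp: abs_le_iff min_le_iff_disj")
   have pt: "?d j w <= min (?d j w) c + 8 / c*(f j w^4 + g w^4)" for w
   proof (cases "?d j w <= c")
    case True
    thus ?thesis using c0 by (simp add: min_absorb1)
   next
    case False
    let ?h = "?d j w"
    have h2: "?h <= 2*(f j w)^2 + 2*(g w)^2" using square_sum_le[of "f j w" "- g w"] by simp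
    have "?h * ?h <= (2*(f j w)^2 + 2*(g w)^2)^2"
     unfolding power2_eq_square[of "2*(f j w)^2 + 2*(g w)^2"] using h2 by (intro mult_mono) auto
    also have "... <= 2*(2*(f j w)^2)^2 + 2*(2*(g w)^2)^2" by (rule square_sum_le)
    also have "... = 8*(f j w^4 + g w^4)" by (simp add: power2_eq_square power4_eq_xxxx)
    finally have hh: "?h * ?h <= 8*(f j w^4 + g w^4)" .
    have "c * ?h <= ?h * ?h" using False by (intro mult_right_mono) auto
    hence "?h <= 8 / c*(f j w^4 + g w^4)" using hh c0 by (simp add: field_simps)
    thus ?thesis using c0 False by simp
   qed
   have "(EE w. ?d j w) <= (EE w. min (?d j w) c + 8 / c*(f j w^4 + g w^4))"
    using mi f4(1) gi by (intro integral_mono i2 pt) auto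
   also have "... = (EE w. min (?d j w) c) + 8 / c*((EE w. f j w^4) + (EE w. g w^4))"
    using mi f4(1) gi by simp
   also have "... < d / 2 + 8 / c*(C + C)"
    using j0[OF j] f4(2)[of j] g4 c0 by (intro add_less_le_mono mult_left_mono add_mono) auto
   also have "... <= d"
   proof -
    have "8 / c*(C + C) = d / 2*(C / (C + 1))" using C0 d by (simp add: c_def field_simps)
    also have "... <= d / 2*1" using C0 d by (intro mult_left_mono) auto
    finally show ?thesis by simp
   qed
   finally show ?thesis by simp
  qed
  thus "\<exists>j0. \<forall>j\<ge>j0. norm ((EE w. ?d j w) - 0) < d" by blast
 qed
 hence "(%j. ennreal (EE w. ?d j w)) ----> ennreal 0" by (rule tendsto_ennrealI)
 thus ?thesis using i2 by (simp add: nn_integral_eq_integral)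
qed

lemma grid_cell_unique:
 assumes "0 < (d::real)" "real m*d < t" "t <= real (Suc m)*d"
 shows "nat \<lceil>t / d\<rceil> - 1 = m"
proof -
 have "real m < t / d" "t / d <= real (Suc m)" using assms by (auto simp: field_simps)
 hence "\<lceil>t / d\<rceil> = int (Suc m)" by (intro ceiling_unique) auto
 thus ?thesis by simp
qed

lemma indicator_telescope:
 fixes phi :: "nat => real"
 assumes "!!i. i < k ==> Q i \<longleftrightarrow> i < q" "q <= k"
 shows "(\<Sum>i<k. (if Q i then phi (Suc i) - phi i else 0)) = phi q - phi 0"
proof -
 have "(\<Sum>i<k. (if Q i then phi (Suc i) - phi i else 0)) = (\<Sum>i<k. if i < q then phi (Suc i) - phi i else 0)"
  by (intro sum.cong) (use assms(1) in auto)
 also have "... = (\<Sum>i<q. phi (Suc i) - phi i)" using assms(2) by (intro sum.mono_neutral_cong_right) auto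
 also have "... = phi q - phi 0" by (rule sum_lessThan_telescope)
 finally show ?thesis .
qed

text \<open>\<open>null_F\<close> puts all null sets into every \<open>F t\<close>, so that paths of
  \<open>B\<close> can be altered on a null set without losing adaptedness.\<close>

locale euler = brownian M F B for M :: "'w measure" and F B +
 fixes mu r sig a M1 L :: real and e pol :: "real => real" and n :: nat and x de :: real
 assumes null_F: "!!t N. N \<in> null_sets M ==> N \<in> sets (F t)"
  and ax: "a <= x" and eL: "L-lipschitz_on {a..} e" and polm: "pol \<in> \<B> borel"
  and polb: "!!y. abs (pol y) <= M1" and de: "0 < de"
begin

text \<open>Continued constantly below \<open>a\<close>, the function \<open>e\<close> becomes
  Lipschitz on the whole line, and the equation has a solution for all times, also past the hitting
  time.\<close>

definition h :: "real => real" where "h y = e (max a y)"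

lemma h_lip: "L-lipschitz_on UNIV h"
proof (rule lipschitz_onI)
 fix y z :: real
 have "dist (h y) (h z) <= L*dist (max a y) (max a z)" unfolding h_def by (rule lipschitz_onD[OF eL]) auto
 also have "... <= L*dist y z"
  using lipschitz_on_nonneg[OF eL] by (intro mult_left_mono) (auto simp: dist_real_def max_def)
 finally show "dist (h y) (h z) <= L*dist y z" .
qed (rule lipschitz_on_nonneg[OF eL])

sublocale ode: lipschitz_ode h L by unfold_locales (rule h_lip)

text \<open>A null set outside of which the paths are continuous, fixed by choice because the almost
  sure statement names none.\<close>

definition bad :: "'w set" where
 "bad = (SOME N. N \<in> null_sets M \<and> (\<forall>w\<in>space M - N. continuous_on {0..} (%t. B t w)))"

definition Bc :: "real => 'w => real" where "Bc t w = (if w \<in> bad then 0 else B t w)"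

lemma bad: "bad \<in> null_sets M" "!!w. w \<in> space M ==> w \<notin> bad ==> continuous_on {0..} (%t. B t w)"
proof -
 have "AE w in M. continuous_on {0..} (%t. B t w)" using bm by (simp add: brownian_motion_def)
 then obtain N where "N \<in> null_sets M" "{w \<in> space M. \<not> continuous_on {0..} (%t. B t w)} \<subseteq> N"
  by (auto simp: eventually_ae_filter)
 hence "\<exists>N. N \<in> null_sets M \<and> (\<forall>w\<in>space M - N. continuous_on {0..} (%t. B t w))" by blast
 from someI_ex[OF this] show "bad \<in> null_sets M" "!!w. w \<in> space M ==> w \<notin> bad ==> continuous_on {0..} (%t. B t w)"
  unfolding bad_def by auto
qed

lemma AE_good: "AE w in M. w \<notin> bad" using bad(1) by (rule AE_not_in)

lemma Bc_cont: "w \<in> space M ==> continuous_on {0..} (%t. Bc t w)"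
 using bad(2)[of w] by (cases "w \<in> bad") (auto simp: Bc_def)

lemma Bc_meas: "0 <= t ==> t <= u ==> Bc t \<in> \<B> (F u)"
proof -
 assume t: "0 <= t" "t <= u"
 have [measurable]: "B t \<in> \<B> (F u)" using B_meas t by simp
 have "bad \<inter> space (F u) = bad" using null_setsD2[OF bad(1)] sets.sets_into_space by auto
 hence [measurable]: "Measurable.pred (F u) (%w. w \<in> bad)"
  using null_F[OF bad(1), of u] by (simp add: pred_def Collect_conj_eq Int_commute cong: conj_cong)
 show ?thesis unfolding Bc_def[abs_def] by measurable
qed

definition g :: real where "g = 1 / sqrt (real n) * sig"

definition tk :: "nat => real" where "tk k = real k*de"

text \<open>The forcing of the integral equation once the controls of the first \<open>k\<close>
  cells are fixed. The control of the next cell is read off from the solution at \<open>tk k\<close>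
  under the forcing built so far; it multiplies time and noise increments that do not involve the
  state, so the whole wealth path is a single \<open>ode_sol\<close>.\<close>

primrec forc :: "nat => 'w => real => real" where
 "forc 0 = (%w t. x)"
| "forc (Suc k) = (%w t. forc k w t + pol (ode_sol h (forc k w) (tk k)) *
  ((mu - r)*(min t (tk (Suc k)) - min t (tk k)) + g*(Bc (min t (tk (Suc k))) w - Bc (min t (tk k)) w)))"

definition P :: "nat => 'w => real" where "P k w = pol (ode_sol h (forc k w) (tk k))"

definition S :: "nat => real => 'w => real" where
 "S k t w = (\<Sum>j<k. P j w*(Bc (min t (tk (Suc j))) w - Bc (min t (tk j)) w))"

definition Q :: "nat => real => 'w => real" where
 "Q k t w = (\<Sum>j<k. P j w*(min t (tk (Suc j)) - min t (tk j)))"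

definition cells :: "real => nat" where "cells t = nat \<lceil>t / de\<rceil>"

definition N :: "real => 'w => real" where "N t w = S (cells t) t w"

definition W :: "real => 'w => real" where "W t w = ode_sol h (forc (cells t) w) t"

definition p :: "real => 'w => real" where "p t w = P (cells t - 1) w"

lemma forc_eq: "forc k w t = x + (mu - r)*Q k t w + g*S k t w"
 by (induction k) (simp_all add: Q_def S_def P_def algebra_simps)

lemma tk: "0 <= tk k" "tk k <= tk (Suc k)" "tk 0 = 0" "tk (Suc k) = tk k + de"
 using de by (auto simp: tk_def algebra_simps)

lemma tk_mono: "j <= k ==> tk j <= tk k"
 using de by (simp add: tk_def mult_right_mono)

lemma cells_ge: "t <= tk (cells t)"
proof -
 have "t / de <= real (cells t)" unfolding cells_def by linarith
 thus ?thesis using de by (simp add: tk_def field_simps)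
qed

lemma cells_mono: "s <= t ==> cells s <= cells t"
 unfolding cells_def using de by (intro nat_mono ceiling_mono divide_right_mono) auto

text \<open>Cells that start at or after \<open>t\<close> contribute 0, since both of their ends are
  cut at \<open>t\<close>. So any number of cells that reaches up to \<open>t\<close> gives the same
  values.\<close>

lemma stable:
 assumes "t <= tk k" "k <= k'"
 shows "S k' t w = S k t w" "Q k' t w = Q k t w"
proof -
 have z: "min t (tk j) = t" if "k <= j" for j using assms(1) tk_mono[OF that] by simp
 have *: "(\<Sum>j<k'. f j) = (\<Sum>j<k. f j)" if "!!j. k <= j ==> f j = 0" for f :: "nat => real"
  using assms(2) that by (intro sum.mono_neutral_right) auto
 show "S k' t w = S k t w" "Q k' t w = Q k t w" unfolding S_def Q_def by (rule *, simp add: z)+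
qed

lemma stable2:
 assumes "t <= tk k" "t <= tk k'"
 shows "S k' t w = S k t w" (is ?th1) "Q k' t w = Q k t w" (is ?th2) "forc k' w t = forc k w t"
proof -
 have 1: ?th1 ?th2
 proof -
  show ?th1
   by (cases "k <= k'") (metis stable(1) assms(1), metis stable(1) assms(2) nat_le_linear)
  show ?th2
   by (cases "k <= k'") (metis stable(2) assms(1), metis stable(2) assms(2) nat_le_linear)
 qed
 thus ?th1 ?th2 by -
 show "forc k' w t = forc k w t" unfolding forc_eq using 1 by simp
qed

lemma N_eq: "t <= tk k ==> N t w = S k t w"
 unfolding N_def by (rule stable2(1)[OF _ cells_ge])

lemma W_eq:
 assumes "0 <= t" "t <= tk k"
 shows "W t w = ode_sol h (forc k w) t" unfolding W_def
proof (rule ode.ode_sol_causal[OF _ assms(1)])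
 fix s assume "0 <= s" "s <= t"
 thus "forc (cells t) w s = forc k w s" using assms cells_ge[of t] by (intro stable2) auto
qed

lemma S_cont:
 assumes "w \<in> space M"
 shows "continuous_on {0..} (%t. S k t w)" (is ?th1) "continuous_on {0..} (%t. Q k t w)" (is ?th2) "continuous_on {0..} (forc k w)" (is ?th3)
proof -
 have c: "continuous_on {0..} (%t. Bc (min t (tk j)) w)" for j
  by (rule continuous_on_compose2[OF Bc_cont[OF assms]]) (use tk(1)[of j] in "auto intro!: continuous_on_min")
 show 1: ?th1 unfolding S_def by (intro continuous_intros c)
 show 2: ?th2 unfolding Q_def by (intro continuous_intros)
 have "forc k w = (%t. x + (mu - r)*Q k t w + g*S k t w)" by (rule ext, rule forc_eq)
 moreover have "continuous_on {0..} (%t. x + (mu - r)*Q k t w + g*S k t w)"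
  by (intro continuous_intros 1 2)
 ultimately show ?th3 by simp
qed

lemma W_cont:
 assumes "w \<in> space M"
 shows "continuous_on {0..} (%t. W t w)"
proof (rule continuous_on_halfline)
 fix T :: real assume "0 <= T"
 have "continuous_on {0..T} (ode_sol h (forc (cells T) w))"
  by (rule continuous_on_subset[OF ode.ode_sol_cont[OF S_cont(3)[OF assms]]]) auto
 thus "continuous_on {0..T} (%t. W t w)"
 proof (rule continuous_on_eq)
  show "ode_sol h (forc (cells T) w) t = W t w" if "t \<in> {0..T}" for t
   using that cells_ge[of T] by (intro W_eq[symmetric]) auto
 qed
qed

lemma N_cont:
 assumes "w \<in> space M"
 shows "continuous_on {0..} (%t. N t w)"
proof (rule continuous_on_halfline)
 fix T :: real assume "0 <= T"
 have "continuous_on {0..T} (%t. S (cells T) t w)" by (rule continuous_on_subset[OF S_cont(1)[OF assms]]) auto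
 thus "continuous_on {0..T} (%t. N t w)"
 proof (rule continuous_on_eq)
  show "S (cells T) t w = N t w" if "t \<in> {0..T}" for t
   using that cells_ge[of T] by (intro N_eq[symmetric]) auto
 qed
qed

text \<open>The two claims are coupled: \<open>P k\<close> is a function of the solution under
  \<open>forc k\<close>, and \<open>forc (Suc k)\<close> contains \<open>P k\<close>. At times
  before \<open>tk k\<close> the new summand is 0, so \<open>P k\<close> enters only once it is
  known.\<close>

lemma adapted_forc: "(\<forall>t\<ge>0. (%w. forc k w t) \<in> \<B> (F t)) \<and> P k \<in> \<B> (F (tk k))"
proof (induction k)
 case 0
 have "(%w. ode_sol h (forc 0 w) (tk 0)) \<in> \<B> (F (tk 0))"
  by (rule ode.ode_sol_measurable) (use tk in auto)
 thus ?case using polm unfolding P_def[abs_def] by (auto intro: measurable_compose)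
next
 case (Suc k)
 have 1: "(%w. forc (Suc k) w t) \<in> \<B> (F t)" if t: "0 <= t" for t
 proof -
  have b: "Bc (min t (tk j)) \<in> \<B> (F t)" for j using tk(1) t by (intro Bc_meas) auto
  have f: "(%w. forc k w t) \<in> \<B> (F t)" using Suc t by simp
  show ?thesis
  proof (cases "tk k <= t")
   case True
   hence "P k \<in> \<B> (F t)" using Suc meas_mono by blast
   thus ?thesis using b f unfolding forc.simps P_def[abs_def] by measurable
  next
   case False
   hence "min t (tk (Suc k)) = t" "min t (tk k) = t" using tk(2)[of k] by auto
   thus ?thesis using f by simp
  qed
 qed
 have "(%w. ode_sol h (forc (Suc k) w) (tk (Suc k))) \<in> \<B> (F (tk (Suc k)))"
 proof (rule ode.ode_sol_measurable)
  show "(%w. forc (Suc k) w s) \<in> \<B> (F (tk (Suc k)))" if "0 <= s" "s <= tk (Suc k)" for s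
   using 1[OF that(1)] meas_mono[OF that(2)] by blast
  show "continuous_on {0..} (forc (Suc k) w)" if "w \<in> space (F (tk (Suc k)))" for w
   by (rule S_cont(3)) (use that in simp)
 qed (rule tk)
 hence "P (Suc k) \<in> \<B> (F (tk (Suc k)))"
  unfolding P_def[abs_def] by (rule measurable_compose[OF _ polm])
 with 1 show ?case by blast
qed

lemma P_meas: "tk k <= t ==> P k \<in> \<B> (F t)" using adapted_forc meas_mono by blast

lemma P_bound: "abs (P k w) <= M1" unfolding P_def by (rule polb)

lemma P_W: "P k w = pol (W (tk k) w)" unfolding P_def by (subst W_eq[of "tk k" k]) (use tk in auto)

lemma W_meas:
 assumes "0 <= t"
 shows "W t \<in> \<B> (F t)" unfolding W_def[abs_def]
proof (rule ode.ode_sol_measurable)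
 show "(%w. forc (cells t) w s) \<in> \<B> (F t)" if "0 <= s" "s <= t" for s
  using adapted_forc meas_mono[OF that(2)] that(1) by blast
qed (use S_cont(3) assms in auto)

lemma W_equation:
 assumes "w \<in> space M" "0 <= t"
 shows "W t w = x + (mu - r)*Q (cells t) t w + g*N t w - integral {0..t} (%s. h (W s w))"
proof -
 have "W t w = forc (cells t) w t - integral {0..t} (%s. h (ode_sol h (forc (cells t) w) s))"
  unfolding W_def by (rule ode.ode_sol_eq[OF S_cont(3)[OF assms(1)] assms(2)])
 also have "integral {0..t} (%s. h (ode_sol h (forc (cells t) w) s)) = integral {0..t} (%s. h (W s w))"
  by (rule integral_cong) (use cells_ge[of t] in \<open>auto simp: W_eq[of _ "cells t"]\<close>)
 finally show ?thesis by (simp add: forc_eq N_def)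
qed

lemma W_0: "w \<in> space M ==> W 0 w = x"
 using W_equation[of w 0] by (simp add: Q_def N_def S_def cells_def)

lemma N_incr:
 assumes "0 <= s" "s <= s'" "s' <= tk (Suc m)" "tk m <= s \<or> s = s'"
 shows "N s' w - N s w = P m w*(Bc s' w - Bc s w)"
proof (cases "s = s'")
 case False
 hence m: "tk m <= s" using assms(4) by simp
 have e: "S (Suc m) r w = S m r w + P m w*(Bc r w - Bc (tk m) w)" if "tk m <= r" "r <= tk (Suc m)" for r
  using that by (simp only: S_def sum.lessThan_Suc min_absorb1 min_absorb2)
 have "N s' w - N s w = S (Suc m) s' w - S (Suc m) s w"
  using assms N_eq[of s' "Suc m"] N_eq[of s "Suc m"] by simp
 also have "... = P m w*(Bc s' w - Bc s w) + (S m s' w - S m s w)"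
  using e[of s] e[of s'] assms(2,3) m by (simp add: right_diff_distrib)
 also have "S m s' w = S m s w" unfolding S_def
 proof (rule sum.cong[OF refl])
  fix j assume "j \<in> {..<m}"
  hence "tk j <= tk m" "tk (Suc j) <= tk m" by (auto intro: tk_mono)
  thus "P j w*(Bc (min s' (tk (Suc j))) w - Bc (min s' (tk j)) w) = P j w*(Bc (min s (tk (Suc j))) w - Bc (min s (tk j)) w)"
   using m assms(2) by (simp add: min_absorb2)
 qed
 finally show ?thesis by simp
qed simp

end

lemma cell_sum:
 fixes f :: "nat => real"
 assumes "0 < d" "real m*d < t" "t <= real (Suc m)*d" "m < k"
 shows "(\<Sum>i<k. f i*indicator {real i*d <.. real (Suc i)*d} t) = f m"
proof -
 have "f i*indicator {real i*d <.. real (Suc i)*d} t = (if i = m then f i else 0)" for i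
 proof (cases i m rule: linorder_cases)
  case less
  hence "real (Suc i)*d <= real m*d" using assms(1) by (intro mult_right_mono) auto
  thus ?thesis using less assms(2) by simp
 next
  case greater
  hence "real (Suc m)*d <= real i*d" using assms(1) by (intro mult_right_mono) auto
  thus ?thesis using greater assms(3) by simp
 qed (use assms in simp)
 thus ?thesis using assms(4) by simp
qed

lemma positive_cell:
 assumes "0 < (d::real)" "0 < t"
 obtains m where "real m*d < t" "t <= real (Suc m)*d" "nat \<lceil>t / d\<rceil> = Suc m"
proof -
 have c: "0 < \<lceil>t / d\<rceil>" using assms by simp
 define m where "m = nat \<lceil>t / d\<rceil> - 1"
 have m: "real_of_int \<lceil>t / d\<rceil> = real (Suc m)" using c by (simp add: m_def)
 have 1: "real m < t / d" "t / d <= real (Suc m)" using m by linarith+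
 show thesis
 proof (rule that[of m])
  show "real m*d < t" "t <= real (Suc m)*d" using 1 assms by (auto simp: field_simps simp del: of_nat_Suc)
  show "nat \<lceil>t / d\<rceil> = Suc m" using c by (simp add: m_def)
 qed
qed

context euler
begin

definition tau :: "'w => ereal" where "tau w = hit_time a (%s. W s w)"

definition th :: "real => 'w => real" where "th t w = real_of_ereal (min (ereal t) (tau w))"

lemma tau_nonneg: "0 <= tau w"
 unfolding tau_def hit_time_def by (rule Inf_greatest) auto

lemma th_eq: "0 <= t ==> ereal (th t w) = min (ereal t) (tau w)"
 unfolding th_def using tau_nonneg[of w] by (cases "tau w") (auto simp: min_def)

lemma th_le_iff: "0 <= t ==> s <= th t w \<longleftrightarrow> s <= t \<and> ereal s <= tau w"
 using th_eq[of t w] by (metis ereal_less_eq(3) min.bounded_iff)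

lemma th_bounds: "0 <= t ==> 0 <= th t w" "0 <= t ==> th t w <= t"
 using th_le_iff[of t 0 w] th_le_iff[of t "th t w" w] tau_nonneg[of w] by (auto simp: zero_ereal_def)

lemma th_before: "0 <= t ==> ereal t <= tau w ==> th t w = t"
 using th_le_iff[of t t w] th_bounds(2)[of t w] by auto

lemma hit_meas: "0 <= t ==> {w \<in> space M. tau w <= ereal t} \<in> sets (F t)"
 unfolding tau_def by (rule hit_le_measurable) (use W_meas W_cont W_0 ax in auto)

lemma th_meas:
 assumes t: "0 <= t"
 shows "th t \<in> \<B> (F t)" unfolding borel_measurable_iff_le
proof
 fix c :: real
 have le: "th t w <= c \<longleftrightarrow> t <= c \<or> tau w <= ereal c" for w
  using th_eq[OF t, of w] by (metis ereal_less_eq(3) min_le_iff_disj)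
 show "{w \<in> space (F t). th t w <= c} \<in> sets (F t)"
 proof (cases "t <= c \<or> c < 0")
  case True
  thus ?thesis
  proof
   assume "c < 0"
   hence "\<not> th t w <= c" for w using th_bounds(1)[OF t, of w] by linarith
   thus ?thesis by simp
  next
   assume "t <= c"
   hence "{w \<in> space (F t). th t w <= c} = space (F t)" by (auto simp: le)
   thus ?thesis by (simp only: sets.top)
  qed
 next
  case False
  hence "{w \<in> space (F t). th t w <= c} = {w \<in> space M. tau w <= ereal c}" by (auto simp: le)
  thus ?thesis using hit_meas[of c] F_mono[of c t] False by auto
 qed
qed

lemma N_meas:
 assumes "0 <= s" "s <= t"
 shows "N s \<in> \<B> (F t)"
proof -
 have b: "Bc (min s (tk j)) \<in> \<B> (F t)" for j using assms tk(1) by (intro Bc_meas) auto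
 have "(%w. P j w*(Bc (min s (tk (Suc j))) w - Bc (min s (tk j)) w)) \<in> \<B> (F t)" for j
 proof (cases "tk j <= s")
  case True
  hence "P j \<in> \<B> (F t)" using P_meas[of j t] assms by simp
  thus ?thesis by (intro borel_measurable_times borel_measurable_diff b)
 next
  case False
  hence "min s (tk (Suc j)) = s" "min s (tk j) = s" using tk(2)[of j] by auto
  thus ?thesis by simp
 qed
 thus ?thesis unfolding N_def[abs_def] S_def by (rule borel_measurable_sum)
qed

definition I :: "real => 'w => real" where "I t w = N (th t w) w"

text \<open>The stopped time is inserted into a jointly measurable map; cutting the time argument of
  \<open>N\<close> to \<open>[0, t]\<close> makes this map measurable with respect to
  \<open>F t\<close>.\<close>

lemma I_adapted: "adapted F I"
 unfolding adapted_def
proof (intro allI impI)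
 fix t :: real assume t: "0 <= t"
 let ?Y = "%s. N (min t (max 0 s))"
 have m1: "(%(w, s). ?Y s w) \<in> \<B> (F t \<Otimes>\<^sub>M lborel)"
 proof (rule continuous_joint_measurable)
  show "?Y s \<in> \<B> (F t)" for s by (rule N_meas) (use t in auto)
  show "continuous_on UNIV (%s. ?Y s w)" if "w \<in> space (F t)" for w
   by (rule continuous_on_compose2[OF N_cont]) (use that t in "auto intro!: continuous_intros")
 qed
 have m2: "(%w. (w, th t w)) \<in> measurable (F t) (F t \<Otimes>\<^sub>M lborel)"
  using th_meas[OF t] by simp
 have "(%w. ?Y (th t w) w) \<in> \<B> (F t)" using measurable_compose[OF m2 m1] by (simp only: prod.case)
 moreover have "?Y (th t w) w = I t w" for w using th_bounds[OF t, of w] by (simp add: I_def)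
 ultimately show "I t \<in> \<B> (F t)" by simp
qed

lemma th_cont: "continuous_on {0..} (%t. th t w)"
proof (cases "tau w")
 case (real c)
 hence "th t w = min t c" for t by (simp add: th_def min_def)
 thus ?thesis by (simp add: continuous_intros)
next
 case PInf
 hence "th t w = t" for t by (simp add: th_def)
 thus ?thesis by simp
qed (use tau_nonneg[of w] in simp)

lemma I_cont: "w \<in> space M ==> continuous_on {0..} (%t. I t w)"
 unfolding I_def by (rule continuous_on_compose2[OF N_cont th_cont]) (auto simp: th_bounds)

lemma p_bound: "abs (p t w) <= M1" unfolding p_def by (rule P_bound)

lemma cells_pos:
 assumes "0 < t"
 obtains m where "tk m < t" "t <= tk (Suc m)" "cells t = Suc m"
 using positive_cell[OF de assms] unfolding tk_def cells_def by blast

lemma p_cell: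
 assumes "tk m < t" "t <= tk (Suc m)"
 shows "p t w = P m w"
 unfolding p_def cells_def using assms grid_cell_unique[OF de, of m t] by (simp add: tk_def)

lemma p_progressive: "progressively_measurable F p"
 unfolding progressively_measurable_def
proof (intro allI impI)
 fix T :: real assume T: "0 <= T"
 let ?N = "restrict_space borel {0..T} \<Otimes>\<^sub>M F T"
 \<comment> \<open>Controls of cells that start after \<open>T\<close> are not known at
   \<open>T\<close> and are replaced by 0; times in \<open>[0, T]\<close> never select such a
   cell.\<close>
 let ?P = "%i w. if tk i <= T then P i w else 0"
 have m: "(%x. ?P (cells (fst x) - 1) (snd x)) \<in> \<B> ?N"
 proof (rule measurable_compose_countable[where g = "%x. cells (fst x) - 1" and f = "%i x. ?P i (snd x)"])
  fix i
  have "?P i \<in> \<B> (F T)" by (cases "tk i <= T") (auto intro: P_meas)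
  thus "(%x. ?P i (snd x)) \<in> \<B> ?N" by (rule measurable_compose[OF measurable_snd])
 next
  have "(%s::real. cells s - 1) \<in> measurable borel (count_space UNIV)" unfolding cells_def by measurable
  hence "(%s. cells s - 1) \<in> measurable (restrict_space borel {0..T}) (count_space UNIV)"
   by (rule measurable_restrict_space1)
  thus "(%x. cells (fst x) - 1) \<in> measurable ?N (count_space UNIV)"
   by (rule measurable_compose[OF measurable_fst])
 qed
 have eq: "?P (cells (fst x) - 1) (snd x) = (case x of (s, w) => p s w)" if "x \<in> space ?N" for x
 proof -
  have x: "0 <= fst x" "fst x <= T" using that by (auto simp: space_pair_measure space_restrict_space)
  have "tk (cells (fst x) - 1) <= T"
  proof (cases "0 < fst x")
   case True
   then obtain m where "tk m < fst x" "cells (fst x) = Suc m" by (rule cells_pos)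
   thus ?thesis using x by simp
  next
   case False
   hence "fst x = 0" using x by simp
   thus ?thesis using T by (simp add: cells_def tk)
  qed
  thus ?thesis by (simp add: p_def case_prod_beta')
 qed
 show "(%(s, w). p s w) \<in> \<B> ?N" using m by (simp only: measurable_cong[OF eq])
qed

definition H :: "real => 'w => real" where "H t w = (if ereal t <= tau w then p t w else 0)"

lemma H_progressive: "progressively_measurable F H"
 unfolding progressively_measurable_def
proof (intro allI impI)
 fix T :: real assume T: "0 <= T"
 let ?N = "restrict_space borel {0..T} \<Otimes>\<^sub>M F T"
 have [measurable]: "(%(s, w). p s w) \<in> \<B> ?N" "th T \<in> \<B> (F T)"
  using p_progressive th_meas T by (auto simp: progressively_measurable_def)
 have [measurable]: "fst \<in> \<B> ?N"
  by (rule measurable_compose[OF measurable_fst]) (rule measurable_restrict_space1, simp)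
 have m: "(%x. if fst x <= th T (snd x) then (case x of (s, w) => p s w) else 0) \<in> \<B> ?N" by measurable
 have eq: "(if fst x <= th T (snd x) then (case x of (s, w) => p s w) else 0) = (case x of (s, w) => H s w)"
  if "x \<in> space ?N" for x using that th_le_iff[OF T, of "fst x" "snd x"]
  by (simp add: space_pair_measure space_restrict_space H_def mem_Times_iff case_prod_beta')
 show "(%(s, w). H s w) \<in> \<B> ?N" using m by (simp only: measurable_cong[OF eq])
qed

end

section \<open>The stopped noise of the Euler scheme as an Ito integral\<close>

context euler
begin

text \<open>Each cell of length \<open>de\<close> is divided into \<open>Suc j\<close> parts, so
  that the fine grid resolves the hitting time up to \<open>hj j\<close>.\<close>

definition hj :: "nat => real" where "hj j = de / real (Suc j)"

definition ts :: "nat => nat => real" where "ts j i = real i*hj j"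

text \<open>The control of the surrounding coarse cell, kept as long as the fine cell starts before
  the hitting time. This is known at the start of the fine cell, whereas cutting off exactly at
  \<open>tau\<close> would not be.\<close>

definition xi :: "nat => nat => 'w => real" where
 "xi j i w = (if ereal (ts j i) < tau w then P (i div Suc j) w else 0)"

text \<open>\<open>Suc j\<close> fine cells in each of \<open>Suc j\<close> coarse ones: the horizon
  \<open>real (Suc j) * de\<close> tends to infinity while the mesh tends to 0.\<close>

definition kj :: "nat => nat" where "kj j = Suc j*Suc j"

abbreviation "SI j \<equiv> simple_integral B (kj j) (ts j) (xi j)"

abbreviation "SP j \<equiv> simple_process (kj j) (ts j) (xi j)"

lemma hj_pos: "0 < hj j" using de by (simp add: hj_def)

lemma hj_tendsto: "hj ----> 0"
 unfolding hj_def using lim_const_over_n[of de] LIMSEQ_Suc by fastforce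

lemma M1_nonneg: "0 <= M1" using polb[of 0] by linarith

lemma ts: "ts j 0 = 0" "0 <= ts j i" "ts j (Suc i) = ts j i + hj j" "i <= i' ==> ts j i <= ts j i'"
 using hj_pos[of j] by (auto simp: ts_def algebra_simps)

lemma sub_cell: "tk (i div Suc j) <= ts j i" "ts j (Suc i) <= tk (Suc (i div Suc j))"
proof -
 have hd: "real (Suc j)*hj j = de" by (simp add: hj_def)
 have tk: "tk m = real (m*Suc j)*hj j" for m unfolding of_nat_mult mult.assoc hd tk_def ..
 have "i div Suc j*Suc j <= i" by (rule div_times_less_eq_dividend)
 thus "tk (i div Suc j) <= ts j i"
  unfolding tk ts_def using hj_pos[of j] by (intro mult_right_mono of_nat_mono) auto
 have "Suc i <= Suc (i div Suc j)*Suc j" using dividend_less_div_times[of "Suc j" i] by simp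
 thus "ts j (Suc i) <= tk (Suc (i div Suc j))"
  unfolding tk ts_def using hj_pos[of j] by (intro mult_right_mono of_nat_mono) auto
qed

lemma kj_end: "ts j (kj j) = real (Suc j)*de"
 by (simp add: ts_def kj_def hj_def del: of_nat_Suc mult_Suc mult_Suc_right)

lemma data: "simple_data F (kj j) (ts j) (xi j)"
 unfolding simple_data_def
proof (intro conjI allI impI)
 fix i
 show "ts j i <= ts j (Suc i)" by (rule ts(4)) simp
 have "{w \<in> space (F (ts j i)). ereal (ts j i) < tau w} = space (F (ts j i)) - {w \<in> space M. tau w <= ereal (ts j i)}"
  by auto
 also have "... \<in> sets (F (ts j i))" using hit_meas[OF ts(2)] by blast
 finally show "xi j i \<in> \<B> (F (ts j i))"
  unfolding xi_def[abs_def] using P_meas[OF sub_cell(1)] by (intro measurable_If) auto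
 show "\<exists>C. \<forall>w\<in>space (F (ts j i)). abs (xi j i w) <= C"
  using P_bound M1_nonneg by (intro exI[of _ M1]) (simp add: xi_def)
qed (simp add: ts)

lemma xi_bound: "abs (xi j i w) <= M1" using P_bound M1_nonneg by (simp add: xi_def)

text \<open>The simple process and \<open>H\<close> differ only between the hitting time and the end
  of the fine cell that contains it. If \<open>tau w\<close> is infinite they agree, and the default
  value of \<open>real_of_ereal\<close> does no harm.\<close>

lemma process_error:
 assumes "0 < t" "t <= real (Suc j)*de"
 shows "(SP j t w - H t w)^2 <=
  M1^2*indicator {real_of_ereal (tau w) <.. real_of_ereal (tau w) + hj j} t"
proof -
 obtain m where m: "real m*hj j < t" "t <= real (Suc m)*hj j" by (rule positive_cell[OF hj_pos[of j] assms(1)])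
 have "real m*hj j < real (kj j)*hj j" using m(1) assms(2) kj_end[of j] by (simp add: ts_def)
 hence mk: "m < kj j" using hj_pos[of j] by (simp add: mult_less_cancel_right)
 have sp: "SP j t w = xi j m w"
  unfolding simple_process_def ts_def by (rule cell_sum[OF hj_pos m mk])
 have p: "p t w = P (m div Suc j) w"
  using sub_cell(1)[of m j] sub_cell(2)[of j m] m by (intro p_cell) (auto simp: ts_def)
 show ?thesis
 proof (cases "ereal t <= tau w")
  case True
  have "ereal (ts j m) < ereal t" using m(1) by (simp add: ts_def)
  hence "ereal (ts j m) < tau w" using True by (rule less_le_trans)
  thus ?thesis using True by (simp add: sp H_def xi_def p)
 next
  case False
  show ?thesis
  proof (cases "ereal (ts j m) < tau w")
   case True
   obtain c where c: "tau w = ereal c" using False tau_nonneg[of w] by (cases "tau w") auto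
   have "t \<in> {c <.. c + hj j}" using True False m ts(3)[of j m] by (auto simp: c ts_def)
   moreover have "(P (m div Suc j) w)^2 <= M1^2" using P_bound M1_nonneg by (simp add: abs_le_square_iff[symmetric])
   ultimately show ?thesis using True False by (simp add: sp H_def xi_def p c)
  qed (use False in "simp add: sp H_def xi_def")
 qed
qed

lemma process_error_integral:
 assumes "0 <= T" "T <= real (Suc j)*de"
 shows "(NN w. (\<integral>\<^sup>+t\<in>{0..T}. ennreal ((SP j t w - H t w)^2) \<partial>lborel))
  <= ennreal (M1^2*hj j)"
proof -
 let ?f = "%t w. ennreal ((SP j t w - H t w)^2)"
 have "(\<integral>\<^sup>+t\<in>{0..T}. ?f t w \<partial>lborel) <= ennreal (M1^2*hj j)" for w
 proof -
  define c where "c = real_of_ereal (tau w)"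
  have "(\<integral>\<^sup>+t\<in>{0..T}. ?f t w \<partial>lborel)
   <= (\<integral>\<^sup>+t. ennreal (M1^2)*indicator {c <.. c + hj j} t \<partial>lborel)"
  proof (rule nn_integral_mono_AE, rule eventually_mono[OF AE_lborel_singleton[of 0]])
   fix t :: real assume "t \<noteq> 0"
   show "?f t w*indicator {0..T} t <= ennreal (M1^2)*indicator {c <.. c + hj j} t"
   proof (cases "t \<in> {0..T}")
    case True
    hence "?f t w <= ennreal (M1^2*indicator {c <.. c + hj j} t)"
     unfolding c_def using \<open>t \<noteq> 0\<close> assms by (intro ennreal_leI process_error) auto
    thus ?thesis using True by (auto simp: indicator_def)
   qed simp
  qed
  also have "... = ennreal (M1^2)*ennreal (hj j)"
   using hj_pos[of j] by (subst nn_integral_cmult_indicator) auto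
  finally show ?thesis using hj_pos[of j] by (simp add: ennreal_mult)
 qed
 hence "(NN w. (\<integral>\<^sup>+t\<in>{0..T}. ?f t w \<partial>lborel))
  <= (NN w. ennreal (M1^2*hj j))" by (intro nn_integral_mono) simp
 also have "... = ennreal (M1^2*hj j)" using emeasure_space_1 by simp
 finally show ?thesis .
qed

text \<open>The sum telescopes to \<open>N\<close> at the earlier of \<open>T\<close> and the first
  fine grid point not before the hitting time, or the last grid point if there is none. This exceeds
  the stopped time by at most one fine cell.\<close>

lemma integral_path:
 assumes "w \<in> space M" "w \<notin> bad" "0 <= T" "T <= real (Suc j)*de"
 shows "\<exists>s\<ge>0. SI j T w = N s w \<and> abs (s - th T w) <= hj j"
proof -
 let ?Q = "%i. ereal (ts j i) < tau w"
 define q where "q = (LEAST i. i = kj j \<or> \<not> ?Q i)"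
 have q: "q = kj j \<or> \<not> ?Q q" unfolding q_def by (rule LeastI[of _ "kj j"]) simp
 have qk: "q <= kj j" unfolding q_def by (rule Least_le) simp
 have below: "?Q i" if "i < q" for i using not_less_Least[OF that[unfolded q_def]] by simp
 have iff: "?Q i \<longleftrightarrow> i < q" if "i < kj j" for i
 proof
  assume Qi: "?Q i"
  show "i < q"
  proof (rule ccontr)
   assume "\<not> i < q"
   hence "ts j q <= ts j i" by (intro ts(4)) simp
   hence "?Q q" using Qi by (meson ereal_less_eq(3) le_less_trans)
   thus False using q \<open>\<not> i < q\<close> that by simp
  qed
 qed (rule below)
 let ?N = "%i. N (min T (ts j i)) w"
 have "SI j T w = (\<Sum>i<kj j. if ?Q i then ?N (Suc i) - ?N i else 0)"
  unfolding simple_integral_def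
 proof (rule sum.cong[OF refl])
  fix i
  have "?N (Suc i) - ?N i = P (i div Suc j) w*(Bc (min T (ts j (Suc i))) w - Bc (min T (ts j i)) w)"
  proof (rule N_incr)
   show "min T (ts j i) <= min T (ts j (Suc i))" using ts(4)[of i "Suc i" j] by simp
   show "min T (ts j (Suc i)) <= tk (Suc (i div Suc j))" using sub_cell(2)[of j i] by simp
   show "tk (i div Suc j) <= min T (ts j i) \<or> min T (ts j i) = min T (ts j (Suc i))"
    using sub_cell(1)[of i j] ts(4)[of i "Suc i" j] by auto
  qed (use assms ts in simp)
  thus "xi j i w*(B (min T (ts j (Suc i))) w - B (min T (ts j i)) w) = (if ?Q i then ?N (Suc i) - ?N i else 0)"
   using assms(2) by (simp add: xi_def Bc_def)
 qed
 also have "... = ?N q - ?N 0" by (rule indicator_telescope[OF iff qk])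
 also have "?N 0 = 0" using assms(3) by (simp add: ts N_def S_def cells_def min_def)
 finally have eq: "SI j T w = N (min T (ts j q)) w" by simp
 have up: "th T w <= min T (ts j q)"
 proof -
  have "th T w <= ts j q"
  proof (cases "q = kj j")
   case True
   thus ?thesis using th_bounds(2)[OF assms(3), of w] assms(4) by (simp add: kj_end)
  next
   case False
   hence "tau w <= ereal (ts j q)" using q by simp
   moreover have "ereal (th T w) <= tau w" using th_eq[OF assms(3), of w] by simp
   ultimately show ?thesis by (meson ereal_less_eq(3) order_trans)
  qed
  thus ?thesis using th_bounds(2)[OF assms(3), of w] by simp
 qed
 have lo: "min T (ts j q) - hj j <= th T w"
 proof (cases q)
  case 0
  thus ?thesis using th_bounds(1)[OF assms(3), of w] hj_pos[of j] assms(3) by (simp add: ts)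
 next
  case (Suc i)
  hence "ereal (ts j i) < tau w" using below by simp
  moreover have "ereal (min T (ts j q) - hj j) <= ereal (ts j i)" using Suc by (simp add: ts(3))
  ultimately have "ereal (min T (ts j q) - hj j) <= tau w" by (meson le_less_trans less_imp_le)
  thus ?thesis using hj_pos[of j] by (subst th_le_iff[OF assms(3)]) simp
 qed
 show ?thesis
 proof (intro exI[of _ "min T (ts j q)"] conjI)
  show "0 <= min T (ts j q)" using assms(3) ts(2) by simp
  show "abs (min T (ts j q) - th T w) <= hj j" using up lo hj_pos[of j] by linarith
 qed (rule eq)
qed

lemma eventually_mesh: "eventually (%j. T <= real (Suc j)*de) sequentially"
proof -
 obtain j0 :: nat where "T / de <= real j0" using real_arch_simple by blast
 hence j0: "T <= real j0*de" using de by (simp add: field_simps)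
 show ?thesis
 proof (rule eventually_sequentiallyI)
  fix j assume "j0 <= j"
  hence "real j0*de <= real (Suc j)*de" using de by (intro mult_right_mono) auto
  thus "T <= real (Suc j)*de" using j0 by simp
 qed
qed

lemma integral_tendsto:
 assumes "w \<in> space M" "w \<notin> bad" "0 <= T"
 shows "(%j. SI j T w) ----> I T w"
proof (rule tendstoI)
 fix c :: real assume "0 < c"
 have "th T w \<in> {0..}" using th_bounds(1)[OF assms(3)] by simp
 with N_cont[OF assms(1)] \<open>0 < c\<close> obtain d where d: "0 < d" "!!s. 0 <= s ==> dist s (th T w) < d ==> dist (N s w) (N (th T w) w) < c"
  unfolding continuous_on_iff by (metis atLeast_iff)
 have "eventually (%j. hj j < d) sequentially" using hj_tendsto d(1) by (rule order_tendstoD)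
 with eventually_mesh[of T] show "eventually (%j. dist (SI j T w) (I T w) < c) sequentially"
 proof eventually_elim
  case (elim j)
  from integral_path[OF assms elim(1)] obtain s where
   "0 <= s" "SI j T w = N s w" "abs (s - th T w) <= hj j" by blast
  thus ?case using d(2)[of s] elim(2) by (simp add: dist_real_def I_def)
 qed
qed

text \<open>The mean squared distance of the integrands is at most \<open>M1^2 * hj j\<close>. The
  integrals converge along each good path, and their bounded fourth moments turn this into
  convergence in L2.\<close>

lemma ito: "ito_integral M F B H I"
 unfolding ito_integral_def
proof (intro conjI exI[of _ kj] exI[of _ ts] exI[of _ xi] allI impI ballI)
 show "progressively_measurable F H" by (rule H_progressive)
 show "adapted F I" by (rule I_adapted)
 show "continuous_on {0..} (%t. I t w)" if "w \<in> space M" for w using that by (rule I_cont)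
 show "simple_data F (kj j) (ts j) (xi j)" for j by (rule data)
 fix T :: real assume T: "0 <= T"
 show "(%j. NN w. (\<integral>\<^sup>+t\<in>{0..T}. ennreal ((SP j t w - H t w)^2) \<partial>lborel)) ----> 0"
 proof (rule tendsto_sandwich)
  show "eventually (%j. (0::ennreal) <= (NN w. (\<integral>\<^sup>+t\<in>{0..T}. ennreal ((SP j t w - H t w)^2) \<partial>lborel))) sequentially"
   by simp
  show "eventually (%j. (NN w. (\<integral>\<^sup>+t\<in>{0..T}. ennreal ((SP j t w - H t w)^2) \<partial>lborel)) <= ennreal (M1^2*hj j)) sequentially"
   using eventually_mesh[of T] by eventually_elim (rule process_error_integral[OF T])
  have "(%j. ennreal (M1^2*hj j)) ----> ennreal (M1^2*0)" by (intro tendsto_ennrealI tendsto_intros hj_tendsto)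
  thus "(%j. ennreal (M1^2*hj j)) ----> 0" by simp
 qed simp
 show "(%j. NN w. ennreal ((SI j T w - I T w)^2)) ----> 0"
 proof (rule L2_from_AE[where C = "3*M1^4*T^2"])
  have z: "SI j 0 w = 0" for j w
   using ts(2) by (simp add: simple_integral_def min_absorb1)
  note * = simple_integral_incr[OF data order_refl T xi_bound M1_nonneg, where Z = "%_. 0" and K = 0, simplified z diff_zero T]
  show "SI j T \<in> \<B> M" for j using *(1)[of j] by simp
  show "integrable M (%w. SI j T w^4)" for j using *(2)[of j] by simp
  show "(EE w. SI j T w^4) <= 3*M1^4*T^2" for j using *(3)[of j] by simp
  show "I T \<in> \<B> M" using I_adapted T meas_M by (auto simp: adapted_def)
  show "AE w in M. (%j. SI j T w) ----> I T w"
   using AE_good AE_space by eventually_elim (rule integral_tendsto[OF _ _ T])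
 qed
qed

lemma Q_integral:
 assumes "0 <= t"
 shows "integrable lborel (%s. indicator {0..t} s*p s w)" (is ?th1) "(LBINT s:{0..t}. p s w) = Q (cells t) t w" (is ?th2)
proof -
 let ?f = "%s. \<Sum>j<cells t. P j w*indicator {tk j <.. min t (tk (Suc j))} s"
 have eq: "indicator {0..t} s*p s w = ?f s" if "s \<noteq> 0" for s
 proof (cases "s \<in> {0..t}")
  case True
  hence "0 < s" "s <= t" using that by auto
  then obtain m where m: "tk m < s" "s <= tk (Suc m)" "cells s = Suc m" using cells_pos by metis
  have "?f s = (\<Sum>j<cells t. P j w*indicator {real j*de <.. real (Suc j)*de} s)"
   using \<open>s <= t\<close> by (intro sum.cong) (auto simp: tk_def indicator_def)
  also have "... = P m w"
   using m cells_mono[OF \<open>s <= t\<close>] by (intro cell_sum[OF de]) (auto simp: tk_def)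
  finally show ?thesis using True p_cell[OF m(1,2), of w] by simp
 next
  case False
  hence "indicator {tk j <.. min t (tk (Suc j))} s = (0::real)" for j using tk(1)[of j] by (auto simp: indicator_def)
  thus ?thesis using False by simp
 qed
 hence ae: "AE s in lborel. ?f s = indicator {0..t} s*p s w"
  using AE_lborel_singleton[of "0::real"] by (auto elim!: eventually_mono)
 have ii: "integrable lborel (indicat_real {c <.. d})" for c d :: real
  by (cases "c <= d") (auto intro!: integrable_real_indicator)
 have fi: "integrable lborel ?f" by (intro int_sum integrable_mult_right ii)
 have pm: "(%s. p s w) \<in> \<B> borel"
 proof -
  have "(%s. P (cells s - 1) w) \<in> \<B> borel"
   by (rule measurable_compose[of "%s. cells s - 1" _ "count_space UNIV"]) (auto simp: cells_def)
  thus ?thesis by (simp add: p_def)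
 qed
 show 1: ?th1
  by (rule integrable_cong_AE_imp[OF fi]) (use pm ae in auto)
 have "(LBINT s:{0..t}. p s w) = (\<integral>s. indicator {0..t} s*p s w \<partial>lborel)" by (simp add: set_lebesgue_integral_def)
 also have "... = (\<integral>s. ?f s \<partial>lborel)"
 proof (rule integral_cong_AE)
  show "AE s in lborel. indicator {0..t} s*p s w = ?f s" using ae by (auto elim: eventually_mono)
  show "?f \<in> \<B> lborel" using fi by (rule borel_measurable_integrable)
 qed (use pm in simp)
 also have "... = (\<Sum>j<cells t. P j w*measure lborel {tk j <.. min t (tk (Suc j))})"
  using ii by (subst lint_sum) auto
 also have "... = Q (cells t) t w" unfolding Q_def
 proof (rule sum.cong[OF refl])
  fix j
  have "measure lborel {tk j <.. min t (tk (Suc j))} = min t (tk (Suc j)) - min t (tk j)"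
   using tk(2)[of j] by (cases "tk j <= t") (auto simp: min_def)
  thus "P j w*measure lborel {tk j <.. min t (tk (Suc j))} = P j w*(min t (tk (Suc j)) - min t (tk j))" by simp
 qed
 finally show ?th2 .
qed

lemma W_above:
 assumes "w \<in> space M" "0 <= s" "ereal s <= tau w"
 shows "a <= W s w"
proof -
 have "a <= W 0 w" using W_0 assms ax by simp
 with W_cont[OF assms(1)] show ?thesis
 proof (cases rule: hit_time_cases)
  case never
  thus ?thesis using assms(2) by (simp add: less_imp_le)
 next
  case (hit t)
  thus ?thesis using assms by (cases "s = t") (auto simp: tau_def less_imp_le)
 qed
qed

lemma wealth: "wealth_process mu r sig a e M F B n x p W"
 unfolding wealth_process_def
proof (intro conjI ballI exI[of _ I] AE_I2 allI impI)
 show "adapted F W" using W_meas by (simp add: adapted_def)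
 show "W 0 w = x" "continuous_on {0..} (%t. W t w)" if "w \<in> space M" for w using that W_0 W_cont by auto
 show "ito_integral M F B (%t w. if ereal t <= hit_time a (%s. W s w) then p t w else 0) I"
  using ito unfolding H_def[abs_def] tau_def .
 fix w t assume wv: "w \<in> space M" and t: "0 <= t" "ereal t <= hit_time a (%s. W s w)"
 have hW: "h (W s w) = e (W s w)" if "0 <= s" "s <= t" for s
 proof -
  have "ereal s <= tau w" using that t(2) by (metis tau_def ereal_less_eq(3) order_trans)
  thus ?thesis using W_above[OF wv that(1)] by (simp add: h_def max_def)
 qed
 have cW: "continuous_on {0..} (%s. h (W s w))"
  by (rule continuous_on_compose2[OF ode.h_cont W_cont[OF wv]]) auto
 have "continuous_on {0..t} (%s. h (W s w))" by (rule continuous_on_subset[OF cW]) auto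
 hence si: "set_integrable lborel {0..t} (%s. h (W s w))" by (rule borel_integrable_atLeastAtMost')
 have sp: "set_integrable lborel {0..t} (%s. p s w)" using Q_integral(1)[OF t(1), of w] by (simp add: set_integrable_def)
 have "(LBINT s:{0..t}. - e (W s w) + (mu - r)*p s w) = (LBINT s:{0..t}. (mu - r)*p s w - h (W s w))"
  by (rule set_lebesgue_integral_cong) (auto simp: hW)
 also have "... = (mu - r)*(LBINT s:{0..t}. p s w) - (LBINT s:{0..t}. h (W s w))"
  using si sp by (simp add: set_integral_diff)
 also have "(LBINT s:{0..t}. h (W s w)) = integral {0..t} (%s. h (W s w))" by (rule set_borel_integral_eq_integral(2)[OF si])
 finally show "W t w = x + (LBINT s:{0..t}. - e (W s w) + (mu - r)*p s w) + 1 / sqrt (real n) * sig*I t w"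
  using W_equation[OF wv t(1)] th_before[OF t(1), of w] t(2) Q_integral(2)[OF t(1), of w]
  by (simp add: I_def g_def tau_def)
qed

end

section \<open>Augmentation of the Brownian filtration\<close>

lemma sigma_sets_null_completion:
 assumes G: "sigma_algebra (space M) G" "G \<subseteq> sets M"
  and A: "A \<in> sigma_sets (space M) (G \<union> null_sets M)"
 shows "A \<in> sets M \<and> (\<exists>A'\<in>G. AE w in M. w \<in> A \<longleftrightarrow> w \<in> A')"
 using A
proof induction
 interpret G: sigma_algebra "space M" G by fact
 case (Basic a)
 show ?case
 proof (cases "a \<in> G")
  case False
  hence a: "a \<in> null_sets M" using Basic by simp
  hence "AE w in M. w \<in> a \<longleftrightarrow> w \<in> {}" using AE_not_in[OF a] by simp
  thus ?thesis using a by (blast intro: G.empty_sets null_setsD2)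
 qed (use G(2) in auto)
next
 interpret G: sigma_algebra "space M" G by fact
 case Empty
 show ?case by (intro conjI bexI[of _ "{}"]) auto
next
 interpret G: sigma_algebra "space M" G by fact
 case (Compl a)
 then obtain A' where A': "A' \<in> G" "AE w in M. w \<in> a \<longleftrightarrow> w \<in> A'" by blast
 have "AE w in M. w \<in> space M - a \<longleftrightarrow> w \<in> space M - A'" using A'(2) by eventually_elim auto
 thus ?case using Compl A'(1) by blast
next
 interpret G: sigma_algebra "space M" G by fact
 case (Union a)
 hence "\<forall>i::nat. \<exists>A'\<in>G. AE w in M. w \<in> a i \<longleftrightarrow> w \<in> A'" by blast
 then obtain A' where A': "!!i. A' i \<in> G" "!!i. AE w in M. w \<in> a i \<longleftrightarrow> w \<in> A' i" by metis
 have "AE w in M. \<forall>i. w \<in> a i \<longleftrightarrow> w \<in> A' i" using A'(2) by (simp add: AE_all_countable)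
 hence "AE w in M. w \<in> (\<Union>i. a i) \<longleftrightarrow> w \<in> (\<Union>i. A' i)" by eventually_elim auto
 moreover have "(\<Union>i. A' i) \<in> G" using A'(1) by (intro G.countable_UN) auto
 ultimately show ?case using Union by blast
qed

lemma (in prob_space) indep_set_null_completion:
 assumes G: "sigma_algebra (space M) G" and ind: "indep_set G C"
 shows "indep_set (sigma_sets (space M) (G \<union> null_sets M)) C"
proof -
 have GM: "G \<subseteq> sets M" and CM: "C \<subseteq> sets M" using ind by (auto simp: indep_sets2_eq)
 note compl = sigma_sets_null_completion[OF G GM]
 show ?thesis unfolding indep_sets2_eq
 proof (intro conjI ballI)
  show "sigma_sets (space M) (G \<union> null_sets M) \<subseteq> events" using compl by blast
  show "C \<subseteq> events" by (rule CM)
  fix A c assume A: "A \<in> sigma_sets (space M) (G \<union> null_sets M)" and c: "c \<in> C"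
  obtain A' where A': "A' \<in> G" "AE w in M. w \<in> A \<longleftrightarrow> w \<in> A'" using compl[OF A] by blast
  have m: "A \<in> events" "A' \<in> events" "c \<in> events" using compl[OF A] A'(1) GM c CM by auto
  have "prob (A \<inter> c) = prob (A' \<inter> c)"
  proof (rule finite_measure_eq_AE)
   show "AE w in M. w \<in> A \<inter> c \<longleftrightarrow> w \<in> A' \<inter> c" using A'(2) by eventually_elim blast
  qed (use m in auto)
  also have "... = prob A'*prob c" using ind A'(1) c by (auto simp: indep_sets2_eq)
  also have "prob A' = prob A"
  proof (rule finite_measure_eq_AE)
   show "AE w in M. w \<in> A' \<longleftrightarrow> w \<in> A" using A'(2) by eventually_elim blast
  qed (use m in auto)
  finally show "prob (A \<inter> c) = prob A*prob c" .
 qed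
qed

lemma sets_augmented:
 assumes "!!t. sets (natural_filtration M B t) \<subseteq> sets M"
 shows "sets (augmented_filtration M B t) = sigma_sets (space M) (sets (natural_filtration M B t) \<union> null_sets M)" (is ?th1)
  "space (augmented_filtration M B t) = space M" (is ?th2)
proof -
 have *: "sets (natural_filtration M B t) \<union> null_sets M \<subseteq> Pow (space M)"
  using assms[of t] sets.space_closed[of M] null_setsD2 by blast
 show ?th1
  ?th2
  unfolding augmented_filtration_def by (rule sets_measure_of[OF *], rule space_measure_of[OF *])
qed

lemma augmented_brownian:
 assumes B: "standard_brownian_motion M B"
 shows "brownian_motion M (augmented_filtration M B) B"
  and "!!N t. N \<in> null_sets M ==> N \<in> sets (augmented_filtration M B t)"
  and "!!D. independent_of_filtration M (natural_filtration M B) D ==>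
   independent_of_filtration M (augmented_filtration M B) D"
proof -
 let ?G = "natural_filtration M B" and ?F = "augmented_filtration M B"
 have bm: "brownian_motion M ?G B" using B by (simp add: standard_brownian_motion_def)
 interpret prob_space M using bm by (simp add: brownian_motion_def)
 have G: "space (?G t) = space M" "sets (?G t) \<subseteq> sets M" for t
  using bm by (auto simp: brownian_motion_def subalgebra_def)
 have Gm: "sets (?G s) \<subseteq> sets (?G t)" if "s <= t" for s t
  using bm that by (auto simp: brownian_motion_def filtration_def)
 have sF: "sets (?F t) = sigma_sets (space M) (sets (?G t) \<union> null_sets M)" "space (?F t) = space M" for t
  by (rule sets_augmented, rule G(2))+
 have Galg: "sigma_algebra (space M) (sets (?G t))" for t using sets.sigma_algebra_axioms[of "?G t"] by (simp add: G)
 have FM: "sets (?F t) \<subseteq> sets M" for t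
  unfolding sF(1) using sigma_sets_null_completion[OF Galg G(2)] by blast
 have GF: "sets (?G t) \<subseteq> sets (?F t)" for t unfolding sF(1) by auto
 show null: "N \<in> sets (?F t)" if "N \<in> null_sets M" for N t using that unfolding sF(1) by auto
 show "brownian_motion M ?F B" unfolding brownian_motion_def
 proof (intro conjI allI impI)
  show "filtration (space M) ?F"
  proof
   show "space (?F t) = space M" for t by (rule sF)
   show "sets (?F s) \<subseteq> sets (?F t)" if "s <= t" for s t
    unfolding sF(1) using Gm[OF that] by (intro sigma_sets_mono') auto
  qed
  show "subalgebra M (?F t)" for t using FM sF(2) by (simp add: subalgebra_def)
  show "adapted ?F B" unfolding adapted_def
  proof (intro allI impI)
   fix t :: real assume "0 <= t"
   hence "B t \<in> \<B> (?G t)" using bm by (simp add: brownian_motion_def adapted_def)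
   moreover have "subalgebra (?F t) (?G t)" using GF by (simp add: subalgebra_def G sF(2))
   ultimately show "B t \<in> \<B> (?F t)" by (rule measurable_from_subalg[rotated])
  qed
  fix s t :: real assume st: "0 <= s \<and> s < t"
  show "distributed M lborel (%w. B t w - B s w) (normal_density 0 (sqrt (t - s)))"
   using bm st by (simp add: brownian_motion_def)
  have "indep_set (sets (?G s)) (preimages M (%w. B t w - B s w))"
   using bm st by (simp add: brownian_motion_def)
  thus "indep_set (sets (?F s)) (preimages M (%w. B t w - B s w))"
   unfolding sF(1) by (rule indep_set_null_completion[OF Galg])
 qed (use bm in "auto simp: brownian_motion_def")
 fix D assume D: "independent_of_filtration M ?G D"
 let ?S = "sigma_sets (space M) (\<Union>t. sets (?G t))"
 have SP: "(\<Union>t. sets (?G t)) \<subseteq> Pow (space M)" using G(2) sets.space_closed[of M] by blast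
 have ind: "indep_set (sigma_sets (space M) (?S \<union> null_sets M)) (preimages M D)"
  by (rule indep_set_null_completion[OF sigma_algebra_sigma_sets[OF SP]])
   (use D in "simp add: independent_of_filtration_def")
 have "sets (?F t) \<subseteq> sigma_sets (space M) (?S \<union> null_sets M)" for t
  unfolding sF(1) by (intro sigma_sets_mono') auto
 hence sub: "sigma_sets (space M) (\<Union>t. sets (?F t)) \<subseteq> sigma_sets (space M) (?S \<union> null_sets M)"
  by (intro sigma_sets_mono) auto
 show "independent_of_filtration M ?F D" unfolding independent_of_filtration_def indep_sets2_eq
 proof (intro conjI ballI)
  show "sigma_sets (space M) (\<Union>t. sets (?F t)) \<subseteq> events" using sub ind by (auto simp: indep_sets2_eq)
  show "preimages M D \<subseteq> events" using ind by (auto simp: indep_sets2_eq)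
  fix A c assume "A \<in> sigma_sets (space M) (\<Union>t. sets (?F t))" "c \<in> preimages M D"
  thus "prob (A \<inter> c) = prob A*prob c" using ind sub by (auto simp: indep_sets2_eq)
 qed
qed

section \<open>Sign of the drift and error of piecewise constant controls\<close>

context wealth
begin

text \<open>The drift part is handled by Cauchy-Schwarz over the step together with
  \<open>be_bound\<close>, the noise by its variance; both contributions are of the order
  \<open>de\<close>.\<close>

lemma increment_square:
 assumes S: "0 < S" and s: "0 <= s0" "s0 <= s" "s <= S" "s - s0 <= de"
 shows "integrable M (%w. (X s w - X s0 w)^2)" (is ?th1)
  "(EE w. (X s w - X s0 w)^2) <= 2*de*be_bound S + 2*gg^2*(M1^2*de)" (is ?th2)
proof -
 let ?i = "%w. I s w - I s0 w"
 define V where "V w = ival 0 S (%r. (be r w)^2)" for w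
 have Vi: "integrable M V" "(EE w. V w) <= be_bound S" unfolding V_def by (rule be_moment[OF S])+
 have V0: "0 <= V w" for w unfolding V_def by (intro integral_nonneg_AE AE_I2) simp
 have Iv: "integrable M (%w. ?i w^2)" "(EE w. ?i w^2) <= M1^2*(s - s0)"
  using s by (intro I_var; simp)+
 define Y where "Y w = 2*(s - s0)*V w + 2*gg^2 * ?i w^2" for w
 have Yi: "integrable M Y" unfolding Y_def using Vi(1) Iv(1) by simp
 have Y0: "0 <= Y w" for w unfolding Y_def using V0 s by simp
 have le: "AE w in M. (X s w - X s0 w)^2 <= Y w" using ito.be_good[OF S] AE_space
 proof eventually_elim
  case (elim w)
  let ?b = "ival s0 s (%r. be r w)"
  have i: "iable 0 S (%r. (be r w)^2)" using elim by simp
  have i2: "iable s0 S (%r. (be r w)^2)" by (rule indicator_integral_split(2)[OF i s(1)]) (use s in simp)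
  have i3: "iable s0 s (%r. (be r w)^2)" by (rule indicator_integral_split(1)[OF i2 s(2,3)])
  have "X s w - X s0 w - gg * ?i w = ?b" using elim s by blast
  hence "X s w - X s0 w = ?b + gg * ?i w" by simp
  hence "(X s w - X s0 w)^2 <= 2 * ?b^2 + 2*(gg * ?i w)^2" by (simp only: square_sum_le)
  also have "?b^2 <= (s - s0)*ival s0 s (%r. (be r w)^2)"
   by (rule integral_square_le(2)[OF ito.bem[OF elim(2)] i3 s(2)])
  also have "... <= (s - s0)*V w"
   unfolding V_def by (intro mult_left_mono integral_mono i i3) (use s in "auto simp: indicator_def")
  finally show ?case unfolding Y_def power_mult_distrib mult.assoc by simp
 qed
 have m: "(%w. (X s w - X s0 w)^2) \<in> \<B> M" using XM[of s] XM[of s0] s by simp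
 show i: ?th1
  by (rule int_bound[OF Yi m]) (use le Y0 in "auto elim!: eventually_mono")
 have "(EE w. (X s w - X s0 w)^2) <= (EE w. Y w)" by (rule integral_mono_AE[OF i Yi le])
 also have "... = 2*(s - s0)*(EE w. V w) + 2*gg^2*(EE w. ?i w^2)"
  unfolding Y_def using Vi(1) Iv(1) by simp
 also have "... <= 2*de*be_bound S + 2*gg^2*(M1^2*de)"
 proof (intro add_mono)
  have "0 <= (EE w. V w)" using V0 by simp
  thus "2*(s - s0)*(EE w. V w) <= 2*de*be_bound S" using Vi(2) s by (intro mult_mono) auto
  show "2*gg^2*(EE w. ?i w^2) <= 2*gg^2*(M1^2*de)"
  proof (rule mult_left_mono)
   have "M1^2*(s - s0) <= M1^2*de" using s by (intro mult_left_mono) auto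
   thus "(EE w. ?i w^2) <= M1^2*de" using Iv(2) by simp
  qed simp
 qed
 finally show ?th2 .
qed

end

context wealth_clock
begin

definition genf :: "(real => real) => (real => real) => (real => real) => real => real => real" where
 "genf u u1 u2 y q = real n*(l y - lam)*u y + u1 y*(- e y + (mu - r)*q) + gg^2 / 2*u2 y*q^2 + lam*real n"

text \<open>After absorption killing and source cancel,
  \<open>- n lam u a + lam n exp (n rho) = 0\<close>, which is what fixes the boundary value of
  \<open>u\<close>. The time \<open>tau w\<close> is excluded because \<open>H\<close> still has the
  value of the control there.\<close>

lemma gen_value:
 assumes "w \<in> space M" "0 < s" "ereal s \<noteq> tau w" "u a = exp (real n*rho)"
 shows "ito.gen u u1 u2 s w + lam*real n*cc (X s w) = (if a < X s w then genf u u1 u2 (X s w) (H s w) else 0)"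
proof (cases "a < X s w")
 case True
 thus ?thesis using assms by (simp add: ito.gen_def al_def be_def cc_def genf_def algebra_simps)
next
 case False
 hence "tau w < ereal s" "X s w = a" using X_cases[OF assms(1), of s] assms by auto
 hence "\<not> ereal s <= tau w" "X s w = a" by auto
 thus ?thesis using assms by (simp add: ito.gen_def al_def be_def cc_def H_def algebra_simps)
qed

lemma AE_not_tau: "AE s in lborel. ereal s \<noteq> tau w"
proof (cases "tau w")
 case (real c)
 thus ?thesis using AE_lborel_singleton[of c] by simp
qed auto

text \<open>The factor \<open>c\<close> is used with the values 1 and -1, for subsolutions and
  supersolutions.\<close>

lemma drift_sign:
 assumes ua: "u a = exp (real n*rho)"
  and g: "!!s w. 0 < s ==> w \<in> space M ==> a < X s w ==> 0 <= c*genf u u1 u2 (X s w) (H s w)"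
 shows "0 <= c*drift u u1 u2 T" unfolding drift_def integral_mult_right_zero[symmetric]
proof (rule integral_nonneg_AE, rule AE_I2, rule integral_nonneg_AE)
 fix w assume wv: "w \<in> space M"
 show "AE s in lborel. 0 <= c*(indicator {0<..T} s*(exp (A s w)*(ito.gen u u1 u2 s w + lam*real n*cc (X s w))))"
  using AE_not_tau[of w]
 proof eventually_elim
  case (elim s)
  have "0 <= exp (A s w)*(c*(ito.gen u u1 u2 s w + lam*real n*cc (X s w)))" if s: "0 < s"
   unfolding gen_value[where u = u, OF wv s elim ua] using g[OF s wv] by simp
  thus ?case by (simp add: indicator_def mult.left_commute)
 qed
qed

text \<open>Turns bounds on the mean at fixed times into a bound on the mean of the time integral
  that is uniform in \<open>T\<close>.\<close>

lemma iterated_le_Fubini: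
 fixes h :: "real => 'a => real" and f :: "real => ennreal"
 assumes h: "(%(w, s). indicator {0<..T} s*h s w) \<in> \<B> MT" and T: "0 < T"
  and b: "!!s w. 0 < s ==> w \<in> space M ==> 0 <= h s w" "!!s w. 0 < s ==> w \<in> space M ==> h s w <= b"
  and f: "!!s. 0 < s ==> (NN w. ennreal (h s w)) <= f s" and f0: "(\<integral>\<^sup>+s. f s*indicator {0<..} s \<partial>lborel) <= ennreal c"
  and c: "0 <= c"
 shows "(EE w. ival 0 T (%s. h s w)) <= c"
proof -
 interpret P: pair_sigma_finite M lborel ..
 let ?h = "%(w, s). indicator {0<..T} s*h s w"
 have ab: "abs (h s w) <= b" if "0 < s" "w \<in> space M" for s w using b[OF that] by simp
 note bi = bounded_iterated[OF h T ab]
 have pos: "0 <= indicator {0<..T} s*h s w" if "w \<in> space M" for s w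
  using b(1)[of s w] that by (simp add: indicator_def)
 have pos2: "0 <= ival 0 T (%s. h s w)" if "w \<in> space M" for w
  by (intro integral_nonneg_AE AE_I2 pos[OF that])
 have "ennreal (EE w. ival 0 T (%s. h s w)) = (NN w. ennreal (ival 0 T (%s. h s w)))"
  by (rule nn_integral_eq_integral[symmetric]) (use bi(2) pos2 in auto)
 also have "... = (NN w. (\<integral>\<^sup>+s. ennreal (?h (w, s)) \<partial>lborel))"
 proof (rule nn_integral_cong)
  fix w assume wv: "w \<in> space M"
  show "ennreal (ival 0 T (%s. h s w)) = (\<integral>\<^sup>+s. ennreal (?h (w, s)) \<partial>lborel)"
   using nn_integral_eq_integral[OF bi(1)[OF _ _ wv]] pos[OF wv] by simp
 qed
 also have "... = (\<integral>\<^sup>+s. (NN w. ennreal (?h (w, s))) \<partial>lborel)"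
  using P.Fubini'[of "%w s. ennreal (?h (w, s))"] h by (simp add: case_prod_beta')
 also have "... <= (\<integral>\<^sup>+s. f s*indicator {0<..} s \<partial>lborel)"
 proof (rule nn_integral_mono)
  fix s :: real
  show "(NN w. ennreal (?h (w, s))) <= f s*indicator {0<..} s"
   using f[of s] by (cases "s \<in> {0<..T}") auto
 qed
 also note f0
 finally show ?thesis using c by (simp add: ennreal_le_iff)
qed

text \<open>The control at time \<open>s\<close> is \<open>pol\<close> at the state of the earlier
  time \<open>ka s\<close>, and the defect of the generator is at most \<open>K\<close> times the
  resulting deviation. Up to \<open>S\<close> its mean is at most \<open>Lp\<close> times the root
  mean square displacement over one step; after \<open>S\<close> the discount makes the crude bound
  \<open>2 * M1\<close> small.\<close>

lemma drift_euler:
 assumes tf: "test_fun a u u1 u2" and R: "\<forall>y\<ge>R. u1 y = 0"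
  and ua: "u a = exp (real n*rho)" and pol: "Lp-lipschitz_on {a..} pol" and polb: "!!y. a <= y ==> abs (pol y) <= M1"
  and g: "!!y q. a < y ==> abs q <= M1 ==> genf u u1 u2 y q <= K*abs (q - pol y)" and K: "0 <= K"
  and k: "!!s. 0 < s ==> 0 <= ka s \<and> ka s <= s \<and> s - ka s <= de"
   "!!s w. 0 < s ==> w \<in> space M ==> p s w = pol (W (ka s) w)" and S: "0 < S" and T: "0 < T"
 shows "drift u u1 u2 T <= K*(S*(Lp * sqrt (2*de*be_bound S + 2*gg^2*(M1^2*de)))
  + 2*M1 / (real n*(lam - l a))*exp (- (real n*(lam - l a))*S))"
proof -
 define v where "v = 2*de*be_bound S + 2*gg^2*(M1^2*de)"
 define c where "c = real n*(lam - l a)"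
 let ?M = "%s. 2*M1*exp (- c * s)"
 have c: "0 < c" using par l2 by (simp add: c_def)
 have Lp: "0 <= Lp" using pol by (rule lipschitz_on_nonneg)
 have polc: "continuous_on {a..} pol" using pol by (rule lipschitz_on_continuous_on)
 define q where "q s w = (if a < X s w then abs (H s w - pol (X s w)) else 0)" for s w
 define h where "h s w = exp (A s w)*q s w" for s w
 let ?V = "EE w. ival 0 T (%s. h s w)"
 have q0: "0 <= q s w" for s w by (simp add: q_def)
 have qb: "q s w <= 2*M1" if "0 < s" "w \<in> space M" for s w
  using HK[of s w] polb[of "X s w"] Xa[of s w] that M1_nonneg by (auto simp: q_def)
 have qX: "q s w <= Lp*abs (X s w - X (ka s) w)" if s: "0 < s" and wv: "w \<in> space M" for s w
 proof (cases "a < X s w")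
  case True
  hence ts: "ereal s < tau w" using X_cases[OF wv, of s] s by auto
  have "ereal (ka s) <= ereal s" using k(1)[OF s] by simp
  hence "ereal (ka s) < tau w" using ts by (rule le_less_trans)
  hence "X (ka s) w = W (ka s) w" "a < X (ka s) w" using X_cases[OF wv, of "ka s"] k(1)[OF s] by auto
  moreover have "H s w = p s w" using ts by (simp add: H_def)
  ultimately have "q s w = dist (pol (X (ka s) w)) (pol (X s w))"
   using True k(2)[OF s wv] by (simp add: q_def dist_real_def)
  also have "... <= Lp*dist (X (ka s) w) (X s w)"
   by (rule lipschitz_onD[OF pol]) (use True \<open>a < X (ka s) w\<close> in auto)
  finally show ?thesis by (simp add: dist_real_def abs_minus_commute)
 qed (use Lp in "simp add: q_def")
 let ?q = "%x. if a < X (max 0 (snd x)) (fst x) then abs (indicator {0..} (snd x)*H (snd x) (fst x) - pol (X (max 0 (snd x)) (fst x))) else 0"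
 have qm: "?q \<in> \<B> MT" using f_joint[OF polc] by measurable
 have hm: "(%(w, s). indicator {0<..T} s*h s w) \<in> \<B> MT"
 proof -
  have [measurable]: "(%x. A (max 0 (snd x)) (fst x)) \<in> \<B> MT"
   using ito.A_joint by (simp add: case_prod_beta')
  have "(%x. indicator {0<..T} (snd x)*(exp (A (max 0 (snd x)) (fst x)) * ?q x)) \<in> \<B> MT"
   using qm by measurable
  thus ?thesis by (rule measurable_cong[THEN iffD1, rotated]) (auto simp: indicator_def h_def q_def)
 qed
 have qs: "q s \<in> \<B> M" if s: "0 < s" for s
 proof -
  have "(%w. ?q (w, s)) \<in> \<B> M" by (rule measurable_compose[OF _ qm]) simp
  thus ?thesis by (rule measurable_cong[THEN iffD1, rotated]) (use s in "simp add: q_def")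
 qed
 have qE: "(NN w. ennreal (q s w)) <= ennreal (Lp * sqrt v)" if s: "0 < s" "s <= S" for s
 proof -
  have qi: "integrable M (q s)"
   by (rule integrable_const_bound[where B = "2*M1"]) (use qs qb q0 s in "auto intro!: AE_I2")
  have qi2: "integrable M (%w. (q s w)^2)"
  proof (rule integrable_const_bound[where B = "(2*M1)^2"])
   have "(q s w)^2 <= (2*M1)^2" if "w \<in> space M" for w by (rule power_mono[OF qb[OF s(1) that] q0])
   thus "AE w in M. norm ((q s w)^2) <= (2*M1)^2" by (intro AE_I2) simp
  qed (use qs s in simp)
  note incr = increment_square[OF S, of "ka s" s de]
  have "0 <= variance (q s)" by (rule variance_positive)
  hence "(EE w. q s w)^2 <= (EE w. (q s w)^2)" using variance_eq[OF qi qi2] by simp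
  also have "... <= (EE w. Lp^2*(X s w - X (ka s) w)^2)"
  proof (rule integral_mono[OF qi2])
   show "integrable M (%w. Lp^2*(X s w - X (ka s) w)^2)" using incr(1) k(1)[OF s(1)] s by simp
   fix w assume "w \<in> space M"
   hence "(q s w)^2 <= (Lp*abs (X s w - X (ka s) w))^2" using qX[OF s(1)] q0 by (intro power_mono)
   thus "(q s w)^2 <= Lp^2*(X s w - X (ka s) w)^2" by (simp add: power_mult_distrib)
  qed
  also have "... <= Lp^2 * v" unfolding v_def using incr(2) k(1)[OF s(1)] s by (simp add: mult_left_mono)
  finally have "(EE w. q s w) <= sqrt (Lp^2 * v)" by (rule real_le_rsqrt)
  hence "(EE w. q s w) <= Lp * sqrt v" using Lp by (simp add: real_sqrt_mult)
  thus ?thesis using nn_integral_eq_integral[OF qi] q0 by (simp add: ennreal_leI)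
 qed
 let ?f = "%s. ennreal (Lp * sqrt v)*indicator {0<..S} s + ennreal (?M s)*indicator {S..} s"
 have hle: "h s w <= q s w" "h s w <= ?M s" if "0 < s" "w \<in> space M" for s w
 proof -
  have "exp (A s w)*q s w <= 1*q s w" using A_exp_le1[OF that(2), of s] that q0 by (intro mult_right_mono) auto
  thus "h s w <= q s w" by (simp add: h_def)
  have "exp (A s w)*q s w <= exp (- c * s)*(2*M1)"
   using A_le(1)[OF that(2), of s] that q0 qb[OF that] unfolding c_def by (intro mult_mono) auto
  thus "h s w <= ?M s" by (simp add: h_def mult.commute)
 qed
 have v0: "0 <= sqrt v"
 proof -
  have "0 <= (EE w. (X S w - X (ka S) w)^2)" by simp
  also have "... <= v" unfolding v_def using increment_square(2)[OF S, of "ka S" S de] k(1)[OF S] by simp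
  finally show ?thesis by simp
 qed
 have hE: "(NN w. ennreal (h s w)) <= ?f s" if s: "0 < s" for s
 proof (cases "s <= S")
  case True
  have "(NN w. ennreal (h s w)) <= (NN w. ennreal (q s w))"
   using hle(1)[OF s] by (intro nn_integral_mono ennreal_leI) auto
  also have "... <= ennreal (Lp * sqrt v)" by (rule qE[OF s True])
  also have "... <= ?f s" using s True by simp
  finally show ?thesis .
 next
  case False
  have "(NN w. ennreal (h s w)) <= (NN w. ennreal (?M s))"
   using hle(2)[OF s] by (intro nn_integral_mono ennreal_leI) auto
  also have "... = ennreal (?M s)" using emeasure_space_1 by simp
  finally show ?thesis using False by simp
 qed
 define C where "C = S*(Lp * sqrt v) + 2*M1 / c*exp (- c*S)"
 have C0: "0 <= C" unfolding C_def using S Lp v0 M1_nonneg c by (intro add_nonneg_nonneg mult_nonneg_nonneg) auto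
 have fi: "(\<integral>\<^sup>+s. ?f s*indicator {0<..} s \<partial>lborel) <= ennreal C"
 proof -
  have tail: "(\<integral>\<^sup>+s. ennreal (?M s)*indicator {S..} s \<partial>lborel) = ennreal (0 - (- (2*M1 / c)*exp (- c*S)))"
  proof (rule nn_integral_FTC_atLeast)
   show "((%s. - (2*M1 / c)*exp (- c * s)) has_real_derivative ?M s) (at s)" for s
    using c by (auto intro!: derivative_eq_intros)
   have "filterlim (%s. - c * s) at_bot at_top"
    using c by (intro filterlim_tendsto_neg_mult_at_bot[OF tendsto_const] filterlim_ident) auto
   from tendsto_mult[OF tendsto_const filterlim_compose[OF exp_at_bot this], of "- (2*M1 / c)"]
   show "((%s. - (2*M1 / c)*exp (- c * s)) \<longlongrightarrow> 0) at_top" by simp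
  qed (use M1_nonneg in auto)
  have "(\<integral>\<^sup>+s. ?f s*indicator {0<..} s \<partial>lborel) <= (\<integral>\<^sup>+s. ?f s \<partial>lborel)"
   by (intro nn_integral_mono) (auto simp: indicator_def)
  also have "... = (\<integral>\<^sup>+s. ennreal (Lp * sqrt v)*indicator {0<..S} s \<partial>lborel) + (\<integral>\<^sup>+s. ennreal (?M s)*indicator {S..} s \<partial>lborel)"
   by (rule nn_integral_add) auto
  also have "... = ennreal (Lp * sqrt v)*ennreal S + ennreal (2*M1 / c*exp (- c*S))"
   unfolding tail using S by (subst nn_integral_cmult_indicator) auto
  also have "... = ennreal C"
   unfolding C_def using S Lp v0 M1_nonneg c by (simp add: ennreal_mult[symmetric] ennreal_plus[symmetric] mult.commute del: ennreal_plus)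
  finally show ?thesis .
 qed
 have main: "?V <= C"
 proof (rule iterated_le_Fubini[OF hm T _ _ hE fi C0])
  show "0 <= h s w" for s w using q0 by (simp add: h_def)
  show "h s w <= 2*M1" if "0 < s" "w \<in> space M" for s w using hle(1)[OF that] qb[OF that] by simp
 qed
 have hab: "abs (h s w) <= 2*M1" if "0 < s" "w \<in> space M" for s w
  using hle(1)[OF that] qb[OF that] q0 by (simp add: h_def)
  let ?g = "%s w. exp (A s w)*ito.gen u u1 u2 s w + run s w"
 note bi = bounded_iterated[OF hm T hab]
 obtain G where G: "!!s w. 0 < s ==> w \<in> space M ==> abs (exp (A s w)*ito.gen u u1 u2 s w) <= G"
  using gen_bound[OF tf R] by blast
 have dj: "(%(w, s). indicator {0<..T} s*(?g s w)) \<in> \<B> MT"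
  using borel_measurable_add[OF ito.gen_joint[OF tf, of T] run_joint[of T]] by (simp add: case_prod_beta' distrib_left)
 have db: "abs (?g s w) <= G + lam*real n*exp (real n*rho)" if "0 < s" "w \<in> space M" for s w
  using G[OF that] run_bound(2)[OF that] by linarith
 note di = bounded_iterated[OF dj T db]
 have eq: "?g s w = exp (A s w)*(ito.gen u u1 u2 s w + lam*real n*cc (X s w))" for s w
  by (simp add: run_def algebra_simps)
 have "drift u u1 u2 T <= (EE w. K*ival 0 T (%s. h s w))" unfolding drift_def eq[symmetric]
 proof (rule integral_mono)
  show "integrable M (%w. ival 0 T (%s. ?g s w))" by (rule di(2))
  show "integrable M (%w. K*ival 0 T (%s. h s w))" using bi(2) by simp
  fix w assume wv: "w \<in> space M"
  have "ival 0 T (%s. ?g s w)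
   <= (\<integral>s. K*(indicator {0<..T} s*h s w) \<partial>lborel)"
  proof (rule integral_mono_AE)
   show "iable 0 T (%s. ?g s w)" by (rule di(1)[OF _ _ wv])
   show "integrable lborel (%s. K*(indicator {0<..T} s*h s w))" using bi(1)[OF _ _ wv] by simp
   show "AE s in lborel. indicator {0<..T} s*(?g s w) <= K*(indicator {0<..T} s*h s w)"
    using AE_not_tau[of w]
   proof eventually_elim
    case (elim s)
    have "exp (A s w)*(ito.gen u u1 u2 s w + lam*real n*cc (X s w)) <= exp (A s w)*(K*q s w)" if s: "0 < s"
    proof (rule mult_left_mono)
     show "ito.gen u u1 u2 s w + lam*real n*cc (X s w) <= K*q s w"
      unfolding gen_value[where u = u, OF wv s elim ua] q_def using g[of "X s w" "H s w"] HK[of s w] s wv by simp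
    qed simp
    thus ?case unfolding eq h_def by (auto simp: indicator_def mult_ac)
   qed
  qed
  thus "ival 0 T (%s. ?g s w) <= K*ival 0 T (%s. h s w)" by simp
 qed
 also have "... = K * ?V" by simp
 also have "... <= K*C" by (rule mult_left_mono[OF main K])
 finally show ?thesis unfolding C_def v_def c_def .
qed

end

section \<open>Smoothing of densities and exponential test functions\<close>

lemma eventually_constant:
 fixes f :: "real => real"
 assumes "a <= R" "continuous_on {a..} f" "!!y. R <= y ==> f y = f R"
 shows "uniformly_continuous_on {a..} f" (is ?th1) "\<exists>C. \<forall>y\<ge>a. abs (f y) <= C" (is ?th2)
proof -
 have eq: "f y = f (min y R)" for y using assms(3)[of y] by (auto simp: min_def)
 have c: "continuous_on {a..R} f" by (rule continuous_on_subset[OF assms(2)]) auto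
 have "uniformly_continuous_on {a..R} f" by (rule compact_uniformly_continuous[OF c]) simp
 moreover have "(%y. min y R) ` {a..} \<subseteq> {a..R}" using assms(1) by auto
 ultimately have "uniformly_continuous_on ((%y. min y R) ` {a..}) f"
  unfolding uniformly_continuous_on_def by (meson subsetD)
 moreover have "uniformly_continuous_on {a..} (%y. min y R)"
  by (rule lipschitz_on_uniformly_continuous[of 1], rule lipschitz_onI) (auto simp: dist_real_def min_def)
 ultimately have "uniformly_continuous_on {a..} (%y. f (min y R))" by (rule uniformly_continuous_on_compose[rotated])
 thus ?th1 by (simp only: eq[symmetric])
 have "bounded (f ` {a..R})" by (intro compact_imp_bounded compact_continuous_image c) simp
 then obtain C where "\<forall>x\<in>f ` {a..R}. norm x <= C" unfolding bounded_iff by blast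
 hence C: "abs (f y) <= C" if "y \<in> {a..R}" for y using that by simp
 have "abs (f y) <= C" if "a <= y" for y unfolding eq[of y] by (rule C) (use that assms(1) in auto)
 thus ?th2 by blast
qed

lemma halfline_integral_derivative:
 fixes f :: "real => real"
 assumes "continuous_on {a..} f" "a <= y"
 shows "((%x. integral {a..x} f) has_real_derivative f y) (at y within {a..})"
proof -
 have "((%x. integral {a..x} f) has_real_derivative f y) (at y within {a..y + 1})"
  by (rule integral_has_real_derivative) (use assms in "auto intro: continuous_on_subset")
 moreover have "at y within {a..} = at y within {a..y + 1}" by (rule at_within_nhd[of _ "{..<y + 1}"]) auto
 ultimately show ?thesis by simp
qed

text \<open>\<open>m y\<close> is the mean of \<open>m0\<close> over \<open>[y, y + h]\<close>.
  Averaging forward stays inside \<open>{a..}\<close> and keeps \<open>m\<close> equal to 0 beyond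
  \<open>R\<close>; the mean is a value of \<open>m0\<close> in the window, so uniform continuity
  gives the error \<open>eta\<close>.\<close>

lemma smoothing:
 fixes m0 :: "real => real"
 assumes aR: "a <= R" and c: "continuous_on {a..} m0" and nn: "!!y. a <= y ==> 0 <= m0 y"
  and z: "!!y. R <= y ==> m0 y = 0" and eta: "0 < eta"
 obtains m m1 where "!!y. a <= y ==> (m has_real_derivative m1 y) (at y within {a..})"
  "continuous_on {a..} m1" "!!y. a <= y ==> 0 <= m y" "!!y. R <= y ==> m y = 0" "!!y. R <= y ==> m1 y = 0"
  "!!y. a <= y ==> abs (m y - m0 y) <= (eta::real)"
proof -
 have "uniformly_continuous_on {a..} m0" by (rule eventually_constant(1)[OF aR c]) (simp add: z)
 with eta obtain h' where h': "0 < h'" "!!y wv. a <= y ==> a <= wv ==> dist wv y < h' ==> dist (m0 wv) (m0 y) < eta"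
  unfolding uniformly_continuous_on_def by (metis atLeast_iff)
 define h where "h = h' / 2"
 have h: "0 < h" "h < h'" using h'(1) by (auto simp: h_def)
 define F where "F y = integral {a..y} m0" for y
 have dF: "(F has_real_derivative m0 y) (at y within {a..})" if "a <= y" for y
  unfolding F_def by (rule halfline_integral_derivative[OF c that])
 define m where "m y = (F (y + h) - F y) / h" for y
 define m1 where "m1 y = (m0 (y + h) - m0 y) / h" for y
 have xi: "\<exists>xi. y < xi \<and> xi < y + h \<and> m y = m0 xi" if "a <= y" for y
 proof -
  have "\<exists>xi\<in>{y<..<y + h}. F (y + h) - F y = (%t. m0 xi*t) ((y + h) - y)"
  proof (rule mvt_simple[where f' = "%x t. m0 x*t"])
   fix x assume "y <= x" "x <= y + h"
   hence "(F has_real_derivative m0 x) (at x within {y..y + h})"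
    using that by (intro has_field_derivative_subset[OF dF]) auto
   thus "(F has_derivative (%t. m0 x*t)) (at x within {y..y + h})" by (simp add: has_field_derivative_def)
  qed (use h in simp)
  thus ?thesis using h by (auto simp: m_def)
 qed
 have sh: "((%y. F (y + h)) has_real_derivative m0 (y + h)) (at y within {a..})" if "a <= y" for y
 proof -
  have "(F has_real_derivative m0 (y + h)) (at (y + h) within (%y. y + h) ` {a..})"
   by (rule has_field_derivative_subset[OF dF]) (use that h in auto)
  moreover have "((%y. y + h) has_real_derivative 1) (at y within {a..})" by (auto intro!: derivative_eq_intros)
  ultimately show ?thesis using DERIV_image_chain[of F "m0 (y + h)" "%y. y + h" y "{a..}" 1] by (simp add: o_def)
 qed
 show thesis
 proof (rule that)
  show "(m has_real_derivative m1 y) (at y within {a..})" if "a <= y" for y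
   unfolding m_def[abs_def] m1_def using h that by (auto intro!: derivative_eq_intros dF sh)
  show "continuous_on {a..} m1" unfolding m1_def[abs_def]
   by (intro continuous_intros continuous_on_compose2[OF c] c) (use h in auto)
  show "0 <= m y" if y: "a <= y" for y
  proof -
   obtain xi where "y < xi" "m y = m0 xi" using xi[OF y] by blast
   thus ?thesis using nn[of xi] y by simp
  qed
  show "m y = 0" if y: "R <= y" for y
  proof -
   have "a <= y" using y aR by simp
   then obtain xi where "y < xi" "m y = m0 xi" using xi by blast
   thus ?thesis using z[of xi] y by simp
  qed
  show "m1 y = 0" if "R <= y" for y using z[of y] z[of "y + h"] h that by (simp add: m1_def)
  show "abs (m y - m0 y) <= eta" if y: "a <= y" for y
  proof -
   obtain xi where xi: "y < xi" "xi < y + h" "m y = m0 xi" using xi[OF y] by blast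
   hence "dist (m0 xi) (m0 y) < eta" using h y by (intro h'(2)) (auto simp: dist_real_def)
   thus ?thesis using xi by (simp add: dist_real_def)
  qed
 qed
qed

text \<open>Beyond \<open>R\<close> the density vanishes and \<open>V\<close> is constant, so the
  functions are continuous up to \<open>R\<close> and constant after it, hence bounded and uniformly
  continuous.\<close>

lemma exp_test_fun:
 fixes m m1 :: "real => real" and rho N :: real
 assumes aR: "a <= R" and dm: "!!y. a <= y ==> (m has_real_derivative m1 y) (at y within {a..})"
  and c1: "continuous_on {a..} m1" and z: "!!y. R <= y ==> m y = 0" "!!y. R <= y ==> m1 y = 0"
 defines "V \<equiv> %y. rho - integral {a..y} m"
 shows "test_fun a (%y. exp (N*V y)) (%y. - N*m y*exp (N*V y)) (%y. (N^2*(m y)^2 - N*m1 y)*exp (N*V y))"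
proof -
 have cm: "continuous_on {a..} m" by (rule DERIV_continuous_on) (use dm in auto)
 have dV: "(V has_real_derivative - m y) (at y within {a..})" if "a <= y" for y
  unfolding V_def by (auto intro!: derivative_eq_intros halfline_integral_derivative[OF cm that])
 have cV: "continuous_on {a..} V" by (rule DERIV_continuous_on) (use dV in auto)
 define vR where "vR = rho - integral {a..R} m"
 have VR: "V y = vR" if "R <= y" for y
 proof -
  have mi: "m integrable_on {a..y}" by (rule integrable_continuous_interval, rule continuous_on_subset[OF cm]) auto
  have "integral {a..y} m = integral {a..R} m + integral {R..y} m"
   by (rule Henstock_Kurzweil_Integration.integral_combine[symmetric, OF aR that mi])
  also have "integral {R..y} m = integral {R..y} (%_. 0)" by (rule integral_cong) (simp add: z)
  finally show ?thesis by (simp add: V_def vR_def)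
 qed
 have d0: "((%y. exp (N*V y)) has_real_derivative - N*m y*exp (N*V y)) (at y within {a..})" if "a <= y" for y
  by (auto intro!: derivative_eq_intros dV that)
 have d1: "((%y. - N*m y*exp (N*V y)) has_real_derivative (N^2*(m y)^2 - N*m1 y)*exp (N*V y)) (at y within {a..})" if "a <= y" for y
  by (rule DERIV_cong[OF DERIV_mult[OF DERIV_cmult[OF dm[OF that]] d0[OF that]]]) (simp add: algebra_simps power2_eq_square)
 have k: "continuous_on {a..} (%y. exp (N*V y))" "continuous_on {a..} (%y. - N*m y*exp (N*V y))"
  "continuous_on {a..} (%y. (N^2*(m y)^2 - N*m1 y)*exp (N*V y))"
  by (intro continuous_intros cV cm c1)+
 note e = eventually_constant[OF aR]
 show ?thesis unfolding test_fun_def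
 proof (intro conjI allI impI)
  show "uniformly_continuous_on {a..} (%y. (N^2*(m y)^2 - N*m1 y)*exp (N*V y))"
   by (rule e(1)[OF k(3)]) (simp add: z VR)
  show "\<exists>C. \<forall>y\<ge>a. abs (exp (N*V y)) <= C" by (rule e(2)[OF k(1)]) (simp add: VR)
  show "\<exists>C. \<forall>y\<ge>a. abs (- N*m y*exp (N*V y)) <= C" by (rule e(2)[OF k(2)]) (simp add: z)
  show "\<exists>C. \<forall>y\<ge>a. abs ((N^2*(m y)^2 - N*m1 y)*exp (N*V y)) <= C" by (rule e(2)[OF k(3)]) (simp add: z)
 qed (use d0 d1 in auto)
qed

section \<open>The Hamiltonian and strict sub- and supersolutions\<close>

locale model =
 fixes mu r sig a lam rho M1 L :: real and e l :: "real => real"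
 assumes par: "r < mu" "0 < sig" "0 < a" "0 < lam" "0 < rho" and M1: "0 <= M1"
  and eL: "L-lipschitz_on {a..} e" and lc: "continuous_on {a..} l"
  and l0: "!!y. a <= y ==> 0 <= l y" and l1: "!!y. a <= y ==> l y <= l a" and l2: "l a < lam"
begin

definition HH :: "real => real => real => real" where
 "HH y m q = l y - lam + m*e y - (mu - r)*m*q + sig^2 / 2*m^2*q^2"

text \<open>With \<open>V y = rho - integral {a..y} m\<close>, this is the generator plus source at
  \<open>exp (N * V)\<close>, divided by \<open>N * exp (N * V)\<close>: the Hamiltonian, the
  second-order correction, and the source of the clock, whose size for large \<open>N\<close> is
  decided by the sign of \<open>V\<close>.\<close>

definition gen_exp :: "(real => real) => (real => real) => real => real => real => real" where
 "gen_exp m m1 N y q = HH y (m y) q - sig^2*m1 y*q^2 / (2*N) + lam*exp (- N*(rho - integral {a..y} m))"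

lemma e_cont: "continuous_on {a..} e" using eL by (rule lipschitz_on_continuous_on)

definition smooth_density :: "(real => real) => (real => real) => real => bool" where
 "smooth_density m m1 R \<longleftrightarrow> a <= R \<and>
  (\<forall>y\<ge>a. (m has_real_derivative m1 y) (at y within {a..})) \<and> continuous_on {a..} m1 \<and>
  (\<forall>y\<ge>a. 0 <= m y) \<and> (\<forall>y\<ge>R. m y = 0) \<and> (\<forall>y\<ge>R. m1 y = 0)"

lemma smooth_density:
 assumes "smooth_density m m1 R"
 shows "a <= R" "continuous_on {a..} m" "continuous_on {a..} m1" "!!y. a <= y ==> 0 <= m y" "!!y. R <= y ==> m y = 0"
  "\<exists>C. \<forall>y\<ge>a. abs (m1 y) <= C" (is ?th1) "\<exists>C. \<forall>y\<ge>a. abs (m y) <= C" (is ?th2)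
proof -
 show 1: "a <= R" "continuous_on {a..} m1" "!!y. a <= y ==> 0 <= m y" "!!y. R <= y ==> m y = 0"
  using assms by (auto simp: smooth_density_def)
 show 2: "continuous_on {a..} m"
  by (rule DERIV_continuous_on) (use assms in "auto simp: smooth_density_def")
 show ?th1
  by (rule eventually_constant(2)[OF 1(1,2)]) (use assms in "auto simp: smooth_density_def")
 show ?th2
  by (rule eventually_constant(2)[OF 1(1) 2]) (use assms in "auto simp: smooth_density_def")
qed

lemma density_integral:
 assumes c: "continuous_on {a..} m" and nn: "!!y. a <= y ==> 0 <= m y" and y: "a <= y" "y <= wv"
 shows "integral {a..y} m <= integral {a..wv} (m :: real => real)" "m integrable_on {a..y}"
proof -
 have i: "m integrable_on {a..v}" for v by (rule integrable_continuous_interval, rule continuous_on_subset[OF c]) auto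
 show "m integrable_on {a..y}" by (rule i)
 show "integral {a..y} m <= integral {a..wv} m" by (rule integral_subset_le[OF _ i i]) (use y nn in auto)
qed

lemma density_integral_le:
 assumes c: "continuous_on {a..} m" and nn: "!!y. a <= y ==> 0 <= m y" and z: "!!y. R <= y ==> m y = 0" and y: "a <= y" "a <= R"
 shows "integral {a..y} m <= integral {a..R} (m :: real => real)"
proof (cases "y <= R")
 case False
 have mi: "m integrable_on {a..y}" by (rule density_integral(2)[OF c nn y(1) order_refl])
 have "integral {a..y} m = integral {a..R} m + integral {R..y} m"
  by (rule Henstock_Kurzweil_Integration.integral_combine[symmetric]) (use y mi False in auto)
 also have "integral {R..y} m = integral {R..y} (%_. 0)" by (rule integral_cong) (simp add: z)
 finally show ?thesis by simp
qed (use density_integral(1)[OF c nn y(1)] in simp)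

definition density :: "(real => real) => real => bool" where
 "density m0 R \<longleftrightarrow> a <= R \<and> continuous_on {a..} m0 \<and> (\<forall>y\<ge>a. 0 <= m0 y) \<and> (\<forall>y\<ge>R. m0 y = 0)"

lemma densityD: "density m0 R ==> a <= R" "density m0 R ==> continuous_on {a..} m0"
 "density m0 R ==> a <= y ==> 0 <= m0 y" "density m0 R ==> R <= y ==> m0 y = 0" by (auto simp: density_def)

text \<open>\<open>HH\<close> is Lipschitz in bounded \<open>m\<close>, uniformly for
  \<open>abs q <= M1\<close> and \<open>y\<close> up to \<open>R\<close>; beyond \<open>R\<close>
  both densities vanish. \<open>K\<close> collects this Lipschitz constant and the length
  \<open>R - a\<close>, which converts the error of the density into one of its integral.\<close>

lemma smooth_HH:
 assumes dens: "density m0 R" and kap: "0 < kap"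
 obtains m m1 where "smooth_density m m1 R"
  "!!y. a <= y ==> y <= R ==> abs (integral {a..y} m - integral {a..y} m0) <= kap"
  "!!y q. a <= y ==> abs q <= M1 ==> abs (HH y (m y) q - HH y (m0 y) q) <= kap"
proof -
 note aR = densityD(1)[OF dens] and c = densityD(2)[OF dens] and nn = densityD(3)[OF dens] and z = densityD(4)[OF dens]
 obtain C0 where C0: "!!y. a <= y ==> abs (m0 y) <= C0"
  using eventually_constant(2)[OF aR c] z by (metis order_refl)
 have "bounded (e ` {a..R})"
  by (intro compact_imp_bounded compact_continuous_image continuous_on_subset[OF e_cont]) auto
 then obtain Ce where "\<forall>x\<in>e ` {a..R}. norm x <= Ce" unfolding bounded_iff by blast
 hence Ce: "abs (e y) <= Ce" if "a <= y" "y <= R" for y using that by simp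
 have pos: "0 <= C0" "0 <= Ce" using C0[of a] Ce[of a] aR by linarith+
 define K where "K = Ce + (mu - r)*M1 + sig^2 / 2*M1^2*(2*C0 + 1) + (R - a) + 1"
 have t: "0 <= (mu - r)*M1" "0 <= sig^2 / 2*M1^2*(2*C0 + 1)" using par M1 pos by simp_all
 have K: "0 < K" using pos t aR unfolding K_def by linarith
 define eta where "eta = min 1 (kap / K)"
 have eta: "0 < eta" "eta <= 1" "eta*K <= kap" using kap K by (auto simp: eta_def min_def field_simps)
 obtain m m1 where m: "!!y. a <= y ==> (m has_real_derivative m1 y) (at y within {a..})"
  "continuous_on {a..} m1" "!!y. a <= y ==> 0 <= m y" "!!y. R <= y ==> m y = 0" "!!y. R <= y ==> m1 y = 0"
  "!!y. a <= y ==> abs (m y - m0 y) <= eta" using smoothing[OF aR c nn z eta(1)] by blast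
 have sd: "smooth_density m m1 R" using aR m by (simp add: smooth_density_def)
 show thesis
 proof (rule that[OF sd])
  fix y assume y: "a <= y" "y <= R"
  have i: "m integrable_on {a..y}" "m0 integrable_on {a..y}"
   using density_integral(2)[OF smooth_density(2)[OF sd] m(3) y(1) order_refl] density_integral(2)[OF c nn y(1) order_refl] by auto
  have "abs (integral {a..y} m - integral {a..y} m0) = norm (integral {a..y} (%s. m s - m0 s))"
   using i by (simp add: Henstock_Kurzweil_Integration.integral_diff)
  also have "... <= eta*(y - a)"
  proof -
   have "norm (integral {a..y} (%s. m s - m0 s)) <= integral {a..y} (%s. eta)"
    by (rule integral_norm_bound_integral) (use i m(6) in "auto intro: integrable_diff")
   thus ?thesis using y by (simp add: mult.commute)
  qed
  also have "... <= eta*K"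
   by (rule mult_left_mono) (use eta y pos t in "unfold K_def, linarith+")
  also note eta(3)
  finally show "abs (integral {a..y} m - integral {a..y} m0) <= kap" .
 next
  fix y q assume y: "a <= y" and q: "abs q <= M1"
  show "abs (HH y (m y) q - HH y (m0 y) q) <= kap"
  proof (cases "y <= R")
   case False
   thus ?thesis using m(4)[of y] z[of y] kap by simp
  next
   case True
   have q2: "q^2 <= M1^2" using q M1 by (simp add: abs_le_square_iff[symmetric])
   have "HH y (m y) q - HH y (m0 y) q = (m y - m0 y)*(e y - (mu - r)*q + sig^2 / 2*q^2*(m y + m0 y))"
    by (simp add: HH_def power2_eq_square field_simps)
   also have "abs (...) <= eta*K" unfolding abs_mult
   proof (rule mult_mono)
    have "abs ((mu - r)*q) <= (mu - r)*M1" using par q by (simp add: abs_mult)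
    moreover have "abs (sig^2 / 2*q^2*(m y + m0 y)) <= sig^2 / 2*M1^2*(2*C0 + 1)" unfolding abs_mult
    proof (intro mult_mono)
     show "abs (m y + m0 y) <= 2*C0 + 1" using m(6)[OF y] C0[OF y] eta(2) by linarith
    qed (use q2 pos in auto)
    ultimately show "abs (e y - (mu - r)*q + sig^2 / 2*q^2*(m y + m0 y)) <= K"
     using Ce[OF y True] aR unfolding K_def by linarith
   qed (use m(6)[OF y] eta(1) in auto)
   also note eta(3)
   finally show ?thesis .
  qed
 qed
qed

lemma exp_decay: "0 < c ==> ((%n. k*exp (- real n*c)) ----> 0)" for k c :: real
 by real_asymp

lemma eventually_small:
 assumes "0 < d"
 shows "eventually (%n. k / (2*real n) <= (d::real)) sequentially"
proof -
 have "(%n. k / (2*real n)) ----> 0" by real_asymp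
 from order_tendstoD(2)[OF this assms] show ?thesis by (auto elim: eventually_mono)
qed

text \<open>The mass of \<open>m0\<close> is below \<open>rho\<close>, so \<open>V\<close> stays
  above some \<open>v > 0\<close> and the source \<open>lam exp (- n V)\<close> is exponentially
  small. Of the margin \<open>d\<close>, one half goes to smoothing, a quarter to the source and a
  quarter to the term of order \<open>1 / n\<close>.\<close>

lemma super_test:
 assumes dens: "density m0 R" and eps: "0 < eps" and tot: "integral {a..R} m0 < rho"
  and d: "0 < d" "!!y. a < y ==> HH y (m0 y) (pol y) <= - d" and polb: "!!y. a < y ==> abs (pol y) <= M1" and x: "a <= x" "x <= R"
 obtains m m1 where "smooth_density m m1 R" "abs (integral {a..x} m - integral {a..x} m0) <= eps" "integral {a..R} m <= rho"
  "eventually (%n. \<forall>y>a. gen_exp m m1 (real n) y (pol y) <= 0) sequentially"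
proof -
 define kap where "kap = min eps (min (d / 2) ((rho - integral {a..R} m0) / 2))"
 have "0 < kap \<and> kap <= eps \<and> kap <= d / 2 \<and> kap <= (rho - integral {a..R} m0) / 2"
  using eps d(1) tot unfolding kap_def min_le_iff_disj by simp
 hence kap: "0 < kap" "kap <= eps" "kap <= d / 2" "kap <= (rho - integral {a..R} m0) / 2" by blast+
 obtain m m1 where m: "smooth_density m m1 R"
  "!!y. a <= y ==> y <= R ==> abs (integral {a..y} m - integral {a..y} m0) <= kap"
  "!!y q. a <= y ==> abs q <= M1 ==> abs (HH y (m y) q - HH y (m0 y) q) <= kap"
  using smooth_HH[OF dens kap(1)] by blast
 note sd = smooth_density[OF m(1)]
 obtain K where K: "!!y. a <= y ==> abs (m1 y) <= K" using sd(6) by blast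
 define v where "v = rho - integral {a..R} m"
 have v: "0 < v" using m(2)[of R] densityD(1)[OF dens] kap(4) tot unfolding v_def by (simp add: abs_le_iff)
 show thesis
 proof (rule that[OF m(1)])
  show "abs (integral {a..x} m - integral {a..x} m0) <= eps" using m(2)[OF x] kap(2) by simp
  show "integral {a..R} m <= rho" using v by (simp add: v_def)
  have "eventually (%n. lam*exp (- real n * v) < d / 4) sequentially"
   by (rule order_tendstoD(2)[OF exp_decay[OF v]]) (use d in simp)
  moreover have "eventually (%n. sig^2*K*M1^2 / (2*real n) <= d / 4) sequentially"
   by (rule eventually_small) (use d in simp)
  moreover have "eventually (%n::nat. 0 < n) sequentially" by (rule eventually_gt_at_top)
  ultimately show "eventually (%n. \<forall>y>a. gen_exp m m1 (real n) y (pol y) <= 0) sequentially"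
  proof eventually_elim
   case (elim n)
   show ?case
   proof (intro allI impI)
    fix y assume y: "a < y"
    have q2: "(pol y)^2 <= M1^2" using polb[OF y] M1 by (simp add: abs_le_square_iff[symmetric])
    have "abs (sig^2*m1 y*(pol y)^2 / (2*real n)) <= sig^2*K*M1^2 / (2*real n)"
     unfolding abs_divide abs_mult using K[of y] y q2 elim(3) by (intro frac_le mult_mono) auto
    moreover have "HH y (m y) (pol y) <= - d / 2"
     using m(3)[of y "pol y"] d(2)[OF y] polb[OF y] y kap(3) by (simp add: abs_le_iff)
    moreover have "lam*exp (- real n*(rho - integral {a..y} m)) <= lam*exp (- real n * v)"
    proof -
     have "integral {a..y} m <= integral {a..R} m" by (rule density_integral_le) (use sd y in auto)
     thus ?thesis using par unfolding v_def by (intro mult_left_mono) (auto intro: mult_left_mono)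
    qed
    ultimately show "gen_exp m m1 (real n) y (pol y) <= 0" using elim(1,2) unfolding gen_exp_def by linarith
   qed
  qed
 qed
qed

text \<open>Strictness is asked up to \<open>D1\<close>, where the mass already exceeds
  \<open>rho\<close>. From there on \<open>V <= - v < 0\<close>, and the source
  \<open>lam exp (- n V)\<close> grows exponentially and outweighs the lower bound
  \<open>- C\<close> of the Hamiltonian; so the density may descend to 0 to the right of
  \<open>D1\<close>.\<close>

lemma sub_test:
 assumes dens: "density m0 R" and eps: "0 < eps" and D1: "a <= D1" "D1 <= R" "rho - integral {a..D1} m0 < 0"
  and d: "0 < d" "!!y q. a < y ==> y <= D1 ==> abs q <= M1 ==> d <= HH y (m0 y) q" and x: "a <= x" "x <= R"
 obtains m m1 where "smooth_density m m1 R" "abs (integral {a..x} m - integral {a..x} m0) <= eps"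
  "eventually (%n. \<forall>y>a. \<forall>q. abs q <= M1 --> 0 <= gen_exp m m1 (real n) y q) sequentially"
proof -
 define kap where "kap = min eps (min (d / 2) ((integral {a..D1} m0 - rho) / 2))"
 have "0 < kap \<and> kap <= eps \<and> kap <= d / 2 \<and> kap <= (integral {a..D1} m0 - rho) / 2"
  using eps d(1) D1(3) unfolding kap_def min_le_iff_disj by simp
 hence kap: "0 < kap" "kap <= eps" "kap <= d / 2" "kap <= (integral {a..D1} m0 - rho) / 2" by blast+
 obtain m m1 where m: "smooth_density m m1 R"
  "!!y. a <= y ==> y <= R ==> abs (integral {a..y} m - integral {a..y} m0) <= kap"
  "!!y q. a <= y ==> abs q <= M1 ==> abs (HH y (m y) q - HH y (m0 y) q) <= kap"
  using smooth_HH[OF dens kap(1)] by blast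
 note sd = smooth_density[OF m(1)]
 obtain K where K: "!!y. a <= y ==> abs (m1 y) <= K" using sd(6) by blast
 obtain Cm where Cm: "!!y. a <= y ==> abs (m y) <= Cm" using sd(7) by blast
 have "continuous_on {a..} (%y. m y*e y)" by (intro continuous_intros sd(2) e_cont)
 hence "\<exists>C. \<forall>y\<ge>a. abs (m y*e y) <= C" by (rule eventually_constant(2)[OF sd(1)]) (simp add: sd(5))
 then obtain Ce where Ce: "!!y. a <= y ==> abs (m y*e y) <= Ce" by blast
 define C where "C = lam + Ce + (mu - r)*(Cm*M1)"
 have HHlow: "- C <= HH y (m y) q" if y: "a <= y" and q: "abs q <= M1" for y q
 proof -
  have "abs ((mu - r)*m y*q) <= (mu - r)*(Cm*M1)" unfolding mult.assoc abs_mult using par Cm[OF y] q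
   by (intro mult_mono) (auto intro: order_trans[OF abs_ge_zero])
  moreover have "0 <= sig^2 / 2*(m y)^2*q^2" by simp
  ultimately show ?thesis using Ce[OF y] l0[OF y] unfolding HH_def C_def by linarith
 qed
 define v where "v = integral {a..D1} m - rho"
 have v: "0 < v" using m(2)[OF D1(1,2)] kap(4) D1(3) unfolding v_def by (simp add: abs_le_iff)
 show thesis
 proof (rule that[OF m(1)])
  show "abs (integral {a..x} m - integral {a..x} m0) <= eps" using m(2)[OF x] kap(2) by simp
  have "filterlim (%n. lam*exp (real n * v)) at_top sequentially" using v par by real_asymp
  hence "eventually (%n. C + 1 <= lam*exp (real n * v)) sequentially" by (simp add: filterlim_at_top)
  moreover have "eventually (%n. sig^2*K*M1^2 / (2*real n) <= min 1 (d / 2)) sequentially"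
   by (rule eventually_small) (use d in simp)
  moreover have "eventually (%n::nat. 0 < n) sequentially" by (rule eventually_gt_at_top)
  ultimately show "eventually (%n. \<forall>y>a. \<forall>q. abs q <= M1 --> 0 <= gen_exp m m1 (real n) y q) sequentially"
  proof eventually_elim
   case (elim n)
   show ?case
   proof (intro allI impI)
    fix y q assume y: "a < y" and q: "abs q <= M1"
    have q2: "q^2 <= M1^2" using q M1 by (simp add: abs_le_square_iff[symmetric])
    have *: "abs (sig^2*m1 y*q^2 / (2*real n)) <= sig^2*K*M1^2 / (2*real n)"
     unfolding abs_divide abs_mult using K[of y] y q2 elim(3) by (intro frac_le mult_mono) auto
    have **: "0 <= lam*exp (- real n*(rho - integral {a..y} m))" using par by simp
    show "0 <= gen_exp m m1 (real n) y q"
    proof (cases "y <= D1")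
     case True
     have "d / 2 <= HH y (m y) q" using m(3)[of y q] d(2)[OF y True q] q y kap(3) by (simp add: abs_le_iff)
     thus ?thesis using * ** elim(2) unfolding gen_exp_def by linarith
    next
     case False
     have "integral {a..D1} m <= integral {a..y} m" using False D1 by (intro density_integral(1) sd) auto
     hence "real n * v <= real n*(integral {a..y} m - rho)" unfolding v_def by (intro mult_left_mono) auto
     hence "lam*exp (real n * v) <= lam*exp (- real n*(rho - integral {a..y} m))"
      using par by (simp add: algebra_simps)
     thus ?thesis using * elim(1,2) HHlow[of y q] y q unfolding gen_exp_def by linarith
    qed
   qed
  qed
 qed
qed

end

section \<open>Lipschitz functions under products, reciprocals and stopping\<close>

lemma lipschitz_on_product:
 fixes f g :: "real => real"
 assumes f: "C-lipschitz_on S f" "!!y. y \<in> S ==> abs (f y) <= A" and g: "D-lipschitz_on S g" "!!y. y \<in> S ==> abs (g y) <= B"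
  and "0 <= A" "0 <= B"
 shows "(A*D + B*C)-lipschitz_on S (%y. f y*g y)"
proof (rule lipschitz_onI)
 note nn = lipschitz_on_nonneg[OF f(1)] lipschitz_on_nonneg[OF g(1)]
 show "0 <= A*D + B*C" using nn assms by simp
 fix y z assume yz: "y \<in> S" "z \<in> S"
 have "f y*g y - f z*g z = f y*(g y - g z) + g z*(f y - f z)" by (simp add: algebra_simps)
 also have "abs (...) <= abs (f y)*abs (g y - g z) + abs (g z)*abs (f y - f z)"
  by (metis abs_mult abs_triangle_ineq)
 also have "... <= A*(D*dist y z) + B*(C*dist y z)"
  using lipschitz_onD[OF f(1) yz] lipschitz_onD[OF g(1) yz] f(2)[OF yz(1)] g(2)[OF yz(2)] assms(5,6)
  by (intro add_mono mult_mono) (auto simp: dist_real_def)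
 finally show "dist (f y*g y) (f z*g z) <= (A*D + B*C)*dist y z"
  by (simp add: dist_real_def algebra_simps)
qed

lemma lipschitz_on_inverse:
 fixes f :: "real => real"
 assumes f: "C-lipschitz_on S f" "!!y. y \<in> S ==> c <= f y" and c: "0 < c"
 shows "(C / c^2)-lipschitz_on S (%y. inverse (f y))"
proof (rule lipschitz_onI)
 show "0 <= C / c^2" using lipschitz_on_nonneg[OF f(1)] by simp
 fix y z assume yz: "y \<in> S" "z \<in> S"
 have p: "c <= f y" "c <= f z" using f(2) yz by auto
 have "inverse (f y) - inverse (f z) = (f z - f y) / (f y*f z)" using p c by (simp add: field_simps)
 hence "dist (inverse (f y)) (inverse (f z)) = dist (f y) (f z) / (f y*f z)"
  using p c by (simp add: dist_real_def abs_mult abs_minus_commute)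
 also have "... <= (C*dist y z) / (c*c)"
  using lipschitz_onD[OF f(1) yz] p c lipschitz_on_nonneg[OF f(1)] by (intro frac_le mult_mono) auto
 finally show "dist (inverse (f y)) (inverse (f z)) <= C / c^2*dist y z" by (simp add: power2_eq_square)
qed

lemma lipschitz_on_stop:
 fixes f :: "real => real"
 assumes "C-lipschitz_on {a..d} f" "a <= d"
 shows "C-lipschitz_on {a..} (%y. f (min y d))"
proof (rule lipschitz_onI)
 fix y z :: real assume "y \<in> {a..}" "z \<in> {a..}"
 hence "dist (f (min y d)) (f (min z d)) <= C*dist (min y d) (min z d)"
  using assms(2) by (intro lipschitz_onD[OF assms(1)]) auto
 also have "... <= C*dist y z"
  using lipschitz_on_nonneg[OF assms(1)] by (intro mult_left_mono) (auto simp: dist_real_def min_def)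
 finally show "dist (f (min y d)) (f (min z d)) <= C*dist y z" .
qed (rule lipschitz_on_nonneg[OF assms(1)])

section \<open>The critical density, its level and the limiting value\<close>

locale model_lip = model +
 fixes Ll :: real
 assumes lL: "Ll-lipschitz_on {a..} l"
  and ps: "!!y. a <= y ==> abs (pi_star mu r sig a lam rho e l y) <= M1"
begin

definition nu :: real where "nu = 1/2*((mu - r) / sig)^2"

definition La :: "real => real" where "La y = lam - l y + nu"

definition gq :: "real => real" where "gq y = La y / e y"

definition po :: "real => real" where "po y = (mu - r)*e y / (sig^2*La y)"

abbreviation "pis \<equiv> pi_star mu r sig a lam rho e l"

abbreviation "dl \<equiv> d_level mu r sig a lam rho e l"

lemma pis: "pis y = (if ereal y < dl then po y else 0)"
 unfolding pi_star_def po_def La_def nu_def by (simp add: algebra_simps)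

lemma nu_pos: "0 < nu" using par by (simp add: nu_def)

lemma La_pos: "a <= y ==> nu + (lam - l a) <= La y" "a <= y ==> nu < La y" "a <= y ==> 0 < La y"
 using l1[of y] l2 nu_pos by (auto simp: La_def)

lemma La_cont: "continuous_on {a..} La" unfolding La_def[abs_def] by (intro continuous_intros lc)

lemma gq_cont: "(!!s. a <= s ==> s <= y ==> 0 < e s) ==> continuous_on {a..y} gq"
 unfolding gq_def[abs_def]
 by (intro continuous_on_divide continuous_on_subset[OF La_cont] continuous_on_subset[OF e_cont]) force+

text \<open>Completing the square: the part of \<open>HH\<close> that depends on \<open>q\<close>
  is, up to a constant, half the square of \<open>sig m q - (mu - r) / sig\<close>.\<close>

lemma HH_low: "- La y + m*e y <= HH y m q"
proof -
 have "HH y m q = - La y + m*e y + (sig*m*q - (mu - r) / sig)^2 / 2"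
  using par by (simp add: HH_def La_def nu_def power2_eq_square field_simps)
 thus ?thesis by simp
qed

text \<open>In terms of the ratio \<open>m e / La\<close>, which is 1 at the critical density
  \<open>gq\<close>, the Hamiltonian under the feedback is a quadratic polynomial; subcritical
  densities are tested with it.\<close>

lemma HH_po:
 assumes "a <= y"
 shows "HH y m (po y) = - (lam - l y) + m*e y - 2*nu*(m*e y / La y) + nu*(m*e y / La y)^2"
proof -
 have p: "La y \<noteq> 0" "sig \<noteq> 0" using La_pos[OF assms] par by auto
 define s where "s = m*e y / La y"
 have 1: "m*po y = (mu - r) * s / sig^2" using p by (simp add: po_def s_def mult_ac)
 have 2: "(mu - r)*m*po y = 2*nu * s" using p 1 by (simp add: mult.assoc nu_def power2_eq_square)
 have 3: "sig^2 / 2*m^2*(po y)^2 = nu * s^2"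
 proof -
  have "sig^2 / 2*m^2*(po y)^2 = sig^2 / 2*(m*po y)^2" by (simp add: power_mult_distrib)
  also have "... = nu * s^2" unfolding 1 using p by (simp add: nu_def power2_eq_square field_simps)
  finally show ?thesis .
 qed
 show ?thesis unfolding HH_def 2 3 s_def[symmetric] by simp
qed

text \<open>Because \<open>e\<close> is Lipschitz, the integral of \<open>1 / e\<close> diverges
  logarithmically: at infinity, where \<open>e\<close> grows at most linearly, or at the first zero
  of \<open>e\<close>, which is approached at most linearly. So the mass \<open>rho\<close> is
  reached while \<open>e\<close> is still positive.\<close>

lemma exists_level:
 assumes ea: "0 < e a"
 obtains d where "a < d" "!!y. a <= y ==> y <= d ==> 0 < e y" "integral {a..d} gq = rho"
proof -
 define K where "K = L + 1"
 have K: "0 < K" using lipschitz_on_nonneg[OF eL] by (simp add: K_def)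
 have eK: "abs (e y - e z) <= K*abs (y - z)" if "a <= y" "a <= z" for y z
 proof -
  have "abs (e y - e z) <= L*abs (y - z)" using lipschitz_onD[OF eL, of y z] that by (simp add: dist_real_def)
  also have "... <= K*abs (y - z)" by (intro mult_right_mono) (auto simp: K_def)
  finally show ?thesis .
 qed
 define c0 where "c0 = nu + (lam - l a)"
 have c0: "0 < c0" using nu_pos l2 by (simp add: c0_def)
 \<comment> \<open>The logarithmic length required: in both cases \<open>Y\<close> is placed so that
   the comparison density \<open>c0 / q\<close> has the integral
   \<open>c0 / K * k = rho\<close>.\<close>
 define k where "k = K*rho / c0"
 have k: "0 < k" using K c0 par by (simp add: k_def)
 have compare: "rho <= integral {a..Y} gq"
  if Y: "a <= Y" and pos: "!!s. a <= s ==> s <= Y ==> 0 < e s" and q: "!!s. a <= s ==> s <= Y ==> e s <= q s"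
   and G: "!!s. a <= s ==> s <= Y ==> (G has_real_derivative c0 / q s) (at s within {a..Y})" "G Y - G a = rho"
  for Y q G
 proof -
  have "((%s. c0 / q s) has_integral G Y - G a) {a..Y}"
   by (rule fundamental_theorem_of_calculus[OF Y]) (use G(1) in "auto simp: has_real_derivative_iff_has_vector_derivative")
  moreover have "(gq has_integral integral {a..Y} gq) {a..Y}"
   by (intro integrable_integral integrable_continuous_interval gq_cont pos)
  ultimately have "G Y - G a <= integral {a..Y} gq"
  proof (rule has_integral_le)
   fix s assume s: "s \<in> {a..Y}"
   hence "0 < e s" "e s <= q s" "c0 <= La s" using pos q La_pos(1)[of s] by (auto simp: c0_def)
   thus "c0 / q s <= gq s" unfolding gq_def using c0 by (intro frac_le) auto
  qed
  thus ?thesis using G(2) by simp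
 qed
 have "\<exists>Y>a. (\<forall>s. a <= s --> s <= Y --> 0 < e s) \<and> rho <= integral {a..Y} gq"
 proof -
  have "continuous_on {0..} (%t. e (a + t))"
   by (rule continuous_on_compose2[OF e_cont]) (auto intro!: continuous_intros)
  moreover have "0 <= e (a + 0)" using ea by simp
  ultimately show ?thesis
  proof (cases rule: hit_time_cases)
   case never
   have pos: "0 < e s" if "a <= s" for s using never(2)[of "s - a"] that by simp
   define Y where "Y = a + e a / K*(exp k - 1)"
   have Y: "a < Y" using ea K k by (simp add: Y_def)
   have "rho <= integral {a..Y} gq"
   proof (rule compare)
    show "a <= Y" using Y by simp
    show "e s <= e a + K*(s - a)" if "a <= s" for s using eK[of s a] that by simp
    fix s assume s: "a <= s" "s <= Y"
    have p: "0 < e a + K*(s - a)" using ea K s by (simp add: add_pos_nonneg)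
    show "((%s. c0 / K*ln (e a + K*(s - a))) has_real_derivative c0 / (e a + K*(s - a))) (at s within {a..Y})"
     using p K by (auto intro!: derivative_eq_intros)
   next
    have "e a + K*(Y - a) = e a*exp k" using K by (simp add: Y_def field_simps)
    thus "c0 / K*ln (e a + K*(Y - a)) - c0 / K*ln (e a + K*(a - a)) = rho"
     using ea K c0 by (simp add: ln_mult k_def algebra_simps)
   qed (use pos in auto)
   thus ?thesis using Y pos by blast
  next
   case (hit t)
   define b where "b = a + t"
   have eb: "e b = 0" using hit(3) by (simp add: b_def)
   have ab: "a < b" using hit(1,3) ea by (cases "t = 0") (auto simp: b_def)
   have pos: "0 < e s" if "a <= s" "s < b" for s using hit(4)[of "s - a"] that by (simp add: b_def)
   define Y where "Y = b - (b - a)*exp (- k)"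
   have Yb: "Y < b" using ab by (simp add: Y_def)
   have "(b - a)*exp (- k) < (b - a)*1" using ab k by (intro mult_strict_left_mono) auto
   hence Y: "a < Y" by (simp add: Y_def)
   have "rho <= integral {a..Y} gq"
   proof (rule compare)
    show "a <= Y" using Y by simp
    show "0 < e s" if "a <= s" "s <= Y" for s using pos[of s] that Yb by simp
    show "e s <= K*(b - s)" if "a <= s" "s <= Y" for s using eK[of s b] that Yb ab eb by simp
    fix s assume s: "a <= s" "s <= Y"
    have p: "0 < b - s" using s Yb by simp
    show "((%s. - (c0 / K)*ln (b - s)) has_real_derivative c0 / (K*(b - s))) (at s within {a..Y})"
     using p K by (auto intro!: derivative_eq_intros)
   next
    have "b - Y = (b - a)*exp (- k)" by (simp add: Y_def)
    hence "ln (b - Y) = ln (b - a) - k" using ab by (simp add: ln_mult)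
    thus "- (c0 / K)*ln (b - Y) - - (c0 / K)*ln (b - a) = rho" using K c0 by (simp add: k_def field_simps)
   qed
   thus ?thesis using Y Yb pos by force
  qed
 qed
 then obtain Y where Y: "a < Y" "!!s. a <= s ==> s <= Y ==> 0 < e s" "rho <= integral {a..Y} gq" by blast
 have "continuous_on {a..Y} (%y. integral {a..y} gq)"
  by (intro indefinite_integral_continuous_1 integrable_continuous_interval gq_cont Y(2))
 hence "\<exists>d\<ge>a. d <= Y \<and> integral {a..d} gq = rho" using Y par by (intro IVT') auto
 then obtain d where d: "a <= d" "d <= Y" "integral {a..d} gq = rho" by blast
 have "d \<noteq> a" using d(3) par by auto
 thus thesis using d Y(2) by (intro that[of d]) auto
qed

text \<open>Up to \<open>d\<close> the density \<open>gq\<close> is positive, so \<open>d\<close> is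
  the first point at which its integral equals \<open>rho\<close>; as \<open>e\<close> is positive
  there, \<open>b_level\<close> lies no lower.\<close>

lemma d_level_eq:
 assumes d: "a < d" "!!y. a <= y ==> y <= d ==> 0 < e y" "integral {a..d} gq = rho"
 shows "dl = ereal d"
proof -
 have lb: "(LBINT u:{a..y}. (lam - l u + 1/2*((mu - r) / sig)^2) / e u) = integral {a..y} gq" if "a <= y" "y <= d" for y
 proof -
  have "continuous_on {a..y} gq" by (rule gq_cont) (use d that in auto)
  hence "set_integrable lborel {a..y} gq" by (rule borel_integrable_atLeastAtMost')
  from set_borel_integral_eq_integral(2)[OF this] show ?thesis by (simp add: gq_def[abs_def] La_def nu_def)
 qed
 let ?S = "{y. a < y \<and> rho - (LBINT u:{a..y}. (lam - l u + 1/2*((mu - r) / sig)^2) / e u) = 0}"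
 have Inf: "Inf (ereal ` ?S) = ereal d"
 proof (rule antisym)
  show "Inf (ereal ` ?S) <= ereal d" by (rule Inf_lower) (use d lb[of d] in auto)
  show "ereal d <= Inf (ereal ` ?S)"
  proof (rule Inf_greatest, safe)
   fix y assume y: "a < y" "rho - (LBINT u:{a..y}. (lam - l u + 1/2*((mu - r) / sig)^2) / e u) = 0"
   show "ereal d <= ereal y"
   proof (rule ccontr)
    assume "\<not> ereal d <= ereal y"
    hence yd: "y < d" by simp
    have int: "gq integrable_on {a..d}" by (intro integrable_continuous_interval gq_cont d(2))
    have "integral {a..d} gq = integral {a..y} gq + integral {y..d} gq"
     by (rule Henstock_Kurzweil_Integration.integral_combine[symmetric]) (use y yd int in auto)
    moreover have "integral {a..y} gq = rho" using lb[of y] y yd by simp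
    moreover have "0 < integral {y..d} gq"
    proof -
     have "integral {y..d} (%_. 0) < integral {y..d} gq"
     proof (rule integral_less_real)
      show "continuous_on {y..d} gq" by (rule continuous_on_subset[OF gq_cont[OF d(2)]]) (use y in auto)
      show "{y<..<d} \<noteq> {}" using yd by simp
      show "0 < gq s" if "s \<in> {y<..<d}" for s
       using that y d(2)[of s] La_pos(3)[of s] by (auto simp: gq_def)
     qed simp
     thus ?thesis by simp
    qed
    ultimately show False using d(3) by simp
   qed
  qed
 qed
 have "ereal d <= b_level a e" unfolding b_level_def
 proof (rule Inf_greatest, safe)
  fix y assume "a <= y" "e y < 0"
  thus "ereal d <= ereal y" using d(2)[of y] by force
 qed
 thus ?thesis unfolding d_level_def Inf by (simp add: min_def)
qed

end

context model_lip
begin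

definition Uv :: "real => real" where
 "Uv x = (if x = a then rho else if 0 < e a then rho - integral {a..min x (real_of_ereal dl)} gq else 0)"

definition strict_super :: "(real => real) => (real => real) => bool" where
 "strict_super m0 pol \<longleftrightarrow> (\<exists>d>0. \<forall>y>a. HH y (m0 y) (pol y) <= - d)"

lemma continuous_bounded_interval:
 fixes f :: "real => real"
 assumes "continuous_on {a..d} f"
 obtains C where "0 <= C" "!!y. a <= y ==> y <= d ==> abs (f y) <= C"
proof -
 have "bounded (f ` {a..d})" by (intro compact_imp_bounded compact_continuous_image assms) simp
 then obtain C where C: "\<forall>x\<in>f ` {a..d}. norm x <= C" unfolding bounded_iff by blast
 show thesis
 proof (rule that[of "max 0 C"])
  show "abs (f y) <= max 0 C" if "a <= y" "y <= d" for y using C that by (auto intro: le_max_iff_disj[THEN iffD2])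
 qed simp
qed

end

locale level = model_lip +
 fixes d :: real
 assumes d1: "a < d" and d2: "!!y. a <= y ==> y <= d ==> 0 < e y" and d3: "integral {a..d} gq = rho"
begin

lemma dl_eq: "dl = ereal d" by (rule d_level_eq[OF d1 d2 d3])

lemma Uv_eq: "a <= x ==> Uv x = rho - integral {a..min x d} gq"
 using d1 d2[of a] by (auto simp: Uv_def dl_eq min_def)

lemma gqc: "continuous_on {a..d} gq" by (rule gq_cont[OF d2])

lemma gq_pos: "a <= y ==> y <= d ==> 0 < gq y"
 using d2[of y] La_pos(3)[of y] by (simp add: gq_def)

lemma gqi: "a <= y ==> wv <= d ==> gq integrable_on {y..wv}"
 by (intro integrable_continuous_interval continuous_on_subset[OF gqc]) auto

lemma gqi_cmult: "a <= y ==> wv <= d ==> (%s. c*gq s) integrable_on {y..wv}"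
 by (intro integrable_continuous_interval continuous_on_subset[OF continuous_on_mult_left[OF gqc]]) auto

lemma e_min: obtains c where "0 < c" "!!y. a <= y ==> y <= d ==> c <= e y"
proof -
 have "\<exists>y\<in>{a..d}. \<forall>wv\<in>{a..d}. e y <= e wv"
  by (rule continuous_attains_inf) (use d1 in "auto intro: continuous_on_subset[OF e_cont]")
 then obtain y where "y \<in> {a..d}" "!!wv. wv \<in> {a..d} ==> e y <= e wv" by blast
 thus thesis using d2[of y] by (intro that[of "e y"]) auto
qed

lemma La_lip: "Ll-lipschitz_on {a..} La"
proof (rule lipschitz_onI)
 fix y z assume "y \<in> {a..}" "z \<in> {a..}"
 thus "dist (La y) (La z) <= Ll*dist y z"
  using lipschitz_onD[OF lL, of y z] by (simp add: La_def dist_real_def abs_minus_commute)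
qed (rule lipschitz_on_nonneg[OF lL])

lemma gq_lip: "\<exists>C. C-lipschitz_on {a..d} gq"
proof -
 obtain c where c: "0 < c" "!!y. a <= y ==> y <= d ==> c <= e y" using e_min by blast
 obtain A where A: "0 <= A" "!!y. a <= y ==> y <= d ==> abs (La y) <= A"
  by (rule continuous_bounded_interval[OF continuous_on_subset[OF La_cont, of "{a..d}"]]) auto
 have "L-lipschitz_on {a..d} e" by (rule lipschitz_on_subset[OF eL]) auto
 hence inv: "(L / c^2)-lipschitz_on {a..d} (%y. inverse (e y))" using c by (intro lipschitz_on_inverse) auto
 have "Ll-lipschitz_on {a..d} La" by (rule lipschitz_on_subset[OF La_lip]) auto
 hence "(A*(L / c^2) + (1 / c)*Ll)-lipschitz_on {a..d} (%y. La y*inverse (e y))"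
 proof (rule lipschitz_on_product[OF _ _ inv])
  show "abs (La y) <= A" if "y \<in> {a..d}" for y using A that by simp
  show "abs (inverse (e y)) <= 1 / c" if "y \<in> {a..d}" for y
   using c(2)[of y] c(1) that by (simp add: field_simps)
 qed (use A c in auto)
 thus ?thesis unfolding gq_def[abs_def] divide_inverse by blast
qed

text \<open>The feedback frozen at its value at \<open>d\<close> instead of dropping to 0. The game
  and the Euler scheme ask for a Lipschitz function, and the supersolution has density 0 from
  \<open>d\<close> on, where the control has no influence on \<open>HH\<close>.\<close>

definition polA :: "real => real" where "polA y = po (min y d)"

lemma polA_lip: "\<exists>C. C-lipschitz_on {a..} polA"
proof -
 obtain A where A: "0 <= A" "!!y. a <= y ==> y <= d ==> abs (e y) <= A"
  by (rule continuous_bounded_interval[OF continuous_on_subset[OF e_cont, of "{a..d}"]]) auto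
 have el: "L-lipschitz_on {a..d} e" by (rule lipschitz_on_subset[OF eL]) auto
 have "Ll-lipschitz_on {a..d} La" by (rule lipschitz_on_subset[OF La_lip]) auto
 moreover have "nu <= La y" if "y \<in> {a..d}" for y using La_pos(2)[of y] that by simp
 ultimately have inv: "(Ll / nu^2)-lipschitz_on {a..d} (%y. inverse (La y))"
  using nu_pos by (intro lipschitz_on_inverse)
 have "(A*(Ll / nu^2) + (1 / nu)*L)-lipschitz_on {a..d} (%y. e y*inverse (La y))" (is "?C-lipschitz_on _ ?f")
 proof (rule lipschitz_on_product[OF el _ inv])
  show "abs (e y) <= A" if "y \<in> {a..d}" for y using A that by simp
  show "abs (inverse (La y)) <= 1 / nu" if "y \<in> {a..d}" for y
   using La_pos(2)[of y] nu_pos that by (simp add: field_simps)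
 qed (use A nu_pos in auto)
 hence "(abs ((mu - r) / sig^2) * ?C)-lipschitz_on {a..d} (%y. (mu - r) / sig^2 * ?f y)"
  by (rule lipschitz_on_cmult_real)
 moreover have "(%y. (mu - r) / sig^2 * ?f y) = po" by (rule ext) (simp add: po_def divide_inverse mult_ac)
 ultimately have "(abs ((mu - r) / sig^2) * ?C)-lipschitz_on {a..d} po" by (simp only:)
 from lipschitz_on_stop[OF this less_imp_le[OF d1]] show ?thesis unfolding polA_def[abs_def] by blast
qed

text \<open>At \<open>d\<close> itself \<open>pi_star\<close> is 0 and says nothing about
  \<open>po\<close>; the bound is carried over by continuity.\<close>

lemma po_bound: "a <= y ==> y <= d ==> abs (po y) <= M1"
proof -
 assume y: "a <= y" "y <= d"
 have lt: "abs (po z) <= M1" if "a <= z" "z < d" for z using ps[of z] that by (simp add: pis dl_eq)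
 show "abs (po y) <= M1"
 proof (cases "y < d")
  case False
  have c: "continuous_on {a..d} polA" using polA_lip
   by (auto intro: continuous_on_subset[OF lipschitz_on_continuous_on])
  have cl: "closure {a..<d} = {a..d}" using d1 by simp
  have "abs (polA d) <= M1" by (rule continuous_le_on_closure[where S = "{a..<d}" and f = "%y. abs (polA y)"])
    (use c lt d1 in "auto simp: cl polA_def intro!: continuous_intros")
  thus ?thesis using False y by (simp add: polA_def)
 qed (use lt y in simp)
qed

lemma polA_bound: "a <= y ==> abs (polA y) <= M1"
 unfolding polA_def using d1 by (intro po_bound) auto

lemma pis_polA: "a <= y ==> y < d ==> pis y = polA y" "d <= y ==> pis y = 0"
 by (auto simp: pis dl_eq polA_def)

text \<open>At the fraction \<open>q\<close> of the critical density the Hamiltonian under the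
  feedback factors as \<open>(q - 1) * (nu * q + (lam - l y))\<close>.\<close>

lemma HH_fraction:
 assumes y: "a < y" "y <= d" and q: "0 <= q" "q <= 1 - dd" "0 < dd"
 shows "HH y (q*gq y) (po y) <= - dd*(lam - l a)"
proof -
 have p: "0 < e y" "0 < La y" using d2[of y] La_pos(3)[of y] y by auto
 hence s: "q*gq y*e y = q*La y" "q*gq y*e y / La y = q" by (auto simp: gq_def)
 have "HH y (q*gq y) (po y) = - (lam - l y) + q*La y - 2*nu*q + nu*q^2"
  using HH_po[of y "q*gq y"] y p unfolding s by simp
 also have "... = (q - 1)*(nu*q + (lam - l y))" by (simp add: La_def power2_eq_square algebra_simps)
 also have "... <= - dd*(lam - l a)"
 proof -
  have b: "lam - l a <= nu*q + (lam - l y)" "0 < lam - l a"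
  proof -
   have "0 <= nu*q" using nu_pos q by simp
   thus "lam - l a <= nu*q + (lam - l y)" using l1[of y] y by linarith
  qed (use l2 in simp)
  have "dd*(lam - l a) <= (1 - q)*(nu*q + (lam - l y))" using q b by (intro mult_mono) auto
  thus ?thesis by (simp add: algebra_simps)
 qed
 finally show ?thesis .
qed

text \<open>Scaling the critical density by \<open>1 - dd\<close> makes it strict and puts its mass
  below \<open>rho\<close>; the ramp \<open>chi\<close> of width \<open>k\<close> brings it
  continuously to 0 at \<open>d\<close>. Scaling and ramp cost at most \<open>eps / 2\<close> each
  in the value. From \<open>d\<close> on the Hamiltonian is \<open>l y - lam\<close> for any
  control, so the same density serves \<open>polA\<close> and the discontinuous
  \<open>pis\<close>.\<close>

lemma super_density:
 assumes x: "a <= x" and eps: "0 < eps"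
 shows "\<exists>m0 R. x <= R \<and> density m0 R \<and> integral {a..R} m0 < rho \<and> strict_super m0 polA \<and> strict_super m0 pis \<and>
  rho - integral {a..x} m0 <= Uv x + eps"
proof -
 obtain G where G: "0 <= G" "!!y. a <= y ==> y <= d ==> abs (gq y) <= G"
  by (rule continuous_bounded_interval[OF gqc]) auto
 define dd where "dd = min (1 / 2) (eps / (2*rho))"
 have dd: "0 < dd" "dd < 1" "dd*rho <= eps / 2" using eps par by (auto simp: dd_def min_def field_simps)
 define k where "k = min (d - a) (eps / (2*(G + 1)))"
 have kG: "k*G <= eps / 2"
 proof -
  have "k*G <= eps / (2*(G + 1))*(G + 1)" using G(1) d1 eps unfolding k_def by (intro mult_mono) auto
  also have "eps / (2*(G + 1))*(G + 1) = eps / 2" using G(1) by (simp add: field_simps add_eq_0_iff)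
  finally show ?thesis .
 qed
 have k: "0 < k" "k <= d - a" using d1 eps G(1) by (auto simp: k_def)
 define chi where "chi y = max 0 (min 1 ((d - y) / k))" for y
 have chi: "0 <= chi y" "chi y <= 1" for y by (auto simp: chi_def)
 have chi1: "chi y = 1" if "y <= d - k" for y using that k by (simp add: chi_def field_simps)
 have chi0: "chi y = 0" if "d <= y" for y using that k by (simp add: chi_def divide_nonpos_pos)
 define m0 where "m0 y = (1 - dd)*chi y*gq (min y d)" for y
 let ?f = "%y. gq y - m0 y"
 define R where "R = max x d"
 have m0c: "continuous_on {a..} m0" unfolding m0_def chi_def
  by (intro continuous_intros continuous_on_compose2[OF gqc]) (use d1 k in auto)
 have m0n: "0 <= m0 y" if "a <= y" for y
  unfolding m0_def using dd chi gq_pos[of "min y d"] d1 that by (intro mult_nonneg_nonneg) (auto simp: less_imp_le)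
 have m0z: "m0 y = 0" if "d <= y" for y using chi0[OF that] by (simp add: m0_def)
 have m0i: "m0 integrable_on {y..wv}" if "a <= y" for y wv
  by (intro integrable_continuous_interval continuous_on_subset[OF m0c]) (use that in auto)
 have dens: "density m0 R" unfolding density_def R_def using x m0c m0n m0z by auto
 have le: "m0 y <= (1 - dd)*gq y" if "a <= y" "y <= d" for y
  unfolding m0_def using that dd chi[of y] gq_pos[of y] by (auto simp: mult_le_cancel_left1 intro!: mult_left_mono)
 have tail: "integral {a..wv} m0 <= integral {a..d} m0" if "a <= wv" for wv
  by (rule density_integral_le) (use m0c m0n m0z that d1 in auto)
 have tot: "integral {a..R} m0 < rho"
 proof -
  have "integral {a..R} m0 <= integral {a..d} m0" by (rule tail) (use x in "simp add: R_def")
  also have "... <= integral {a..d} (%y. (1 - dd)*gq y)"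
   by (intro integral_le m0i gqi_cmult) (use le in auto)
  also have "... = (1 - dd)*rho" using d3 by simp
  also have "... < rho" using dd par by simp
  finally show ?thesis .
 qed
 have sup: "strict_super m0 polA \<and> strict_super m0 pis"
 proof -
  define c where "c = dd*(lam - l a)"
  have c: "0 < c" using dd l2 by (simp add: c_def)
  have below: "HH y (m0 y) (po y) <= - c" if "a < y" "y <= d" for y
  proof -
   have "(1 - dd)*chi y <= 1 - dd" using dd chi[of y] by (simp add: mult_le_cancel_left1)
   thus ?thesis using HH_fraction[OF that, of "(1 - dd)*chi y" dd] that dd chi[of y] by (simp add: m0_def c_def min_def)
  qed
  have above: "HH y (m0 y) q <= - c" if "d <= y" for y q
  proof -
   have "HH y (m0 y) q = - (lam - l y)" using m0z[OF that] by (simp add: HH_def)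
   moreover have "dd*(lam - l a) <= 1*(lam - l a)" using dd l2 by (intro mult_right_mono) auto
   ultimately show ?thesis using l1[of y] that d1 by (simp add: c_def)
  qed
  have "HH y (m0 y) (polA y) <= - c" if "a < y" for y
   using below[OF that] above[of y] by (cases "y <= d") (auto simp: polA_def min_def)
  moreover have "HH y (m0 y) (pis y) <= - c" if "a < y" for y
   using below[OF that] above[of y] pis_polA[of y] that by (cases "y < d") (auto simp: polA_def min_def)
  ultimately show ?thesis using c unfolding strict_super_def by blast
 qed
 have val: "rho - integral {a..x} m0 <= Uv x + eps"
 proof -
  define z where "z = min x d"
  have z: "a <= z" "z <= d" "z <= x" using x d1 by (auto simp: z_def)
  have "integral {a..z} gq - integral {a..z} m0 = integral {a..z} ?f"
   using z by (intro Henstock_Kurzweil_Integration.integral_diff[symmetric] gqi m0i) auto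
  also have "... <= integral {a..d} ?f"
  proof (rule integral_subset_le)
   have "0 <= gq y - m0 y" if "y \<in> {a..d}" for y
   proof -
    have "0 <= dd*gq y" "m0 y <= gq y - dd*gq y"
     using le[of y] gq_pos[of y] dd that by (auto simp: left_diff_distrib)
    thus ?thesis by linarith
   qed
   thus "\<forall>y\<in>{a..d}. 0 <= gq y - m0 y" by blast
  qed (use z in "auto intro!: integrable_diff gqi m0i")
  also have "... = integral {a..d - k} ?f + integral {d - k..d} ?f"
   by (rule Henstock_Kurzweil_Integration.integral_combine[symmetric]) (use k d1 in "auto intro!: integrable_diff gqi m0i")
  also have "integral {a..d - k} ?f = integral {a..d - k} (%y. dd*gq y)"
   by (rule integral_cong) (use k chi1 in "auto simp: m0_def algebra_simps min_def")
  also have "... <= integral {a..d} (%y. dd*gq y)"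
  proof (rule integral_subset_le)
   show "\<forall>y\<in>{a..d}. 0 <= dd*gq y" using gq_pos dd by (simp add: less_imp_le)
  qed (use k d1 in "auto intro!: gqi_cmult")
  also have "... = dd*rho" using d3 by simp
  also note dd(3)
  also have "integral {d - k..d} ?f <= integral {d - k..d} (%y. G)"
  proof (rule integral_le)
   fix y assume y: "y \<in> {d - k..d}"
   hence "a <= y" "y <= d" using k by auto
   thus "gq y - m0 y <= G" using G(2)[of y] m0n[of y] by (simp add: abs_le_iff)
  qed (use k in "auto intro!: integrable_diff gqi m0i")
  also have "... = k*G" using k by (simp add: mult.commute)
  also note kG
  finally have "integral {a..z} gq - integral {a..z} m0 <= eps" by simp
  moreover have "integral {a..z} m0 <= integral {a..x} m0" by (intro density_integral(1) m0c m0n z) auto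
  ultimately show ?thesis using Uv_eq[OF x] by (simp add: z_def)
 qed
 show ?thesis by (intro exI[of _ m0] exI[of _ R] conjI) (use dens tot sup val in "auto simp: R_def")
qed

text \<open>Scaling by \<open>1 + dd\<close> with \<open>dd = eps / rho\<close> makes the
  Hamiltonian at least \<open>dd * nu\<close> for every control and carries the mass beyond
  \<open>rho\<close> at \<open>d\<close>. The cutoff \<open>chi\<close> ends the density on
  \<open>[d, d + 1]\<close>, where no sign is claimed.\<close>

lemma sub_density:
 assumes x: "a <= x" "x < d" and eps: "0 < eps"
 shows "\<exists>m0 c. x <= d + 1 \<and> density m0 (d + 1) \<and> rho < integral {a..d} m0 \<and>
  0 < c \<and> (\<forall>y q. a < y \<and> y <= d --> c <= HH y (m0 y) q) \<and> Uv x - eps <= rho - integral {a..x} m0"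
proof -
 define dd where "dd = eps / rho"
 have dd: "0 < dd" "dd*rho = eps" using eps par by (auto simp: dd_def)
 define chi where "chi y = max 0 (min 1 (d + 1 - y))" for y :: real
 define m0 where "m0 y = (1 + dd)*chi y*gq (min y d)" for y
 have chi: "0 <= chi y" for y by (auto simp: chi_def)
 have m0c: "continuous_on {a..} m0" unfolding m0_def chi_def
  by (intro continuous_intros continuous_on_compose2[OF gqc]) (use d1 in auto)
 have m0n: "0 <= m0 y" if "a <= y" for y
  unfolding m0_def using dd chi gq_pos[of "min y d"] d1 that by (intro mult_nonneg_nonneg) (auto simp: less_imp_le)
 have dens: "density m0 (d + 1)" unfolding density_def using d1 m0c m0n by (auto simp: m0_def chi_def)
 have m0d: "m0 y = (1 + dd)*gq y" if "y <= d" for y using that by (simp add: m0_def chi_def)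
 have int: "integral {a..wv} m0 = (1 + dd)*integral {a..wv} gq" if "wv <= d" for wv
 proof -
  have "integral {a..wv} m0 = integral {a..wv} (%y. (1 + dd)*gq y)" by (rule integral_cong) (use that m0d in auto)
  thus ?thesis by simp
 qed
 show ?thesis
 proof (rule exI[of _ m0], rule exI[of _ "dd*nu"], intro conjI allI impI)
  show "rho < integral {a..d} m0" using int[of d] d3 dd par by simp
  show "dd*nu <= HH y (m0 y) q" if "a < y \<and> y <= d" for y q
  proof -
   have y: "a <= y" "y <= d" using that by auto
   have "m0 y*e y = (1 + dd)*La y" using m0d[OF y(2)] d2[OF y] by (simp add: gq_def)
   hence "dd*La y <= HH y (m0 y) q" using HH_low[of y "m0 y" q] by (simp add: algebra_simps)
   moreover have "dd*nu <= dd*La y" using La_pos(2)[OF y(1)] dd by simp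
   ultimately show ?thesis by simp
  qed
  have "integral {a..x} gq <= integral {a..d} gq"
   by (rule integral_subset_le) (use x gqi gq_pos in "auto simp: less_imp_le")
  hence "dd*integral {a..x} gq <= dd*rho" unfolding d3 using dd by (intro mult_left_mono) auto
  thus "Uv x - eps <= rho - integral {a..x} m0"
   using Uv_eq[OF x(1)] int[of x] x dd by (simp add: min_def algebra_simps)
 qed (use x d1 dens dd nu_pos in auto)
qed

end

context model_lip
begin

lemma pis_cases:
 assumes "a <= y"
 shows "pis y = 0 \<or> pis y = po y \<and> 0 <= e y"
proof (cases "ereal y < dl")
 case True
 have "0 <= e y"
 proof (rule ccontr)
  assume "\<not> 0 <= e y"
  hence "b_level a e <= ereal y" unfolding b_level_def using assms by (intro Inf_lower) auto
  moreover have "dl <= b_level a e" unfolding d_level_def by simp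
  ultimately show False using True by simp
 qed
 thus ?thesis using True by (simp add: pis)
qed (simp add: pis)

text \<open>Near \<open>a\<close> the drift satisfies \<open>e y <= K (y - a)\<close>, so the density may be of order \<open>1 / (y - a)\<close>,
  whose integral diverges: the whole mass \<open>rho\<close> fits to the left of \<open>x\<close>.\<close>
lemma super_density_flat:
 assumes ea: "e a <= 0" and x: "a < x" and eps: "0 < eps"
 shows "\<exists>m0 R. x <= R \<and> density m0 R \<and> integral {a..R} m0 < rho \<and> strict_super m0 (%_. 0) \<and> strict_super m0 pis \<and>
  rho - integral {a..x} m0 <= eps"
proof -
 define K where "K = L + 1"
 have K: "0 < K" using lipschitz_on_nonneg[OF eL] by (simp add: K_def)
 have eK: "e y <= K*(y - a)" if "a <= y" for y
 proof -
  have "e y - e a <= L*(y - a)" using lipschitz_onD[OF eL, of y a] that by (simp add: dist_real_def abs_le_iff)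
  also have "... <= K*(y - a)" using that by (intro mult_right_mono) (auto simp: K_def)
  finally show ?thesis using ea by simp
 qed
 define s0 where "s0 = (lam - l a) / 2"
 have s0: "0 < s0" using l2 by (simp add: s0_def)
 define k where "k = K*rho / s0 + 1"
 have k: "1 < k" using K s0 par by (simp add: k_def)
 \<comment> \<open>With this value the denominator grows by the factor \<open>exp k\<close> from
   \<open>a\<close> to \<open>x\<close>, so the logarithm gains exactly \<open>k\<close>.\<close>
 define eta where "eta = K*(x - a) / (exp k - 1)"
 let ?D = "%y. K*(y - a) + eta"
 have eta: "0 < eta" using K x k by (simp add: eta_def)
 have ratio: "?D x = eta*exp k" using k by (simp add: eta_def field_simps)
 \<comment> \<open>Subtracting the value at \<open>x\<close> brings the density continuously to 0
   there. The loss in the integral is at most \<open>1 / K\<close>, for which \<open>k\<close>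
   contains the summand 1.\<close>
 define f where "f y = 1 / (?D y) - 1 / (?D x)" for y
 define I where "I = integral {a..x} f"
 have den: "0 < ?D y" if "a <= y" for y using K eta that by (simp add: add_nonneg_pos)
 have fpos: "0 <= f y" if "a <= y" "y <= x" for y
  unfolding f_def using den[OF that(1)] K that by (simp add: frac_le)
 have fneg: "f y <= 0" if "x <= y" for y unfolding f_def using den[of x] K x that by (simp add: frac_le)
 let ?f = "%y. 1 / K*ln (?D y) - y / ?D x"
 have fc: "continuous_on {a..} f"
 proof -
  have "?D y \<noteq> 0" if "y \<in> {a..}" for y using den[of y] that by simp
  thus ?thesis unfolding f_def[abs_def] using den[of x] x by (intro continuous_intros) auto
 qed
 have "(f has_integral (?f x) - (?f a)) {a..x}"
 proof (rule fundamental_theorem_of_calculus)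
  fix y assume "y \<in> {a..x}"
  hence "0 < ?D y" by (intro den) simp
  hence "((%y. ?f y) has_real_derivative f y) (at y within {a..x})"
   using K den[of x] x unfolding f_def by (auto intro!: derivative_eq_intros)
  thus "((%y. ?f y) has_vector_derivative f y) (at y within {a..x})"
   by (simp add: has_real_derivative_iff_has_vector_derivative)
 qed (use x in simp)
 hence "I = (?f x) - (?f a)"
  unfolding I_def by (rule integral_unique)
 also have "... = k / K - (x - a) / (?D x)"
  using eta K unfolding ratio by (simp add: ln_mult add_divide_distrib diff_divide_distrib)
 finally have Ieq: "I = k / K - (x - a) / (?D x)" .
 moreover have "(x - a) / (?D x) <= 1 / K" using den[of x] x K eta by (simp add: field_simps)
 ultimately have "k / K - 1 / K <= I" by linarith
 hence I: "rho <= s0*I" using K s0 by (simp add: k_def field_simps)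
 have I0: "0 < s0*I" using I par by simp
 define ep where "ep = min eps (rho / 2)"
 have ep: "0 < ep" "ep <= eps" "ep < rho" using eps par by (auto simp: ep_def)
 \<comment> \<open>Normalises the mass to \<open>rho - ep\<close>, close to \<open>rho\<close> but
   strictly below it.\<close>
 define th where "th = (rho - ep) / (s0*I)"
 have th: "0 <= th" "th <= 1" "th*(s0*I) = rho - ep" using ep I I0 by (auto simp: th_def)
 define m0 where "m0 y = th * s0*max 0 (f y)" for y
 have m0c: "continuous_on {a..} m0" unfolding m0_def by (intro continuous_intros fc)
 have m0n: "0 <= m0 y" for y unfolding m0_def using th s0 by simp
 have m0z: "m0 y = 0" if "x <= y" for y using fneg[OF that] by (simp add: m0_def max_def)
 have dens: "density m0 x" unfolding density_def using x m0c m0n m0z by auto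
 have int: "integral {a..x} m0 = rho - ep"
 proof -
  have "integral {a..x} m0 = integral {a..x} (%y. th * s0*f y)"
   by (rule integral_cong) (use fpos in "auto simp: m0_def max_def")
  thus ?thesis using th(3) by (simp add: I_def mult.assoc)
 qed
 have me: "m0 y*e y <= s0" if y: "a <= y" for y
 proof (cases "0 <= e y")
  case True
  have "m0 y <= 1 * s0*(1 / (?D y))" unfolding m0_def
  proof (intro mult_mono)
   show "max 0 (f y) <= 1 / (?D y)" using den[OF y] den[of x] x by (simp add: f_def)
  qed (use th s0 in auto)
  hence "m0 y*e y <= s0*(1 / (?D y))*(K*(y - a))"
   using eK[OF y] True s0 den[OF y] m0n[of y] by (intro mult_mono) auto
  also have "... = s0*(K*(y - a) / (?D y))" by simp
  also have "... <= s0*1" using den[OF y] eta s0 by (intro mult_left_mono) auto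
  finally show ?thesis by simp
 next
  case False
  hence "m0 y*e y <= 0" using m0n[of y] by (simp add: mult_nonneg_nonpos)
  thus ?thesis using s0 by simp
 qed
 have l2': "- (lam - l y) <= - 2 * s0" if "a <= y" for y using l1[OF that] by (simp add: s0_def)
 have zero: "HH y (m0 y) 0 <= - s0" if "a <= y" for y using me[OF that] l2'[OF that] by (simp add: HH_def)
 have "HH y (m0 y) (pis y) <= - s0" if y: "a < y" for y
 proof -
  consider "pis y = 0" | "pis y = po y" "0 <= e y" using pis_cases[of y] y by auto
  thus ?thesis
  proof cases
   case 2
   define t where "t = m0 y*e y / La y"
   have L0: "0 < La y" "s0 <= La y" using La_pos(1,3)[of y] y nu_pos s0 by (auto simp: s0_def)
   have t: "0 <= t" "t <= 1" using 2 m0n[of y] L0 me[of y] y by (auto simp: t_def)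
   have "t^2 <= t" using t by (simp add: power2_eq_square mult_left_le)
   hence "nu*t^2 <= nu*(2*t)" using nu_pos t by (intro mult_left_mono) auto
   thus ?thesis using HH_po[of y "m0 y"] me[of y] l2'[of y] y unfolding 2(1) t_def[symmetric] by simp
  qed (use zero y in simp)
 qed
 hence "strict_super m0 (%_. 0)" "strict_super m0 pis"
  unfolding strict_super_def using zero s0 by (auto intro!: exI[of _ s0])
 thus ?thesis by (intro exI[of _ m0] exI[of _ x]) (use dens int ep in auto)
qed

text \<open>A single density for two tasks: \<open>pol\<close> is the Lipschitz control for the game
  and for the Euler policies, \<open>pis\<close> the actual feedback. If \<open>e a <= 0\<close> the
  control is 0, and at \<open>x = a\<close> so is the density.\<close>

lemma super_exists:
 assumes x: "a <= x" and eps: "0 < eps"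
 shows "\<exists>m0 R pol Lp. x <= R \<and> density m0 R \<and> integral {a..R} m0 < rho \<and> Lp-lipschitz_on {a..} pol \<and>
  (\<forall>y\<ge>a. abs (pol y) <= M1) \<and> strict_super m0 pol \<and> strict_super m0 pis \<and> rho - integral {a..x} m0 <= Uv x + eps"
proof (cases "0 < e a")
 case True
 then obtain d where "a < d" "!!y. a <= y ==> y <= d ==> 0 < e y" "integral {a..d} gq = rho"
  using exists_level by blast
 then interpret level mu r sig a lam rho M1 L e l Ll d by unfold_locales
 show ?thesis using super_density[OF x eps] polA_lip polA_bound by blast
next
 case False
 have lip: "0-lipschitz_on {a..} (%_. 0::real)" by (rule lipschitz_onI) auto
 show ?thesis
 proof (cases "x = a")
  case True
  have "HH y 0 q <= - (lam - l a)" if "a < y" for y q using l1[of y] that by (simp add: HH_def)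
  hence "strict_super (%_. 0) (%_. 0)" "strict_super (%_. 0) pis"
   using l2 unfolding strict_super_def by (auto intro!: exI[of _ "lam - l a"])
  moreover have "density (%_. 0) a" by (simp add: density_def)
  ultimately show ?thesis using True lip M1 par eps
   by (intro exI[of _ "%_. 0"] exI[of _ a] exI[of _ 0]) (auto simp: Uv_def)
 next
  case xa: False
  hence "Uv x = 0" using False by (simp add: Uv_def)
  moreover obtain m0 R where "x <= R" "density m0 R" "integral {a..R} m0 < rho" "strict_super m0 (%_. 0)" "strict_super m0 pis"
   "rho - integral {a..x} m0 <= eps" using super_density_flat[of x eps] False xa x eps by auto
  ultimately show ?thesis using lip M1 by (intro exI[of _ m0] exI[of _ R] exI[of _ "%_. 0"] exI[of _ 0]) simp
 qed
qed

text \<open>Prepares the lower bounds: in the first two cases the value \<open>rho\<close> at the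
  boundary or 0 is reached trivially, and only the third one uses a subsolution.\<close>

lemma Uv_cases:
 assumes x: "a <= x"
 obtains "x = a" "Uv x = rho" | "a < x" "Uv x = 0"
 | d where "level mu r sig a lam rho M1 L e l Ll d" "a < x" "x < d"
proof (cases "x = a")
 case True
 thus thesis using that(1) by (simp add: Uv_def)
next
 case False
 show thesis
 proof (cases "0 < e a")
  case True
  then obtain d where d: "a < d" "!!y. a <= y ==> y <= d ==> 0 < e y" "integral {a..d} gq = rho"
  using exists_level by blast
  then interpret level mu r sig a lam rho M1 L e l Ll d by unfold_locales
  show thesis
  proof (cases "x < d")
   case True
   show thesis by (rule that(3)[OF level_axioms]) (use True False x in auto)
  next
   case xd: False
   have "Uv x = 0" using Uv_eq[OF x] xd d3 by (simp add: min_def)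
   thus thesis using that(2) False x by simp
  qed
 next
  case ea: False
  thus thesis using that(2) False x by (simp add: Uv_def)
 qed
qed

end

section \<open>Cost bounds from exponential test functions\<close>

context model_lip
begin

definition expV :: "(real => real) => nat => real => real" where
 "expV m n y = exp (real n*(rho - integral {a..y} m))"

definition expV1 :: "(real => real) => nat => real => real" where
 "expV1 m n y = - real n*m y*expV m n y"

definition expV2 :: "(real => real) => (real => real) => nat => real => real" where
 "expV2 m m1 n y = ((real n)^2*(m y)^2 - real n*m1 y)*expV m n y"

lemma expV_test_fun: "smooth_density m m1 R ==> test_fun a (expV m n) (expV1 m n) (expV2 m m1 n)"
 unfolding expV_def[abs_def] expV1_def[abs_def] expV2_def[abs_def] smooth_density_def
 by (rule exp_test_fun) auto

lemma generator_exp: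
 assumes n: "0 < n"
 shows "real n*(l y - lam)*expV m n y + expV1 m n y*(- e y + (mu - r)*q) + (1 / sqrt (real n) * sig)^2 / 2*expV2 m m1 n y*q^2 + lam*real n
  = real n*expV m n y*gen_exp m m1 (real n) y q"
proof -
 have g2: "(1 / sqrt (real n) * sig)^2 = sig^2 / real n" using n by (simp add: power_mult_distrib power_divide)
 have 1: "expV m n y*exp (- real n*(rho - integral {a..y} m)) = 1"
  unfolding expV_def by (simp add: exp_add[symmetric])
 have "real n*expV m n y*gen_exp m m1 (real n) y q = real n*expV m n y*(HH y (m y) q - sig^2*m1 y*q^2 / (2*real n))
  + lam*real n*(expV m n y*exp (- real n*(rho - integral {a..y} m)))"
  unfolding gen_exp_def by (simp add: algebra_simps)
 also have "... = real n*expV m n y*(HH y (m y) q - sig^2*m1 y*q^2 / (2*real n)) + lam*real n" unfolding 1 by simp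
 finally show ?thesis
  unfolding g2 expV1_def expV2_def HH_def using n by (simp add: field_simps power2_eq_square)
qed

lemma cost_lower:
 assumes wc: "wealth_clock M F B mu r sig a lam rho M1 L e l n x p W I D" and n: "0 < n"
  and sd: "smooth_density m m1 R" and g: "\<forall>y>a. \<forall>q. abs q <= M1 --> 0 <= gen_exp m m1 (real n) y q"
 shows "rho - integral {a..x} m <= cost a rho l M n D W"
proof -
 interpret wc: wealth_clock M F B mu r sig a lam rho M1 L e l n x p W I D by fact
 have "expV m n x <= (\<integral>w. wc.Psi w \<partial>M)"
 proof (rule wc.value_lower[OF expV_test_fun[OF sd], of R])
  show "\<forall>y\<ge>R. expV1 m n y = 0" using smooth_density(5)[OF sd] by (simp add: expV1_def)
  show "0 <= wc.drift (expV m n) (expV1 m n) (expV2 m m1 n) T" for T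
  proof (rule wc.drift_sign[where c = 1, simplified])
   show "expV m n a = exp (real n*rho)" by (simp add: expV_def)
   show "0 <= wc.genf (expV m n) (expV1 m n) (expV2 m m1 n) (wc.X s w) (wc.H s w)"
    if "0 < s" "w \<in> space M" "a < wc.X s w" for s w unfolding wc.genf_def wc.gg_def generator_exp[OF n]
    using g that wc.HK[of s w] by (simp add: expV_def)
  qed
 qed
 hence "real n*(rho - integral {a..x} m) <= ln (\<integral>w. wc.Psi w \<partial>M)"
  by (subst ln_ge_iff) (auto simp: expV_def intro: less_le_trans[OF exp_gt_zero])
 thus ?thesis unfolding wc.cost_eq using n by (simp add: field_simps)
qed

lemma cost_upper:
 assumes wc: "wealth_clock M F B mu r sig a lam rho M1 L e l n x p W I D" and n: "0 < n"
  and p: "!!s w. 0 <= s ==> w \<in> space M ==> p s w = pol (W s w)"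
  and sd: "smooth_density m m1 R" and g: "\<forall>y>a. gen_exp m m1 (real n) y (pol y) <= 0"
 shows "cost a rho l M n D W <= rho - integral {a..x} m"
proof -
 interpret wc: wealth_clock M F B mu r sig a lam rho M1 L e l n x p W I D by fact
 have le: "(\<integral>w. wc.Psi w \<partial>M) <= expV m n x + 0"
 proof (rule wc.value_upper(2)[OF expV_test_fun[OF sd], of R])
  show "\<forall>y\<ge>R. expV1 m n y = 0" using smooth_density(5)[OF sd] by (simp add: expV1_def)
  show "wc.drift (expV m n) (expV1 m n) (expV2 m m1 n) T <= 0" for T
  proof (rule wc.drift_sign[where c = "-1", simplified])
   show "expV m n a = exp (real n*rho)" by (simp add: expV_def)
   show "wc.genf (expV m n) (expV1 m n) (expV2 m m1 n) (wc.X s w) (wc.H s w) <= 0"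
    if s: "0 < s" "w \<in> space M" "a < wc.X s w" for s w
   proof -
    have "ereal s < wc.tau w" "wc.X s w = W s w" using wc.X_cases[OF s(2), of s] s by auto
    hence "wc.H s w = pol (wc.X s w)" using p s by (simp add: wc.H_def)
    thus ?thesis unfolding wc.genf_def wc.gg_def generator_exp[OF n]
     using g s by (simp add: expV_def mult_nonneg_nonpos)
   qed
  qed
 qed (simp add: expV_def)
 have "1 <= (\<integral>w. wc.Psi w \<partial>M)" by (rule wc.Psi_expectation_ge) (rule wc.cc_bounds)
 hence "ln (\<integral>w. wc.Psi w \<partial>M) <= ln (expV m n x)" using le by (subst ln_le_cancel_iff) (auto simp: expV_def)
 thus ?thesis unfolding wc.cost_eq using n by (simp add: expV_def field_simps)
qed

text \<open>The mesh may depend on \<open>n\<close>. A horizon \<open>S\<close> makes the discounted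
  tail of the defect at most \<open>1 / 2\<close>, and \<open>de\<close> makes the part before
  \<open>S\<close> at most \<open>1 / 2\<close>. The total defect 1 is at most
  \<open>expV m n x\<close>, because the mass of \<open>m\<close> is at most \<open>rho\<close>; so
  the expectation is at most \<open>2 * expV m n x\<close>, which adds \<open>ln 2 / n\<close> to
  the cost.\<close>

lemma cost_euler:
 assumes n: "0 < n" and x: "a <= x"
  and pol: "Lp-lipschitz_on {a..} pol" and polb: "!!y. a <= y ==> abs (pol y) <= M1"
  and sd: "smooth_density m m1 R" and g: "\<forall>y>a. gen_exp m m1 (real n) y (pol y) <= 0"
  and tot: "integral {a..R} m <= rho"
 obtains de where "0 < de"
  "!!M F B p W I (D :: 'w => real) ka. wealth_clock M F B mu r sig a lam rho M1 L e l n x p W I D ==>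
   (\<forall>s>0. 0 <= ka s \<and> ka s <= s \<and> s - ka s <= de) ==> (\<forall>s>0. \<forall>w\<in>space M. p s w = pol (W (ka s) w)) ==>
   cost a rho l M n D W <= rho - integral {a..x} m + ln 2 / real n"
proof -
 define gg where "gg = 1 / sqrt (real n) * sig"
 note tf = expV_test_fun[OF sd, of n]
 obtain C1 where C1: "!!y. a <= y ==> abs (expV1 m n y) <= C1" using tf unfolding test_fun_def by blast
 obtain C2 where C2: "!!y. a <= y ==> abs (expV2 m m1 n y) <= C2" using tf unfolding test_fun_def by blast
 have C0: "0 <= C1" "0 <= C2" using C1[of a] C2[of a] by linarith+
 define K where "K = C1*(mu - r) + gg^2 / 2*C2*(2*M1)"
 have K: "0 <= K" unfolding K_def using C0 M1 par by (intro add_nonneg_nonneg mult_nonneg_nonneg) auto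
 define G where "G y q = real n*(l y - lam)*expV m n y + expV1 m n y*(- e y + (mu - r)*q) + gg^2 / 2*expV2 m m1 n y*q^2 + lam*real n" for y q
 have GK: "G y q <= K*abs (q - pol y)" if y: "a < y" and q: "abs q <= M1" for y q
 proof -
  have "G y (pol y) <= 0"
   unfolding G_def gg_def generator_exp[OF n] using g y by (simp add: expV_def mult_nonneg_nonpos)
  moreover have "G y q - G y (pol y) = (expV1 m n y*(mu - r) + gg^2 / 2*expV2 m m1 n y*(q + pol y))*(q - pol y)"
   unfolding G_def by (simp add: power2_eq_square field_simps)
  moreover have "... <= K*abs (q - pol y)"
  proof -
   have "abs (expV1 m n y*(mu - r) + gg^2 / 2*expV2 m m1 n y*(q + pol y)) <= abs (expV1 m n y*(mu - r)) + abs (gg^2 / 2*expV2 m m1 n y*(q + pol y))"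
    by (rule abs_triangle_ineq)
   also have "... <= K" unfolding K_def abs_mult
    by (intro add_mono mult_mono) (use C1[of y] C2[of y] C0 y q polb[of y] par in auto)
   finally have "abs ((expV1 m n y*(mu - r) + gg^2 / 2*expV2 m m1 n y*(q + pol y))*(q - pol y)) <= K*abs (q - pol y)"
    unfolding abs_mult[of _ "q - pol y"] by (intro mult_right_mono) auto
   thus ?thesis by simp
  qed
  ultimately show ?thesis by linarith
 qed
 define c where "c = real n*(lam - l a)"
 have c: "0 < c" using n l2 by (simp add: c_def)
 have "((%S. K*(2*M1 / c)*exp (- c*S)) \<longlongrightarrow> 0) at_top" using c by real_asymp
 hence "eventually (%S. K*(2*M1 / c)*exp (- c*S) < 1 / 2) at_top" by (rule order_tendstoD) simp
 hence "eventually (%S. 0 < S \<and> K*(2*M1 / c)*exp (- c*S) < 1 / 2) at_top"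
  using eventually_gt_at_top[of 0] by eventually_elim simp
 then obtain S where S: "0 < S" "K*(2*M1 / c)*exp (- c*S) < 1 / 2" by (auto dest!: eventually_happens)
 \<comment> \<open>Taken outside its locale: the bound depends on the data alone and is available
   before a probability space is given.\<close>
 define bb where "bb = wealth.be_bound mu r sig a M1 L e n x S"
 define v where "v = 2*bb + 2*gg^2*M1^2"
 have Lp: "0 <= Lp" using pol by (rule lipschitz_on_nonneg)
 define k where "k = 1 / (2*(K*(S*Lp) + 1))"
 have KS: "0 <= K*(S*Lp)" using K S Lp by simp
 have k: "0 < k" "K*(S*Lp)*k <= 1 / 2" using KS by (auto simp: k_def field_simps)
 \<comment> \<open>The displacement bound over one step is \<open>sqrt (de * v)\<close>, and this
   \<open>de\<close> makes it at most \<open>k\<close>; the absolute value and the summand 1 keep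
   the denominator positive.\<close>
 define de where "de = k^2 / (abs v + 1)"
 have de: "0 < de" using k by (simp add: de_def)
 have "de * v <= de*(abs v + 1)" using de by (intro mult_left_mono) auto
 also have "... = k^2" by (simp add: de_def)
 finally have dv: "sqrt (2*de*bb + 2*gg^2*(M1^2*de)) <= k"
  using k by (intro real_le_lsqrt) (auto simp: v_def algebra_simps)
 show thesis
 proof (rule that[OF de])
  fix M :: "'w measure" and F B p W I D ka
  assume wc: "wealth_clock M F B mu r sig a lam rho M1 L e l n x p W I D"
   and ka: "\<forall>s>0. 0 <= ka s \<and> ka s <= s \<and> s - ka s <= de" "\<forall>s>0. \<forall>w\<in>space M. p s w = pol (W (ka s) w)"
  interpret wc: wealth_clock M F B mu r sig a lam rho M1 L e l n x p W I D by fact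
  have z: "\<forall>y\<ge>R. expV1 m n y = 0" using smooth_density(5)[OF sd] by (simp add: expV1_def)
  have ga: "expV m n a = exp (real n*rho)" by (simp add: expV_def)
  have dr: "wc.drift (expV m n) (expV1 m n) (expV2 m m1 n) T <= 1" if T: "0 < T" for T
  proof -
   have "wc.drift (expV m n) (expV1 m n) (expV2 m m1 n) T <= K*(S*(Lp * sqrt (2*de*wc.be_bound S + 2*wc.gg^2*(M1^2*de)))
    + 2*M1 / (real n*(lam - l a))*exp (- (real n*(lam - l a))*S))"
   proof (rule wc.drift_euler[OF tf z ga pol polb _ K _ _ S(1) T])
    show "wc.genf (expV m n) (expV1 m n) (expV2 m m1 n) y q <= K*abs (q - pol y)" if "a < y" "abs q <= M1" for y q
     using GK[OF that] unfolding G_def wc.genf_def wc.gg_def gg_def .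
   qed (use ka in auto)
   also have "... = K*(S*Lp) * sqrt (2*de*bb + 2*gg^2*(M1^2*de)) + K*(2*M1 / c)*exp (- c*S)"
    unfolding bb_def wc.gg_def gg_def c_def by (simp add: algebra_simps)
   also have "... <= K*(S*Lp)*k + 1 / 2" using dv KS S(2) by (intro add_mono mult_left_mono) auto
   also have "... <= 1" using k by simp
   finally show ?thesis .
  qed
  have le: "(\<integral>w. wc.Psi w \<partial>M) <= expV m n x + 1"
   by (rule wc.value_upper(2)[OF tf z dr]) (auto simp: expV_def intro: add_nonneg_nonneg)
  have "integral {a..x} m <= rho"
   using density_integral_le[of m R x] smooth_density[OF sd] x tot by (meson order_trans)
  hence "1 <= expV m n x" by (simp add: expV_def)
  hence "(\<integral>w. wc.Psi w \<partial>M) <= 2*expV m n x" using le by simp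
  moreover have "1 <= (\<integral>w. wc.Psi w \<partial>M)" by (rule wc.Psi_expectation_ge) (rule wc.cc_bounds)
  ultimately have "ln (\<integral>w. wc.Psi w \<partial>M) <= ln (2*expV m n x)" by (subst ln_le_cancel_iff) (auto simp: expV_def)
  also have "... = ln 2 + real n*(rho - integral {a..x} m)" by (simp add: expV_def ln_mult)
  finally show "cost a rho l M n D W <= rho - integral {a..x} m + ln 2 / real n"
   unfolding wc.cost_eq using n by (simp add: field_simps)
 qed
qed

end

context model_lip
begin

lemma wealth_clock_exists:
 assumes bm: "brownian_motion M F B" and n: "0 < n" and x: "a <= x"
  and wv: "wealth_process mu r sig a e M F B n x p W"
  and pb: "!!t w. 0 <= t ==> w \<in> space M ==> ereal t <= hit_time a (%s. W s w) ==> abs (p t w) <= M1"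
  and D: "distributed M lborel D (exponential_density (lam*real n))" "independent_of_filtration M F D"
 shows "\<exists>I. wealth_clock M F B mu r sig a lam rho M1 L e l n x p W I D"
proof -
 interpret prob_space M using bm by (simp add: brownian_motion_def)
 from wv obtain I where I: "ito_integral M F B (%t w. if ereal t <= hit_time a (%s. W s w) then p t w else 0) I"
  "AE w in M. \<forall>t\<ge>0. ereal t <= hit_time a (%s. W s w) -->
   W t w = x + (LBINT s:{0..t}. - e (W s w) + (mu - r)*p s w) + 1 / sqrt (real n) * sig*I t w"
  unfolding wealth_process_def by blast
 have "wealth_clock M F B mu r sig a lam rho M1 L e l n x p W I D"
  by unfold_locales (use bm n x wv pb D I par eL lc l0 l1 l2 in "auto simp: wealth_process_def")
 thus ?thesis by blast
qed

text \<open>The quantifier over probability spaces and policies stands inside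
  \<open>eventually\<close>: the threshold for \<open>n\<close> comes from \<open>sub_test\<close>
  alone, so the bound passes to the infimum over policies.\<close>

lemma stochastic_lower:
 assumes x: "a <= x" and eps: "0 < eps"
 shows "eventually (%n. \<forall>(M :: 'w measure) F B p W I D.
  wealth_clock M F B mu r sig a lam rho M1 L e l n x p W I D --> Uv x - eps <= cost a rho l M n D W) sequentially"
 using x
proof (cases rule: Uv_cases)
 case 1
 have "Uv x - eps <= cost a rho l M n D W"
  if wc: "wealth_clock M F B mu r sig a lam rho M1 L e l n x p W I D" for M :: "'w measure" and F B n p W I D
 proof -
  interpret wc: wealth_clock M F B mu r sig a lam rho M1 L e l n x p W I D by fact
  show ?thesis using wc.cost_at_a[OF 1(1)] 1 eps by simp
 qed
 thus ?thesis by (intro always_eventually) blast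
next
 case 2
 have "Uv x - eps <= cost a rho l M n D W"
  if wc: "wealth_clock M F B mu r sig a lam rho M1 L e l n x p W I D" for M :: "'w measure" and F B n p W I D
 proof -
  interpret wc: wealth_clock M F B mu r sig a lam rho M1 L e l n x p W I D by fact
  show ?thesis using wc.cost_nonneg 2 eps by simp
 qed
 thus ?thesis by (intro always_eventually) blast
next
 case (3 d)
 interpret level mu r sig a lam rho M1 L e l Ll d by fact
 obtain m0 c where m0: "x <= d + 1" "density m0 (d + 1)" "rho < integral {a..d} m0" "0 < c"
  "!!y q. a < y ==> y <= d ==> c <= HH y (m0 y) q" "Uv x - eps / 2 <= rho - integral {a..x} m0"
  using sub_density[OF x 3(3), of "eps / 2"] eps by auto
 obtain m m1 where m: "smooth_density m m1 (d + 1)" "abs (integral {a..x} m - integral {a..x} m0) <= eps / 2"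
  "eventually (%n. \<forall>y>a. \<forall>q. abs q <= M1 --> 0 <= gen_exp m m1 (real n) y q) sequentially"
 proof (rule sub_test[where R = "d + 1" and ?D1.0 = d and ?m0.0 = m0 and eps = "eps / 2" and d = c and x = x])
  show "c <= HH y (m0 y) q" if "a < y" "y <= d" for y q using m0(5) that by blast
 qed (use m0 d1 x eps that in auto)
 have U: "Uv x - eps <= rho - integral {a..x} m" using m(2) m0(6) by linarith
 show ?thesis using m(3) eventually_gt_at_top[of "0::nat"]
 proof eventually_elim
  case (elim n)
  have "Uv x - eps <= cost a rho l M n D W"
   if wc: "wealth_clock M F B mu r sig a lam rho M1 L e l n x p W I D" for M :: "'w measure" and F B p W I D
   using cost_lower[OF wc elim(2) m(1) elim(1)] U by simp
  thus ?case by blast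
 qed
qed

lemma stochastic_feedback:
 assumes x: "a <= x" and eps: "0 < eps"
 shows "eventually (%n. \<forall>(M :: 'w measure) F B W I D.
  wealth_clock M F B mu r sig a lam rho M1 L e l n x (%t w. pis (W t w)) W I D --> cost a rho l M n D W <= Uv x + eps) sequentially"
proof -
 obtain m0 R where m0: "x <= R" "density m0 R" "integral {a..R} m0 < rho" "strict_super m0 pis"
  "rho - integral {a..x} m0 <= Uv x + eps / 2" using super_exists[OF x, of "eps / 2"] eps by auto
 obtain c where c: "0 < c" "!!y. a < y ==> HH y (m0 y) (pis y) <= - c" using m0(4) by (auto simp: strict_super_def)
 obtain m m1 where m: "smooth_density m m1 R" "abs (integral {a..x} m - integral {a..x} m0) <= eps / 2" "integral {a..R} m <= rho"
  "eventually (%n. \<forall>y>a. gen_exp m m1 (real n) y (pis y) <= 0) sequentially"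
 proof (rule super_test)
  show "0 < eps / 2" using eps by simp
  show "abs (pis y) <= M1" if "a < y" for y using ps[of y] that by simp
 qed (use m0 c x that in auto)
 have U: "rho - integral {a..x} m <= Uv x + eps" using m(2) m0(5) by linarith
 show ?thesis using m(4) eventually_gt_at_top[of "0::nat"]
 proof eventually_elim
  case (elim n)
  have "cost a rho l M n D W <= Uv x + eps"
   if wc: "wealth_clock M F B mu r sig a lam rho M1 L e l n x (%t w. pis (W t w)) W I D" for M :: "'w measure" and F B W I D
   using cost_upper[OF wc elim(2) _ m(1) elim(1)] U by simp
  thus ?case by blast
 qed
qed

text \<open>The error is split in three: the density, its smoothing, and \<open>ln 2 / n\<close> for
  the Euler policy. \<open>pol0\<close> is continued constantly below \<open>a\<close>, because the
  Euler path may leave \<open>{a..}\<close> after the hitting time.\<close>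

lemma stochastic_upper:
 assumes x: "a <= x" and eps: "0 < eps"
 shows "eventually (%n. \<forall>(M :: 'w measure) B D.
  standard_brownian_motion M B --> distributed M lborel D (exponential_density (lam*real n)) -->
  independent_of_filtration M (natural_filtration M B) D -->
  (\<exists>p W. p \<in> policies M B M1 \<and> wealth_process mu r sig a e M (augmented_filtration M B) B n x p W \<and>
   cost a rho l M n D W <= Uv x + eps)) sequentially"
proof -
 obtain m0 R pol0 Lp where m0: "x <= R" "density m0 R" "integral {a..R} m0 < rho" "Lp-lipschitz_on {a..} pol0"
  "!!y. a <= y ==> abs (pol0 y) <= M1" "strict_super m0 pol0" "rho - integral {a..x} m0 <= Uv x + eps / 3"
  using super_exists[OF x, of "eps / 3"] eps by auto
 define pol where "pol y = pol0 (max a y)" for y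
 have pol: "Lp-lipschitz_on UNIV pol"
 proof (rule lipschitz_onI)
  fix y z :: real
  have "dist (pol y) (pol z) <= Lp*dist (max a y) (max a z)" unfolding pol_def by (rule lipschitz_onD[OF m0(4)]) auto
  also have "... <= Lp*dist y z"
   using lipschitz_on_nonneg[OF m0(4)] by (intro mult_left_mono) (auto simp: dist_real_def max_def)
  finally show "dist (pol y) (pol z) <= Lp*dist y z" .
 qed (rule lipschitz_on_nonneg[OF m0(4)])
 have polb: "abs (pol y) <= M1" for y unfolding pol_def by (rule m0(5)) simp
 have polm: "pol \<in> \<B> borel"
  by (rule borel_measurable_continuous_onI[OF lipschitz_on_continuous_on[OF pol]])
 have pola: "Lp-lipschitz_on {a..} pol" by (rule lipschitz_on_subset[OF pol]) simp
 obtain c where c: "0 < c" "!!y. a < y ==> HH y (m0 y) (pol0 y) <= - c" using m0(6) by (auto simp: strict_super_def)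
 obtain m m1 where m: "smooth_density m m1 R" "abs (integral {a..x} m - integral {a..x} m0) <= eps / 3" "integral {a..R} m <= rho"
  "eventually (%n. \<forall>y>a. gen_exp m m1 (real n) y (pol y) <= 0) sequentially"
 proof (rule super_test)
  show "0 < eps / 3" using eps by simp
  show "HH y (m0 y) (pol y) <= - c" if "a < y" for y using c(2)[OF that] that by (simp add: pol_def max_def)
 qed (use m0 c polb x that in auto)
 have U: "rho - integral {a..x} m <= Uv x + 2*eps / 3" using m(2) m0(7) by linarith
 have "(%n. ln 2 / real n) ----> 0" by real_asymp
 hence "eventually (%n. ln 2 / real n < eps / 3) sequentially" using eps by (intro order_tendstoD(2)) auto
 with m(4) show ?thesis using eventually_gt_at_top[of "0::nat"]
 proof eventually_elim
  case (elim n)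
  obtain de where de: "0 < de"
   "!!M F B p W I (D :: 'w => real) ka. wealth_clock M F B mu r sig a lam rho M1 L e l n x p W I D ==>
    (\<forall>s>0. 0 <= ka s \<and> ka s <= s \<and> s - ka s <= de) ==> (\<forall>s>0. \<forall>w\<in>space M. p s w = pol (W (ka s) w)) ==>
    cost a rho l M n D W <= rho - integral {a..x} m + ln 2 / real n"
   using cost_euler[OF elim(3) x pola polb m(1) elim(1) m(3)] by blast
  have "\<exists>p W. p \<in> policies M B M1 \<and> wealth_process mu r sig a e M (augmented_filtration M B) B n x p W \<and>
   cost a rho l M n D W <= Uv x + eps"
   if B: "standard_brownian_motion M B" and D: "distributed M lborel D (exponential_density (lam*real n))"
    "independent_of_filtration M (natural_filtration M B) D" for M :: "'w measure" and B D
  proof -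
   let ?F = "augmented_filtration M B"
   note ab = augmented_brownian[OF B]
   interpret prob_space M using ab(1) by (simp add: brownian_motion_def)
   interpret E: euler M ?F B mu r sig a M1 L e pol n x de by unfold_locales (use ab x eL polm polb de in auto)
   have pb: "abs (E.p t w) <= M1" for t w by (rule E.p_bound)
   have pp: "E.p \<in> policies M B M1" unfolding policies_def using E.p_progressive pb by auto
   obtain I where wc: "wealth_clock M ?F B mu r sig a lam rho M1 L e l n x E.p E.W I D"
    using wealth_clock_exists[OF ab(1) elim(3) x E.wealth pb D(1) ab(3)[OF D(2)]] by blast
   define ka where "ka s = E.tk (E.cells s - 1)" for s
   have "cost a rho l M n D E.W <= rho - integral {a..x} m + ln 2 / real n"
   proof (rule de(2)[OF wc, of ka])
    show "\<forall>s>0. 0 <= ka s \<and> ka s <= s \<and> s - ka s <= de"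
    proof (intro allI impI)
     fix s :: real assume "0 < s"
     then obtain k where "E.tk k < s" "s <= E.tk (Suc k)" "E.cells s = Suc k" by (rule E.cells_pos)
     thus "0 <= ka s \<and> ka s <= s \<and> s - ka s <= de" using E.tk(1,4)[of k] by (simp add: ka_def)
    qed
    show "\<forall>s>0. \<forall>w\<in>space M. E.p s w = pol (E.W (ka s) w)" by (simp add: E.p_def E.P_W ka_def)
   qed
   hence "cost a rho l M n D E.W <= Uv x + eps" using U elim(2) by linarith
   thus ?thesis using pp E.wealth by blast
  qed
  thus ?case by blast
 qed
qed

end

section \<open>The differential game\<close>

lemma AC_D:
 assumes ac: "abs_continuous_on_interval s t f" and e: "0 < e"
 shows "\<exists>d>0. \<forall>(k::nat) u v. (\<forall>i<k. s <= u i \<and> u i <= v i \<and> v i <= t) -->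
   disjoint_family_on (%i. {u i <..< v i}) {..<k} --> (\<Sum>i<k. v i - u i) < d --> (\<Sum>i<k. abs (f (v i) - f (u i))) < e"
 using spec[OF ac[unfolded abs_continuous_on_interval_def], of e, THEN mp, OF e] by (simp only: imp_conjL)

text \<open>The definition speaks of families indexed by initial segments of the naturals, while a
  tagged division is a finite set of pairs; hence this reindexing.\<close>

lemma AC_finite:
 assumes ac: "abs_continuous_on_interval s t f" and e: "0 < e"
 shows "\<exists>d>0. \<forall>(S :: 'i set) u v. finite S --> (\<forall>i\<in>S. s <= u i \<and> u i <= v i \<and> v i <= t) -->
  disjoint_family_on (%i. {u i <..< v i}) S --> (\<Sum>i\<in>S. v i - u i) < d --> (\<Sum>i\<in>S. abs (f (v i) - f (u i))) < e"
proof -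
 from AC_D[OF ac e] obtain d where "0 < d" and "\<forall>(k::nat) u v. (\<forall>i<k. s <= u i \<and> u i <= v i \<and> v i <= t) -->
   disjoint_family_on (%i. {u i <..< v i}) {..<k} --> (\<Sum>i<k. v i - u i) < d --> (\<Sum>i<k. abs (f (v i) - f (u i))) < e"
  by (elim exE conjE)
 note d = this(1) this(2)[THEN spec, THEN spec, THEN spec, THEN mp, THEN mp, THEN mp]
 show ?thesis
 proof (intro exI[of _ d] conjI allI impI d(1))
  fix S :: "'i set" and u v
  assume fin: "finite S" and uv: "\<forall>i\<in>S. s <= u i \<and> u i <= v i \<and> v i <= t"
   and dj: "disjoint_family_on (%i. {u i <..< v i}) S" and small: "(\<Sum>i\<in>S. v i - u i) < d"
  obtain h where h: "bij_betw h {0..<card S} S" using ex_bij_betw_nat_finite[OF fin] by blast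
  hence h: "bij_betw h {..<card S} S" by (simp add: atLeast0LessThan)
  have "(\<Sum>i<card S. abs (f (v (h i)) - f (u (h i)))) < e"
  proof (rule d(2))
   show "\<forall>i<card S. s <= u (h i) \<and> u (h i) <= v (h i) \<and> v (h i) <= t"
    using uv bij_betwE[OF h] by blast
   have "{u (h i)<..<v (h i)} \<inter> {u (h j)<..<v (h j)} = {}" if "i < card S" "j < card S" "i \<noteq> j" for i j
   proof -
    have "h i \<in> S" "h j \<in> S" "h i \<noteq> h j" using h that by (auto simp: bij_betw_def inj_on_def)
    thus ?thesis using dj unfolding disjoint_family_on_def by blast
   qed
   thus "disjoint_family_on (%i. {u (h i)<..<v (h i)}) {..<card S}" unfolding disjoint_family_on_def by auto
   show "(\<Sum>i<card S. v (h i) - u (h i)) < d"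
    using small sum.reindex_bij_betw[OF h, of "%i. v i - u i"] by simp
  qed
  thus "(\<Sum>i\<in>S. abs (f (v i) - f (u i))) < e"
   using sum.reindex_bij_betw[OF h, of "%i. abs (f (v i) - f (u i))"] by simp
 qed
qed

lemma straddle:
 fixes f :: "real => real"
 assumes "(f has_real_derivative c) (at x)" "0 < e"
 shows "\<exists>d>0. \<forall>y. abs (y - x) < d --> abs (f y - f x - c*(y - x)) <= e*abs (y - x)"
 using assms unfolding has_field_derivative_def has_derivative_at_alt by auto

text \<open>A gauge argument. Cells tagged outside \<open>N\<close> are estimated by
  differentiability at the tag; cells tagged in \<open>N\<close> lie in an open set of small
  measure, where absolute continuity makes the increments of \<open>f\<close> small. Integrability
  of the derivative is part of the conclusion.\<close>

lemma AC_fundamental_theorem: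
 fixes f f' :: "real => real"
 assumes ac: "abs_continuous_on_interval 0 T f" and T: "0 <= T" and N: "negligible N"
  and f': "!!t. t \<in> {0..T} - N ==> (f has_real_derivative f' t) (at t)"
 shows "((%t. if t \<in> N then 0 else f' t) has_integral f T - f 0) {0..T}" unfolding has_integral_real
proof (intro allI impI)
 fix e :: real assume e: "0 < e"
 let ?g = "%t. if t \<in> N then 0 else f' t"
 define eta where "eta = e / (2*(T + 1))"
 have eta: "0 < eta" "eta*T <= e / 2" using e T by (auto simp: eta_def field_simps)
 from AC_finite[OF ac half_gt_zero[OF e]] obtain d where "0 < d"
  and "\<forall>(S :: (real \<times> real set) set) u v. finite S --> (\<forall>i\<in>S. 0 <= u i \<and> u i <= v i \<and> v i <= T) -->
   disjoint_family_on (%i. {u i <..< v i}) S --> (\<Sum>i\<in>S. v i - u i) < d --> (\<Sum>i\<in>S. abs (f (v i) - f (u i))) < e / 2"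
  by (elim exE conjE)
 note d = this(1) this(2)[THEN spec, THEN spec, THEN spec, THEN mp, THEN mp, THEN mp, THEN mp]
 have Nn: "N \<in> null_sets lebesgue" using N by (simp add: negligible_iff_null_sets)
 obtain G where G: "open G" "N \<subseteq> G" "emeasure lebesgue (G - N) < ennreal d"
  using sets_lebesgue_outer_open[of N d] Nn d(1) by blast
 have Gd: "emeasure lborel G < ennreal d"
 proof -
  have "emeasure lebesgue G = emeasure lebesgue (G - N)"
   using Nn G(1) by (intro emeasure_Diff_null_set[symmetric]) auto
  thus ?thesis using G(1,3) by simp
 qed
 have "\<exists>r>0. (t \<in> N --> ball t r \<subseteq> G) \<and> (t \<in> {0..T} - N --> (\<forall>y. abs (y - t) < r --> abs (f y - f t - f' t*(y - t)) <= eta*abs (y - t)))" for t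
 proof (cases "t \<in> N")
  case True
  thus ?thesis using G(1,2) by (auto simp: open_contains_ball)
 next
  case False
  show ?thesis
  proof (cases "t \<in> {0..T}")
   case True
   thus ?thesis using straddle[OF f' eta(1), of t] False by auto
  qed (use False in "auto intro: exI[of _ 1]")
 qed
 then obtain R where R: "!!t. 0 < R t" "!!t. t \<in> N ==> ball t (R t) \<subseteq> G"
  "!!t y. t \<in> {0..T} - N ==> abs (y - t) < R t ==> abs (f y - f t - f' t*(y - t)) <= eta*abs (y - t)" by metis
 show "\<exists>\<gamma>. gauge \<gamma> \<and> (\<forall>\<D>. \<D> tagged_division_of {0..T} \<and> \<gamma> fine \<D> --> norm ((\<Sum>(x, k)\<in>\<D>. measure lborel k *\<^sub>R ?g x) - (f T - f 0)) < e)"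
 proof (intro exI[of _ "%t. ball t (R t)"] conjI allI impI)
  show "gauge (%t. ball t (R t))" using R(1) gauge_ball_dependent by blast
  fix D assume "D tagged_division_of {0..T} \<and> (%t. ball t (R t)) fine D"
  hence D: "D tagged_division_of {0..T}" and fine: "(%t. ball t (R t)) fine D" by auto
  have fin: "finite D" using D by blast
  let ?B = "{i \<in> D. fst i \<notin> N}"
  let ?A = "{i \<in> D. fst i \<in> N}"
  let ?u = "%i. Inf (snd i)" and ?v = "%i. Sup (snd i)"
  have cell: "snd i = {?u i..?v i} \<and> 0 <= ?u i \<and> ?u i <= fst i \<and> fst i <= ?v i \<and> ?v i <= T \<and> {?u i..?v i} \<subseteq> ball (fst i) (R (fst i))" if i: "i \<in> D" for i
  proof -
   obtain x k where xk: "i = (x, k)" by (cases i)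
   have x: "x \<in> k" "k \<subseteq> {0..T}" "k \<subseteq> ball x (R x)" using D fine i unfolding xk by (auto dest: fineD)
   obtain c c' where "k = cbox c c'" using D i unfolding xk by blast
   hence k: "k = {c..c'}" "c <= c'" using x(1) by auto
   thus ?thesis using x unfolding xk by auto
  qed
  have uv: "0 <= ?u i \<and> ?u i <= ?v i \<and> ?v i <= T" if "i \<in> D" for i
   using cell[OF that] by linarith
  have dj: "{?u i<..<?v i} \<inter> {?u j<..<?v j} = {}" if "i \<in> D" "j \<in> D" "i \<noteq> j" for i j
  proof -
   have "interior (snd i) \<inter> interior (snd j) = {}"
    using tagged_division_ofD(5)[OF D, of "fst i" "snd i" "fst j" "snd j"] that by (simp add: prod_eq_iff)
   thus ?thesis using cell[OF that(1)] cell[OF that(2)] by (metis interior_atLeastAtMost_real)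
  qed
  define h where "h i = measure lborel (snd i) * ?g (fst i) - (f (?v i) - f (?u i))" for i
  let ?S = "(\<Sum>(x, k)\<in>D. measure lborel k *\<^sub>R ?g x) - (f T - f 0)"
  have "?S = (\<Sum>i\<in>D. h i)"
   using additive_tagged_division_1[OF T D, of f] by (simp add: h_def sum_subtractf case_prod_beta')
  also have "... = (\<Sum>i\<in>?A. h i) + (\<Sum>i\<in>?B. h i)"
  proof -
   have "(\<Sum>i\<in>?A \<union> ?B. h i) = (\<Sum>i\<in>?A. h i) + (\<Sum>i\<in>?B. h i)"
    by (rule sum.union_disjoint) (use fin in auto)
   moreover have "?A \<union> ?B = D" by auto
   ultimately show ?thesis by (simp only:)
  qed
  finally have split: "?S = (\<Sum>i\<in>?A. h i) + (\<Sum>i\<in>?B. h i)" .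
  have 1: "abs (\<Sum>i\<in>?A. h i) < e / 2"
  proof -
   let ?S = "?A"
   have djS: "disjoint_family_on (%i. {?u i <..< ?v i}) ?S" unfolding disjoint_family_on_def using dj by blast
   have "(\<Sum>i\<in>?S. ennreal (?v i - ?u i)) = (\<Sum>i\<in>?S. emeasure lborel {?u i <..< ?v i})"
    by (rule sum.cong[OF refl]) (use uv in simp)
   also have "... = emeasure lborel (\<Union>i\<in>?S. {?u i <..< ?v i})"
    by (rule sum_emeasure[OF _ djS]) (use fin in auto)
   also have "... <= emeasure lborel G"
   proof (rule emeasure_mono)
    have "{?u i <..< ?v i} \<subseteq> G" if i: "i \<in> ?S" for i
    proof -
     have "{?u i <..< ?v i} \<subseteq> {?u i..?v i}" by auto
     also have "... \<subseteq> ball (fst i) (R (fst i))" using cell[of i] i by blast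
     also have "... \<subseteq> G" using R(2) i by blast
     finally show ?thesis .
    qed
    thus "(\<Union>i\<in>?S. {?u i <..< ?v i}) \<subseteq> G" by blast
   qed (use G(1) in auto)
   also note Gd
   also have "(\<Sum>i\<in>?S. ennreal (?v i - ?u i)) = ennreal (\<Sum>i\<in>?S. ?v i - ?u i)"
    by (rule sum_ennreal) (use uv in simp)
   finally have small: "(\<Sum>i\<in>?S. ?v i - ?u i) < d"
    by (subst (asm) ennreal_less_iff) (use uv in "auto intro!: sum_nonneg")
   have "abs (\<Sum>i\<in>?S. h i) <= (\<Sum>i\<in>?S. abs (h i))" by (rule sum_abs)
   also have "... = (\<Sum>i\<in>?S. abs (f (?v i) - f (?u i)))" by (rule sum.cong) (auto simp: h_def)
   also have "... < e / 2" by (rule d(2)[OF _ _ djS small]) (use fin uv in auto)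
   finally show ?thesis .
  qed
  have 2: "abs (\<Sum>i\<in>?B. h i) <= e / 2"
  proof -
   let ?S = "?B"
   have hi: "abs (h i) <= eta*(?v i - ?u i)" if i: "i \<in> ?S" for i
   proof -
    define x where "x = fst i"
    have c: "snd i = {?u i..?v i}" "0 <= ?u i" "?u i <= x" "x <= ?v i" "?v i <= T" "{?u i..?v i} \<subseteq> ball x (R x)"
     using cell[of i] i by (auto simp: x_def)
    have x: "x \<in> {0..T} - N" using c i by (auto simp: x_def)
    have "?v i \<in> ball x (R x)" "?u i \<in> ball x (R x)" by (rule subsetD[OF c(6)], use c(3,4) in simp)+
    hence "abs (f (?v i) - f x - f' x*(?v i - x)) <= eta*abs (?v i - x)" "abs (f (?u i) - f x - f' x*(?u i - x)) <= eta*abs (?u i - x)"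
     by (intro R(3)[OF x]; simp add: dist_real_def abs_minus_commute)+
    hence b: "abs (f (?v i) - f x - f' x*(?v i - x)) <= eta*(?v i - x)" "abs (f (?u i) - f x - f' x*(?u i - x)) <= eta*(x - ?u i)"
     using c(3,4) by auto
    have cont: "measure lborel (snd i) = ?v i - ?u i" by (subst c(1)) (use c(3,4) in simp)
    have "h i = - (f (?v i) - f x - f' x*(?v i - x)) + (f (?u i) - f x - f' x*(?u i - x))"
     using x unfolding h_def cont x_def[symmetric] by (simp add: algebra_simps)
    also have "abs (...) <= eta*(?v i - x) + eta*(x - ?u i)" using b by linarith
    finally show ?thesis by (simp add: algebra_simps)
   qed
   have "abs (\<Sum>i\<in>?S. h i) <= (\<Sum>i\<in>?S. eta*(?v i - ?u i))"
    by (rule order_trans[OF sum_abs sum_mono]) (rule hi)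
   also have "... <= (\<Sum>i\<in>D. eta*(?v i - ?u i))" by (rule sum_mono2) (use fin uv eta in auto)
   also have "... = eta*T"
    using additive_tagged_division_1[OF T D, of "%x. x"] by (simp add: sum_distrib_left[symmetric] case_prod_beta')
   finally show ?thesis using eta(2) by simp
  qed
  show "norm ?S < e"
   unfolding split real_norm_def using 1 2 by linarith
 qed
qed

lemma AC_compose_lipschitz:
 assumes ac: "abs_continuous_on_interval 0 T f" and C: "0 <= C"
  and g: "!!s t. 0 <= s ==> s <= t ==> t <= T ==> abs (g t - g s) <= C*abs (f t - f s)"
 shows "abs_continuous_on_interval 0 T g" unfolding abs_continuous_on_interval_def
proof (intro allI impI)
 fix e :: real assume e: "0 < e"
 have "0 < e / (C + 1)" using e C by simp
 from AC_D[OF ac this] obtain d where "0 < d" and "\<forall>(k::nat) u v. (\<forall>i<k. 0 <= u i \<and> u i <= v i \<and> v i <= T) -->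
   disjoint_family_on (%i. {u i <..< v i}) {..<k} --> (\<Sum>i<k. v i - u i) < d --> (\<Sum>i<k. abs (f (v i) - f (u i))) < e / (C + 1)"
  by (elim exE conjE)
 note d = this(1) this(2)[THEN spec, THEN spec, THEN spec, THEN mp, THEN mp, THEN mp]
 show "\<exists>d>0. \<forall>(k::nat) u v. (\<forall>i<k. 0 <= u i \<and> u i <= v i \<and> v i <= T) \<and>
    disjoint_family_on (%i. {u i <..< v i}) {..<k} \<and> (\<Sum>i<k. v i - u i) < d --> (\<Sum>i<k. abs (g (v i) - g (u i))) < e"
 proof (intro exI[of _ d] conjI allI impI d(1))
  fix k :: nat and u v
  assume a: "(\<forall>i<k. 0 <= u i \<and> u i <= v i \<and> v i <= T) \<and> disjoint_family_on (%i. {u i <..< v i}) {..<k} \<and> (\<Sum>i<k. v i - u i) < d"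
  have "(\<Sum>i<k. abs (g (v i) - g (u i))) <= (\<Sum>i<k. C*abs (f (v i) - f (u i)))"
   by (rule sum_mono) (use a g in auto)
  also have "... = C*(\<Sum>i<k. abs (f (v i) - f (u i)))" by (simp add: sum_distrib_left)
  also have "... <= C*(e / (C + 1))"
   by (rule mult_left_mono[OF less_imp_le[OF d(2)[OF conjunct1[OF a] conjunct1[OF conjunct2[OF a]] conjunct2[OF conjunct2[OF a]]]] C])
  also have "... < e" using C e by (simp add: field_simps)
  finally show "(\<Sum>i<k. abs (g (v i) - g (u i))) < e" .
 qed
qed

lemma AC_lipschitz:
 assumes C: "0 <= C" and g: "!!s t. 0 <= s ==> s <= t ==> t <= T ==> abs (g t - g s) <= C*abs (t - s)"
 shows "abs_continuous_on_interval 0 T g"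
proof (rule AC_compose_lipschitz[OF _ C g])
 show "abs_continuous_on_interval 0 T (%t. t)"
  unfolding abs_continuous_on_interval_def by (intro allI impI, rule_tac x = \<epsilon> in exI) auto
qed

lemma AC_continuous:
 assumes ac: "abs_continuous_halfline f"
 shows "continuous_on {0..} f"
proof (rule continuous_on_halfline)
 fix T :: real assume "0 <= T"
 hence ac: "abs_continuous_on_interval 0 T f" using ac by (simp add: abs_continuous_halfline_def)
 show "continuous_on {0..T} f" unfolding continuous_on_iff
 proof (intro ballI allI impI)
  fix s e :: real assume s: "s \<in> {0..T}" and e: "0 < e"
  from AC_D[OF ac e] obtain d where "0 < d" and "\<forall>(k::nat) u v. (\<forall>i<k. 0 <= u i \<and> u i <= v i \<and> v i <= T) -->
    disjoint_family_on (%i. {u i <..< v i}) {..<k} --> (\<Sum>i<k. v i - u i) < d --> (\<Sum>i<k. abs (f (v i) - f (u i))) < e"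
  by (elim exE conjE)
 note d = this(1) this(2)[THEN spec, THEN spec, THEN spec, THEN mp, THEN mp, THEN mp]
  show "\<exists>d>0. \<forall>t\<in>{0..T}. dist t s < d --> dist (f t) (f s) < e"
  proof (intro exI[of _ d] conjI ballI impI d(1))
   fix t assume "t \<in> {0..T}" "dist t s < d"
   hence "abs (f (max s t) - f (min s t)) < e" using d(2)[of 1 "%_. min s t" "%_. max s t"] s
    by (auto simp: dist_real_def disjoint_family_on_def)
   thus "dist (f t) (f s) < e" by (cases "s <= t") (auto simp: dist_real_def abs_minus_commute)
  qed
 qed
qed

lemma stopped_time:
 assumes c: "continuous_on {0..} f" and f0: "a <= f 0" and T: "0 <= T"
 obtains th where "0 <= th" "th <= T" "min (ereal T) (hit_time a f) = ereal th"
  "!!s. 0 <= s ==> s < th ==> a < f s \<and> ereal s < hit_time a f" "a <= f th" "hit_time a f <= ereal T ==> f th = a"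
 using c f0
proof (cases rule: hit_time_cases)
 case never
 thus thesis using T that[of T] by (simp add: less_imp_le)
next
 case (hit t)
 show thesis
 proof (cases "t <= T")
  case True
  thus thesis using hit that[of t] by (auto simp: min_def)
 next
  case False
  thus thesis using hit T that[of T] by (auto simp: min_def less_imp_le)
 qed
qed

text \<open>As a gauge integral that of \<open>k\<close> might converge only conditionally, which
  rules out a direct comparison. If the majorant has finite integral, the positive part of
  \<open>k\<close> is Lebesgue integrable and dominates \<open>k\<close>; otherwise the claim is
  trivial.\<close>

lemma nn_integral_majorant:
 fixes k :: "real => real" and v :: "real => ennreal"
 assumes k: "(k has_integral c) S" and le: "AE t in lborel. t \<in> S --> ennreal (k t) <= v t"
 shows "ereal c <= enn2ereal (\<integral>\<^sup>+t\<in>S. v t \<partial>lborel)"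
proof (cases "(\<integral>\<^sup>+t\<in>S. v t \<partial>lborel) = \<infinity>")
 let ?I = "\<integral>\<^sup>+t\<in>S. v t \<partial>lborel"
 case False
 define K where "K t = k t*indicator S t" for t
 have Km: "K \<in> \<B> lebesgue"
  unfolding K_def[abs_def] by (rule has_integral_implies_lebesgue_measurable_real[OF k])
 have "K = (%t. if t \<in> S then k t else 0)" by (auto simp: K_def)
 hence KI: "(K has_integral c) UNIV" using k by (simp only: has_integral_restrict_UNIV)
 have "(\<integral>\<^sup>+t. ennreal (max 0 (K t)) \<partial>lebesgue) = (\<integral>\<^sup>+t. ennreal (max 0 (K t)) \<partial>lborel)" by (rule nn_integral_completion)
 also have "... <= ?I"
 proof (rule nn_integral_mono_AE, use le in eventually_elim)
  case (elim t)
  thus ?case by (cases "t \<in> S") (auto simp: K_def max_def ennreal_neg)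
 qed
 finally have le2: "(\<integral>\<^sup>+t. ennreal (max 0 (K t)) \<partial>lebesgue) <= ?I" .
 have i: "integrable lebesgue (%t. max 0 (K t))"
  using Km le2 False by (intro integrableI_nonneg) (auto simp: top.not_eq_extremum intro: le_less_trans)
 have "c <= (\<integral>t. max 0 (K t) \<partial>lebesgue)"
  by (rule has_integral_le[OF KI has_integral_integral_lebesgue[OF i]]) simp
 hence "ennreal c <= ennreal (\<integral>t. max 0 (K t) \<partial>lebesgue)" by (rule ennreal_leI)
 also have "... = (\<integral>\<^sup>+t. ennreal (max 0 (K t)) \<partial>lebesgue)"
  by (rule nn_integral_eq_integral[symmetric, OF i]) simp
 also note le2
 finally have "enn2ereal (ennreal c) <= enn2ereal ?I" by (simp add: less_eq_ennreal.rep_eq)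
 moreover have "ereal c <= enn2ereal (ennreal c)"
 proof (cases "0 <= c")
  case False
  hence "ereal c <= 0" by simp
  also have "0 <= enn2ereal (ennreal c)" by simp
  finally show ?thesis .
 qed (simp add: enn2ereal_ennreal)
 ultimately show ?thesis by (rule order_trans[rotated])
qed simp

context model_lip
begin

text \<open>The difference of the two sides is the square
  \<open>(sig m q + z)^2 / 2\<close>.\<close>

lemma HH_square: "l y - lam - m*(- e y + (mu - r)*q + sig*q*z) <= HH y m q + z^2 / 2"
proof -
 have "HH y m q + z^2 / 2 - (l y - lam - m*(- e y + (mu - r)*q + sig*q*z)) = (sig*m*q + z)^2 / 2"
  by (simp add: HH_def power2_eq_square field_simps)
 thus ?thesis using zero_le_power2[of "sig*m*q + z"] by linarith
qed

text \<open>Along a state path \<open>V (\<phi> t)\<close> is absolutely continuous, and its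
  derivative plus the running rate is at most half the squared derivative of the noise. Integration
  up to the stopped time leaves \<open>V x\<close>, and \<open>V\<close> at the end dominates the
  terminal reward, being \<open>rho\<close> at \<open>a\<close> and nonnegative elsewhere. Noise of
  infinite energy has payoff \<open>-\<infinity>\<close>.\<close>

lemma payoff_upper:
 assumes x: "a <= x" and dens: "density m0 R" and tot: "integral {a..R} m0 <= rho"
  and sup: "!!y. a < y ==> HH y (m0 y) (pol y) <= 0"
  and st: "state_process mu r sig a e x pol \<psi> \<phi>" and T: "0 <= T"
 shows "payoff a lam rho l \<psi> \<phi> T <= ereal (rho - integral {a..x} m0)"
proof -
 note m0 = densityD[OF dens]
 have ac: "abs_continuous_halfline \<phi>" and \<phi>0: "\<phi> 0 = x" and
  ae: "AE t in lborel. 0 < t \<and> ereal t < hit_time a \<phi> -->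
    (\<phi> has_real_derivative (- e (\<phi> t) + (mu - r)*pol (\<phi> t) + sig*pol (\<phi> t)*deriv \<psi> t)) (at t)"
  using st by (auto simp: state_process_def)
 have c: "continuous_on {0..} \<phi>" by (rule AC_continuous[OF ac])
 obtain th where th: "0 <= th" "th <= T" "min (ereal T) (hit_time a \<phi>) = ereal th"
  "!!s. 0 <= s ==> s < th ==> a < \<phi> s \<and> ereal s < hit_time a \<phi>" "a <= \<phi> th" "hit_time a \<phi> <= ereal T ==> \<phi> th = a"
  using stopped_time[OF c _ T, of a] \<phi>0 x by auto
 have above: "a <= \<phi> s" if "0 <= s" "s <= th" for s using th(4)[of s] th(5) that by (cases "s = th") auto
 have S: "{t. 0 <= t \<and> ereal t <= min (ereal T) (hit_time a \<phi>)} = {0..th}" unfolding th(3) by auto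
 define V where "V y = rho - integral {a..y} m0" for y
 have dV: "(V has_real_derivative - m0 y) (at y within {a..})" if "a <= y" for y
  unfolding V_def[abs_def] by (auto intro!: derivative_eq_intros halfline_integral_derivative[OF m0(2) that])
 have "\<exists>C. \<forall>y\<ge>a. abs (m0 y) <= C" by (rule eventually_constant(2)[OF m0(1,2)]) (simp add: m0(4))
 then obtain C where C: "!!y. a <= y ==> abs (m0 y) <= C" by blast
 have C0: "0 <= C" using C[of a] by simp
 have Vlip: "abs (V y - V z) <= C*abs (y - z)" if "a <= y" "a <= z" for y z
 proof -
  have "norm (V y - V z) <= C*norm (y - z)"
   by (rule field_differentiable_bound[where S = "{a..}" and f' = "%y. - m0 y"]) (use that C dV in auto)
  thus ?thesis by simp
 qed
 have V0: "0 <= V y" if "a <= y" for y using density_integral_le[of m0 R y] m0 that tot by (force simp: V_def)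
 define wv where "wv t = V (\<phi> t)" for t
 have acw: "abs_continuous_on_interval 0 th wv"
 proof (rule AC_compose_lipschitz[OF _ C0])
  show "abs_continuous_on_interval 0 th \<phi>" using ac th(1) by (simp add: abs_continuous_halfline_def)
  show "abs (wv t - wv s) <= C*abs (\<phi> t - \<phi> s)" if "0 <= s" "s <= t" "t <= th" for s t
   unfolding wv_def by (rule Vlip) (use above that in auto)
 qed
 obtain N0 where N0: "N0 \<in> null_sets lborel" "{t. \<not> (0 < t \<and> ereal t < hit_time a \<phi> -->
    (\<phi> has_real_derivative (- e (\<phi> t) + (mu - r)*pol (\<phi> t) + sig*pol (\<phi> t)*deriv \<psi> t)) (at t))} \<subseteq> N0"
  using ae by (auto simp: eventually_ae_filter)
 \<comment> \<open>The end points are added because the equation for the state holds only strictly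
   between time 0 and the hitting time.\<close>
 define N where "N = N0 \<union> {0, th}"
 have N: "negligible N"
  unfolding N_def using N0(1) by (intro negligible_Un) (auto simp: negligible_iff_null_sets null_sets_completionI)
 define z where "z t = deriv \<psi> t" for t
 define f' where "f' t = - m0 (\<phi> t)*(- e (\<phi> t) + (mu - r)*pol (\<phi> t) + sig*pol (\<phi> t)*z t)" for t
 have dw: "(wv has_real_derivative f' t) (at t)" if t: "t \<in> {0..th} - N" for t
 proof -
  have t': "0 < t" "t < th" "t \<notin> N0" using t by (auto simp: N_def)
  have a: "a < \<phi> t" "ereal t < hit_time a \<phi>" using th(4)[of t] t' by auto
  have "(\<phi> has_real_derivative (- e (\<phi> t) + (mu - r)*pol (\<phi> t) + sig*pol (\<phi> t)*z t)) (at t)"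
   using N0(2) t' a unfolding z_def by blast
  moreover have "(V has_real_derivative - m0 (\<phi> t)) (at (\<phi> t))"
   using dV[of "\<phi> t"] a at_within_interior[of "\<phi> t" "{a..}"] by simp
  ultimately show ?thesis unfolding wv_def[abs_def] f'_def using DERIV_chain2 by blast
 qed
 have FT: "((%t. if t \<in> N then 0 else f' t) has_integral wv th - wv 0) {0..th}"
  by (rule AC_fundamental_theorem[OF acw th(1) N dw])
 have lc': "continuous_on {0..th} (%t. - lam + l (\<phi> t))"
 proof (intro continuous_intros continuous_on_compose2[OF lc])
  show "continuous_on {0..th} \<phi>" by (rule continuous_on_subset[OF c]) auto
 qed (use above in auto)
 define J where "J = integral {0..th} (%t. - lam + l (\<phi> t))"
 have J: "(LBINT t:{0..th}. - lam + l (\<phi> t)) = J"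
  unfolding J_def by (rule set_borel_integral_eq_integral(2)[OF borel_integrable_atLeastAtMost'[OF lc']])
 have "((%t. (if t \<in> N then 0 else f' t) + (- lam + l (\<phi> t))) has_integral (wv th - wv 0) + J) {0..th}"
  unfolding J_def by (intro has_integral_add FT integrable_integral integrable_continuous_interval lc')
 hence main: "ereal ((wv th - wv 0) + J) <= enn2ereal (\<integral>\<^sup>+t\<in>{0..th}. ennreal (1/2*(z t)^2) \<partial>lborel)"
 proof (rule nn_integral_majorant)
  have "AE t in lborel. t \<noteq> 0 \<and> t \<noteq> th \<and> t \<notin> N0"
   using AE_lborel_singleton[of "0::real"] AE_lborel_singleton[of th] AE_not_in[OF N0(1)] by eventually_elim simp
  thus "AE t in lborel. t \<in> {0..th} --> ennreal ((if t \<in> N then 0 else f' t) + (- lam + l (\<phi> t))) <= ennreal (1/2*(z t)^2)"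
  proof eventually_elim
   case (elim t)
   show ?case
   proof
    assume t: "t \<in> {0..th}"
    hence a: "a < \<phi> t" using th(4)[of t] elim by simp
    have "f' t + (- lam + l (\<phi> t)) <= HH (\<phi> t) (m0 (\<phi> t)) (pol (\<phi> t)) + (z t)^2 / 2"
     using HH_square[of "\<phi> t" "m0 (\<phi> t)" "pol (\<phi> t)" "z t"] by (simp add: f'_def)
    also have "... <= 1/2*(z t)^2" using sup[OF a] by simp
    finally show "ennreal ((if t \<in> N then 0 else f' t) + (- lam + l (\<phi> t))) <= ennreal (1/2*(z t)^2)"
     using elim by (intro ennreal_leI) (simp add: N_def)
   qed
  qed
 qed
 define P where "P = enn2ereal (\<integral>\<^sup>+t\<in>{0..th}. ennreal (1/2*(z t)^2) \<partial>lborel)"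
 have pay: "payoff a lam rho l \<psi> \<phi> T = ereal J - P + ereal (rho*(if hit_time a \<phi> <= ereal T then 1 else 0))"
  unfolding payoff_def Let_def S J P_def z_def ..
 have final: "rho*(if hit_time a \<phi> <= ereal T then 1 else 0) <= wv th"
 proof (cases "hit_time a \<phi> <= ereal T")
  case True
  thus ?thesis using th(6) by (simp add: wv_def V_def)
 qed (use V0[OF th(5)] in "simp add: wv_def")
 have w0: "wv 0 = rho - integral {a..x} m0" by (simp add: wv_def V_def \<phi>0)
 have P0: "0 <= P" unfolding P_def by simp
 show ?thesis
 proof (cases P)
  case (real p)
  thus ?thesis using main final w0 unfolding pay P_def[symmetric] by simp
 next
  case PInf
  thus ?thesis unfolding pay by simp
 next
  case MInf
  thus ?thesis using P0 by simp
 qed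
qed

end

lemma derivative_at_positive:
 fixes f :: "real => real"
 assumes "(f has_real_derivative c) (at t within {0..})" "0 < t"
 shows "(f has_real_derivative c) (at t)" using assms at_within_interior[of t "{0..}"] by simp

lemma integral_AC:
 fixes k :: "real => real"
 assumes k: "continuous_on {0..} k" and g: "!!t. 0 <= t ==> g t = c + integral {0..t} k"
 shows "abs_continuous_halfline g" unfolding abs_continuous_halfline_def
proof (intro allI impI)
 fix T :: real assume T: "0 <= T"
 have "bounded (k ` {0..T})"
  by (intro compact_imp_bounded compact_continuous_image continuous_on_subset[OF k]) auto
 then obtain C where "\<forall>x\<in>k ` {0..T}. norm x <= C" unfolding bounded_iff by blast
 hence C: "abs (k t) <= C" if "0 <= t" "t <= T" for t using that by simp
 show "abs_continuous_on_interval 0 T g"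
 proof (rule AC_lipschitz)
  show "0 <= C" using C[of 0] T by linarith
  fix s t assume st: "0 <= s" "s <= t" "t <= T"
  have "norm (integral {0..t} k - integral {0..s} k) <= C*norm (t - s)"
  proof (rule field_differentiable_bound[where S = "{0..T}" and f' = k])
   show "((%t. integral {0..t} k) has_field_derivative k z) (at z within {0..T})" if "z \<in> {0..T}" for z
    by (rule has_field_derivative_subset[OF halfline_integral_derivative[OF k]]) (use that in auto)
  qed (use st C in auto)
  thus "abs (g t - g s) <= C*abs (t - s)" using g[of t] g[of s] st by simp
 qed
qed

context lipschitz_ode
begin

definition flow :: "real => real => real" where "flow x = ode_sol h (%_. x)"

lemma flow_cont: "continuous_on {0..} (flow x)"
 unfolding flow_def by (rule ode_sol_cont) simp

lemma h_flow_cont: "continuous_on {0..} (%t. h (flow x t))"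
 by (rule continuous_on_compose2[OF h_cont flow_cont]) auto

lemma flow_eq: "0 <= t ==> flow x t = x + integral {0..t} (%s. - h (flow x s))"
 unfolding flow_def by (subst ode_sol_eq) auto

lemma flow_0: "flow x 0 = x" using flow_eq[of 0 x] by simp

lemma flow_deriv:
 assumes "0 <= t"
 shows "(flow x has_real_derivative - h (flow x t)) (at t within {0..})"
proof -
 have c: "continuous_on {0..} (%s. - h (flow x s))" by (intro continuous_intros h_flow_cont)
 have "((%t. x + integral {0..t} (%s. - h (flow x s))) has_real_derivative - h (flow x t)) (at t within {0..})"
  by (rule DERIV_cong[OF DERIV_add[OF DERIV_const halfline_integral_derivative[OF c assms]]]) simp
 thus ?thesis by (rule has_field_derivative_transform_within[of _ _ _ _ 1]) (use assms flow_eq in auto)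
qed

lemma flow_AC: "abs_continuous_halfline (flow x)"
 by (rule integral_AC[OF _ flow_eq]) (intro continuous_intros h_flow_cont)

end

lemma lipschitz_on_clamp:
 fixes f :: "real => real"
 assumes "C-lipschitz_on {a..b} f" "a <= b"
 shows "C-lipschitz_on UNIV (%y. f (max a (min y b)))"
proof (rule lipschitz_onI)
 fix y z :: real
 have "dist (f (max a (min y b))) (f (max a (min z b))) <= C*dist (max a (min y b)) (max a (min z b))"
  using assms(2) by (intro lipschitz_onD[OF assms(1)]) auto
 also have "... <= C*dist y z"
  using lipschitz_on_nonneg[OF assms(1)] by (intro mult_left_mono) (auto simp: dist_real_def min_def max_def)
 finally show "dist (f (max a (min y b))) (f (max a (min z b))) <= C*dist y z" .
qed (rule lipschitz_on_nonneg[OF assms(1)])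

lemma lipschitz_on_extend:
 fixes f :: "real => real"
 assumes "C-lipschitz_on {a..} f"
 shows "C-lipschitz_on UNIV (%y. f (max a y))"
proof (rule lipschitz_onI)
 fix y z :: real
 have "dist (f (max a y)) (f (max a z)) <= C*dist (max a y) (max a z)" by (intro lipschitz_onD[OF assms(1)]) auto
 also have "... <= C*dist y z"
  using lipschitz_on_nonneg[OF assms(1)] by (intro mult_left_mono) (auto simp: dist_real_def max_def)
 finally show "dist (f (max a y)) (f (max a z)) <= C*dist y z" .
qed (rule lipschitz_on_nonneg[OF assms(1)])

context model_lip
begin

text \<open>Supplies a competitor for the supremum in the game: with zero noise and
  \<open>T = 0\<close> the payoff is 0, or \<open>rho\<close> if the start is
  \<open>a\<close>.\<close>

lemma zero_noise_state:
 assumes pol: "pol \<in> game_policies a M1" and x: "a <= x"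
 shows "\<exists>\<phi>. state_process mu r sig a e x pol (%_. 0) \<phi>"
proof -
 obtain Lp where Lp: "Lp-lipschitz_on {a..} pol" using pol by (auto simp: game_policies_def)
 have "(L + abs (- (mu - r))*Lp)-lipschitz_on {a..} (%y. e y + - (mu - r)*pol y)"
  by (intro lipschitz_on_add eL lipschitz_on_cmult_real Lp)
 hence "(L + abs (- (mu - r))*Lp)-lipschitz_on UNIV (%y. e (max a y) + - (mu - r)*pol (max a y))"
  by (rule lipschitz_on_extend)
 then interpret lipschitz_ode "%y. e (max a y) + - (mu - r)*pol (max a y)" "L + abs (- (mu - r))*Lp" by unfold_locales
 have "state_process mu r sig a e x pol (%_. 0) (flow x)" unfolding state_process_def
 proof (intro conjI flow_AC flow_0 AE_I2 impI)
  fix t assume t: "0 < t \<and> ereal t < hit_time a (flow x)"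
  have "a < flow x t"
  proof -
   have "a <= flow x 0" using x flow_0 by simp
   with flow_cont show ?thesis
   proof (cases rule: hit_time_cases)
    case never
    thus ?thesis using t by simp
   next
    case (hit s)
    thus ?thesis using t by simp
   qed
  qed
  thus "(flow x has_real_derivative - e (flow x t) + (mu - r)*pol (flow x t) + sig*pol (flow x t)*deriv (%_. 0) t) (at t)"
   using derivative_at_positive[OF flow_deriv, of t x] t by (simp add: max_def algebra_simps)
 qed
 thus ?thesis by blast
qed

lemma singleton_integral: "(LBINT t:{c::real}. f t) = (0::real)"
 unfolding set_lebesgue_integral_def
 by (rule integral_eq_zero_AE, rule eventually_mono[OF AE_lborel_singleton[of c]]) simp

lemma AC0_zero: "(%_. 0) \<in> AC0"
 unfolding AC0_def by (auto intro!: integral_AC[of "%_. 0" _ 0])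

end

context level
begin

text \<open>The maximising noise is a function of the state, so the closed loop is an autonomous
  equation with the Lipschitz right-hand side \<open>- h0\<close>, solved with its argument clamped
  to \<open>[a, x]\<close>. As \<open>h0 >= c / 2\<close> there, the state stays at most
  \<open>x\<close> and reaches \<open>a\<close> in finite time, so up to then the clamp is not
  felt.\<close>

lemma payoff_lower:
 assumes pol: "pol \<in> game_policies a M1" and x: "a < x" "x < d"
 shows "\<exists>\<psi> \<phi> T. \<psi> \<in> AC0 \<and> state_process mu r sig a e x pol \<psi> \<phi> \<and> 0 <= T \<and> ereal (Uv x) <= payoff a lam rho l \<psi> \<phi> T"
proof -
 obtain Lp where Lp: "Lp-lipschitz_on {a..} pol" and pb: "!!y. a <= y ==> abs (pol y) <= M1" using pol by (auto simp: game_policies_def)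
 obtain C where C: "C-lipschitz_on {a..d} gq" using gq_lip by blast
 obtain G where G: "0 <= G" "!!y. a <= y ==> y <= d ==> abs (gq y) <= G" using continuous_bounded_interval[OF gqc] by blast
 let ?D = "M1*(M1*C + G*Lp) + (M1*G)*Lp"
 have sub: "{a..x} \<subseteq> {a..d}" using x by auto
 have lp: "Lp-lipschitz_on {a..x} pol" by (rule lipschitz_on_subset[OF Lp]) auto
 have lpg: "(M1*C + G*Lp)-lipschitz_on {a..x} (%y. pol y*gq y)"
  by (rule lipschitz_on_product[OF lp _ lipschitz_on_subset[OF C sub]]) (use pb G x M1 in auto)
 have lppg: "?D-lipschitz_on {a..x} (%y. pol y*(pol y*gq y))"
 proof (rule lipschitz_on_product[OF lp _ lpg])
  show "abs (pol y*gq y) <= M1*G" if "y \<in> {a..x}" for y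
   unfolding abs_mult using pb[of y] G(2)[of y] that x M1 by (intro mult_mono) auto
 qed (use pb M1 G in auto)
 define h0 where "h0 y = e y + - (mu - r)*pol y + sig^2*(pol y*(pol y*gq y))" for y
 have "L-lipschitz_on {a..x} e" by (rule lipschitz_on_subset[OF eL]) auto
 hence "(L + abs (- (mu - r))*Lp + abs (sig^2) * ?D)-lipschitz_on {a..x} h0"
  unfolding h0_def[abs_def] by (intro lipschitz_on_add lipschitz_on_cmult_real lp lppg)
 from lipschitz_on_clamp[OF this less_imp_le[OF x(1)]]
 have hl: "(L + abs (- (mu - r))*Lp + abs (sig^2) * ?D)-lipschitz_on UNIV (%y. h0 (max a (min y x)))" .
 interpret lipschitz_ode "%y. h0 (max a (min y x))" "L + abs (- (mu - r))*Lp + abs (sig^2) * ?D"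
  by unfold_locales (rule hl)
 obtain c where c: "0 < c" "!!y. a <= y ==> y <= d ==> c <= e y" using e_min by blast
 have gh: "gq y*h0 y = La y - (mu - r)*(pol y*gq y) + (sig*(pol y*gq y))^2" if "a <= y" "y <= d" for y
  using d2[OF that] by (simp add: gq_def h0_def power2_eq_square field_simps)
 \<comment> \<open>After multiplication by \<open>gq\<close> this becomes
   \<open>La / 2 <= La - (mu - r) q + (sig q)^2\<close>: the last two terms are at least
   \<open>- nu / 2\<close>, and \<open>nu < La\<close>.\<close>
 have h0_low: "c / 2 <= h0 y" if y: "a <= y" "y <= d" for y
 proof -
  define q where "q = pol y*gq y"
  have g: "0 < gq y" by (rule gq_pos[OF y])
  have "La y / 2 <= La y - (mu - r)*q + (sig*q)^2"
  proof -
   have "(mu - r)*q = 2*(sig*q)*((mu - r) / (2 * sig))" using par by simp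
   also have "... <= (sig*q)^2 + ((mu - r) / (2 * sig))^2"
    using zero_le_power2[of "sig*q - (mu - r) / (2 * sig)"] by (simp add: power2_diff)
   also have "((mu - r) / (2 * sig))^2 = nu / 2" by (simp add: nu_def power2_eq_square)
   also have "nu / 2 <= La y / 2" using La_pos(2)[OF y(1)] by simp
   finally show ?thesis by simp
  qed
  also have "... = gq y*h0 y" unfolding gh[OF y] q_def ..
  finally have "gq y*(e y / 2) <= gq y*h0 y" using d2[OF y] by (simp add: gq_def)
  hence "e y / 2 <= h0 y" using g by simp
  thus ?thesis using c(2)[OF y] by simp
 qed
 define \<phi> where "\<phi> = flow x"
 let ?l = "%t. - lam + l (\<phi> t)"
 have low: "c / 2 <= h0 (max a (min y x))" for y by (rule h0_low) (use x in auto)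
 have dec: "\<phi> t <= x - c / 2*t" if t: "0 <= t" for t
 proof -
  have "integral {0..t} (%s. - h0 (max a (min (flow x s) x))) <= integral {0..t} (%s. - (c / 2))"
   by (intro integral_le integrable_continuous_interval continuous_on_minus continuous_on_subset[OF h_flow_cont] continuous_on_const)
    (use low in auto)
  thus ?thesis using flow_eq[OF t, of x] t unfolding \<phi>_def by (simp add: mult.commute)
 qed
 have \<phi>0: "\<phi> 0 = x" unfolding \<phi>_def by (rule flow_0)
 have \<phi>c: "continuous_on {0..} \<phi>" unfolding \<phi>_def by (rule flow_cont)
 obtain t0 where t0: "0 <= t0" "hit_time a \<phi> = ereal t0" "\<phi> t0 = a" "!!s. 0 <= s ==> s < t0 ==> a < \<phi> s"
 proof -
  have "a <= \<phi> 0" using \<phi>0 x by simp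
  with \<phi>c show thesis
  proof (cases rule: hit_time_cases)
   case never
   \<comment> \<open>At this time the upper bound \<open>x - c / 2 * t\<close> for the state meets
     \<open>a\<close>.\<close>
   define s where "s = 2*(x - a) / c"
   have "0 <= s" "x - c / 2 * s = a" using x c by (auto simp: s_def field_simps)
   hence "\<phi> s <= a" using dec[of s] by simp
   thus thesis using never(2)[OF \<open>0 <= s\<close>] by simp
  next
   case (hit t)
   thus thesis by (rule that)
  qed
 qed
 have range: "a <= \<phi> s \<and> \<phi> s <= x" if s: "0 <= s" "s <= t0" for s
 proof -
  have "0 <= c / 2 * s" using s c by simp
  thus ?thesis using t0(3) t0(4)[of s] dec[of s] s by (cases "s = t0") auto
 qed
 have clamp: "max a (min (\<phi> s) x) = \<phi> s" if "0 <= s" "s <= t0" for s using range[OF that] by auto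
 have d\<phi>: "(\<phi> has_real_derivative - h0 (\<phi> t)) (at t within {0..})" if "0 <= t" "t <= t0" for t
  using flow_deriv[OF that(1), of x] clamp[OF that] unfolding \<phi>_def by simp
 \<comment> \<open>The noise rate in closed loop; the clamp makes it continuous for all times and is
   inactive up to the hitting time.\<close>
 define k where "k t = - sig*(%y. pol y*gq y) (max a (min (\<phi> t) x))" for t
 let ?k = "%t. 1/2*(k t)^2"
 have kc: "continuous_on {0..} k" unfolding k_def
  by (intro continuous_intros continuous_on_compose2[OF lipschitz_on_continuous_on[OF lpg]] \<phi>c) (use x in auto)
 define \<psi> where "\<psi> t = integral {0..t} k" for t
 let ?P = "\<integral>\<^sup>+t\<in>{0..t0}. ennreal (1/2*(deriv \<psi> t)^2) \<partial>lborel"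
 have \<psi>AC: "\<psi> \<in> AC0"
  unfolding AC0_def using integral_AC[OF kc, of \<psi> 0] by (simp add: \<psi>_def)
 have d\<psi>: "deriv \<psi> t = k t" if "0 < t" for t
 proof (rule DERIV_imp_deriv)
  have "(\<psi> has_real_derivative k t) (at t within {0..})"
   unfolding \<psi>_def[abs_def] by (rule halfline_integral_derivative[OF kc]) (use that in simp)
  thus "(\<psi> has_real_derivative k t) (at t)" by (rule derivative_at_positive[OF _ that])
 qed
 have k: "k t = - sig*(pol (\<phi> t)*gq (\<phi> t))" if "0 <= t" "t <= t0" for t using clamp[OF that] by (simp add: k_def)
 have st: "state_process mu r sig a e x pol \<psi> \<phi>" unfolding state_process_def
 proof (intro conjI AE_I2 impI \<phi>0)
  show "abs_continuous_halfline \<phi>" unfolding \<phi>_def by (rule flow_AC)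
  fix t assume "0 < t \<and> ereal t < hit_time a \<phi>"
  hence t: "0 < t" "t < t0" using t0(2) by auto
  have "(\<phi> has_real_derivative - h0 (\<phi> t)) (at t)" using derivative_at_positive[OF d\<phi>] t by simp
  moreover have "- h0 (\<phi> t) = - e (\<phi> t) + (mu - r)*pol (\<phi> t) + sig*pol (\<phi> t)*deriv \<psi> t"
   using k[of t] t unfolding d\<psi>[OF t(1)] by (simp add: h0_def power2_eq_square algebra_simps)
  ultimately show "(\<phi> has_real_derivative - e (\<phi> t) + (mu - r)*pol (\<phi> t) + sig*pol (\<phi> t)*deriv \<psi> t) (at t)" by simp
 qed
 define J where "J = integral {0..t0} (%t. ?l t)"
 define K where "K = integral {0..t0} (%t. ?k t)"
 have c0: "continuous_on {0..t0} \<phi>" by (rule continuous_on_subset[OF \<phi>c]) auto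
 have lc': "continuous_on {0..t0} (%t. ?l t)"
  by (intro continuous_intros continuous_on_compose2[OF lc c0]) (use range in auto)
 have kc': "continuous_on {0..t0} (%t. ?k t)"
  by (intro continuous_intros continuous_on_subset[OF kc]) auto
 have pay: "payoff a lam rho l \<psi> \<phi> t0 = ereal (J - K + rho)"
 proof -
  have S: "{t. 0 <= t \<and> ereal t <= min (ereal t0) (hit_time a \<phi>)} = {0..t0}" unfolding t0(2) by auto
  have 1: "(LBINT t:{0..t0}. ?l t) = J"
   unfolding J_def by (rule set_borel_integral_eq_integral(2)[OF borel_integrable_atLeastAtMost'[OF lc']])
  have "?P = (\<integral>\<^sup>+t. ennreal (indicator {0..t0} t*(?k t)) \<partial>lborel)"
  proof (rule nn_integral_cong_AE, rule eventually_mono[OF AE_lborel_singleton[of 0]])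
   fix t :: real assume "t \<noteq> 0"
   thus "ennreal (1/2*(deriv \<psi> t)^2)*indicator {0..t0} t = ennreal (indicator {0..t0} t*(?k t))"
    using d\<psi>[of t] by (auto simp: indicator_def)
  qed
  also have "... = ennreal K"
  proof (rule nn_integral_has_integral_lebesgue)
   show "((%t. ?k t) has_integral K) {0..t0}"
    unfolding K_def by (intro integrable_integral integrable_continuous_interval kc')
  qed simp
  finally have "enn2ereal ?P = enn2ereal (ennreal K)" by simp
  also have "enn2ereal (ennreal K) = ereal K"
  proof -
   have "0 <= K" unfolding K_def by (rule Henstock_Kurzweil_Integration.integral_nonneg[OF integrable_continuous_interval[OF kc']]) simp
   thus "enn2ereal (ennreal K) = ereal K" by (rule enn2ereal_ennreal)
  qed
  finally have 2: "enn2ereal ?P = ereal K" .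
  show ?thesis unfolding payoff_def Let_def S 1 2 using t0(2) by simp
 qed
 have "Uv x <= J - K + rho"
 proof -
  \<comment> \<open>Comparing the derivative of \<open>W\<close> with the net payoff rate avoids
    evaluating either integral; the pointwise inequality is
    \<open>(sig q - (mu - r) / sig)^2 / 2 >= 0\<close>.\<close>
  define W where "W t = integral {a..\<phi> t} gq" for t
  have "((%t. gq (\<phi> t) * - h0 (\<phi> t)) has_integral W t0 - W 0) {0..t0}"
  proof (rule fundamental_theorem_of_calculus[OF t0(1)])
   fix t assume t: "t \<in> {0..t0}"
   have im: "\<phi> ` {0..t0} \<subseteq> {a..x}" using range by auto
   have "((%y. integral {a..y} gq) has_real_derivative gq (\<phi> t)) (at (\<phi> t) within {a..x})"
    by (rule integral_has_real_derivative) (use t range continuous_on_subset[OF gqc sub] in auto)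
   hence "((%y. integral {a..y} gq) has_real_derivative gq (\<phi> t)) (at (\<phi> t) within \<phi> ` {0..t0})"
    by (rule has_field_derivative_subset[OF _ im])
   moreover have "(\<phi> has_real_derivative - h0 (\<phi> t)) (at t within {0..t0})"
    by (rule has_field_derivative_subset[OF d\<phi>]) (use t in auto)
   ultimately have "((%y. integral {a..y} gq) \<circ> \<phi> has_real_derivative gq (\<phi> t) * - h0 (\<phi> t)) (at t within {0..t0})"
    by (rule DERIV_image_chain)
   thus "(W has_vector_derivative gq (\<phi> t) * - h0 (\<phi> t)) (at t within {0..t0})"
    by (simp add: W_def[abs_def] o_def has_real_derivative_iff_has_vector_derivative)
  qed
  moreover have "((%t. (?l t) - ?k t) has_integral J - K) {0..t0}"
   unfolding J_def K_def by (intro has_integral_diff integrable_integral integrable_continuous_interval lc' kc')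
  ultimately have "W t0 - W 0 <= J - K"
  proof (rule has_integral_le)
   fix t assume t: "t \<in> {0..t0}"
   define q where "q = pol (\<phi> t)*gq (\<phi> t)"
   have y: "a <= \<phi> t" "\<phi> t <= d" using range[of t] t x by auto
   have "0 <= (sig*q - (mu - r) / sig)^2 / 2" by simp
   also have "... = nu - (mu - r)*q + 1/2*(sig*q)^2" using par by (simp add: nu_def power2_eq_square field_simps)
   finally have "- (La (\<phi> t) - (mu - r)*q + (sig*q)^2) <= (?l t) - 1/2*(sig*q)^2"
    by (simp add: La_def)
   thus "gq (\<phi> t) * - h0 (\<phi> t) <= (?l t) - ?k t"
    using gh[OF y] k[of t] t by (simp add: q_def)
  qed
  moreover have "W t0 = 0" "W 0 = integral {a..x} gq" by (simp_all add: W_def t0(3) \<phi>0)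
  ultimately show ?thesis using Uv_eq[of x] x by (simp add: min_def)
 qed
 thus ?thesis using \<psi>AC st t0(1) pay by (metis ereal_less_eq(3))
qed

end

context model_lip
begin

text \<open>For the upper bound one Lipschitz policy limits all payoffs up to \<open>eps\<close>.
  For the lower bound each policy is answered by a noise of its own: the closed-loop noise if
  \<open>a < x < d\<close>, and zero noise stopped at once otherwise.\<close>

lemma game_value_eq:
 assumes x: "a <= x"
 shows "game_value mu r sig M1 a lam rho e l x = ereal (Uv x)"
proof (rule antisym)
 show "game_value mu r sig M1 a lam rho e l x <= ereal (Uv x)"
 proof (rule ereal_le_epsilon2)
  fix eps :: real assume eps: "0 < eps"
  show "game_value mu r sig M1 a lam rho e l x <= ereal (Uv x) + ereal eps"
  proof -
   obtain m0 R pol Lp where m0: "x <= R" "density m0 R" "integral {a..R} m0 < rho" "Lp-lipschitz_on {a..} pol"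
    "!!y. a <= y ==> abs (pol y) <= M1" "strict_super m0 pol" "rho - integral {a..x} m0 <= Uv x + eps"
    using super_exists[OF x eps] by auto
   obtain c where c: "0 < c" "!!y. a < y ==> HH y (m0 y) (pol y) <= - c" using m0(6) by (auto simp: strict_super_def)
   have pol: "pol \<in> game_policies a M1" using m0 by (auto simp: game_policies_def)
   have "payoff a lam rho l \<psi> \<phi> T <= ereal (Uv x + eps)" if "state_process mu r sig a e x pol \<psi> \<phi>" "0 <= T" for \<psi> \<phi> T
   proof -
    have "payoff a lam rho l \<psi> \<phi> T <= ereal (rho - integral {a..x} m0)"
    proof (rule payoff_upper[OF x m0(2) _ _ that])
     show "HH y (m0 y) (pol y) <= 0" if "a < y" for y using c(2)[OF that] c(1) by simp
    qed (use m0 in simp)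
    also have "... <= ereal (Uv x + eps)" using m0(7) by simp
    finally show ?thesis .
   qed
   hence "Sup {payoff a lam rho l \<psi> \<phi> T | \<psi> \<phi> T. \<psi> \<in> AC0 \<and> state_process mu r sig a e x pol \<psi> \<phi> \<and> 0 <= T} <= ereal (Uv x + eps)"
    by (intro Sup_least) auto
   thus "game_value mu r sig M1 a lam rho e l x <= ereal (Uv x) + ereal eps"
    unfolding game_value_def using pol by (auto intro: INF_lower2)
  qed
 qed
 show "ereal (Uv x) <= game_value mu r sig M1 a lam rho e l x" unfolding game_value_def
 proof (rule INF_greatest)
  fix pol assume pol: "pol \<in> game_policies a M1"
  have "\<exists>\<psi> \<phi> T. \<psi> \<in> AC0 \<and> state_process mu r sig a e x pol \<psi> \<phi> \<and> 0 <= T \<and> ereal (Uv x) <= payoff a lam rho l \<psi> \<phi> T"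
   using x
  proof (cases rule: Uv_cases)
   case (3 d)
   interpret level mu r sig a lam rho M1 L e l Ll d by fact
   show ?thesis by (rule payoff_lower[OF pol 3(2,3)])
  next
   case 1
   obtain \<phi> where st: "state_process mu r sig a e x pol (%_. 0) \<phi>" using zero_noise_state[OF pol x] by blast
   have h: "hit_time a \<phi> = 0"
   proof (rule antisym)
    show "hit_time a \<phi> <= 0" unfolding hit_time_def
     by (rule Inf_lower) (use st 1 in "auto simp: state_process_def zero_ereal_def")
    show "0 <= hit_time a \<phi>" unfolding hit_time_def by (rule Inf_greatest) auto
   qed
   have S: "{t. 0 <= t \<and> ereal t <= min (ereal 0) 0} = {0}" by (auto simp: zero_ereal_def)
   have "ereal (Uv x) <= payoff a lam rho l (%_. 0) \<phi> 0"
    unfolding payoff_def Let_def h S using 1 by (simp add: zero_ereal_def[symmetric] zero_ennreal.rep_eq singleton_integral)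
   thus ?thesis using st AC0_zero by blast
  next
   case 2
   obtain \<phi> where st: "state_process mu r sig a e x pol (%_. 0) \<phi>" using zero_noise_state[OF pol x] by blast
   have c: "continuous_on {0..} \<phi>" and \<phi>0: "\<phi> 0 = x" using st AC_continuous by (auto simp: state_process_def)
   have "\<not> hit_time a \<phi> <= ereal 0"
   proof -
    have "a <= \<phi> 0" using x \<phi>0 by simp
    with c show ?thesis
    proof (cases rule: hit_time_cases)
     case (hit t)
     thus ?thesis using \<phi>0 2 by (cases "t = 0") auto
    qed simp
   qed
   hence h: "min (ereal 0) (hit_time a \<phi>) = ereal 0" "\<not> hit_time a \<phi> <= ereal 0" by auto
   have S: "{t. 0 <= t \<and> ereal t <= ereal 0} = {0}" by auto
   have "ereal (Uv x) <= payoff a lam rho l (%_. 0) \<phi> 0"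
    unfolding payoff_def Let_def h(1) S using h(2) 2 by (simp add: zero_ereal_def[symmetric] zero_ennreal.rep_eq singleton_integral)
   thus ?thesis using st AC0_zero by blast
  qed
  thus "ereal (Uv x) <= Sup {payoff a lam rho l \<psi> \<phi> T | \<psi> \<phi> T. \<psi> \<in> AC0 \<and> state_process mu r sig a e x pol \<psi> \<phi> \<and> 0 <= T}"
   by (auto intro: Sup_upper2)
 qed
qed

end

section \<open>Convergence of the costs to the value of the game\<close>

lemma ereal_tendstoI:
 fixes f :: "nat => ereal"
 assumes "!!eps. 0 < eps ==> eventually (%n. ereal (U - eps) <= f n) sequentially"
  and "!!eps. 0 < eps ==> eventually (%n. f n <= ereal (U + eps)) sequentially"
 shows "f ----> ereal U"
proof (rule order_tendstoI)
 fix c assume "c < ereal U"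
 then obtain z where z: "c < ereal z" "ereal z < ereal U" using ereal_dense2 by blast
 have "eventually (%n. ereal (U - (U - z)) <= f n) sequentially" using z by (intro assms(1)) simp
 thus "eventually (%n. c < f n) sequentially" by (rule eventually_mono) (use z in auto)
next
 fix c assume "ereal U < c"
 then obtain z where z: "ereal U < ereal z" "ereal z < c" using ereal_dense2 by blast
 have "eventually (%n. f n <= ereal (U + (z - U))) sequentially" using z by (intro assms(2)) simp
 thus "eventually (%n. f n < c) sequentially" by (rule eventually_mono) (use z in auto)
qed

theorem theorem1:
  fixes mu r sig M0 a lam rho M1 :: real
    and e l :: "real \<Rightarrow> real"
    and M :: "'w measure"
    and B :: "real \<Rightarrow> 'w \<Rightarrow> real"
    and D :: "nat \<Rightarrow> 'w \<Rightarrow> real"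
  assumes "mu > r" "r > 0" "sig > 0" "M0 > 0" "a > 0" "lam > 0" "rho > 0"
    and "\<exists>L. L-lipschitz_on {a..} e" and "\<forall>x\<ge>a. e x \<le> M0"
    and "\<exists>L. L-lipschitz_on {a..} l" and "\<forall>x\<ge>a. 0 \<le> l x \<and> l x < lam"
    and "antimono_on {a..} l"
    and "M1 > 0" and "\<forall>x\<ge>a. \<bar>pi_star mu r sig a lam rho e l x\<bar> \<le> M1"
    and "standard_brownian_motion M B"
    and "\<forall>n\<ge>1. distributed M lborel (D n) (exponential_density (lam * real n))"
    and "\<forall>n\<ge>1. independent_of_filtration M (natural_filtration M B) (D n)"
  shows "\<forall>x\<ge>a.
    (\<lambda>n. optimal_cost mu r sig M1 a rho e l M B n (D n) x)
       \<longlonglongrightarrow> game_value mu r sig M1 a lam rho e l x \<and>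
    (\<forall>F W.
       (\<forall>n\<ge>1. feedback_wealth_process mu r sig a lam rho e l M (F n) B n (D n) x (W n)) \<longrightarrow>
       (\<lambda>n. ereal (cost a rho l M n (D n) (W n)))
         \<longlonglongrightarrow> game_value mu r sig M1 a lam rho e l x)"
proof (intro allI impI conjI)
 fix x assume x: "a <= x"
 obtain L where L: "L-lipschitz_on {a..} e" using assms(8) by blast
 obtain Ll where Ll: "Ll-lipschitz_on {a..} l" using assms(10) by blast
 have anti: "l y <= l a" if "a <= y" for y using assms(12) that by (auto simp: monotone_on_def)
 interpret model_lip mu r sig a lam rho M1 L e l Ll
  by unfold_locales (use assms(1,3,5,6,7,11,13,14) L Ll anti lipschitz_on_continuous_on[OF Ll] in auto)
 note ab = augmented_brownian[OF assms(15)]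
 show "(%n. optimal_cost mu r sig M1 a rho e l M B n (D n) x) ----> game_value mu r sig M1 a lam rho e l x"
  unfolding game_value_eq[OF x]
 proof (rule ereal_tendstoI)
  fix eps :: real assume eps: "0 < eps"
  show "eventually (%n. ereal (Uv x - eps) <= optimal_cost mu r sig M1 a rho e l M B n (D n) x) sequentially"
   using stochastic_lower[where 'w = 'w, OF x eps] eventually_ge_at_top[of "1::nat"]
  proof eventually_elim
   case (elim n)
   show ?case unfolding optimal_cost_def
   proof (rule Inf_greatest, safe)
    fix p W assume p: "p \<in> policies M B M1" and W: "wealth_process mu r sig a e M (augmented_filtration M B) B n x p W"
    have pb: "abs (p t w) <= M1" if "0 <= t" "w \<in> space M" for t w using p that by (auto simp: policies_def)
    have "\<exists>I. wealth_clock M (augmented_filtration M B) B mu r sig a lam rho M1 L e l n x p W I (D n)"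
     by (rule wealth_clock_exists[OF ab(1) _ x W pb]) (use elim(2) assms(16,17) ab(3) in auto)
    thus "ereal (Uv x - eps) <= ereal (cost a rho l M n (D n) W)" using elim(1) by auto
   qed
  qed
  show "eventually (%n. optimal_cost mu r sig M1 a rho e l M B n (D n) x <= ereal (Uv x + eps)) sequentially"
   using stochastic_upper[where 'w = 'w, OF x eps] eventually_ge_at_top[of "1::nat"]
  proof eventually_elim
   case (elim n)
   from elim(2) assms(15,16,17) elim(1) obtain p W where "p \<in> policies M B M1"
    "wealth_process mu r sig a e M (augmented_filtration M B) B n x p W" "cost a rho l M n (D n) W <= Uv x + eps" by meson
   thus ?case unfolding optimal_cost_def by (intro Inf_lower2[of "ereal (cost a rho l M n (D n) W)"]) auto
  qed
 qed
 fix F W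
 assume fb: "\<forall>n\<ge>1. feedback_wealth_process mu r sig a lam rho e l M (F n) B n (D n) x (W n)"
 have wc: "\<exists>I. wealth_clock M (F n) B mu r sig a lam rho M1 L e l n x (%t w. pis (W n t w)) (W n) I (D n)" if n: "1 <= n" for n
 proof -
  have f: "brownian_motion M (F n) B" "independent_of_filtration M (F n) (D n)"
   "wealth_process mu r sig a e M (F n) B n x (%t w. pis (W n t w)) (W n)"
   using fb n by (auto simp: feedback_wealth_process_def)
  show ?thesis
  proof (rule wealth_clock_exists[OF f(1) _ x f(3)])
   \<comment> \<open>\<open>pi_star\<close> is bounded by \<open>M1\<close> on \<open>{a..}\<close>,
     and the wealth stays there up to the hitting time.\<close>
   fix t w assume t: "0 <= t" "w \<in> space M" "ereal t <= hit_time a (%s. W n s w)"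
   have c: "continuous_on {0..} (%s. W n s w)" "a <= W n 0 w"
    using f(3) t(2) x by (auto simp: wealth_process_def)
   have "a <= W n t w" using c
   proof (cases rule: hit_time_cases)
    case never
    thus ?thesis using t(1) by (simp add: less_imp_le)
   next
    case (hit s)
    thus ?thesis using t by (cases "t = s") (auto simp: less_imp_le)
   qed
   thus "abs (pis (W n t w)) <= M1" by (rule ps)
  qed (use n assms(16) f in auto)
 qed
 show "(%n. ereal (cost a rho l M n (D n) (W n))) ----> game_value mu r sig M1 a lam rho e l x"
  unfolding game_value_eq[OF x]
 proof (rule ereal_tendstoI)
  fix eps :: real assume eps: "0 < eps"
  show "eventually (%n. ereal (Uv x - eps) <= ereal (cost a rho l M n (D n) (W n))) sequentially"
   using stochastic_lower[where 'w = 'w, OF x eps] eventually_ge_at_top[of "1::nat"]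
  proof eventually_elim
   case (elim n)
   thus ?case using wc[OF elim(2)] by auto
  qed
  show "eventually (%n. ereal (cost a rho l M n (D n) (W n)) <= ereal (Uv x + eps)) sequentially"
   using stochastic_feedback[where 'w = 'w, OF x eps] eventually_ge_at_top[of "1::nat"]
  proof eventually_elim
   case (elim n)
   thus ?case using wc[OF elim(2)] by auto
  qed
 qed
qed

end
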